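(* Let $\Gamma$ be a finite graph without multiple edges and without loops. For every integer $k\geq 1$, there is a coproduct $\Delta$ on $C(\mathbb{G}_k^+(\Gamma))$ given on the generators by $\Delta(q_{ij})=\sum_{l=1}^{n}q_{il}\otimes q_{lj}$, and $(C(\mathbb{G}_k^+(\Gamma)),\Delta)$ is a quantum subgroup of $\mathrm{Aut}^+(\Gamma)$.
   Context: $\Gamma$ is an undirected graph with vertex set $V=\{1,\dots,n\}$ and adjacency matrix $\epsilon=(\epsilon_{ij})$. A path of length $\alpha$ is a tuple $(i_1,\dots,i_{\alpha+1})$ of vertices with $\epsilon_{i_ti_{t+1}}=1$ for $1\le t\le\alpha$ (repetitions allowed). A compact quantum group $\mathbb{G}$ is a pair $(C(\mathbb{G}),\Delta)$ with $C(\mathbb{G})$ a unital $C^*$-algebra and $\Delta:C(\mathbb{G})\to C(\mathbb{G})\otimes_{\min}C(\mathbb{G})$ a unital $*$-homomorphism that is coassociative and such that $\Delta(C(\mathbb{G}))(1\otimes C(\mathbb{G}))$ and $\Delta(C(\mathbb{G}))(C(\mathbb{G})\otimes 1)$ have dense linear span. $\mathbb{H}$ is a quantum subgroup of $\mathbb{G}$ if there is a surjective unital $*$-homomorphism $C(\mathbb{G})\to C(\mathbb{H})$ intertwining the coproducts (here: the one sending generators $q_{ij}$ to $q_{ij}$). $C(\mathrm{Aut}^+(\Gamma))$ is the universal unital $C^*$-algebra generated by self-adjoint elements $q_{ij}$ ($1\le i,j\le n$) such that $\sum_j q_{ij}=1=\sum_j q_{ji}$ for all $i$, $q_{ij}q_{il}=\delta_{jl}q_{ij}$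 and $q_{ji}q_{li}=\delta_{jl}q_{ji}$ for all $i,j,l$, and $q\epsilon=\epsilon q$ where $q=(q_{ij})$; its coproduct is $\Delta(q_{ij})=\sum_l q_{il}\otimes q_{lj}$. For $k\geq1$, $C(\mathbb{G}_k^+(\Gamma))$ is the universal $C^*$-algebra generated by elements $q_{ij}$ satisfying these relations together with $$q_{i_1j_1}q_{i_2j_2}\cdots q_{i_\beta j_\beta}=q_{i_\beta j_\beta}\cdots q_{i_2j_2}q_{i_1j_1}$$ for all $\beta\le k+1$ and all paths $(i_1,\dots,i_\beta)$, $(j_1,\dots,j_\beta)$. *)

theory Defs
  imports
    "HOL-Algebra.Module"
    "HOL-Analysis.Infinite_Sum"
    "HOL-Library.Poly_Mapping"
    "Graph_Theory.Digraph"
begin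

section \<open>Unital C*-algebras\<close>

definition complex_ring :: "complex ring" where
  "complex_ring = \<lparr>carrier = UNIV, monoid.mult = (*), one = 1, zero = 0, add = (+)\<rparr>"

record 'a star_alg = "(complex, 'a) module" +
  star :: "'a \<Rightarrow> 'a"

record 'a cstar_alg = "'a star_alg" +
  cnorm :: "'a \<Rightarrow> real"

definition star_algebra :: "('a, 'm) star_alg_scheme \<Rightarrow> bool" where
  "star_algebra A \<longleftrightarrow>
     ring A \<and> Module.module complex_ring A \<and>
     (\<forall>c. \<forall>x\<in>carrier A. \<forall>y\<in>carrier A.
        (c \<odot>\<^bsub>A\<^esub> x) \<otimes>\<^bsub>A\<^esub> y = c \<odot>\<^bsub>A\<^esub> (x \<otimes>\<^bsub>A\<^esub> y) \<and>
        x \<otimes>\<^bsub>A\<^esub> (c \<odot>\<^bsub>A\<^esub> y) = c \<odot>\<^bsub>A\<^esub> (x \<otimes>\<^bsub>A\<^esub> y)) \<and>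
     (\<forall>x\<in>carrier A. star A x \<in> carrier A \<and> star A (star A x) = x \<and>
        (\<forall>c. star A (c \<odot>\<^bsub>A\<^esub> x) = cnj c \<odot>\<^bsub>A\<^esub> star A x)) \<and>
     (\<forall>x\<in>carrier A. \<forall>y\<in>carrier A.
        star A (x \<oplus>\<^bsub>A\<^esub> y) = star A x \<oplus>\<^bsub>A\<^esub> star A y \<and>
        star A (x \<otimes>\<^bsub>A\<^esub> y) = star A y \<otimes>\<^bsub>A\<^esub> star A x)"

definition cstar_seminorm :: "('a, 'm) star_alg_scheme \<Rightarrow> ('a \<Rightarrow> real) \<Rightarrow> bool" where
  "cstar_seminorm A p \<longleftrightarrow>
     (\<forall>x\<in>carrier A. 0 \<le> p x \<and> p (star A x \<otimes>\<^bsub>A\<^esub> x) = (p x)\<^sup>2 \<and>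
        (\<forall>c. p (c \<odot>\<^bsub>A\<^esub> x) = cmod c * p x)) \<and>
     (\<forall>x\<in>carrier A. \<forall>y\<in>carrier A.
        p (x \<oplus>\<^bsub>A\<^esub> y) \<le> p x + p y \<and> p (x \<otimes>\<^bsub>A\<^esub> y) \<le> p x * p y)"

definition seminorm_Cauchy :: "('a, 'm) star_alg_scheme \<Rightarrow> ('a \<Rightarrow> real) \<Rightarrow> (nat \<Rightarrow> 'a) \<Rightarrow> bool" where
  "seminorm_Cauchy A p \<sigma> \<longleftrightarrow> (\<forall>n. \<sigma> n \<in> carrier A) \<and>
     (\<forall>e>0. \<exists>N. \<forall>m\<ge>N. \<forall>n\<ge>N. p (\<sigma> m \<ominus>\<^bsub>A\<^esub> \<sigma> n) < e)"

definition cstar_algebra :: "('a, 'm) cstar_alg_scheme \<Rightarrow> bool" where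
  "cstar_algebra A \<longleftrightarrow>
     star_algebra A \<and> cstar_seminorm A (cnorm A) \<and>
     (\<forall>x\<in>carrier A. cnorm A x = 0 \<longrightarrow> x = \<zero>\<^bsub>A\<^esub>) \<and>
     (\<forall>\<sigma>. seminorm_Cauchy A (cnorm A) \<sigma> \<longrightarrow>
        (\<exists>x\<in>carrier A. (\<lambda>n. cnorm A (\<sigma> n \<ominus>\<^bsub>A\<^esub> x)) \<longlonglongrightarrow> 0))"

text \<open>Unital *-homomorphisms; \<^const>\<open>ring_hom\<close> already asks for preservation of the unit.\<close>

definition star_hom ::
    "('a, 'm) star_alg_scheme \<Rightarrow> ('b, 'n) star_alg_scheme \<Rightarrow> ('a \<Rightarrow> 'b) set" where
  "star_hom A B = {h \<in> ring_hom A B. \<forall>x\<in>carrier A.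
     (\<forall>c. h (c \<odot>\<^bsub>A\<^esub> x) = c \<odot>\<^bsub>B\<^esub> h x) \<and> h (star A x) = star B (h x)}"

definition lin_span :: "('a, 'm) star_alg_scheme \<Rightarrow> 'a set \<Rightarrow> 'a set" where
  "lin_span A X = {finsum A (\<lambda>x. c x \<odot>\<^bsub>A\<^esub> x) F | c F. finite F \<and> F \<subseteq> X}"

definition norm_dense :: "('a, 'm) cstar_alg_scheme \<Rightarrow> 'a set \<Rightarrow> bool" where
  "norm_dense A X \<longleftrightarrow> X \<subseteq> carrier A \<and>
     (\<forall>a\<in>carrier A. \<forall>e>0. \<exists>x\<in>X. cnorm A (a \<ominus>\<^bsub>A\<^esub> x) < e)"


section \<open>Separated completion of a *-algebra in a C*-seminorm\<close>

text \<open>Points are classes of Cauchy sequences modulo sequences of seminorm tending to 0; in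
  particular elements of seminorm 0 are identified with 0.\<close>

definition completion_rel ::
    "('a, 'm) star_alg_scheme \<Rightarrow> ('a \<Rightarrow> real) \<Rightarrow> ((nat \<Rightarrow> 'a) \<times> (nat \<Rightarrow> 'a)) set" where
  "completion_rel S p = {(\<sigma>, \<tau>). seminorm_Cauchy S p \<sigma> \<and> seminorm_Cauchy S p \<tau> \<and>
     (\<lambda>n. p (\<sigma> n \<ominus>\<^bsub>S\<^esub> \<tau> n)) \<longlonglongrightarrow> 0}"

definition cstar_completion ::
    "('a, 'm) star_alg_scheme \<Rightarrow> ('a \<Rightarrow> real) \<Rightarrow> (nat \<Rightarrow> 'a) set cstar_alg" where
  "cstar_completion S p =
     (let r = completion_rel S p in
      \<lparr>carrier = Collect (seminorm_Cauchy S p) // r,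
       monoid.mult = (\<lambda>X Y. \<Union>\<sigma>\<in>X. \<Union>\<tau>\<in>Y. r `` {\<lambda>n. \<sigma> n \<otimes>\<^bsub>S\<^esub> \<tau> n}),
       one = r `` {\<lambda>n. \<one>\<^bsub>S\<^esub>},
       zero = r `` {\<lambda>n. \<zero>\<^bsub>S\<^esub>},
       add = (\<lambda>X Y. \<Union>\<sigma>\<in>X. \<Union>\<tau>\<in>Y. r `` {\<lambda>n. \<sigma> n \<oplus>\<^bsub>S\<^esub> \<tau> n}),
       smult = (\<lambda>c X. \<Union>\<sigma>\<in>X. r `` {\<lambda>n. c \<odot>\<^bsub>S\<^esub> \<sigma> n}),
       star = (\<lambda>X. \<Union>\<sigma>\<in>X. r `` {\<lambda>n. star S (\<sigma> n)}),
       cnorm = (\<lambda>X. the_elem ((\<lambda>\<sigma>. lim (\<lambda>n. p (\<sigma> n))) ` X))\<rparr>)"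

definition to_completion ::
    "('a, 'm) star_alg_scheme \<Rightarrow> ('a \<Rightarrow> real) \<Rightarrow> 'a \<Rightarrow> (nat \<Rightarrow> 'a) set" where
  "to_completion S p x = completion_rel S p `` {\<lambda>n. x}"


section \<open>The *-algebra of a monoid with involution\<close>

text \<open>Formal finite complex linear combinations of elements of the monoid \<open>M\<close>, with the bilinear
  extension of its multiplication and the conjugate-linear extension of the involution \<open>s\<close>.\<close>

definition monoid_star_alg ::
    "('m, 'z) monoid_scheme \<Rightarrow> ('m \<Rightarrow> 'm) \<Rightarrow> ('m \<Rightarrow>\<^sub>0 complex) star_alg" where
  "monoid_star_alg M s =
     \<lparr>carrier = {f. Poly_Mapping.keys f \<subseteq> carrier M},
      monoid.mult = (\<lambda>f g. \<Sum>u\<in>Poly_Mapping.keys f. \<Sum>v\<in>Poly_Mapping.keys g.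
                 Poly_Mapping.single (u \<otimes>\<^bsub>M\<^esub> v) (Poly_Mapping.lookup f u * Poly_Mapping.lookup g v)),
      one = Poly_Mapping.single \<one>\<^bsub>M\<^esub> 1,
      zero = 0,
      add = (+),
      smult = (\<lambda>c f. Poly_Mapping.map (\<lambda>z. c * z) f),
      star = (\<lambda>f. \<Sum>u\<in>Poly_Mapping.keys f.
                 Poly_Mapping.single (s u) (cnj (Poly_Mapping.lookup f u)))\<rparr>"


section \<open>Universal unital C*-algebras\<close>

text \<open>Noncommutative *-polynomials over the generator set \<open>E\<close> are combinations of words in the
  letters \<open>(g, False)\<close>, standing for \<open>g\<close>, and \<open>(g, True)\<close>, standing for its adjoint; the empty
  word is the unit.\<close>

definition word_star :: "('g \<times> bool) list \<Rightarrow> ('g \<times> bool) list" where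
  "word_star w = rev (map (\<lambda>(g, b). (g, \<not> b)) w)"

type_synonym 'g star_poly = "('g \<times> bool) list \<Rightarrow>\<^sub>0 complex"

definition free_star_alg :: "'g set \<Rightarrow> 'g star_poly star_alg" where
  "free_star_alg E =
     monoid_star_alg \<lparr>carrier = lists (E \<times> UNIV), monoid.mult = (@), one = []\<rparr> word_star"

definition free_gen :: "'g \<Rightarrow> 'g star_poly" where
  "free_gen g = Poly_Mapping.single [(g, False)] 1"

text \<open>A set \<open>R\<close> of pairs of *-polynomials encodes the relations \<open>x = y\<close> for \<open>(x, y) \<in> R\<close>. The
  enveloping C*-seminorm is the supremum of all C*-seminorms on the free *-algebra that respect
  \<open>R\<close>, equivalently of all C*-seminorms on its quotient by the *-ideal of the relations. It is a
  genuine supremum only if these seminorms are pointwise bounded, which is the condition for the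
  universal C*-algebra to exist.\<close>

definition universal_seminorm ::
    "'g set \<Rightarrow> ('g star_poly \<times> 'g star_poly) set \<Rightarrow> 'g star_poly \<Rightarrow> real" where
  "universal_seminorm E R x =
     Sup {p x | p. cstar_seminorm (free_star_alg E) p \<and>
                   (\<forall>(u, v)\<in>R. p (u \<ominus>\<^bsub>free_star_alg E\<^esub> v) = 0)}"

type_synonym 'g univ_elem = "(nat \<Rightarrow> 'g star_poly) set"

definition universal_cstar ::
    "'g set \<Rightarrow> ('g star_poly \<times> 'g star_poly) set \<Rightarrow> 'g univ_elem cstar_alg" where
  "universal_cstar E R = cstar_completion (free_star_alg E) (universal_seminorm E R)"

definition universal_gen ::
    "'g set \<Rightarrow> ('g star_poly \<times> 'g star_poly) set \<Rightarrow> 'g \<Rightarrow> 'g univ_elem" where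
  "universal_gen E R g = to_completion (free_star_alg E) (universal_seminorm E R) (free_gen g)"


section \<open>Operators on \<open>\<ell>\<^sup>2\<close> and representations\<close>

definition ell2 :: "('h \<Rightarrow> complex) set" where
  "ell2 = {f. (\<lambda>h. (cmod (f h))\<^sup>2) summable_on UNIV}"

definition ell2_inner :: "('h \<Rightarrow> complex) \<Rightarrow> ('h \<Rightarrow> complex) \<Rightarrow> complex" where
  "ell2_inner f g = (\<Sum>\<^sub>\<infinity>h. cnj (f h) * g h)"

definition ell2_norm :: "('h \<Rightarrow> complex) \<Rightarrow> real" where
  "ell2_norm f = sqrt (\<Sum>\<^sub>\<infinity>h. (cmod (f h))\<^sup>2)"

type_synonym 'h ell2_op = "('h \<Rightarrow> complex) \<Rightarrow> ('h \<Rightarrow> complex)"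

text \<open>Only the values of an operator on \<^const>\<open>ell2\<close> are meaningful.\<close>

definition bounded_op :: "'h ell2_op \<Rightarrow> bool" where
  "bounded_op T \<longleftrightarrow>
     (\<forall>f\<in>ell2. T f \<in> ell2) \<and>
     (\<forall>f\<in>ell2. \<forall>g\<in>ell2. T (\<lambda>h. f h + g h) = (\<lambda>h. T f h + T g h)) \<and>
     (\<forall>c. \<forall>f\<in>ell2. T (\<lambda>h. c * f h) = (\<lambda>h. c * T f h)) \<and>
     (\<exists>K. \<forall>f\<in>ell2. ell2_norm (T f) \<le> K * ell2_norm f)"

definition op_norm :: "'h ell2_op \<Rightarrow> real" where
  "op_norm T = Sup {ell2_norm (T f) | f. f \<in> ell2 \<and> ell2_norm f \<le> 1}"

text \<open>The Hilbert space tensor product of two \<open>\<ell>\<^sup>2\<close> spaces is \<open>\<ell>\<^sup>2\<close> of the product index set.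
  \<open>op_tensor S T\<close> applies \<open>T\<close> in the second variable and then \<open>S\<close> in the first one.\<close>

definition op_tensor :: "'h ell2_op \<Rightarrow> 'k ell2_op \<Rightarrow> ('h \<times> 'k) ell2_op" where
  "op_tensor S T F = (\<lambda>(x, y). S (\<lambda>x'. T (\<lambda>y'. F (x', y')) y) x)"

text \<open>Possibly degenerate *-representations of a C*-algebra on \<open>\<ell>\<^sup>2\<close>.\<close>

definition representation :: "('a, 'm) star_alg_scheme \<Rightarrow> ('a \<Rightarrow> 'h ell2_op) \<Rightarrow> bool" where
  "representation A \<pi> \<longleftrightarrow>
     (\<forall>a\<in>carrier A. bounded_op (\<pi> a)) \<and>
     (\<forall>a\<in>carrier A. \<forall>b\<in>carrier A. \<forall>f\<in>ell2.
        \<pi> (a \<oplus>\<^bsub>A\<^esub> b) f = (\<lambda>h. \<pi> a f h + \<pi> b f h) \<and>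
        \<pi> (a \<otimes>\<^bsub>A\<^esub> b) f = \<pi> a (\<pi> b f)) \<and>
     (\<forall>c. \<forall>a\<in>carrier A. \<forall>f\<in>ell2. \<pi> (c \<odot>\<^bsub>A\<^esub> a) f = (\<lambda>h. c * \<pi> a f h)) \<and>
     (\<forall>a\<in>carrier A. \<forall>f\<in>ell2. \<forall>g\<in>ell2.
        ell2_inner (\<pi> (star A a) f) g = ell2_inner f (\<pi> a g))"


section \<open>Minimal tensor products\<close>

text \<open>The minimal (spatial) norm of \<open>\<Sum> c\<^sub>i (a\<^sub>i \<otimes> b\<^sub>i)\<close> is the supremum of
  \<open>\<parallel>\<Sum> c\<^sub>i (\<pi> a\<^sub>i \<otimes> \<rho> b\<^sub>i)\<parallel>\<close> over all representations \<open>\<pi>\<close>, \<open>\<rho>\<close> of the two factors. In this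
  supremum it suffices to use cyclic representations. The dimension of a cyclic representation
  of a nonzero \<open>A\<close> is at most the cardinality of \<open>A\<close>, so, with \<open>'a\<close> the type of the elements of
  \<open>A\<close>, it is a subrepresentation of a degenerate representation on \<open>\<ell>\<^sup>2\<close> over the index set
  \<open>'a\<close>.

  The algebraic tensor product is presented by formal combinations of pairs; the bilinearity
  relations have spatial seminorm 0 and are divided out by the completion. The threefold product
  is defined directly and has no bracketing.\<close>

definition rep_seminorm :: "('m \<Rightarrow> 'h ell2_op) set \<Rightarrow> ('m \<Rightarrow>\<^sub>0 complex) \<Rightarrow> real" where
  "rep_seminorm P x =
     Sup ((\<lambda>\<rho>. op_norm (\<lambda>f h. \<Sum>m\<in>Poly_Mapping.keys x. Poly_Mapping.lookup x m * \<rho> m f h)) ` P)"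

definition formal_tensor2 ::
    "('a, 'm) cstar_alg_scheme \<Rightarrow> ('b, 'n) cstar_alg_scheme \<Rightarrow> ('a \<times> 'b \<Rightarrow>\<^sub>0 complex) star_alg" where
  "formal_tensor2 A B = monoid_star_alg (A \<times>\<times> B) (\<lambda>(a, b). (star A a, star B b))"

definition spatial2 ::
    "('a, 'm) cstar_alg_scheme \<Rightarrow> ('b, 'n) cstar_alg_scheme \<Rightarrow> ('a \<times> 'b \<Rightarrow>\<^sub>0 complex) \<Rightarrow> real" where
  "spatial2 A B = rep_seminorm {\<lambda>(a, b). op_tensor (\<pi> a) (\<rho> b) |
     (\<pi> :: 'a \<Rightarrow> 'a ell2_op) (\<rho> :: 'b \<Rightarrow> 'b ell2_op). representation A \<pi> \<and> representation B \<rho>}"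

type_synonym ('a, 'b) tensor2_elem = "(nat \<Rightarrow> ('a \<times> 'b \<Rightarrow>\<^sub>0 complex)) set"

definition min_tensor2 ::
    "('a, 'm) cstar_alg_scheme \<Rightarrow> ('b, 'n) cstar_alg_scheme \<Rightarrow> ('a, 'b) tensor2_elem cstar_alg" where
  "min_tensor2 A B = cstar_completion (formal_tensor2 A B) (spatial2 A B)"

definition tensor2 ::
    "('a, 'm) cstar_alg_scheme \<Rightarrow> ('b, 'n) cstar_alg_scheme \<Rightarrow> 'a \<Rightarrow> 'b \<Rightarrow> ('a, 'b) tensor2_elem" where
  "tensor2 A B a b =
     to_completion (formal_tensor2 A B) (spatial2 A B) (Poly_Mapping.single (a, b) 1)"

definition formal_tensor3 ::
    "('a, 'm) cstar_alg_scheme \<Rightarrow> ('b, 'n) cstar_alg_scheme \<Rightarrow> ('c, 'l) cstar_alg_scheme \<Rightarrow>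
     ('a \<times> 'b \<times> 'c \<Rightarrow>\<^sub>0 complex) star_alg" where
  "formal_tensor3 A B C =
     monoid_star_alg (A \<times>\<times> B \<times>\<times> C) (\<lambda>(a, b, c). (star A a, star B b, star C c))"

definition spatial3 ::
    "('a, 'm) cstar_alg_scheme \<Rightarrow> ('b, 'n) cstar_alg_scheme \<Rightarrow> ('c, 'l) cstar_alg_scheme \<Rightarrow>
     ('a \<times> 'b \<times> 'c \<Rightarrow>\<^sub>0 complex) \<Rightarrow> real" where
  "spatial3 A B C = rep_seminorm {\<lambda>(a, b, c). op_tensor (\<pi> a) (op_tensor (\<rho> b) (\<tau> c)) |
     (\<pi> :: 'a \<Rightarrow> 'a ell2_op) (\<rho> :: 'b \<Rightarrow> 'b ell2_op) (\<tau> :: 'c \<Rightarrow> 'c ell2_op).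
     representation A \<pi> \<and> representation B \<rho> \<and> representation C \<tau>}"

type_synonym ('a, 'b, 'c) tensor3_elem = "(nat \<Rightarrow> ('a \<times> 'b \<times> 'c \<Rightarrow>\<^sub>0 complex)) set"

definition min_tensor3 ::
    "('a, 'm) cstar_alg_scheme \<Rightarrow> ('b, 'n) cstar_alg_scheme \<Rightarrow> ('c, 'l) cstar_alg_scheme \<Rightarrow>
     ('a, 'b, 'c) tensor3_elem cstar_alg" where
  "min_tensor3 A B C = cstar_completion (formal_tensor3 A B C) (spatial3 A B C)"

definition tensor3 ::
    "('a, 'm) cstar_alg_scheme \<Rightarrow> ('b, 'n) cstar_alg_scheme \<Rightarrow> ('c, 'l) cstar_alg_scheme \<Rightarrow>
     'a \<Rightarrow> 'b \<Rightarrow> 'c \<Rightarrow> ('a, 'b, 'c) tensor3_elem" where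
  "tensor3 A B C a b c =
     to_completion (formal_tensor3 A B C) (spatial3 A B C) (Poly_Mapping.single (a, b, c) 1)"

text \<open>The unital *-homomorphism on \<open>A \<otimes> B\<close> with prescribed values \<open>\<phi> a b\<close> on the elementary
  tensors; \<^const>\<open>extensional\<close> makes it unique as a HOL function.\<close>

definition tensor_lift ::
    "('a, 'm) cstar_alg_scheme \<Rightarrow> ('b, 'n) cstar_alg_scheme \<Rightarrow> ('c, 'l) cstar_alg_scheme \<Rightarrow>
     ('a \<Rightarrow> 'b \<Rightarrow> 'c) \<Rightarrow> ('a, 'b) tensor2_elem \<Rightarrow> 'c" where
  "tensor_lift A B C \<phi> =
     (THE h. h \<in> star_hom (min_tensor2 A B) C \<and> h \<in> extensional (carrier (min_tensor2 A B)) \<and>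
             (\<forall>a\<in>carrier A. \<forall>b\<in>carrier B. h (tensor2 A B a b) = \<phi> a b))"

definition tensor_map ::
    "('a, 'm) cstar_alg_scheme \<Rightarrow> ('b, 'n) cstar_alg_scheme \<Rightarrow>
     ('c, 'l) cstar_alg_scheme \<Rightarrow> ('d, 'k) cstar_alg_scheme \<Rightarrow>
     ('a \<Rightarrow> 'c) \<Rightarrow> ('b \<Rightarrow> 'd) \<Rightarrow> ('a, 'b) tensor2_elem \<Rightarrow> ('c, 'd) tensor2_elem" where
  "tensor_map A B C D f g =
     tensor_lift A B (min_tensor2 C D) (\<lambda>a b. tensor2 C D (f a) (g b))"

text \<open>Leg numbering: \<open>a \<otimes> b\<close> is sent to \<open>a \<otimes> b \<otimes> 1\<close> and to \<open>1 \<otimes> a \<otimes> b\<close>, respectively.\<close>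

definition leg12 ::
    "('a, 'm) cstar_alg_scheme \<Rightarrow> ('a, 'a) tensor2_elem \<Rightarrow> ('a, 'a, 'a) tensor3_elem" where
  "leg12 A = tensor_lift A A (min_tensor3 A A A) (\<lambda>a b. tensor3 A A A a b \<one>\<^bsub>A\<^esub>)"

definition leg23 ::
    "('a, 'm) cstar_alg_scheme \<Rightarrow> ('a, 'a) tensor2_elem \<Rightarrow> ('a, 'a, 'a) tensor3_elem" where
  "leg23 A = tensor_lift A A (min_tensor3 A A A) (\<lambda>a b. tensor3 A A A \<one>\<^bsub>A\<^esub> a b)"

text \<open>\<open>\<Delta> \<otimes> id\<close> and \<open>id \<otimes> \<Delta>\<close>, using that \<open>\<Delta>(a) \<otimes> b\<close> is the product of \<open>\<Delta>(a) \<otimes> 1\<close> and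
  \<open>1 \<otimes> 1 \<otimes> b\<close>.\<close>

definition coproduct_id ::
    "('a, 'm) cstar_alg_scheme \<Rightarrow> ('a \<Rightarrow> ('a, 'a) tensor2_elem) \<Rightarrow>
     ('a, 'a) tensor2_elem \<Rightarrow> ('a, 'a, 'a) tensor3_elem" where
  "coproduct_id A \<Delta> = tensor_lift A A (min_tensor3 A A A)
     (\<lambda>a b. leg12 A (\<Delta> a) \<otimes>\<^bsub>min_tensor3 A A A\<^esub> tensor3 A A A \<one>\<^bsub>A\<^esub> \<one>\<^bsub>A\<^esub> b)"

definition id_coproduct ::
    "('a, 'm) cstar_alg_scheme \<Rightarrow> ('a \<Rightarrow> ('a, 'a) tensor2_elem) \<Rightarrow>
     ('a, 'a) tensor2_elem \<Rightarrow> ('a, 'a, 'a) tensor3_elem" where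
  "id_coproduct A \<Delta> = tensor_lift A A (min_tensor3 A A A)
     (\<lambda>a b. tensor3 A A A a \<one>\<^bsub>A\<^esub> \<one>\<^bsub>A\<^esub> \<otimes>\<^bsub>min_tensor3 A A A\<^esub> leg23 A (\<Delta> b))"


section \<open>Compact quantum groups\<close>

type_synonym 'a quantum_group = "'a cstar_alg \<times> ('a \<Rightarrow> ('a, 'a) tensor2_elem)"

definition compact_quantum_group :: "'a quantum_group \<Rightarrow> bool" where
  "compact_quantum_group G \<longleftrightarrow> (case G of (A, \<Delta>) \<Rightarrow>
     cstar_algebra A \<and>
     \<Delta> \<in> star_hom A (min_tensor2 A A) \<and>
     (\<forall>a\<in>carrier A. coproduct_id A \<Delta> (\<Delta> a) = id_coproduct A \<Delta> (\<Delta> a)) \<and>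
     norm_dense (min_tensor2 A A) (lin_span (min_tensor2 A A)
       {\<Delta> a \<otimes>\<^bsub>min_tensor2 A A\<^esub> tensor2 A A \<one>\<^bsub>A\<^esub> b | a b. a \<in> carrier A \<and> b \<in> carrier A}) \<and>
     norm_dense (min_tensor2 A A) (lin_span (min_tensor2 A A)
       {\<Delta> a \<otimes>\<^bsub>min_tensor2 A A\<^esub> tensor2 A A b \<one>\<^bsub>A\<^esub> | a b. a \<in> carrier A \<and> b \<in> carrier A}))"

text \<open>\<open>H\<close> is a quantum subgroup of \<open>G\<close> by means of \<open>\<pi> : C(G) \<rightarrow> C(H)\<close>.\<close>

definition quantum_subgroup_via ::
    "('a \<Rightarrow> 'b) \<Rightarrow> 'b quantum_group \<Rightarrow> 'a quantum_group \<Rightarrow> bool" where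
  "quantum_subgroup_via \<pi> H G \<longleftrightarrow>
     compact_quantum_group H \<and> compact_quantum_group G \<and>
     (case (H, G) of ((B, \<Delta>\<^sub>B), (A, \<Delta>\<^sub>A)) \<Rightarrow>
        \<pi> \<in> star_hom A B \<and> \<pi> ` carrier A = carrier B \<and>
        (\<forall>a\<in>carrier A. tensor_map A A B B \<pi> \<pi> (\<Delta>\<^sub>A a) = \<Delta>\<^sub>B (\<pi> a)))"


section \<open>Quantum automorphism groups of graphs\<close>

definition adj_matrix :: "('v, 'e) pre_digraph \<Rightarrow> 'v \<Rightarrow> 'v \<Rightarrow> complex" where
  "adj_matrix \<Gamma> i j = (if i \<rightarrow>\<^bsub>\<Gamma>\<^esub> j then 1 else 0)"

abbreviation gen_indices :: "('v, 'e) pre_digraph \<Rightarrow> ('v \<times> 'v) set" where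
  "gen_indices \<Gamma> \<equiv> verts \<Gamma> \<times> verts \<Gamma>"

type_synonym 'v relations = "(('v \<times> 'v) star_poly \<times> ('v \<times> 'v) star_poly) set"

definition qaut_relations :: "('v, 'e) pre_digraph \<Rightarrow> 'v relations" where
  "qaut_relations \<Gamma> =
     (let V = verts \<Gamma>; F = free_star_alg (gen_indices \<Gamma>); q = (\<lambda>i j. free_gen (i, j)) in
      {(q i j, star F (q i j)) | i j. i \<in> V \<and> j \<in> V} \<union>
      {(\<Oplus>\<^bsub>F\<^esub>j\<in>V. q i j, \<one>\<^bsub>F\<^esub>) | i. i \<in> V} \<union>
      {(\<Oplus>\<^bsub>F\<^esub>j\<in>V. q j i, \<one>\<^bsub>F\<^esub>) | i. i \<in> V} \<union>
      {(q i j \<otimes>\<^bsub>F\<^esub> q i l, if j = l then q i j else \<zero>\<^bsub>F\<^esub>) | i j l. i \<in> V \<and> j \<in> V \<and> l \<in> V} \<union>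
      {(q j i \<otimes>\<^bsub>F\<^esub> q l i, if j = l then q j i else \<zero>\<^bsub>F\<^esub>) | i j l. i \<in> V \<and> j \<in> V \<and> l \<in> V} \<union>
      {(\<Oplus>\<^bsub>F\<^esub>l\<in>V. adj_matrix \<Gamma> l j \<odot>\<^bsub>F\<^esub> q i l, \<Oplus>\<^bsub>F\<^esub>l\<in>V. adj_matrix \<Gamma> i l \<odot>\<^bsub>F\<^esub> q l j) | i j.
         i \<in> V \<and> j \<in> V})"

text \<open>Paths are nonempty tuples of vertices; repetitions are allowed.\<close>

definition vertex_path :: "('v, 'e) pre_digraph \<Rightarrow> 'v list \<Rightarrow> bool" where
  "vertex_path \<Gamma> is \<longleftrightarrow> is \<noteq> [] \<and> set is \<subseteq> verts \<Gamma> \<and> successively (\<lambda>u v. u \<rightarrow>\<^bsub>\<Gamma>\<^esub> v) is"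

definition list_prod :: "('a, 'm) monoid_scheme \<Rightarrow> 'a list \<Rightarrow> 'a" where
  "list_prod M xs = foldr (\<lambda>x y. x \<otimes>\<^bsub>M\<^esub> y) xs \<one>\<^bsub>M\<^esub>"

definition path_relations :: "('v, 'e) pre_digraph \<Rightarrow> nat \<Rightarrow> 'v relations" where
  "path_relations \<Gamma> k =
     (let F = free_star_alg (gen_indices \<Gamma>) in
      {(list_prod F (map2 (\<lambda>i j. free_gen (i, j)) is js),
        list_prod F (rev (map2 (\<lambda>i j. free_gen (i, j)) is js))) | is js.
         vertex_path \<Gamma> is \<and> vertex_path \<Gamma> js \<and> length is = length js \<and> length is \<le> k + 1})"

definition C_Aut :: "('v, 'e) pre_digraph \<Rightarrow> ('v \<times> 'v) univ_elem cstar_alg" where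
  "C_Aut \<Gamma> = universal_cstar (gen_indices \<Gamma>) (qaut_relations \<Gamma>)"

definition q_Aut :: "('v, 'e) pre_digraph \<Rightarrow> 'v \<Rightarrow> 'v \<Rightarrow> ('v \<times> 'v) univ_elem" where
  "q_Aut \<Gamma> i j = universal_gen (gen_indices \<Gamma>) (qaut_relations \<Gamma>) (i, j)"

definition C_G :: "('v, 'e) pre_digraph \<Rightarrow> nat \<Rightarrow> ('v \<times> 'v) univ_elem cstar_alg" where
  "C_G \<Gamma> k = universal_cstar (gen_indices \<Gamma>) (qaut_relations \<Gamma> \<union> path_relations \<Gamma> k)"

definition q_G :: "('v, 'e) pre_digraph \<Rightarrow> nat \<Rightarrow> 'v \<Rightarrow> 'v \<Rightarrow> ('v \<times> 'v) univ_elem" where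
  "q_G \<Gamma> k i j = universal_gen (gen_indices \<Gamma>) (qaut_relations \<Gamma> \<union> path_relations \<Gamma> k) (i, j)"

definition coproduct_formula ::
    "'v set \<Rightarrow> 'a cstar_alg \<Rightarrow> ('v \<Rightarrow> 'v \<Rightarrow> 'a) \<Rightarrow> ('a \<Rightarrow> ('a, 'a) tensor2_elem) \<Rightarrow> bool" where
  "coproduct_formula V A q \<Delta> \<longleftrightarrow>
     (\<forall>i\<in>V. \<forall>j\<in>V. \<Delta> (q i j) = (\<Oplus>\<^bsub>min_tensor2 A A\<^esub>l\<in>V. tensor2 A A (q i l) (q l j)))"

definition Aut_plus :: "('v, 'e) pre_digraph \<Rightarrow> ('v \<times> 'v) univ_elem quantum_group" where
  "Aut_plus \<Gamma> =
     (C_Aut \<Gamma>,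
      THE \<Delta>. \<Delta> \<in> star_hom (C_Aut \<Gamma>) (min_tensor2 (C_Aut \<Gamma>) (C_Aut \<Gamma>)) \<and>
             \<Delta> \<in> extensional (carrier (C_Aut \<Gamma>)) \<and>
             coproduct_formula (verts \<Gamma>) (C_Aut \<Gamma>) (q_Aut \<Gamma>) \<Delta>)"

end

theory Submission
 imports Defs "HOL-Analysis.L2_Norm"
begin

text \<open>A magic unitary satisfying the relations is the same as a *-homomorphism on the universal
 C*-algebra. The two legs \<open>q\<^sub>i\<^sub>j \<otimes> 1\<close> and \<open>1 \<otimes> q\<^sub>i\<^sub>j\<close> are commuting magic unitaries with the path
 relations, and so is their matrix product: when a product along two paths is expanded, only
 the summands whose intermediate indices again form a path survive. Hence \<open>\<Delta>\<close> exists by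
 universality. Coassociativity and the intertwining property are equalities of
 *-homomorphisms, checked on generators. For density, the row relations recover \<open>q\<^sub>i\<^sub>j \<otimes> 1\<close> as
 \<open>\<Sum>\<^sub>k \<Delta>(q\<^sub>i\<^sub>k)(1 \<otimes> q\<^sub>j\<^sub>k)\<close>, and likewise \<open>1 \<otimes> q\<^sub>i\<^sub>j\<close>.

 Representations are only available on \<open>\<ell>\<^sup>2\<close> over the element type of the algebra. A
 representation of \<open>A \<otimes> A\<close> is moved there along a bijection of the infinite type \<open>'a \<times> 'a\<close>
 with \<open>'a\<close>, which makes \<open>\<Delta> \<otimes> id\<close> bounded without constructing new representations.\<close>

section \<open>Star algebras and limits in C*-seminorms\<close>

text \<open>All of the analysis comes from completeness and the C*-identity by two explicit
  iterations, a square root and a Neumann series. The first yields enough unitaries to make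
  *-homomorphisms contractive; contractivity lets maps extend from dense subalgebras and makes
  homomorphisms that agree on generators equal. The second yields approximate units.

  Density of the range is not enough for a quantum subgroup: every element of
  \<open>C_G \<Gamma> k\<close> must be hit. The distance to the kernel is shown to be a
  C*-seminorm. It respects the relations of the target, hence lies below the universal seminorm of
  the target, and this bound allows preimages of approximations to be corrected inside the kernel
  until they form a Cauchy sequence.

  The maps on tensor products are definite descriptions, so nothing can be said about one of them
  before existence and uniqueness are shown. Existence is one estimate: each representation that
  computes the norm of the target must be a pair of representations of the factors, followed by a
  linear contraction.\<close>

locale star_alg =
 fixes A :: "('a, 'm) star_alg_scheme" (structure)
 assumes star_algebra: "star_algebra A"
begin

sublocale ring A
 using star_algebra by (simp add: star_algebra_def)

lemma module_A: "Module.module complex_ring A"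
 using star_algebra by (simp add: star_algebra_def)

lemma smult_closed [intro, simp]: "x \<in> carrier A ==> c \<odot> x \<in> carrier A"
 using module.smult_closed[OF module_A, of c x] by (simp add: complex_ring_def)

lemma smult_l_distr: "x \<in> carrier A ==> (c + d) \<odot> x = c \<odot> x \<oplus> d \<odot> x"
 using module.smult_l_distr[OF module_A, of c d x] by (simp add: complex_ring_def)

lemma smult_r_distr:
 "x \<in> carrier A ==> y \<in> carrier A ==> c \<odot> (x \<oplus> y) = c \<odot> x \<oplus> c \<odot> y"
 using module.smult_r_distr[OF module_A, of c x y] by (simp add: complex_ring_def)

lemma smult_assoc: "x \<in> carrier A ==> c \<odot> (d \<odot> x) = (c * d) \<odot> x"
 using module.smult_assoc1[OF module_A, of c d x] by (simp add: complex_ring_def)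

lemma smult_one [simp]: "x \<in> carrier A ==> 1 \<odot> x = x"
 using module.smult_one[OF module_A, of x] by (simp add: complex_ring_def)

lemma smult_mult_left:
 "x \<in> carrier A ==> y \<in> carrier A ==> (c \<odot> x) \<otimes> y = c \<odot> (x \<otimes> y)"
 using star_algebra by (simp add: star_algebra_def)

lemma smult_mult_right:
 "x \<in> carrier A ==> y \<in> carrier A ==> x \<otimes> (c \<odot> y) = c \<odot> (x \<otimes> y)"
 using star_algebra by (simp add: star_algebra_def)

lemma star_closed [intro, simp]: "x \<in> carrier A ==> star A x \<in> carrier A"
 and star_star [simp]: "x \<in> carrier A ==> star A (star A x) = x"
 and star_smult: "x \<in> carrier A ==> star A (c \<odot> x) = cnj c \<odot> star A x"
 and star_add: "x \<in> carrier A ==> y \<in> carrier A ==> star A (x \<oplus> y) = star A x \<oplus> star A y"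
 and star_mult: "x \<in> carrier A ==> y \<in> carrier A ==> star A (x \<otimes> y) = star A y \<otimes> star A x"
 using star_algebra by (simp_all add: star_algebra_def)

lemma smult_zero_left [simp]: "x \<in> carrier A ==> 0 \<odot> x = \<zero>"
 by (metis add.l_cancel_one' add_0 smult_closed smult_l_distr)

lemma smult_zero_right [simp]: "c \<odot> \<zero> = \<zero>"
 by (metis add.l_cancel_one' l_zero smult_closed smult_r_distr zero_closed)

lemma smult_minus_one: "x \<in> carrier A ==> (- 1) \<odot> x = \<ominus> x"
 by (metis add.inv_equality ab_left_minus smult_closed smult_l_distr smult_one smult_zero_left)

lemma uminus_smult: "x \<in> carrier A ==> \<ominus> (c \<odot> x) = (- c) \<odot> x"
 by (metis mult_minus1 smult_assoc smult_closed smult_minus_one)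

lemma smult_uminus: "x \<in> carrier A ==> c \<odot> (\<ominus> x) = (- c) \<odot> x"
 by (metis mult_minus1_right smult_assoc smult_minus_one)

lemma smult_diff:
 "x \<in> carrier A ==> y \<in> carrier A ==> c \<odot> (x \<ominus> y) = c \<odot> x \<ominus> c \<odot> y"
 by (simp add: minus_eq smult_r_distr smult_uminus uminus_smult)

lemma star_zero [simp]: "star A \<zero> = \<zero>"
 by (metis complex_cnj_zero smult_zero_left star_closed star_smult zero_closed)

lemma star_one [simp]: "star A \<one> = \<one>"
 by (metis l_one one_closed r_one star_closed star_mult star_star)

lemma star_uminus: "x \<in> carrier A ==> star A (\<ominus> x) = \<ominus> star A x"
 by (metis complex_cnj_minus complex_cnj_one smult_minus_one star_closed star_smult)

lemma star_diff:
 "x \<in> carrier A ==> y \<in> carrier A ==> star A (x \<ominus> y) = star A x \<ominus> star A y"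
 by (simp add: minus_eq star_add star_uminus)

lemma finsum_smult:
 "\<lbrakk>finite I; f \<in> I \<rightarrow> carrier A\<rbrakk> \<Longrightarrow> c \<odot> finsum A f I = (\<Oplus>i\<in>I. c \<odot> f i)"
 by (induction I rule: finite_induct) (auto simp: smult_r_distr Pi_iff)

lemma finsum_star:
 "\<lbrakk>finite I; f \<in> I \<rightarrow> carrier A\<rbrakk> \<Longrightarrow> star A (finsum A f I) = (\<Oplus>i\<in>I. star A (f i))"
 by (induction I rule: finite_induct) (auto simp: star_add Pi_iff)

lemma diff_eq_zero_iff: "x \<in> carrier A ==> y \<in> carrier A ==> x \<ominus> y = \<zero> \<longleftrightarrow> x = y"
 by (metis add.inv_closed add.inv_equality add.inv_inv minus_eq r_neg)

lemma diff_diff_cancel: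
 "\<lbrakk>x \<in> carrier A; y \<in> carrier A; z \<in> carrier A\<rbrakk> \<Longrightarrow> (x \<ominus> y) \<oplus> (y \<ominus> z) = x \<ominus> z"
 by algebra

lemma add_diff_add:
 "\<lbrakk>x \<in> carrier A; y \<in> carrier A; z \<in> carrier A; w \<in> carrier A\<rbrakk> \<Longrightarrow>
  (x \<oplus> y) \<ominus> (z \<oplus> w) = (x \<ominus> z) \<oplus> (y \<ominus> w)"
 by algebra

lemma mult_diff_mult:
 "\<lbrakk>x \<in> carrier A; y \<in> carrier A; z \<in> carrier A; w \<in> carrier A\<rbrakk> \<Longrightarrow>
  (x \<otimes> y) \<ominus> (z \<otimes> w) = (x \<ominus> z) \<otimes> y \<oplus> z \<otimes> (y \<ominus> w)"
 by algebra

lemma minus_self [simp]: "x \<in> carrier A ==> x \<ominus> x = \<zero>"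
 by algebra

end

section \<open>C*-seminorms and sequential limits\<close>

locale cstar_semi = star_alg A for A :: "('a, 'm) star_alg_scheme" (structure) +
 fixes p :: "'a \<Rightarrow> real"
 assumes cstar_seminorm: "cstar_seminorm A p"
begin

lemma p_nonneg [simp]: "x \<in> carrier A ==> 0 \<le> p x"
 and p_cstar: "x \<in> carrier A ==> p (star A x \<otimes> x) = (p x)\<^sup>2"
 and p_smult: "x \<in> carrier A ==> p (c \<odot> x) = cmod c * p x"
 and p_add: "x \<in> carrier A ==> y \<in> carrier A ==> p (x \<oplus> y) \<le> p x + p y"
 and p_mult: "x \<in> carrier A ==> y \<in> carrier A ==> p (x \<otimes> y) \<le> p x * p y"
 using cstar_seminorm by (simp_all add: cstar_seminorm_def)

lemma p_zero [simp]: "p \<zero> = 0"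
 using p_smult[of \<zero> 0] by simp

lemma p_uminus [simp]: "x \<in> carrier A ==> p (\<ominus> x) = p x"
 using p_smult[of x "-1"] by (simp add: smult_minus_one)

lemma p_diff: "x \<in> carrier A ==> y \<in> carrier A ==> p (x \<ominus> y) \<le> p x + p y"
 using p_add[of x "\<ominus> y"] by (simp add: minus_eq)

lemma p_diff_commute: "x \<in> carrier A ==> y \<in> carrier A ==> p (x \<ominus> y) = p (y \<ominus> x)"
proof -
 assume "x \<in> carrier A" "y \<in> carrier A"
 moreover from this have "\<ominus> (x \<ominus> y) = y \<ominus> x" by algebra
 ultimately show ?thesis by (metis minus_closed p_uminus)
qed

lemma p_triangle:
 "\<lbrakk>x \<in> carrier A; y \<in> carrier A; z \<in> carrier A\<rbrakk> \<Longrightarrow> p (x \<ominus> z) \<le> p (x \<ominus> y) + p (y \<ominus> z)"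
 using p_add[of "x \<ominus> y" "y \<ominus> z"] by (simp add: diff_diff_cancel)

lemma p_le_diff: "\<lbrakk>x \<in> carrier A; y \<in> carrier A\<rbrakk> \<Longrightarrow> p x \<le> p y + p (x \<ominus> y)"
 using p_triangle[of x y \<zero>] by (simp add: minus_eq)

lemma p_abs_diff: "\<lbrakk>x \<in> carrier A; y \<in> carrier A\<rbrakk> \<Longrightarrow> \<bar>p x - p y\<bar> \<le> p (x \<ominus> y)"
 using p_le_diff[of x y] p_le_diff[of y x] p_diff_commute[of x y] by simp

text \<open>The C*-identity and submultiplicativity give
  \<open>p x * p x \<le> p (star A x) * p x\<close>, and a positive factor cancels. Isometry of the
  involution is not an axiom of \<open>cstar_seminorm\<close>; it follows by applying this to
  \<open>star A x\<close> as well.\<close>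

lemma p_le_p_star: assumes "x \<in> carrier A" shows "p x \<le> p (star A x)"
proof (cases "p x = 0")
 case False
 then have "p x > 0" using assms p_nonneg[of x] by linarith
 moreover have "p x * p x \<le> p (star A x) * p x"
  using p_mult[of "star A x" x] p_cstar[of x] assms by (simp add: power2_eq_square)
 ultimately show ?thesis by simp
qed (use assms in simp)

lemma p_star [simp]: "x \<in> carrier A ==> p (star A x) = p x"
 using p_le_p_star[of x] p_le_p_star[of "star A x"] by simp

text \<open>The C*-identity at the unit makes \<open>p \<one>\<close> a root of
  \<open>t * t = t\<close>. The value 0 does occur, for instance for the zero seminorm.\<close>

lemma p_one_le: "p \<one> \<le> 1"
proof -
 have "p \<one> * (p \<one> - 1) = 0"
  using p_cstar[of \<one>] by (simp add: power2_eq_square algebra_simps)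
 then show ?thesis by auto
qed

text \<open>Membership in the carrier is built in, so that the limit laws below carry no side
  conditions.\<close>

definition lim_to :: "(nat \<Rightarrow> 'a) \<Rightarrow> 'a \<Rightarrow> bool" where
 "lim_to \<sigma> x \<longleftrightarrow> (\<forall>n. \<sigma> n \<in> carrier A) \<and> x \<in> carrier A \<and> (\<lambda>n. p (\<sigma> n \<ominus> x)) \<longlonglongrightarrow> 0"

lemma null_seqI:
 assumes "\<And>n. \<sigma> n \<in> carrier A" "\<And>n. p (\<sigma> n) \<le> f n" "f \<longlonglongrightarrow> 0"
 shows "(\<lambda>n. p (\<sigma> n)) \<longlonglongrightarrow> 0"
 by (rule real_tendsto_sandwich[OF _ _ tendsto_const assms(3)]) (use assms in auto)

lemma lim_toI:
 assumes "\<And>n. \<sigma> n \<in> carrier A" "x \<in> carrier A" "\<And>n. p (\<sigma> n \<ominus> x) \<le> f n" "f \<longlonglongrightarrow> 0"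
 shows "lim_to \<sigma> x"
 unfolding lim_to_def using null_seqI[of "\<lambda>n. \<sigma> n \<ominus> x"] assms by auto

lemma lim_to_closed: "lim_to \<sigma> x ==> \<sigma> n \<in> carrier A" "lim_to \<sigma> x ==> x \<in> carrier A"
 by (auto simp: lim_to_def)

lemma lim_to_const: "x \<in> carrier A ==> lim_to (\<lambda>_. x) x"
 by (simp add: lim_to_def)

lemma lim_to_p: assumes "lim_to \<sigma> x" shows "(\<lambda>n. p (\<sigma> n)) \<longlonglongrightarrow> p x"
proof -
 have "(\<lambda>n. p (\<sigma> n) - p x) \<longlonglongrightarrow> 0"
  by (rule tendsto_rabs_zero_cancel, rule real_tendsto_sandwich[where f = "\<lambda>_. 0" and h = "\<lambda>n. p (\<sigma> n \<ominus> x)"])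
   (use assms p_abs_diff in \<open>auto simp: lim_to_def\<close>)
 then show ?thesis by (simp add: LIM_zero_iff)
qed

lemma lim_to_add:
 assumes "lim_to \<sigma> x" "lim_to \<tau> y" shows "lim_to (\<lambda>n. \<sigma> n \<oplus> \<tau> n) (x \<oplus> y)"
 by (rule lim_toI[where f = "\<lambda>n. p (\<sigma> n \<ominus> x) + p (\<tau> n \<ominus> y)"])
  (use assms p_add in \<open>auto simp: lim_to_def add_diff_add intro!: tendsto_add_zero\<close>)

lemma lim_to_smult:
 assumes "lim_to \<sigma> x" shows "lim_to (\<lambda>n. c \<odot> \<sigma> n) (c \<odot> x)"
 by (rule lim_toI[where f = "\<lambda>n. cmod c * p (\<sigma> n \<ominus> x)"])
  (use assms in \<open>auto simp: lim_to_def smult_diff[symmetric] p_smult intro!: tendsto_mult_right_zero\<close>)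

lemma lim_to_star:
 assumes "lim_to \<sigma> x" shows "lim_to (\<lambda>n. star A (\<sigma> n)) (star A x)"
 by (rule lim_toI[where f = "\<lambda>n. p (\<sigma> n \<ominus> x)"])
  (use assms in \<open>auto simp: lim_to_def star_diff[symmetric]\<close>)

lemma lim_to_mult:
 assumes "lim_to \<sigma> x" "lim_to \<tau> y" shows "lim_to (\<lambda>n. \<sigma> n \<otimes> \<tau> n) (x \<otimes> y)"
proof (rule lim_toI[where f = "\<lambda>n. p (\<sigma> n \<ominus> x) * p (\<tau> n) + p x * p (\<tau> n \<ominus> y)"])
 have c: "\<sigma> n \<in> carrier A" "\<tau> n \<in> carrier A" "x \<in> carrier A" "y \<in> carrier A" for n
  using assms by (auto simp: lim_to_def)
 show "p (\<sigma> n \<otimes> \<tau> n \<ominus> x \<otimes> y) \<le> p (\<sigma> n \<ominus> x) * p (\<tau> n) + p x * p (\<tau> n \<ominus> y)" for n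
  unfolding mult_diff_mult[OF c(1,2,3,4)]
  by (rule order_trans[OF p_add add_mono[OF p_mult p_mult]]) (use c in auto)
 have "(\<lambda>n. p (\<sigma> n \<ominus> x) * p (\<tau> n) + p x * p (\<tau> n \<ominus> y)) \<longlonglongrightarrow> 0 * p y + p x * 0"
  by (intro tendsto_intros lim_to_p assms) (use assms in \<open>auto simp: lim_to_def\<close>)
 then show "(\<lambda>n. p (\<sigma> n \<ominus> x) * p (\<tau> n) + p x * p (\<tau> n \<ominus> y)) \<longlonglongrightarrow> 0" by simp
qed (use assms in \<open>auto simp: lim_to_def\<close>)

lemma lim_to_uminus: assumes "lim_to \<sigma> x" shows "lim_to (\<lambda>n. \<ominus> \<sigma> n) (\<ominus> x)"
 using lim_to_smult[OF assms, of "-1"] assms by (simp add: lim_to_def smult_minus_one)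

lemma lim_to_diff:
 assumes "lim_to \<sigma> x" "lim_to \<tau> y" shows "lim_to (\<lambda>n. \<sigma> n \<ominus> \<tau> n) (x \<ominus> y)"
 unfolding minus_eq by (intro lim_to_add lim_to_uminus assms)

lemma lim_to_imp_Cauchy: assumes "lim_to \<sigma> x" shows "seminorm_Cauchy A p \<sigma>"
 unfolding seminorm_Cauchy_def
proof (intro conjI allI impI)
 fix e :: real assume "e > 0"
 with assms have "\<forall>\<^sub>F n in sequentially. p (\<sigma> n \<ominus> x) < e / 2"
  unfolding lim_to_def by (intro order_tendstoD(2)[where y = 0]) auto
 then obtain N where N: "\<And>n. n \<ge> N ==> p (\<sigma> n \<ominus> x) < e / 2"
  by (auto simp: eventually_sequentially)
 have "p (\<sigma> m \<ominus> \<sigma> n) < e" if "m \<ge> N" "n \<ge> N" for m n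
  using p_triangle[of "\<sigma> m" x "\<sigma> n"] N[OF that(1)] N[OF that(2)]
   p_diff_commute[of x "\<sigma> n"] assms by (auto simp: lim_to_def)
 then show "\<exists>N. \<forall>m\<ge>N. \<forall>n\<ge>N. p (\<sigma> m \<ominus> \<sigma> n) < e" by blast
qed (use assms in \<open>auto simp: lim_to_def\<close>)

text \<open>Serves three constructions: the square root iteration, the Neumann series and the
  lifting of an approximating sequence through a homomorphism.\<close>

lemma Cauchy_if_geometric:
 assumes c: "0 \<le> c" "c < 1" and \<sigma>: "\<And>n. \<sigma> n \<in> carrier A"
  and step: "\<And>n. p (\<sigma> (Suc n) \<ominus> \<sigma> n) \<le> K * c ^ n"
 shows "seminorm_Cauchy A p \<sigma>"
 unfolding seminorm_Cauchy_def
proof (intro conjI allI impI)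
 have le: "p (\<sigma> (n + k) \<ominus> \<sigma> n) \<le> (\<Sum>i<k. K * c ^ (n + i))" for n k
 proof (induction k)
  case (Suc k)
  have "p (\<sigma> (Suc (n + k)) \<ominus> \<sigma> n) \<le> p (\<sigma> (Suc (n + k)) \<ominus> \<sigma> (n + k)) + p (\<sigma> (n + k) \<ominus> \<sigma> n)"
   by (intro p_triangle \<sigma>)
  with Suc step[of "n + k"] show ?case by simp
 qed (use \<sigma> in simp)
 \<comment> \<open>At n = 0 the hypothesis bounds a seminorm by \<open>K\<close>, which fixes the
   sign of \<open>K\<close>.\<close>
 have K: "K \<ge> 0" using step[of 0] p_nonneg[OF minus_closed[OF \<sigma> \<sigma>], of 1 0] by simp
 have bound: "p (\<sigma> (n + k) \<ominus> \<sigma> n) \<le> K * c ^ n / (1 - c)" for n k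
 proof -
  have "(\<Sum>i<k. K * c ^ (n + i)) = K * c ^ n * (\<Sum>i<k. c ^ i)"
   by (simp add: sum_distrib_left power_add mult.assoc)
  also have "(\<Sum>i<k. c ^ i) \<le> 1 / (1 - c)"
   using c by (simp add: sum_gp_strict divide_right_mono)
  finally show ?thesis using le[of n k] K c by (simp add: mult_left_mono)
 qed
 fix e :: real assume "e > 0"
 have "(\<lambda>n. K * c ^ n / (1 - c)) \<longlonglongrightarrow> K * 0 / (1 - c)"
  by (intro tendsto_intros LIMSEQ_power_zero) (use c in auto)
 then have "\<forall>\<^sub>F n in sequentially. K * c ^ n / (1 - c) < e / 2"
  using \<open>e > 0\<close> by (intro order_tendstoD) auto
 then obtain N where N: "K * c ^ N / (1 - c) < e / 2" by (auto simp: eventually_sequentially)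
 have "p (\<sigma> m \<ominus> \<sigma> n) < e" if "m \<ge> N" "n \<ge> N" for m n
 proof -
  define B where "B = K * c ^ N / (1 - c)"
  have "p (\<sigma> m \<ominus> \<sigma> N) \<le> B" "p (\<sigma> n \<ominus> \<sigma> N) \<le> B"
   using bound[of N "m - N"] bound[of N "n - N"] that by (simp_all add: B_def)
  moreover have "B < e / 2" using N by (simp only: B_def)
  ultimately show ?thesis
   using p_triangle[OF \<sigma> \<sigma> \<sigma>, of m n N] p_diff_commute[OF \<sigma> \<sigma>, of N n] by linarith
 qed
 then show "\<exists>N. \<forall>m\<ge>N. \<forall>n\<ge>N. p (\<sigma> m \<ominus> \<sigma> n) < e" by blast
qed (use \<sigma> in auto)

end

locale cstar_alg =
 fixes A :: "('a, 'm) cstar_alg_scheme" (structure)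
 assumes cstar_algebra: "cstar_algebra A"
begin

sublocale cstar_semi A "cnorm A"
 using cstar_algebra by unfold_locales (simp_all add: cstar_algebra_def)

lemma cnorm_eq_0D: "x \<in> carrier A ==> cnorm A x = 0 ==> x = \<zero>"
 using cstar_algebra by (simp add: cstar_algebra_def)

lemma complete: "seminorm_Cauchy A (cnorm A) \<sigma> ==> \<exists>x. lim_to \<sigma> x"
proof -
 assume \<sigma>: "seminorm_Cauchy A (cnorm A) \<sigma>"
 with cstar_algebra have "\<exists>x\<in>carrier A. (\<lambda>n. cnorm A (\<sigma> n \<ominus> x)) \<longlonglongrightarrow> 0"
  by (simp add: cstar_algebra_def)
 with \<sigma> show ?thesis by (auto simp: lim_to_def seminorm_Cauchy_def)
qed

lemma lim_to_unique: assumes "lim_to \<sigma> x" "lim_to \<sigma> y" shows "x = y"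
proof -
 have "lim_to (\<lambda>n. \<sigma> n \<ominus> \<sigma> n) (x \<ominus> y)" by (intro lim_to_diff assms)
 then have "lim_to (\<lambda>n. \<zero>) (x \<ominus> y)" using assms by (simp add: lim_to_def)
 then have "cnorm A (x \<ominus> y) = 0"
  using lim_to_p[of "\<lambda>n. \<zero>"] by (simp add: LIMSEQ_const_iff)
 then show ?thesis using assms cnorm_eq_0D[of "x \<ominus> y"] by (auto simp: lim_to_def diff_eq_zero_iff)
qed

lemma cnorm_diff_eq_0D:
 "\<lbrakk>x \<in> carrier A; y \<in> carrier A; cnorm A (x \<ominus> y) = 0\<rbrakk> \<Longrightarrow> x = y"
 using cnorm_eq_0D[of "x \<ominus> y"] by (simp add: diff_eq_zero_iff)

end

section \<open>Completion\<close>

lemma cring_complex_ring: "cring complex_ring"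
proof (rule cringI)
 show "abelian_group complex_ring"
 proof (rule abelian_groupI)
  fix x assume "x \<in> carrier complex_ring"
  show "\<exists>y\<in>carrier complex_ring. y \<oplus>\<^bsub>complex_ring\<^esub> x = \<zero>\<^bsub>complex_ring\<^esub>"
   by (rule bexI[of _ "- x"]) (simp_all add: complex_ring_def)
 qed (simp_all add: complex_ring_def)
 show "comm_monoid complex_ring"
  by (rule comm_monoidI) (simp_all add: complex_ring_def)
qed (simp add: complex_ring_def distrib_right)

context cstar_semi
begin

abbreviation Cau :: "(nat \<Rightarrow> 'a) \<Rightarrow> bool" where "Cau \<equiv> seminorm_Cauchy A p"
abbreviation rel where "rel \<equiv> completion_rel A p"
abbreviation C where "C \<equiv> cstar_completion A p"

definition cls :: "(nat \<Rightarrow> 'a) \<Rightarrow> (nat \<Rightarrow> 'a) set" where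
 "cls \<sigma> = rel `` {\<sigma>}"

lemma Cau_closed [simp]: "Cau \<sigma> ==> \<sigma> n \<in> carrier A"
 by (simp add: seminorm_Cauchy_def)

text \<open>A common Cauchy criterion for all algebra operations; for a unary operation both
  comparison sequences are the same.\<close>

lemma Cau_dominated:
 assumes \<sigma>: "\<And>n. \<sigma> n \<in> carrier A" and "Cau \<tau>" "Cau \<rho>" and K: "K > 0"
  and le: "\<And>m n. p (\<sigma> m \<ominus> \<sigma> n) \<le> K * (p (\<tau> m \<ominus> \<tau> n) + p (\<rho> m \<ominus> \<rho> n))"
 shows "Cau \<sigma>"
 unfolding seminorm_Cauchy_def
proof (intro conjI allI impI)
 fix e :: real assume "e > 0"
 then have e: "e / (2 * K) > 0" using K by simp
 obtain M where M: "\<And>m n. m \<ge> M ==> n \<ge> M ==> p (\<tau> m \<ominus> \<tau> n) < e / (2 * K)"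
  using assms(2) e unfolding seminorm_Cauchy_def by blast
 obtain N where N: "\<And>m n. m \<ge> N ==> n \<ge> N ==> p (\<rho> m \<ominus> \<rho> n) < e / (2 * K)"
  using assms(3) e unfolding seminorm_Cauchy_def by blast
 have "p (\<sigma> m \<ominus> \<sigma> n) < e" if "m \<ge> max M N" "n \<ge> max M N" for m n
 proof -
  have "p (\<tau> m \<ominus> \<tau> n) + p (\<rho> m \<ominus> \<rho> n) < e / (2 * K) + e / (2 * K)"
   using M[of m n] N[of m n] that by (intro add_strict_mono) auto
  then have "K * (p (\<tau> m \<ominus> \<tau> n) + p (\<rho> m \<ominus> \<rho> n)) < K * (e / (2 * K) + e / (2 * K))"
   using K by (rule mult_strict_left_mono)
  also have "\<dots> = e" using K by (simp add: field_simps)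
  finally show ?thesis using le[of m n] by linarith
 qed
 then show "\<exists>N. \<forall>m\<ge>N. \<forall>n\<ge>N. p (\<sigma> m \<ominus> \<sigma> n) < e" by blast
qed (use \<sigma> in auto)

lemma Cau_const [simp]: "x \<in> carrier A ==> Cau (\<lambda>_. x)"
 by (simp add: seminorm_Cauchy_def)

lemma Cau_add [simp]: assumes "Cau \<sigma>" "Cau \<tau>" shows "Cau (\<lambda>n. \<sigma> n \<oplus> \<tau> n)"
 by (rule Cau_dominated[where \<tau> = \<sigma> and \<rho> = \<tau> and K = 1])
  (use assms p_add in \<open>auto simp: add_diff_add\<close>)

lemma Cau_smult [simp]: assumes "Cau \<sigma>" shows "Cau (\<lambda>n. c \<odot> \<sigma> n)"
proof (rule Cau_dominated[where \<tau> = \<sigma> and \<rho> = \<sigma> and K = "cmod c + 1"])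
 fix m n
 have "0 \<le> p (\<sigma> m \<ominus> \<sigma> n)" using assms by simp
 moreover have "0 \<le> cmod c * p (\<sigma> m \<ominus> \<sigma> n)" using assms by simp
 ultimately show "p (c \<odot> \<sigma> m \<ominus> c \<odot> \<sigma> n) \<le> (cmod c + 1) * (p (\<sigma> m \<ominus> \<sigma> n) + p (\<sigma> m \<ominus> \<sigma> n))"
  using assms by (simp add: smult_diff[symmetric] p_smult algebra_simps)
qed (use assms in \<open>auto simp: add_nonneg_pos\<close>)

lemma Cau_star [simp]: assumes "Cau \<sigma>" shows "Cau (\<lambda>n. star A (\<sigma> n))"
 by (rule Cau_dominated[where \<tau> = \<sigma> and \<rho> = \<sigma> and K = 1])
  (use assms in \<open>auto simp: star_diff[symmetric]\<close>)

lemma Cau_uminus [simp]: assumes "Cau \<sigma>" shows "Cau (\<lambda>n. \<ominus> \<sigma> n)"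
 using Cau_smult[OF assms, of "-1"] assms by (simp add: smult_minus_one)

lemma Cau_diff [simp]: assumes "Cau \<sigma>" "Cau \<tau>" shows "Cau (\<lambda>n. \<sigma> n \<ominus> \<tau> n)"
 using assms by (simp add: minus_eq)

lemma Cau_p: assumes "Cau \<sigma>" shows "convergent (\<lambda>n. p (\<sigma> n))"
proof (rule Cauchy_convergent, rule CauchyI)
 fix e :: real assume "0 < e"
 then obtain N where N: "\<And>m n. m \<ge> N ==> n \<ge> N ==> p (\<sigma> m \<ominus> \<sigma> n) < e"
  using assms unfolding seminorm_Cauchy_def by blast
 have "norm (p (\<sigma> m) - p (\<sigma> n)) < e" if "m \<ge> N" "n \<ge> N" for m n
  using N[OF that] p_abs_diff[of "\<sigma> m" "\<sigma> n"] assms by simp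
 then show "\<exists>M. \<forall>m\<ge>M. \<forall>n\<ge>M. norm (p (\<sigma> m) - p (\<sigma> n)) < e" by blast
qed

lemma Cau_bounded: assumes "Cau \<sigma>" obtains K where "K > 0" "\<And>n. p (\<sigma> n) \<le> K"
proof -
 have "Bseq (\<lambda>n. p (\<sigma> n))" using Cau_p[OF assms] by (rule convergent_imp_Bseq)
 then obtain K where "K > 0" "\<forall>n. norm (p (\<sigma> n)) \<le> K" unfolding Bseq_def by blast
 then show thesis using that[of K] by (simp add: abs_le_iff)
qed

text \<open>Writing \<open>x y - z w\<close> as \<open>(x - z) y + z (y - w)\<close> involves the
  sizes of the inner factors \<open>y\<close> and \<open>z\<close> only. Besides continuity of the
  product, this gives the contraction estimate of the square root iteration.\<close>

lemma p_mult_diff_mult: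
 assumes "x \<in> carrier A" "y \<in> carrier A" "z \<in> carrier A" "w \<in> carrier A"
  and "p y \<le> K" "p z \<le> L"
 shows "p (x \<otimes> y \<ominus> z \<otimes> w) \<le> K * p (x \<ominus> z) + L * p (y \<ominus> w)"
proof -
 have "p (x \<otimes> y \<ominus> z \<otimes> w) \<le> p ((x \<ominus> z) \<otimes> y) + p (z \<otimes> (y \<ominus> w))"
  using assms by (simp add: mult_diff_mult p_add)
 also have "\<dots> \<le> p (x \<ominus> z) * p y + p z * p (y \<ominus> w)"
  using assms by (intro add_mono p_mult) auto
 also have "p (x \<ominus> z) * p y \<le> p (x \<ominus> z) * K"
  using assms by (intro mult_left_mono) auto
 also have "p z * p (y \<ominus> w) \<le> L * p (y \<ominus> w)"
  using assms by (intro mult_right_mono) auto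
 finally show ?thesis by (simp add: mult.commute)
qed

lemma Cau_mult [simp]: assumes "Cau \<sigma>" "Cau \<tau>" shows "Cau (\<lambda>n. \<sigma> n \<otimes> \<tau> n)"
proof -
 obtain K where K: "K > 0" "\<And>n. p (\<sigma> n) \<le> K" using Cau_bounded[OF assms(1)] by blast
 obtain L where L: "L > 0" "\<And>n. p (\<tau> n) \<le> L" using Cau_bounded[OF assms(2)] by blast
 show ?thesis
 proof (rule Cau_dominated[where \<tau> = \<sigma> and \<rho> = \<tau> and K = "max K L"])
  fix m n
  have "p (\<sigma> m \<otimes> \<tau> m \<ominus> \<sigma> n \<otimes> \<tau> n) \<le> max K L * p (\<sigma> m \<ominus> \<sigma> n) + max K L * p (\<tau> m \<ominus> \<tau> n)"
   using assms K(2)[of n] L(2)[of m] by (intro p_mult_diff_mult) auto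
  then show "p (\<sigma> m \<otimes> \<tau> m \<ominus> \<sigma> n \<otimes> \<tau> n) \<le> max K L * (p (\<sigma> m \<ominus> \<sigma> n) + p (\<tau> m \<ominus> \<tau> n))"
   by (simp add: algebra_simps)
 qed (use assms K(1) in auto)
qed

lemma rel_iff: "(\<sigma>, \<tau>) \<in> rel \<longleftrightarrow> Cau \<sigma> \<and> Cau \<tau> \<and> (\<lambda>n. p (\<sigma> n \<ominus> \<tau> n)) \<longlonglongrightarrow> 0"
 by (simp add: completion_rel_def)

lemma equiv_rel: "equiv (Collect Cau) rel"
proof (rule equivI)
 show "refl_on (Collect Cau) rel" by (auto simp: refl_on_def rel_iff)
 show "sym rel"
 proof (rule symI)
  fix \<sigma> \<tau> assume *: "(\<sigma>, \<tau>) \<in> rel"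
  then have "(\<lambda>n. p (\<sigma> n \<ominus> \<tau> n)) = (\<lambda>n. p (\<tau> n \<ominus> \<sigma> n))"
   by (intro ext p_diff_commute) (simp_all add: rel_iff)
  with * show "(\<tau>, \<sigma>) \<in> rel" by (simp add: rel_iff)
 qed
 show "trans rel"
 proof (rule transI)
  fix \<sigma> \<tau> \<rho> assume *: "(\<sigma>, \<tau>) \<in> rel" "(\<tau>, \<rho>) \<in> rel"
  have "(\<lambda>n. p (\<sigma> n \<ominus> \<rho> n)) \<longlonglongrightarrow> 0"
  proof (rule null_seqI[where f = "\<lambda>n. p (\<sigma> n \<ominus> \<tau> n) + p (\<tau> n \<ominus> \<rho> n)"])
   show "(\<lambda>n. p (\<sigma> n \<ominus> \<tau> n) + p (\<tau> n \<ominus> \<rho> n)) \<longlonglongrightarrow> 0"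
    using * by (intro tendsto_add_zero) (simp_all add: rel_iff)
  qed (use * in \<open>simp_all add: rel_iff p_triangle\<close>)
  with * show "(\<sigma>, \<rho>) \<in> rel" by (simp add: rel_iff)
 qed
qed (auto simp: completion_rel_def)

lemma cls_eq_iff:
 "Cau \<sigma> ==> Cau \<tau> ==> cls \<sigma> = cls \<tau> \<longleftrightarrow> (\<lambda>n. p (\<sigma> n \<ominus> \<tau> n)) \<longlonglongrightarrow> 0"
 unfolding cls_def by (subst eq_equiv_class_iff[OF equiv_rel]) (auto simp: rel_iff)

lemma carrier_C: "carrier C = cls ` Collect Cau"
 by (auto simp: cstar_completion_def quotient_def cls_def Let_def)

lemma cls_closed [simp]: "Cau \<sigma> ==> cls \<sigma> \<in> carrier C"
 by (simp add: carrier_C)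

lemma carrier_C_E: assumes "x \<in> carrier C" obtains \<sigma> where "Cau \<sigma>" "x = cls \<sigma>"
 using assms by (auto simp: carrier_C)

text \<open>The operations of \<open>cstar_completion\<close> are unions over all representatives.
  Once the resulting class does not depend on the representatives, \<open>UN_equiv_class2\<close>
  collapses the union to a single class. The other operations follow this pattern.\<close>

lemma add_C: assumes "Cau \<sigma>" "Cau \<tau>" shows "cls \<sigma> \<oplus>\<^bsub>C\<^esub> cls \<tau> = cls (\<lambda>n. \<sigma> n \<oplus> \<tau> n)"
proof -
 have "cls \<sigma> \<oplus>\<^bsub>C\<^esub> cls \<tau> = (\<Union>\<sigma>'\<in>rel `` {\<sigma>}. \<Union>\<tau>'\<in>rel `` {\<tau>}. cls (\<lambda>n. \<sigma>' n \<oplus> \<tau>' n))"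
  by (simp add: cstar_completion_def Let_def cls_def)
 also have "\<dots> = cls (\<lambda>n. \<sigma> n \<oplus> \<tau> n)"
 proof (rule UN_equiv_class2[OF equiv_rel equiv_rel])
  show "congruent2 rel rel (\<lambda>\<sigma>' \<tau>'. cls (\<lambda>n. \<sigma>' n \<oplus> \<tau>' n))"
  proof (rule congruent2I')
   fix \<sigma> \<sigma>' \<tau> \<tau>' assume *: "(\<sigma>, \<sigma>') \<in> rel" "(\<tau>, \<tau>') \<in> rel"
   have "(\<lambda>n. p (\<sigma> n \<oplus> \<tau> n \<ominus> (\<sigma>' n \<oplus> \<tau>' n))) \<longlonglongrightarrow> 0"
   proof (rule null_seqI[where f = "\<lambda>n. p (\<sigma> n \<ominus> \<sigma>' n) + p (\<tau> n \<ominus> \<tau>' n)"])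
    show "(\<lambda>n. p (\<sigma> n \<ominus> \<sigma>' n) + p (\<tau> n \<ominus> \<tau>' n)) \<longlonglongrightarrow> 0"
     using * by (intro tendsto_add_zero) (simp_all add: rel_iff)
   qed (use * in \<open>simp_all add: rel_iff add_diff_add p_add\<close>)
   with * show "cls (\<lambda>n. \<sigma> n \<oplus> \<tau> n) = cls (\<lambda>n. \<sigma>' n \<oplus> \<tau>' n)"
    by (subst cls_eq_iff) (auto simp: rel_iff)
  qed
 qed (use assms in auto)
 finally show ?thesis .
qed

lemma mult_C: assumes "Cau \<sigma>" "Cau \<tau>" shows "cls \<sigma> \<otimes>\<^bsub>C\<^esub> cls \<tau> = cls (\<lambda>n. \<sigma> n \<otimes> \<tau> n)"
proof -
 have "cls \<sigma> \<otimes>\<^bsub>C\<^esub> cls \<tau> = (\<Union>\<sigma>'\<in>rel `` {\<sigma>}. \<Union>\<tau>'\<in>rel `` {\<tau>}. cls (\<lambda>n. \<sigma>' n \<otimes> \<tau>' n))"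
  by (simp add: cstar_completion_def Let_def cls_def)
 also have "\<dots> = cls (\<lambda>n. \<sigma> n \<otimes> \<tau> n)"
 proof (rule UN_equiv_class2[OF equiv_rel equiv_rel])
  show "congruent2 rel rel (\<lambda>\<sigma>' \<tau>'. cls (\<lambda>n. \<sigma>' n \<otimes> \<tau>' n))"
  proof (rule congruent2I')
   fix \<sigma> \<sigma>' \<tau> \<tau>' assume *: "(\<sigma>, \<sigma>') \<in> rel" "(\<tau>, \<tau>') \<in> rel"
   then have Cau: "Cau \<sigma>" "Cau \<sigma>'" "Cau \<tau>" "Cau \<tau>'" by (auto simp: rel_iff)
   obtain K where K: "\<And>n. p (\<sigma>' n) \<le> K" using Cau_bounded[OF Cau(2)] by blast
   obtain L where L: "\<And>n. p (\<tau> n) \<le> L" using Cau_bounded[OF Cau(3)] by blast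
   have "(\<lambda>n. p (\<sigma> n \<otimes> \<tau> n \<ominus> \<sigma>' n \<otimes> \<tau>' n)) \<longlonglongrightarrow> 0"
   proof (rule null_seqI[where f = "\<lambda>n. L * p (\<sigma> n \<ominus> \<sigma>' n) + K * p (\<tau> n \<ominus> \<tau>' n)"])
    show "p (\<sigma> n \<otimes> \<tau> n \<ominus> \<sigma>' n \<otimes> \<tau>' n) \<le> L * p (\<sigma> n \<ominus> \<sigma>' n) + K * p (\<tau> n \<ominus> \<tau>' n)" for n
     using Cau K L by (intro p_mult_diff_mult) simp_all
    show "(\<lambda>n. L * p (\<sigma> n \<ominus> \<sigma>' n) + K * p (\<tau> n \<ominus> \<tau>' n)) \<longlonglongrightarrow> 0"
     using * by (intro tendsto_add_zero tendsto_mult_right_zero) (simp_all add: rel_iff)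
   qed (use Cau in auto)
   with * show "cls (\<lambda>n. \<sigma> n \<otimes> \<tau> n) = cls (\<lambda>n. \<sigma>' n \<otimes> \<tau>' n)"
    by (subst cls_eq_iff) (auto simp: rel_iff)
  qed
 qed (use assms in auto)
 finally show ?thesis .
qed

lemma smult_C: assumes "Cau \<sigma>" shows "c \<odot>\<^bsub>C\<^esub> cls \<sigma> = cls (\<lambda>n. c \<odot> \<sigma> n)"
proof -
 have "c \<odot>\<^bsub>C\<^esub> cls \<sigma> = (\<Union>\<sigma>'\<in>rel `` {\<sigma>}. cls (\<lambda>n. c \<odot> \<sigma>' n))"
  by (simp add: cstar_completion_def Let_def cls_def)
 also have "\<dots> = cls (\<lambda>n. c \<odot> \<sigma> n)"
 proof (rule UN_equiv_class[OF equiv_rel])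
  show "congruent rel (\<lambda>\<sigma>'. cls (\<lambda>n. c \<odot> \<sigma>' n))"
   by (rule congruentI, subst cls_eq_iff)
    (auto simp: rel_iff smult_diff[symmetric] p_smult intro: tendsto_mult_right_zero)
 qed (use assms in auto)
 finally show ?thesis .
qed

lemma star_C: assumes "Cau \<sigma>" shows "star C (cls \<sigma>) = cls (\<lambda>n. star A (\<sigma> n))"
proof -
 have "star C (cls \<sigma>) = (\<Union>\<sigma>'\<in>rel `` {\<sigma>}. cls (\<lambda>n. star A (\<sigma>' n)))"
  by (simp add: cstar_completion_def Let_def cls_def)
 also have "\<dots> = cls (\<lambda>n. star A (\<sigma> n))"
 proof (rule UN_equiv_class[OF equiv_rel])
  show "congruent rel (\<lambda>\<sigma>'. cls (\<lambda>n. star A (\<sigma>' n)))"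
   by (rule congruentI, subst cls_eq_iff) (auto simp: rel_iff star_diff[symmetric])
 qed (use assms in auto)
 finally show ?thesis .
qed

lemma zero_C: "\<zero>\<^bsub>C\<^esub> = cls (\<lambda>n. \<zero>)" and one_C: "\<one>\<^bsub>C\<^esub> = cls (\<lambda>n. \<one>)"
 by (simp_all add: cstar_completion_def Let_def cls_def)

lemma to_completion_cls: "to_completion A p x = cls (\<lambda>n. x)"
 by (simp add: to_completion_def cls_def)

text \<open>The norm is \<open>the_elem\<close> of the set of limits along all representatives, so
  that set must be shown to be a singleton: equivalent sequences have seminorms with the same
  limit.\<close>

lemma cnorm_C: assumes "Cau \<sigma>" shows "(\<lambda>n. p (\<sigma> n)) \<longlonglongrightarrow> cnorm C (cls \<sigma>)"
proof -
 obtain l where l: "(\<lambda>n. p (\<sigma> n)) \<longlonglongrightarrow> l" using Cau_p[OF assms] by (auto simp: convergent_def)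
 have "lim (\<lambda>n. p (\<tau> n)) = l" if "\<tau> \<in> cls \<sigma>" for \<tau>
 proof -
  have *: "Cau \<tau>" "(\<lambda>n. p (\<sigma> n \<ominus> \<tau> n)) \<longlonglongrightarrow> 0" using that by (auto simp: cls_def rel_iff)
  have "(\<lambda>n. p (\<sigma> n) - p (\<tau> n)) \<longlonglongrightarrow> 0"
   by (rule tendsto_rabs_zero_cancel, rule real_tendsto_sandwich[where f = "\<lambda>_. 0", OF _ _ _ *(2)])
    (use assms * p_abs_diff in auto)
  from tendsto_diff[OF l this] have "(\<lambda>n. p (\<tau> n)) \<longlonglongrightarrow> l" by simp
  then show ?thesis by (rule limI)
 qed
 moreover have "\<sigma> \<in> cls \<sigma>" using assms by (simp add: cls_def rel_iff)
 ultimately have "(\<lambda>\<sigma>. lim (\<lambda>n. p (\<sigma> n))) ` cls \<sigma> = {l}" by (auto simp: image_iff)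
 then have "cnorm C (cls \<sigma>) = l" by (simp add: cstar_completion_def Let_def)
 with l show ?thesis by simp
qed

lemma cnorm_C_const: "x \<in> carrier A ==> cnorm C (cls (\<lambda>_. x)) = p x"
 using cnorm_C[of "\<lambda>_. x"] by (simp add: LIMSEQ_const_iff)

lemma ring_C: "ring C"
proof (rule ringI)
 show "abelian_group C"
 proof (rule abelian_groupI)
  fix x assume "x \<in> carrier C"
  then obtain \<sigma> where \<sigma>: "Cau \<sigma>" "x = cls \<sigma>" by (rule carrier_C_E)
  then have "cls (\<lambda>n. \<ominus> \<sigma> n) \<oplus>\<^bsub>C\<^esub> x = \<zero>\<^bsub>C\<^esub>" by (simp add: add_C zero_C l_neg)
  with \<sigma> show "\<exists>y\<in>carrier C. y \<oplus>\<^bsub>C\<^esub> x = \<zero>\<^bsub>C\<^esub>"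
   by (intro bexI[of _ "cls (\<lambda>n. \<ominus> \<sigma> n)"]) auto
 next
  fix x y assume "x \<in> carrier C" "y \<in> carrier C"
  then show "x \<oplus>\<^bsub>C\<^esub> y = y \<oplus>\<^bsub>C\<^esub> x"
   by (elim carrier_C_E) (simp add: add_C a_comm)
 qed (auto elim!: carrier_C_E simp: add_C zero_C a_assoc)
 show "Group.monoid C"
  by (rule monoidI) (auto elim!: carrier_C_E simp: mult_C one_C m_assoc)
qed (auto elim!: carrier_C_E simp: add_C mult_C l_distr r_distr)

lemma star_algebra_C: "star_algebra C"
 unfolding star_algebra_def
proof (intro conjI)
 show "Module.module complex_ring C"
  by (rule moduleI[OF cring_complex_ring ring.is_abelian_group[OF ring_C]])
   (auto elim!: carrier_C_E simp: smult_C add_C smult_l_distr smult_r_distr smult_assoc complex_ring_def)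
qed (use ring_C in \<open>auto elim!: carrier_C_E
  simp: smult_C mult_C add_C star_C smult_mult_left smult_mult_right star_smult star_add star_mult\<close>)

lemma uminus_C: assumes "Cau \<sigma>" shows "\<ominus>\<^bsub>C\<^esub> cls \<sigma> = cls (\<lambda>n. \<ominus> \<sigma> n)"
proof -
 interpret C: ring C by (rule ring_C)
 show ?thesis
  by (rule C.add.inv_equality) (use assms in \<open>auto simp: add_C zero_C l_neg\<close>)
qed

lemma diff_C: assumes "Cau \<sigma>" "Cau \<tau>" shows "cls \<sigma> \<ominus>\<^bsub>C\<^esub> cls \<tau> = cls (\<lambda>n. \<sigma> n \<ominus> \<tau> n)"
 using assms by (simp add: a_minus_def uminus_C add_C)

lemma cstar_seminorm_C: "cstar_seminorm C (cnorm C)"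
 unfolding cstar_seminorm_def
proof (intro conjI ballI allI)
 fix x assume "x \<in> carrier C"
 then obtain \<sigma> where \<sigma>: "Cau \<sigma>" "x = cls \<sigma>" by (rule carrier_C_E)
 show "0 \<le> cnorm C x"
  using LIMSEQ_le_const[OF cnorm_C[OF \<sigma>(1)], of 0] \<sigma> by simp
 have "(\<lambda>n. p (star A (\<sigma> n) \<otimes> \<sigma> n)) \<longlonglongrightarrow> (cnorm C x)\<^sup>2"
  using \<sigma> by (auto simp: p_cstar intro!: tendsto_power cnorm_C)
 then show "cnorm C (star C x \<otimes>\<^bsub>C\<^esub> x) = (cnorm C x)\<^sup>2"
  using \<sigma> LIMSEQ_unique[OF cnorm_C[of "\<lambda>n. star A (\<sigma> n) \<otimes> \<sigma> n"]] by (auto simp: star_C mult_C)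
 have "(\<lambda>n. p (c \<odot> \<sigma> n)) \<longlonglongrightarrow> cmod c * cnorm C x" for c
  using \<sigma> by (auto simp: p_smult intro!: tendsto_mult_left cnorm_C)
 then show "cnorm C (c \<odot>\<^bsub>C\<^esub> x) = cmod c * cnorm C x" for c
  using LIMSEQ_unique[OF cnorm_C[of "\<lambda>n. c \<odot> \<sigma> n"]] \<sigma> by (auto simp: smult_C)
 fix y assume "y \<in> carrier C"
 then obtain \<tau> where \<tau>: "Cau \<tau>" "y = cls \<tau>" by (rule carrier_C_E)
 have "(\<lambda>n. p (\<sigma> n) + p (\<tau> n)) \<longlonglongrightarrow> cnorm C x + cnorm C y"
  using \<sigma> \<tau> by (auto intro!: tendsto_add cnorm_C)
 then show "cnorm C (x \<oplus>\<^bsub>C\<^esub> y) \<le> cnorm C x + cnorm C y"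
  using LIMSEQ_le[OF cnorm_C[of "\<lambda>n. \<sigma> n \<oplus> \<tau> n"]] \<sigma> \<tau> by (auto simp: add_C p_add)
 have "(\<lambda>n. p (\<sigma> n) * p (\<tau> n)) \<longlonglongrightarrow> cnorm C x * cnorm C y"
  using \<sigma> \<tau> by (auto intro!: tendsto_mult cnorm_C)
 then show "cnorm C (x \<otimes>\<^bsub>C\<^esub> y) \<le> cnorm C x * cnorm C y"
  using LIMSEQ_le[OF cnorm_C[of "\<lambda>n. \<sigma> n \<otimes> \<tau> n"]] \<sigma> \<tau> by (auto simp: mult_C p_mult)
qed

text \<open>The distance from the n-th term to the class is the limit over m of
  \<open>p (\<sigma> n \<ominus> \<sigma> m)\<close>, and the Cauchy bound survives that
  limit.\<close>

lemma cls_lim: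
 assumes "Cau \<sigma>" shows "(\<lambda>n. cnorm C (cls (\<lambda>_. \<sigma> n) \<ominus>\<^bsub>C\<^esub> cls \<sigma>)) \<longlonglongrightarrow> 0"
proof (rule LIMSEQ_I)
 fix e :: real assume e: "0 < e"
 then have "e / 2 > 0" by simp
 then obtain N where N: "\<And>m n. m \<ge> N ==> n \<ge> N ==> p (\<sigma> m \<ominus> \<sigma> n) < e / 2"
  using assms unfolding seminorm_Cauchy_def by blast
 have "norm (cnorm C (cls (\<lambda>_. \<sigma> n) \<ominus>\<^bsub>C\<^esub> cls \<sigma>) - 0) < e" if n: "n \<ge> N" for n
 proof -
  have "(\<lambda>m. p (\<sigma> n \<ominus> \<sigma> m)) \<longlonglongrightarrow> cnorm C (cls (\<lambda>_. \<sigma> n) \<ominus>\<^bsub>C\<^esub> cls \<sigma>)"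
   using assms by (simp add: diff_C cnorm_C)
  from LIMSEQ_le_const2[OF this, of "e / 2"] LIMSEQ_le_const[OF this, of 0]
  have "cnorm C (cls (\<lambda>_. \<sigma> n) \<ominus>\<^bsub>C\<^esub> cls \<sigma>) \<le> e / 2" "0 \<le> cnorm C (cls (\<lambda>_. \<sigma> n) \<ominus>\<^bsub>C\<^esub> cls \<sigma>)"
   using N[OF n] assms by (auto intro: less_imp_le)
  then show ?thesis using e by simp
 qed
 then show "\<exists>no. \<forall>n\<ge>no. norm (cnorm C (cls (\<lambda>_. \<sigma> n) \<ominus>\<^bsub>C\<^esub> cls \<sigma>) - 0) < e" by blast
qed

lemma cls_dense:
 assumes "x \<in> carrier C" "e > 0" obtains a where "a \<in> carrier A" "cnorm C (x \<ominus>\<^bsub>C\<^esub> cls (\<lambda>_. a)) < e"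
proof -
 interpret C: cstar_semi C "cnorm C"
  by unfold_locales (rule star_algebra_C cstar_seminorm_C)+
 obtain \<sigma> where \<sigma>: "Cau \<sigma>" "x = cls \<sigma>" using assms(1) by (rule carrier_C_E)
 have "\<forall>\<^sub>F n in sequentially. cnorm C (cls (\<lambda>_. \<sigma> n) \<ominus>\<^bsub>C\<^esub> cls \<sigma>) < e"
  using cls_lim[OF \<sigma>(1)] assms(2) by (rule order_tendstoD)
 then obtain n where "cnorm C (cls (\<lambda>_. \<sigma> n) \<ominus>\<^bsub>C\<^esub> cls \<sigma>) < e" by (auto simp: eventually_sequentially)
 then show thesis using \<sigma> that[of "\<sigma> n"] by (simp add: C.p_diff_commute)
qed

theorem cstar_algebra_C: "cstar_algebra C"
 unfolding cstar_algebra_def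
proof (intro conjI ballI allI impI)
 interpret C: cstar_semi C "cnorm C"
  by unfold_locales (rule star_algebra_C cstar_seminorm_C)+
 fix x assume "x \<in> carrier C" and 0: "cnorm C x = 0"
 then obtain \<sigma> where \<sigma>: "Cau \<sigma>" "x = cls \<sigma>" using carrier_C_E by blast
 then show "x = \<zero>\<^bsub>C\<^esub>"
  using cnorm_C[OF \<sigma>(1)] 0 by (simp add: zero_C cls_eq_iff minus_eq)
next
 interpret C: cstar_semi C "cnorm C"
  by unfold_locales (rule star_algebra_C cstar_seminorm_C)+
 fix X assume X: "seminorm_Cauchy C (cnorm C) X"
 \<comment> \<open>Diagonal argument: the n-th class is replaced by an element of \<open>A\<close>
   within \<open>e n\<close>. These elements form a Cauchy sequence in \<open>A\<close>, and its
   class is the limit.\<close>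
 define e where "e n = 1 / real (Suc n)" for n
 have e: "e n > 0" "e \<longlonglongrightarrow> 0" for n
  unfolding e_def using LIMSEQ_inverse_real_of_nat by (auto simp: inverse_eq_divide)
 have "\<exists>a. a \<in> carrier A \<and> cnorm C (X n \<ominus>\<^bsub>C\<^esub> cls (\<lambda>_. a)) < e n" for n
 proof -
  have "X n \<in> carrier C" using X by (rule C.Cau_closed)
  then show ?thesis using e(1)[of n] by (rule cls_dense) blast
 qed
 then obtain \<sigma> where \<sigma>: "\<And>n. \<sigma> n \<in> carrier A" "\<And>n. cnorm C (X n \<ominus>\<^bsub>C\<^esub> cls (\<lambda>_. \<sigma> n)) < e n" by metis
 have Xc: "X n \<in> carrier C" for n using X by simp
 have "Cau \<sigma>"
  unfolding seminorm_Cauchy_def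
 proof (intro conjI allI impI)
  fix d :: real assume d: "d > 0"
  then have "d / 3 > 0" by simp
  then obtain N where N: "\<And>m n. m \<ge> N ==> n \<ge> N ==> cnorm C (X m \<ominus>\<^bsub>C\<^esub> X n) < d / 3"
   using X unfolding seminorm_Cauchy_def by blast
  have "\<forall>\<^sub>F n in sequentially. e n < d / 3" using e(2) d by (intro order_tendstoD) auto
  then obtain M where M: "\<And>n. n \<ge> M ==> e n < d / 3" by (auto simp: eventually_sequentially)
  have "p (\<sigma> m \<ominus> \<sigma> n) < d" if "m \<ge> max M N" "n \<ge> max M N" for m n
  proof -
   have "p (\<sigma> m \<ominus> \<sigma> n) = cnorm C (cls (\<lambda>_. \<sigma> m) \<ominus>\<^bsub>C\<^esub> cls (\<lambda>_. \<sigma> n))"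
    using \<sigma> by (simp add: diff_C cnorm_C_const)
   also have "\<dots> \<le> cnorm C (cls (\<lambda>_. \<sigma> m) \<ominus>\<^bsub>C\<^esub> X m) + cnorm C (X m \<ominus>\<^bsub>C\<^esub> cls (\<lambda>_. \<sigma> n))"
    using \<sigma> Xc by (intro C.p_triangle) auto
   also have "cnorm C (X m \<ominus>\<^bsub>C\<^esub> cls (\<lambda>_. \<sigma> n)) \<le> cnorm C (X m \<ominus>\<^bsub>C\<^esub> X n) + cnorm C (X n \<ominus>\<^bsub>C\<^esub> cls (\<lambda>_. \<sigma> n))"
    using \<sigma> Xc by (intro C.p_triangle) auto
   also have "cnorm C (cls (\<lambda>_. \<sigma> m) \<ominus>\<^bsub>C\<^esub> X m) = cnorm C (X m \<ominus>\<^bsub>C\<^esub> cls (\<lambda>_. \<sigma> m))"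
    using \<sigma> Xc by (intro C.p_diff_commute) auto
   finally show ?thesis using \<sigma>(2)[of m] \<sigma>(2)[of n] M[of m] M[of n] N[of m n] that by simp
  qed
  then show "\<exists>N. \<forall>m\<ge>N. \<forall>n\<ge>N. p (\<sigma> m \<ominus> \<sigma> n) < d" by blast
 qed (use \<sigma> in auto)
 have "(\<lambda>n. cnorm C (X n \<ominus>\<^bsub>C\<^esub> cls \<sigma>)) \<longlonglongrightarrow> 0"
 proof (rule C.null_seqI[where f = "\<lambda>n. e n + cnorm C (cls (\<lambda>_. \<sigma> n) \<ominus>\<^bsub>C\<^esub> cls \<sigma>)"])
  show "cnorm C (X n \<ominus>\<^bsub>C\<^esub> cls \<sigma>) \<le> e n + cnorm C (cls (\<lambda>_. \<sigma> n) \<ominus>\<^bsub>C\<^esub> cls \<sigma>)" for n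
   using C.p_triangle[of "X n" "cls (\<lambda>_. \<sigma> n)" "cls \<sigma>"] \<sigma>(2)[of n] \<sigma>(1) \<open>Cau \<sigma>\<close> Xc by simp
  show "(\<lambda>n. e n + cnorm C (cls (\<lambda>_. \<sigma> n) \<ominus>\<^bsub>C\<^esub> cls \<sigma>)) \<longlonglongrightarrow> 0"
   by (rule tendsto_add_zero[OF e(2) cls_lim[OF \<open>Cau \<sigma>\<close>]])
 qed (use \<open>Cau \<sigma>\<close> Xc in simp_all)
 then show "\<exists>x\<in>carrier C. (\<lambda>n. cnorm C (X n \<ominus>\<^bsub>C\<^esub> x)) \<longlonglongrightarrow> 0"
  using \<open>Cau \<sigma>\<close> by auto
qed (rule star_algebra_C cstar_seminorm_C)+

end

section \<open>Contractivity and extension of *-homomorphisms\<close>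

context star_alg
begin

lemma diff_l_distr:
 "\<lbrakk>x \<in> carrier A; y \<in> carrier A; z \<in> carrier A\<rbrakk> \<Longrightarrow> (x \<ominus> y) \<otimes> z = x \<otimes> z \<ominus> y \<otimes> z"
 by (simp add: minus_eq l_distr l_minus)

lemma diff_r_distr:
 "\<lbrakk>x \<in> carrier A; y \<in> carrier A; z \<in> carrier A\<rbrakk> \<Longrightarrow> z \<otimes> (x \<ominus> y) = z \<otimes> x \<ominus> z \<otimes> y"
 by (simp add: minus_eq r_distr r_minus)

end

section \<open>Homomorphisms, possibly not unital\<close>

text \<open>The representations in the spatial norm may be degenerate, so preservation of the unit
  is split off from \<open>star_hom\<close>.\<close>

definition star_map ::
  "('a, 'm) star_alg_scheme \<Rightarrow> ('b, 'n) star_alg_scheme \<Rightarrow> ('a \<Rightarrow> 'b) set" where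
 "star_map A B = {h. h \<in> carrier A \<rightarrow> carrier B \<and>
   (\<forall>x\<in>carrier A. h (star A x) = star B (h x) \<and> (\<forall>c. h (c \<odot>\<^bsub>A\<^esub> x) = c \<odot>\<^bsub>B\<^esub> h x)) \<and>
   (\<forall>x\<in>carrier A. \<forall>y\<in>carrier A.
    h (x \<oplus>\<^bsub>A\<^esub> y) = h x \<oplus>\<^bsub>B\<^esub> h y \<and> h (x \<otimes>\<^bsub>A\<^esub> y) = h x \<otimes>\<^bsub>B\<^esub> h y)}"

lemma star_mapI:
 assumes "\<And>x. x \<in> carrier A ==> h x \<in> carrier B"
  and "\<And>x y. x \<in> carrier A ==> y \<in> carrier A ==> h (x \<oplus>\<^bsub>A\<^esub> y) = h x \<oplus>\<^bsub>B\<^esub> h y"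
  and "\<And>x y. x \<in> carrier A ==> y \<in> carrier A ==> h (x \<otimes>\<^bsub>A\<^esub> y) = h x \<otimes>\<^bsub>B\<^esub> h y"
  and "\<And>c x. x \<in> carrier A ==> h (c \<odot>\<^bsub>A\<^esub> x) = c \<odot>\<^bsub>B\<^esub> h x"
  and "\<And>x. x \<in> carrier A ==> h (star A x) = star B (h x)"
 shows "h \<in> star_map A B"
 using assms by (auto simp: star_map_def)

lemma star_mapD:
 assumes "h \<in> star_map A B"
 shows "x \<in> carrier A ==> h x \<in> carrier B"
  and "x \<in> carrier A ==> y \<in> carrier A ==> h (x \<oplus>\<^bsub>A\<^esub> y) = h x \<oplus>\<^bsub>B\<^esub> h y"
  and "x \<in> carrier A ==> y \<in> carrier A ==> h (x \<otimes>\<^bsub>A\<^esub> y) = h x \<otimes>\<^bsub>B\<^esub> h y"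
  and "x \<in> carrier A ==> h (c \<odot>\<^bsub>A\<^esub> x) = c \<odot>\<^bsub>B\<^esub> h x"
  and "x \<in> carrier A ==> h (star A x) = star B (h x)"
 using assms by (auto simp: star_map_def)

lemma star_hom_iff: "h \<in> star_hom A B \<longleftrightarrow> h \<in> star_map A B \<and> h \<one>\<^bsub>A\<^esub> = \<one>\<^bsub>B\<^esub>"
 by (auto simp: star_hom_def star_map_def ring_hom_def)

lemma star_homI: "h \<in> star_map A B ==> h \<one>\<^bsub>A\<^esub> = \<one>\<^bsub>B\<^esub> ==> h \<in> star_hom A B"
 by (simp add: star_hom_iff)

lemma star_homD: "h \<in> star_hom A B ==> h \<in> star_map A B" "h \<in> star_hom A B ==> h \<one>\<^bsub>A\<^esub> = \<one>\<^bsub>B\<^esub>"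
 by (simp_all add: star_hom_iff)

lemma star_map_comp: "f \<in> star_map A B ==> g \<in> star_map B D ==> (\<lambda>x. g (f x)) \<in> star_map A D"
 by (rule star_mapI) (simp_all add: star_mapD)

lemma star_hom_comp: "f \<in> star_hom A B ==> g \<in> star_hom B D ==> (\<lambda>x. g (f x)) \<in> star_hom A D"
 using star_map_comp[of f A B g D] by (simp add: star_hom_iff)

lemma (in star_alg) star_map_cong:
 assumes "f \<in> star_map A B" "\<And>x. x \<in> carrier A ==> g x = f x"
 shows "g \<in> star_map A B"
 by (rule star_mapI) (simp_all add: assms star_mapD[OF assms(1)])

lemma (in star_alg) star_map_zero:
 assumes "star_alg B" "h \<in> star_map A B" shows "h \<zero> = \<zero>\<^bsub>B\<^esub>"
proof -
 interpret B: star_alg B by fact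
 have "h (0 \<odot> \<zero>) = 0 \<odot>\<^bsub>B\<^esub> h \<zero>" by (rule star_mapD[OF assms(2)]) simp
 then show ?thesis by (simp add: star_mapD[OF assms(2)])
qed

lemma (in star_alg) star_map_diff:
 assumes "star_alg B" "h \<in> star_map A B" "x \<in> carrier A" "y \<in> carrier A"
 shows "h (x \<ominus> y) = h x \<ominus>\<^bsub>B\<^esub> h y"
proof -
 interpret B: star_alg B by fact
 have "h (x \<oplus> (- 1) \<odot> y) = h x \<oplus>\<^bsub>B\<^esub> (- 1) \<odot>\<^bsub>B\<^esub> h y"
  using assms by (simp add: star_mapD[OF assms(2)])
 then show ?thesis
  using assms star_mapD(1)[OF assms(2)] by (simp add: smult_minus_one B.smult_minus_one minus_eq B.minus_eq)
qed

lemma (in star_alg) star_map_finsum: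
 assumes "star_alg B" "h \<in> star_map A B" "finite I" "f \<in> I \<rightarrow> carrier A"
 shows "h (finsum A f I) = (\<Oplus>\<^bsub>B\<^esub>i\<in>I. h (f i))"
proof -
 interpret B: star_alg B by fact
 show ?thesis using assms(3,4)
 proof (induction I rule: finite_induct)
  case (insert i I)
  then show ?case by (subst finsum_insert, simp_all add: Pi_iff star_mapD[OF assms(2)])
 qed (simp add: star_map_zero[OF assms(1,2)])
qed

text \<open>Turns contractivity of a map into a comparison of two C*-seminorms on its source, and
  turns every map out of a free algebra into a candidate for the universal seminorm.\<close>

lemma (in cstar_semi) pullback_seminorm:
 assumes "star_alg S" "h \<in> star_map S A"
 shows "cstar_seminorm S (\<lambda>x. p (h x))"
proof -
 interpret S: star_alg S by fact
 show ?thesis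
  using star_mapD[OF assms(2)] by (auto simp: cstar_seminorm_def p_cstar[symmetric] p_smult p_add p_mult)
qed

context cstar_alg
begin

text \<open>The fixed point \<open>y\<close> of \<open>y \<mapsto> (h\<^sup>2 + y\<^sup>2) / 2\<close> gives \<open>1 - y = (1 - h\<^sup>2)\<^sup>1\<^sup>/\<^sup>2\<close>.\<close>

lemma sqrt_one_minus_square:
 assumes h: "h \<in> carrier A" "star A h = h" "cnorm A h < 1"
 obtains b where "b \<in> carrier A" "star A b = b" "b \<otimes> h = h \<otimes> b" "h \<otimes> h \<oplus> b \<otimes> b = \<one>"
proof -
 define x where "x = h \<otimes> h"
 define F where "F z = (1/2) \<odot> (x \<oplus> z \<otimes> z)" for z
 define y where "y n = (F ^^ n) \<zero>" for n
 define r where "r = cnorm A x"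
 \<comment> \<open>\<open>s\<close> is the smaller fixed point of the scalar map that sends t to (r
   + t * t) / 2. Hence \<open>F\<close> preserves the ball of radius \<open>s\<close> and contracts
   there by the factor \<open>s < 1\<close>.\<close>
 define s where "s = 1 - sqrt (1 - r)"
 have x: "x \<in> carrier A" "star A x = x" "x \<otimes> h = h \<otimes> x"
  using h by (simp_all add: x_def star_mult m_assoc)
 have "r = (cnorm A h)\<^sup>2" using p_cstar[of h] h by (simp add: r_def x_def)
 then have r: "0 \<le> r" "r < 1" using h by (simp_all add: abs_square_less_1 power_less_one_iff)
 then have s: "0 \<le> s" "s < 1" by (simp_all add: s_def)
 have s_eq: "r + s * s = 2 * s"
 proof -
  define t where "t = sqrt (1 - r)"
  have rt: "r = 1 - t * t" using r by (simp add: t_def)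
  have st: "s = 1 - t" by (simp add: s_def t_def)
  show ?thesis unfolding rt st by (simp add: algebra_simps)
 qed
 have y0: "y 0 = \<zero>" and ySuc: "y (Suc n) = F (y n)" for n by (simp_all add: y_def)
 have y: "y n \<in> carrier A \<and> star A (y n) = y n \<and> y n \<otimes> h = h \<otimes> y n \<and> cnorm A (y n) \<le> s" for n
 proof (induction n)
  case (Suc n)
  have 1: "y n \<otimes> y n \<otimes> h = h \<otimes> (y n \<otimes> y n)"
   using Suc h by (metis m_assoc)
  have "cnorm A (x \<oplus> y n \<otimes> y n) \<le> r + s * s"
   unfolding r_def using Suc x s
   by (intro order_trans[OF p_add] add_left_mono order_trans[OF p_mult] mult_mono) auto
  moreover have "cnorm A (F (y n)) = 1/2 * cnorm A (x \<oplus> y n \<otimes> y n)"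
   using Suc x by (simp add: F_def p_smult)
  ultimately have "cnorm A (F (y n)) \<le> s" unfolding s_eq by simp
  with Suc x h 1 show ?case
   by (simp add: ySuc F_def star_smult star_add star_mult smult_mult_left smult_mult_right l_distr r_distr)
 qed (use h s in \<open>simp add: y0\<close>)
 have step: "cnorm A (y (Suc n) \<ominus> y n) \<le> cnorm A (y 1 \<ominus> y 0) * s ^ n" for n
 proof (induction n)
  case (Suc n)
  have c: "y n \<in> carrier A" "y (Suc n) \<in> carrier A" using y by auto
  have "y (Suc (Suc n)) \<ominus> y (Suc n) = (1/2) \<odot> ((x \<oplus> y (Suc n) \<otimes> y (Suc n)) \<ominus> (x \<oplus> y n \<otimes> y n))"
   using c x by (subst smult_diff) (simp_all add: ySuc[of "Suc n"] ySuc[of n, symmetric], simp add: F_def ySuc)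
  also have "(x \<oplus> y (Suc n) \<otimes> y (Suc n)) \<ominus> (x \<oplus> y n \<otimes> y n) = y (Suc n) \<otimes> y (Suc n) \<ominus> y n \<otimes> y n"
   using c x by (simp add: add_diff_add)
  finally have "cnorm A (y (Suc (Suc n)) \<ominus> y (Suc n)) = 1/2 * cnorm A (y (Suc n) \<otimes> y (Suc n) \<ominus> y n \<otimes> y n)"
   using c by (simp add: p_smult)
  also have "cnorm A (y (Suc n) \<otimes> y (Suc n) \<ominus> y n \<otimes> y n)
    \<le> s * cnorm A (y (Suc n) \<ominus> y n) + s * cnorm A (y (Suc n) \<ominus> y n)"
   using y by (intro p_mult_diff_mult) auto
  finally have "cnorm A (y (Suc (Suc n)) \<ominus> y (Suc n)) \<le> s * cnorm A (y (Suc n) \<ominus> y n)" by simp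
  also have "\<dots> \<le> s * (cnorm A (y 1 \<ominus> y 0) * s ^ n)" using Suc s by (intro mult_left_mono) auto
  finally show ?case by (simp add: mult_ac)
 qed simp
 have "seminorm_Cauchy A (cnorm A) y"
  by (rule Cauchy_if_geometric[OF s _ step]) (use y in auto)
 then obtain z where z: "lim_to y z" using complete by blast
 have zc: "z \<in> carrier A" using z by (rule lim_to_closed)
 have "lim_to (\<lambda>n. y (Suc n)) z"
  using z LIMSEQ_Suc[of "\<lambda>n. cnorm A (y n \<ominus> z)"] by (simp add: lim_to_def)
 moreover have "lim_to (\<lambda>n. y (Suc n)) (F z)"
  unfolding ySuc F_def by (intro lim_to_smult lim_to_add lim_to_const lim_to_mult z x)
 ultimately have "z = F z" by (rule lim_to_unique)
 then have "z \<oplus> z = F z \<oplus> F z" by simp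
 also have "\<dots> = (1/2 + 1/2) \<odot> (x \<oplus> z \<otimes> z)"
  unfolding F_def by (rule smult_l_distr[symmetric]) (use x zc in simp)
 finally have zz: "z \<oplus> z = x \<oplus> z \<otimes> z" using x zc by simp
 \<comment> \<open>All iterates are self-adjoint and commute with \<open>h\<close>; uniqueness of
   limits hands both properties to \<open>z\<close>.\<close>
 have "lim_to y (star A z)" using lim_to_star[OF z] y by simp
 then have zs: "star A z = z" using z lim_to_unique by blast
 have "lim_to (\<lambda>n. h \<otimes> y n) (z \<otimes> h)" using lim_to_mult[OF z lim_to_const[OF h(1)]] y by simp
 moreover have "lim_to (\<lambda>n. h \<otimes> y n) (h \<otimes> z)" by (intro lim_to_mult lim_to_const z h)
 ultimately have zh: "z \<otimes> h = h \<otimes> z" by (rule lim_to_unique)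
 \<comment> \<open>Completing the square: the fixed point equation in the form \<open>zz\<close>
   replaces the linear term, and only \<open>\<one> \<ominus> x\<close> remains.\<close>
 have "(\<one> \<ominus> z) \<otimes> (\<one> \<ominus> z) = \<one> \<ominus> (z \<oplus> z) \<oplus> z \<otimes> z"
  using zc by (simp add: minus_eq l_distr r_distr l_minus r_minus minus_add a_ac)
 also have "\<dots> = \<one> \<ominus> (x \<oplus> z \<otimes> z) \<oplus> z \<otimes> z" by (simp add: zz)
 also have "\<dots> = \<one> \<ominus> x" using zc x(1) by algebra
 finally have "h \<otimes> h \<oplus> (\<one> \<ominus> z) \<otimes> (\<one> \<ominus> z) = x \<oplus> (\<one> \<ominus> x)" by (simp add: x_def)
 also have "\<dots> = \<one>" using x(1) by algebra
 finally have "h \<otimes> h \<oplus> (\<one> \<ominus> z) \<otimes> (\<one> \<ominus> z) = \<one>" .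
 moreover have "(\<one> \<ominus> z) \<otimes> h = h \<ominus> z \<otimes> h" "h \<otimes> (\<one> \<ominus> z) = h \<ominus> h \<otimes> z"
  using zc h(1) by (simp_all add: diff_l_distr diff_r_distr)
 ultimately show thesis
  by (intro that[of "\<one> \<ominus> z"]) (use zc zs zh in \<open>simp_all add: star_diff\<close>)
qed

text \<open>A self-adjoint \<open>h\<close> of norm less than 1 is the real part of the unitary
 \<open>h + \<i> (1 - h\<^sup>2)\<^sup>1\<^sup>/\<^sup>2\<close>, which has seminorm at most 1.\<close>

lemma cstar_seminorm_selfadjoint_le_one:
 assumes "cstar_seminorm A q" and h: "h \<in> carrier A" "star A h = h" "cnorm A h < 1"
 shows "q h \<le> 1"
proof -
 interpret Q: cstar_semi A q by unfold_locales fact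
 obtain b where b: "b \<in> carrier A" "star A b = b" "b \<otimes> h = h \<otimes> b" "h \<otimes> h \<oplus> b \<otimes> b = \<one>"
  using sqrt_one_minus_square[OF h] .
 define u where "u = h \<oplus> \<i> \<odot> b"
 have uc: "u \<in> carrier A" using h b by (simp add: u_def)
 have su: "star A u = h \<oplus> (- \<i>) \<odot> b" using h b by (simp add: u_def star_add star_smult)
 have hb: "h \<otimes> b \<in> carrier A" "h \<otimes> h \<in> carrier A" "b \<otimes> b \<in> carrier A" using h b by auto
 \<comment> \<open>The mixed terms carry opposite imaginary coefficients and cancel because
   \<open>b\<close> commutes with \<open>h\<close>.\<close>
 have "star A u \<otimes> u = (h \<otimes> h \<oplus> (- \<i>) \<odot> (h \<otimes> b)) \<oplus> (\<i> \<odot> (h \<otimes> b) \<oplus> b \<otimes> b)"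
  using h b unfolding su by (simp add: u_def l_distr r_distr smult_mult_left smult_mult_right smult_assoc smult_r_distr)
 also have "\<dots> = (h \<otimes> h \<oplus> b \<otimes> b) \<oplus> ((- \<i>) \<odot> (h \<otimes> b) \<oplus> \<i> \<odot> (h \<otimes> b))"
  using hb by (simp add: a_ac)
 also have "(- \<i>) \<odot> (h \<otimes> b) \<oplus> \<i> \<odot> (h \<otimes> b) = \<zero>"
  using hb by (simp add: smult_l_distr[symmetric])
 finally have "star A u \<otimes> u = \<one>" using b by simp
 then have "(q u)\<^sup>2 \<le> 1" using Q.p_cstar[OF uc] Q.p_one_le by simp
 then have qu: "q u \<le> 1" by (simp add: power_le_one_iff abs_square_le_1)
 have "u \<oplus> star A u = (h \<oplus> h) \<oplus> (\<i> \<odot> b \<oplus> (- \<i>) \<odot> b)"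
  unfolding su using h b by (simp add: u_def a_ac)
 also have "\<i> \<odot> b \<oplus> (- \<i>) \<odot> b = \<zero>"
  using b by (simp add: smult_l_distr[symmetric])
 also have "h \<oplus> h \<oplus> \<zero> = (1 + 1) \<odot> h" using h by (subst smult_l_distr) simp_all
 finally have "2 * q h = q (u \<oplus> star A u)" using h by (simp add: Q.p_smult)
 also have "\<dots> \<le> q u + q (star A u)" using uc by (intro Q.p_add) auto
 also have "\<dots> \<le> 2" using qu uc by simp
 finally show ?thesis by simp
qed

text \<open>A self-adjoint element divided by any t above its norm lies in the open unit ball, where
  the bound 1 is known; letting t decrease gives the claim. The C*-identity reduces the general case
  to the self-adjoint element \<open>star A x \<otimes> x\<close>.\<close>

theorem cstar_seminorm_le_cnorm:
 assumes q: "cstar_seminorm A q" and x: "x \<in> carrier A"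
 shows "q x \<le> cnorm A x"
proof -
 interpret Q: cstar_semi A q by unfold_locales fact
 have sa: "q h \<le> cnorm A h" if h: "h \<in> carrier A" "star A h = h" for h
 proof (rule dense_ge)
  fix t assume t: "cnorm A h < t"
  have t0: "t > 0" using t p_nonneg[OF h(1)] by linarith
  have "q (complex_of_real (1/t) \<odot> h) \<le> 1"
   by (rule cstar_seminorm_selfadjoint_le_one[OF q]) (use h t t0 in \<open>simp_all add: star_smult p_smult norm_divide\<close>)
  then show "q h \<le> t" using h t0 by (simp add: Q.p_smult norm_divide field_simps)
 qed
 have "(q x)\<^sup>2 = q (star A x \<otimes> x)" using x by (simp add: Q.p_cstar)
 also have "\<dots> \<le> cnorm A (star A x \<otimes> x)" by (rule sa) (use x in \<open>simp_all add: star_mult\<close>)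
 also have "\<dots> = (cnorm A x)\<^sup>2" using x by (simp add: p_cstar)
 finally show ?thesis using x by (simp add: power2_le_iff_abs_le)
qed

lemma star_map_contractive:
 assumes "cstar_semi B q" "h \<in> star_map A B" "x \<in> carrier A"
 shows "q (h x) \<le> cnorm A x"
proof -
 interpret B: cstar_semi B q by fact
 show ?thesis
  by (rule cstar_seminorm_le_cnorm[OF B.pullback_seminorm[OF star_alg_axioms assms(2)] assms(3)])
qed

end

section \<open>Bounded linear maps and extension from dense subalgebras\<close>

text \<open>Multiplication by a fixed element is linear and bounded but in general not
  multiplicative. Identities such as the commutation of two tensor legs are therefore compared as
  identities of bounded linear maps.\<close>

definition lin_map ::
  "('a, 'm) cstar_alg_scheme \<Rightarrow> ('b, 'n) cstar_alg_scheme \<Rightarrow> ('a \<Rightarrow> 'b) set" where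
 "lin_map A B = {h. h \<in> carrier A \<rightarrow> carrier B \<and>
   (\<forall>x\<in>carrier A. \<forall>y\<in>carrier A. h (x \<oplus>\<^bsub>A\<^esub> y) = h x \<oplus>\<^bsub>B\<^esub> h y) \<and>
   (\<forall>x\<in>carrier A. \<forall>c. h (c \<odot>\<^bsub>A\<^esub> x) = c \<odot>\<^bsub>B\<^esub> h x) \<and>
   (\<exists>K. \<forall>x\<in>carrier A. cnorm B (h x) \<le> K * cnorm A x)}"

context cstar_alg
begin

lemma star_map_lin_map:
 assumes "cstar_alg B" "h \<in> star_map A B" shows "h \<in> lin_map A B"
proof -
 interpret B: cstar_alg B by fact
 have "\<forall>x\<in>carrier A. cnorm B (h x) \<le> 1 * cnorm A x"
  using star_map_contractive[OF B.cstar_semi_axioms assms(2)] by simp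
 then show ?thesis using star_mapD[OF assms(2)] unfolding lin_map_def by blast
qed

lemma lin_map_comp:
 assumes "cstar_alg B" "cstar_alg D" "f \<in> lin_map A B" "g \<in> lin_map B D"
 shows "(\<lambda>x. g (f x)) \<in> lin_map A D"
proof -
 interpret B: cstar_alg B by fact
 interpret D: cstar_alg D by fact
 obtain K where K: "\<And>x. x \<in> carrier A ==> cnorm B (f x) \<le> K * cnorm A x"
  using assms(3) unfolding lin_map_def by blast
 obtain L where L: "\<And>x. x \<in> carrier B ==> cnorm D (g x) \<le> L * cnorm B x"
  using assms(4) unfolding lin_map_def by blast
 have "cnorm D (g (f x)) \<le> (\<bar>L\<bar> * K) * cnorm A x" if x: "x \<in> carrier A" for x
 proof -
  have fx: "f x \<in> carrier B" using assms(3) x by (auto simp: lin_map_def)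
  have "cnorm D (g (f x)) \<le> L * cnorm B (f x)" by (rule L[OF fx])
  \<comment> \<open>The constant \<open>L\<close> could be negative, so it is replaced by its
    absolute value before the next bound is inserted.\<close>
  also have "\<dots> \<le> \<bar>L\<bar> * cnorm B (f x)" using fx by (intro mult_right_mono) auto
  also have "\<dots> \<le> \<bar>L\<bar> * (K * cnorm A x)" using K[OF x] by (intro mult_left_mono) auto
  finally show ?thesis by simp
 qed
 then have "\<exists>K. \<forall>x\<in>carrier A. cnorm D (g (f x)) \<le> K * cnorm A x" by blast
 then show ?thesis using assms(3,4) by (auto simp: lin_map_def Pi_iff)
qed

lemma lin_map_mult_right: assumes "b \<in> carrier A" shows "(\<lambda>x. x \<otimes> b) \<in> lin_map A A"
proof -
 have "\<forall>x\<in>carrier A. cnorm A (x \<otimes> b) \<le> cnorm A b * cnorm A x"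
  using assms p_mult by (simp add: mult.commute)
 then show ?thesis using assms by (auto simp: lin_map_def l_distr smult_mult_left)
qed

lemma lin_map_mult_left: assumes "b \<in> carrier A" shows "(\<lambda>x. b \<otimes> x) \<in> lin_map A A"
proof -
 have "\<forall>x\<in>carrier A. cnorm A (b \<otimes> x) \<le> cnorm A b * cnorm A x"
  using assms p_mult by simp
 then show ?thesis using assms by (auto simp: lin_map_def r_distr smult_mult_right)
qed

lemma lin_map_diff:
 assumes "cstar_alg B" "h \<in> lin_map A B" "x \<in> carrier A" "y \<in> carrier A"
 shows "h (x \<ominus> y) = h x \<ominus>\<^bsub>B\<^esub> h y"
proof -
 interpret B: cstar_alg B by fact
 have h: "h z \<in> carrier B" if "z \<in> carrier A" for z using that assms(2) by (auto simp: lin_map_def)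
 have "h (x \<oplus> (- 1) \<odot> y) = h x \<oplus>\<^bsub>B\<^esub> (- 1) \<odot>\<^bsub>B\<^esub> h y"
  using assms by (simp add: lin_map_def)
 then show ?thesis
  using assms h by (simp add: smult_minus_one B.smult_minus_one minus_eq B.minus_eq)
qed

lemma lin_map_lim:
 assumes B: "cstar_alg B" and h: "h \<in> lin_map A B" and "lim_to \<sigma> x"
 shows "cstar_semi.lim_to B (cnorm B) (\<lambda>n. h (\<sigma> n)) (h x)"
proof -
 interpret B: cstar_alg B by fact
 obtain K where K: "\<And>x. x \<in> carrier A ==> cnorm B (h x) \<le> K * cnorm A x"
  using h unfolding lin_map_def by blast
 have c: "\<sigma> n \<in> carrier A" "x \<in> carrier A" for n using assms(3) by (auto simp: lim_to_def)
 show ?thesis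
 proof (rule B.lim_toI[where f = "\<lambda>n. K * cnorm A (\<sigma> n \<ominus> x)"])
  show "cnorm B (h (\<sigma> n) \<ominus>\<^bsub>B\<^esub> h x) \<le> K * cnorm A (\<sigma> n \<ominus> x)" for n
   using K[of "\<sigma> n \<ominus> x"] c by (simp add: lin_map_diff[OF B h])
  show "(\<lambda>n. K * cnorm A (\<sigma> n \<ominus> x)) \<longlonglongrightarrow> 0"
   using assms(3) by (intro tendsto_mult_right_zero) (simp add: lim_to_def)
 qed (use h c in \<open>auto simp: lin_map_def\<close>)
qed

lemma dense_seq:
 assumes "norm_dense A D" "x \<in> carrier A"
 obtains \<sigma> where "\<And>n. \<sigma> n \<in> D" "lim_to \<sigma> x"
proof -
 have "\<exists>d\<in>D. cnorm A (x \<ominus> d) < inverse (real (Suc n))" for n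
  using assms by (simp add: norm_dense_def)
 then obtain \<sigma> where \<sigma>: "\<And>n. \<sigma> n \<in> D" "\<And>n. cnorm A (x \<ominus> \<sigma> n) < inverse (real (Suc n))" by metis
 have c: "\<sigma> n \<in> carrier A" for n using \<sigma>(1)[of n] assms(1) by (auto simp: norm_dense_def)
 have "lim_to \<sigma> x"
 proof (rule lim_toI[OF c assms(2)])
  show "cnorm A (\<sigma> n \<ominus> x) \<le> inverse (real (Suc n))" for n
   using \<sigma>(2)[of n] p_diff_commute[OF c assms(2), of n] by simp
 qed (rule LIMSEQ_inverse_real_of_nat)
 with \<sigma>(1) show thesis by (rule that)
qed

lemma lin_map_eqI:
 assumes B: "cstar_alg B" and f: "f \<in> lin_map A B" and g: "g \<in> lin_map A B"
  and D: "norm_dense A D" "\<And>d. d \<in> D ==> f d = g d" and x: "x \<in> carrier A"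
 shows "f x = g x"
proof -
 interpret B: cstar_alg B by fact
 obtain \<sigma> where \<sigma>: "\<And>n. \<sigma> n \<in> D" "lim_to \<sigma> x" using dense_seq[OF D(1) x] by blast
 have "B.lim_to (\<lambda>n. f (\<sigma> n)) (f x)" by (rule lin_map_lim[OF B f \<sigma>(2)])
 moreover have "B.lim_to (\<lambda>n. f (\<sigma> n)) (g x)"
  using lin_map_lim[OF B g \<sigma>(2)] by (simp add: D(2)[OF \<sigma>(1)])
 ultimately show ?thesis by (rule B.lim_to_unique)
qed

text \<open>The bound \<open>le\<close> makes the values of \<open>f\<close> along an approximating
  sequence Cauchy, with a limit independent of the sequence; it also makes the map well defined
  where \<open>\<iota>\<close> identifies elements. Algebraic laws pass to the limit
  termwise.\<close>

theorem star_map_extension: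
 assumes S: "star_alg S" and \<iota>: "\<iota> \<in> star_map S A" and dense: "norm_dense A (\<iota> ` carrier S)"
  and B: "cstar_alg B" and f: "f \<in> star_map S B"
  and le: "\<And>x. x \<in> carrier S ==> cnorm B (f x) \<le> cnorm A (\<iota> x)"
 obtains h where "h \<in> star_map A B" "\<And>x. x \<in> carrier S ==> h (\<iota> x) = f x"
proof -
 interpret S: star_alg S by fact
 interpret B: cstar_alg B by fact
 note fD = star_mapD[OF f] and \<iota>D = star_mapD[OF \<iota>]
 define approx where "approx \<sigma> x \<longleftrightarrow> (\<forall>n. \<sigma> n \<in> carrier S) \<and> lim_to (\<lambda>n. \<iota> (\<sigma> n)) x" for \<sigma> x
 have ex: "\<exists>\<sigma>. approx \<sigma> x" if x: "x \<in> carrier A" for x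
 proof -
  obtain \<tau> where \<tau>: "\<And>n. \<tau> n \<in> \<iota> ` carrier S" "lim_to \<tau> x" using dense_seq[OF dense x] by blast
  from \<tau>(1) have "\<forall>n. \<exists>s. s \<in> carrier S \<and> \<tau> n = \<iota> s" by blast
  then obtain \<sigma> where \<sigma>: "\<And>n. \<sigma> n \<in> carrier S" "\<And>n. \<tau> n = \<iota> (\<sigma> n)" by metis
  then have "\<tau> = (\<lambda>n. \<iota> (\<sigma> n))" by auto
  with \<tau>(2) \<sigma>(1) have "approx \<sigma> x" by (simp add: approx_def)
  then show ?thesis by blast
 qed
 have fdiff: "cnorm B (f s \<ominus>\<^bsub>B\<^esub> f t) \<le> cnorm A (\<iota> s \<ominus> \<iota> t)" if "s \<in> carrier S" "t \<in> carrier S" for s t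
  using le[of "s \<ominus>\<^bsub>S\<^esub> t"] that
  by (simp add: S.star_map_diff[OF B.star_alg_axioms f] S.star_map_diff[OF star_alg_axioms \<iota>])
 \<comment> \<open>One limit is claimed for all approximating sequences at once. The chosen function
   can then be evaluated along termwise sums, products and adjoints of sequences.\<close>
 have "\<exists>y. \<forall>\<sigma>. approx \<sigma> x \<longrightarrow> B.lim_to (\<lambda>n. f (\<sigma> n)) y" if x: "x \<in> carrier A" for x
 proof -
  obtain \<sigma> where \<sigma>: "approx \<sigma> x" using ex[OF x] ..
  then have \<sigma>c: "\<sigma> n \<in> carrier S" for n by (simp add: approx_def)
  have C: "seminorm_Cauchy A (cnorm A) (\<lambda>n. \<iota> (\<sigma> n))"
   using \<sigma> by (auto simp: approx_def intro: lim_to_imp_Cauchy)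
  have "seminorm_Cauchy B (cnorm B) (\<lambda>n. f (\<sigma> n))"
   unfolding seminorm_Cauchy_def
  proof (intro conjI allI impI)
   fix e :: real assume "e > 0"
   with C obtain N where N: "\<And>m n. m \<ge> N ==> n \<ge> N ==> cnorm A (\<iota> (\<sigma> m) \<ominus> \<iota> (\<sigma> n)) < e"
    unfolding seminorm_Cauchy_def by blast
   have "cnorm B (f (\<sigma> m) \<ominus>\<^bsub>B\<^esub> f (\<sigma> n)) < e" if "m \<ge> N" "n \<ge> N" for m n
    using N[OF that] fdiff[OF \<sigma>c \<sigma>c, of m n] by linarith
   then show "\<exists>N. \<forall>m\<ge>N. \<forall>n\<ge>N. cnorm B (f (\<sigma> m) \<ominus>\<^bsub>B\<^esub> f (\<sigma> n)) < e" by blast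
  qed (use \<sigma>c fD in auto)
  then obtain y where y: "B.lim_to (\<lambda>n. f (\<sigma> n)) y" using B.complete by blast
  have "B.lim_to (\<lambda>n. f (\<tau> n)) y" if \<tau>: "approx \<tau> x" for \<tau>
  proof -
   have \<tau>c: "\<tau> n \<in> carrier S" for n using \<tau> by (simp add: approx_def)
   show ?thesis
   proof (rule B.lim_toI[where f = "\<lambda>n. cnorm A (\<iota> (\<tau> n) \<ominus> \<iota> (\<sigma> n)) + cnorm B (f (\<sigma> n) \<ominus>\<^bsub>B\<^esub> y)"])
    show "cnorm B (f (\<tau> n) \<ominus>\<^bsub>B\<^esub> y) \<le> cnorm A (\<iota> (\<tau> n) \<ominus> \<iota> (\<sigma> n)) + cnorm B (f (\<sigma> n) \<ominus>\<^bsub>B\<^esub> y)" for n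
     using B.p_triangle[of "f (\<tau> n)" "f (\<sigma> n)" y] fdiff[OF \<tau>c \<sigma>c, of n n] fD(1) \<tau>c \<sigma>c B.lim_to_closed(2)[OF y]
     by force
    have "lim_to (\<lambda>n. \<iota> (\<tau> n) \<ominus> \<iota> (\<sigma> n)) (x \<ominus> x)"
     using \<sigma> \<tau> by (intro lim_to_diff) (simp_all add: approx_def)
    from lim_to_p[OF this] have "(\<lambda>n. cnorm A (\<iota> (\<tau> n) \<ominus> \<iota> (\<sigma> n))) \<longlonglongrightarrow> 0" using x by simp
    then show "(\<lambda>n. cnorm A (\<iota> (\<tau> n) \<ominus> \<iota> (\<sigma> n)) + cnorm B (f (\<sigma> n) \<ominus>\<^bsub>B\<^esub> y)) \<longlonglongrightarrow> 0"
     by (rule tendsto_add_zero) (use y in \<open>simp add: B.lim_to_def\<close>)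
   qed (use \<tau>c fD(1) B.lim_to_closed(2)[OF y] in auto)
  qed
  then show ?thesis by blast
 qed
 then obtain h where h: "\<And>x \<sigma>. x \<in> carrier A ==> approx \<sigma> x ==> B.lim_to (\<lambda>n. f (\<sigma> n)) (h x)" by metis
 have hc: "h x \<in> carrier B" if x: "x \<in> carrier A" for x
  using ex[OF x] h[OF x] B.lim_to_closed(2) by blast
 have "h \<in> star_map A B"
 proof (rule star_mapI[OF hc])
  fix x assume x: "x \<in> carrier A"
  obtain \<sigma> where \<sigma>: "approx \<sigma> x" using ex[OF x] ..
  then have \<sigma>c: "\<sigma> n \<in> carrier S" for n by (simp add: approx_def)
  show "h (star A x) = star B (h x)"
  proof (rule B.lim_to_unique)
   have "approx (\<lambda>n. star S (\<sigma> n)) (star A x)" using \<sigma> by (simp add: approx_def \<iota>D lim_to_star)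
   then show "B.lim_to (\<lambda>n. f (star S (\<sigma> n))) (h (star A x))" by (intro h) (use x in auto)
   show "B.lim_to (\<lambda>n. f (star S (\<sigma> n))) (star B (h x))"
    using B.lim_to_star[OF h[OF x \<sigma>]] \<sigma>c by (simp add: fD)
  qed
  show "h (c \<odot> x) = c \<odot>\<^bsub>B\<^esub> h x" for c
  proof (rule B.lim_to_unique)
   have "approx (\<lambda>n. c \<odot>\<^bsub>S\<^esub> \<sigma> n) (c \<odot> x)" using \<sigma> by (simp add: approx_def \<iota>D lim_to_smult)
   then show "B.lim_to (\<lambda>n. f (c \<odot>\<^bsub>S\<^esub> \<sigma> n)) (h (c \<odot> x))" by (intro h) (use x in auto)
   show "B.lim_to (\<lambda>n. f (c \<odot>\<^bsub>S\<^esub> \<sigma> n)) (c \<odot>\<^bsub>B\<^esub> h x)"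
    using B.lim_to_smult[OF h[OF x \<sigma>], of c] \<sigma>c by (simp add: fD)
  qed
  fix y assume y: "y \<in> carrier A"
  obtain \<tau> where \<tau>: "approx \<tau> y" using ex[OF y] ..
  then have \<tau>c: "\<tau> n \<in> carrier S" for n by (simp add: approx_def)
  show "h (x \<oplus> y) = h x \<oplus>\<^bsub>B\<^esub> h y"
  proof (rule B.lim_to_unique)
   have "approx (\<lambda>n. \<sigma> n \<oplus>\<^bsub>S\<^esub> \<tau> n) (x \<oplus> y)" using \<sigma> \<tau> by (simp add: approx_def \<iota>D lim_to_add)
   then show "B.lim_to (\<lambda>n. f (\<sigma> n \<oplus>\<^bsub>S\<^esub> \<tau> n)) (h (x \<oplus> y))" by (intro h) (use x y in auto)
   show "B.lim_to (\<lambda>n. f (\<sigma> n \<oplus>\<^bsub>S\<^esub> \<tau> n)) (h x \<oplus>\<^bsub>B\<^esub> h y)"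
    using B.lim_to_add[OF h[OF x \<sigma>] h[OF y \<tau>]] \<sigma>c \<tau>c by (simp add: fD)
  qed
  show "h (x \<otimes> y) = h x \<otimes>\<^bsub>B\<^esub> h y"
  proof (rule B.lim_to_unique)
   have "approx (\<lambda>n. \<sigma> n \<otimes>\<^bsub>S\<^esub> \<tau> n) (x \<otimes> y)" using \<sigma> \<tau> by (simp add: approx_def \<iota>D lim_to_mult)
   then show "B.lim_to (\<lambda>n. f (\<sigma> n \<otimes>\<^bsub>S\<^esub> \<tau> n)) (h (x \<otimes> y))" by (intro h) (use x y in auto)
   show "B.lim_to (\<lambda>n. f (\<sigma> n \<otimes>\<^bsub>S\<^esub> \<tau> n)) (h x \<otimes>\<^bsub>B\<^esub> h y)"
    using B.lim_to_mult[OF h[OF x \<sigma>] h[OF y \<tau>]] \<sigma>c \<tau>c by (simp add: fD)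
  qed
 qed
 moreover have "h (\<iota> x) = f x" if x: "x \<in> carrier S" for x
 proof (rule B.lim_to_unique)
  show "B.lim_to (\<lambda>n. f x) (h (\<iota> x))"
   by (rule h) (use x in \<open>simp_all add: approx_def lim_to_const \<iota>D\<close>)
 qed (use x in \<open>simp add: B.lim_to_const fD\<close>)
 ultimately show thesis by (rule that)
qed

end

context cstar_semi
begin

lemma cstar_alg_C: "cstar_alg C"
 by unfold_locales (rule cstar_algebra_C)

lemma to_completion_star_hom: "to_completion A p \<in> star_hom A C"
 by (intro star_homI star_mapI)
  (simp_all add: to_completion_cls add_C mult_C smult_C star_C one_C)

lemma cnorm_to_completion: "x \<in> carrier A ==> cnorm C (to_completion A p x) = p x"
 by (simp add: to_completion_cls cnorm_C_const)

lemma to_completion_dense: "norm_dense C (to_completion A p ` carrier A)"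
 unfolding norm_dense_def
proof (intro conjI ballI allI impI)
 fix x and e :: real assume "x \<in> carrier C" "e > 0"
 then obtain a where "a \<in> carrier A" "cnorm C (x \<ominus>\<^bsub>C\<^esub> cls (\<lambda>_. a)) < e" by (rule cls_dense)
 then show "\<exists>y\<in>to_completion A p ` carrier A. cnorm C (x \<ominus>\<^bsub>C\<^esub> y) < e" by (auto simp: to_completion_cls)
qed (auto simp: to_completion_cls)

end

section \<open>Quotient seminorms and surjectivity\<close>

context cstar_alg
begin

text \<open>Neumann series: \<open>g n\<close> is the sum of the first n powers of \<open>x\<close>.
  Since every partial sum commutes with \<open>x\<close>, the inverse is two-sided.\<close>

lemma one_minus_invertible:
 assumes x: "x \<in> carrier A" "cnorm A x < 1"
 obtains c where "c \<in> carrier A" "(\<one> \<ominus> x) \<otimes> c = \<one>" "c \<otimes> (\<one> \<ominus> x) = \<one>"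
proof -
 define g where "g n = ((\<lambda>y. \<one> \<oplus> x \<otimes> y) ^^ n) \<zero>" for n
 have g0: "g 0 = \<zero>" and gS: "g (Suc n) = \<one> \<oplus> x \<otimes> g n" for n by (simp_all add: g_def)
 have g: "g n \<in> carrier A \<and> g n \<otimes> x = x \<otimes> g n" for n
  by (induction n) (use x in \<open>auto simp: g0 gS l_distr r_distr m_assoc\<close>)
 then have gc: "g n \<in> carrier A" and gx: "g n \<otimes> x = x \<otimes> g n" for n by auto
 have step: "cnorm A (g (Suc n) \<ominus> g n) \<le> cnorm A (g 1 \<ominus> g 0) * cnorm A x ^ n" for n
 proof (induction n)
  case (Suc n)
  have "g (Suc (Suc n)) \<ominus> g (Suc n) = (\<one> \<oplus> x \<otimes> g (Suc n)) \<ominus> (\<one> \<oplus> x \<otimes> g n)"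
   by (simp add: gS[of "Suc n"]) (simp add: gS)
  also have "\<dots> = x \<otimes> (g (Suc n) \<ominus> g n)" using gc[of "Suc n"] gc[of n] x(1) by algebra
  finally have "cnorm A (g (Suc (Suc n)) \<ominus> g (Suc n)) \<le> cnorm A x * cnorm A (g (Suc n) \<ominus> g n)"
   using p_mult gc x by simp
  also have "\<dots> \<le> cnorm A x * (cnorm A (g 1 \<ominus> g 0) * cnorm A x ^ n)"
   using Suc x by (intro mult_left_mono) auto
  finally show ?case by (simp add: mult_ac)
 qed simp
 have "seminorm_Cauchy A (cnorm A) g"
  by (rule Cauchy_if_geometric[OF p_nonneg[OF x(1)] x(2) gc step])
 then obtain c where c: "lim_to g c" using complete by blast
 have cc: "c \<in> carrier A" using c by (rule lim_to_closed)
 have "lim_to (\<lambda>n. g (Suc n)) c"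
  using c LIMSEQ_Suc[of "\<lambda>n. cnorm A (g n \<ominus> c)"] by (simp add: lim_to_def)
 moreover have "lim_to (\<lambda>n. g (Suc n)) (\<one> \<oplus> x \<otimes> c)"
  unfolding gS by (intro lim_to_add lim_to_const lim_to_mult c x one_closed)
 ultimately have c_eq: "c = \<one> \<oplus> x \<otimes> c" by (rule lim_to_unique)
 have "lim_to (\<lambda>n. x \<otimes> g n) (c \<otimes> x)" using lim_to_mult[OF c lim_to_const[OF x(1)]] gx by simp
 moreover have "lim_to (\<lambda>n. x \<otimes> g n) (x \<otimes> c)" by (intro lim_to_mult lim_to_const c x)
 ultimately have cx: "c \<otimes> x = x \<otimes> c" by (rule lim_to_unique)
 have "(\<one> \<ominus> x) \<otimes> c = c \<ominus> x \<otimes> c" using cc x(1) by algebra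
 also have "\<dots> = (\<one> \<oplus> x \<otimes> c) \<ominus> x \<otimes> c" by (simp flip: c_eq)
 also have "\<dots> = \<one>" using cc x(1) by algebra
 finally have 1: "(\<one> \<ominus> x) \<otimes> c = \<one>" .
 have "c \<otimes> (\<one> \<ominus> x) = c \<ominus> c \<otimes> x" using cc x(1) by (simp add: diff_r_distr)
 also have "\<dots> = (\<one> \<ominus> x) \<otimes> c" unfolding cx using cc x(1) by algebra
 finally show thesis using 1 cc by (intro that[of c]) simp_all
qed

text \<open>Because \<open>a - d = (1 - d w) a\<close>, the inverse is \<open>w e\<close>, where
  \<open>e\<close> inverts \<open>1 - d w\<close>.\<close>

lemma inverse_perturbation:
 assumes c: "a \<in> carrier A" "w \<in> carrier A" "d \<in> carrier A"
  and aw: "a \<otimes> w = \<one>" "w \<otimes> a = \<one>" and lt: "cnorm A (d \<otimes> w) < 1"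
 obtains v where "v \<in> carrier A" "(a \<ominus> d) \<otimes> v = \<one>" "v \<otimes> (a \<ominus> d) = \<one>"
proof -
 obtain e where e: "e \<in> carrier A" "(\<one> \<ominus> d \<otimes> w) \<otimes> e = \<one>" "e \<otimes> (\<one> \<ominus> d \<otimes> w) = \<one>"
  using one_minus_invertible[OF _ lt] c by blast
 have "(a \<ominus> d) \<otimes> (w \<otimes> e) = (a \<otimes> w \<ominus> d \<otimes> w) \<otimes> e" using c e(1) by algebra
 then have 1: "(a \<ominus> d) \<otimes> (w \<otimes> e) = \<one>" by (simp add: aw e)
 have "a \<ominus> d = a \<ominus> d \<otimes> (w \<otimes> a)" using c by (simp add: aw)
 also have "\<dots> = (\<one> \<ominus> d \<otimes> w) \<otimes> a" using c by algebra
 finally have "(w \<otimes> e) \<otimes> (a \<ominus> d) = w \<otimes> (e \<otimes> (\<one> \<ominus> d \<otimes> w)) \<otimes> a"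
  using c e(1) by (simp add: m_assoc)
 then have 2: "(w \<otimes> e) \<otimes> (a \<ominus> d) = \<one>" using c by (simp add: aw e)
 show thesis using that[OF _ 1 2] c e by simp
qed

text \<open>The spectrum of a self-adjoint \<open>z\<close> is real, so these elements are
  invertible for t > 0. They replace functional calculus in the construction of approximate
  units.\<close>

definition shifted :: "'a \<Rightarrow> real \<Rightarrow> 'a" where
 "shifted z t = z \<oplus> (\<i> * complex_of_real t) \<odot> \<one>"

lemma shifted_closed [simp]: "z \<in> carrier A ==> shifted z t \<in> carrier A"
 by (simp add: shifted_def)

text \<open>The Cayley transform \<open>1 - 2 \<i> t w\<close> of \<open>z\<close>, with \<open>w = (z + \<i> t)\<^sup>-\<^sup>1\<close>, is unitary.\<close>

lemma cayley_norm:
 assumes z: "z \<in> carrier A" "star A z = z"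
  and w: "w \<in> carrier A" "shifted z t \<otimes> w = \<one>" "w \<otimes> shifted z t = \<one>"
 shows "cnorm A (\<one> \<ominus> (2 * \<i> * complex_of_real t) \<odot> w) \<le> 1"
proof -
 define a where "a = shifted z t"
 have a: "a \<in> carrier A" "a \<otimes> w = \<one>" "w \<otimes> a = \<one>" using z w by (simp_all add: a_def)
 have sa: "star A a = a \<ominus> (2 * \<i> * complex_of_real t) \<odot> \<one>"
 proof -
  have "a \<ominus> (2 * \<i> * complex_of_real t) \<odot> \<one>
    = z \<oplus> ((\<i> * complex_of_real t) \<odot> \<one> \<oplus> (- (2 * \<i> * complex_of_real t)) \<odot> \<one>)"
   using z by (simp add: a_def shifted_def minus_eq uminus_smult a_assoc)
  also have "\<dots> = z \<oplus> (- (\<i> * complex_of_real t)) \<odot> \<one>" by (simp add: smult_l_distr[symmetric])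
  also have "\<dots> = star A a" using z by (simp add: a_def shifted_def star_add star_smult)
  finally show ?thesis by simp
 qed
 define u where "u = star A a \<otimes> w"
 have u: "u = \<one> \<ominus> (2 * \<i> * complex_of_real t) \<odot> w"
 proof -
  have "u = (a \<ominus> (2 * \<i> * complex_of_real t) \<odot> \<one>) \<otimes> w" by (simp add: u_def sa)
  also have "\<dots> = a \<otimes> w \<ominus> ((2 * \<i> * complex_of_real t) \<odot> \<one>) \<otimes> w"
   using a w by (intro diff_l_distr) auto
  finally show ?thesis using w by (simp add: a smult_mult_left)
 qed
 have com: "star A a \<otimes> a = a \<otimes> star A a"
 proof -
  have "star A a \<otimes> a = a \<otimes> a \<ominus> ((2 * \<i> * complex_of_real t) \<odot> \<one>) \<otimes> a"
   using a unfolding sa by (intro diff_l_distr) auto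
  also have "\<dots> = a \<otimes> a \<ominus> a \<otimes> ((2 * \<i> * complex_of_real t) \<odot> \<one>)"
   using a by (simp add: smult_mult_left smult_mult_right)
  also have "\<dots> = a \<otimes> star A a"
   using a unfolding sa by (intro diff_r_distr[symmetric]) auto
  finally show ?thesis .
 qed
 \<comment> \<open>Normality of \<open>a\<close> exchanges the two middle factors, after which
   \<open>a\<close> meets \<open>w\<close> and \<open>star A a\<close> meets
   \<open>star A w\<close>.\<close>
 have "star A u \<otimes> u = star A w \<otimes> (a \<otimes> star A a) \<otimes> w"
  using a w by (simp add: u_def star_mult m_assoc)
 also have "\<dots> = star A (a \<otimes> w) \<otimes> (a \<otimes> w)"
  unfolding com[symmetric] using a(1) w(1) by (simp add: star_mult m_assoc)
 finally have "star A u \<otimes> u = \<one>" by (simp add: a)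
 then have "(cnorm A u)\<^sup>2 \<le> 1" using p_cstar[of u] p_one_le a w by (simp add: u_def)
 then show ?thesis unfolding u[symmetric] by (simp add: power_le_one_iff abs_square_le_1)
qed

text \<open>The element \<open>2 i t w\<close> is the difference of the unit and the Cayley
  transform. Both have norm at most 1, so \<open>2 t\<close> times the norm of \<open>w\<close> is
  at most 2.\<close>

lemma resolvent_norm:
 assumes z: "z \<in> carrier A" "star A z = z" and t: "t > 0"
  and w: "w \<in> carrier A" "shifted z t \<otimes> w = \<one>" "w \<otimes> shifted z t = \<one>"
 shows "cnorm A w \<le> 1 / t"
proof -
 let ?c = "2 * \<i> * complex_of_real t"
 have "?c \<odot> w = \<one> \<ominus> (\<one> \<ominus> ?c \<odot> w)" using smult_closed[OF w(1), of ?c] by algebra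
 then have "cnorm A (?c \<odot> w) \<le> cnorm A \<one> + cnorm A (\<one> \<ominus> ?c \<odot> w)"
  using p_diff[of \<one> "\<one> \<ominus> ?c \<odot> w"] w by simp
 also have "\<dots> \<le> 2" using p_one_le cayley_norm[OF z w] by linarith
 finally show ?thesis using t w by (simp add: p_smult norm_mult field_simps)
qed

text \<open>A shift larger than the norm of \<open>z\<close> is inverted by a Neumann series. If the
  shift 2 s is invertible, its inverse has norm at most 1 / (2 s), so the perturbation down to s has
  relative size at most 1/2 and the shift s is invertible as well. Finitely many halvings reach any
  t > 0.\<close>

lemma resolvent_exists:
 assumes z: "z \<in> carrier A" "star A z = z" and t: "t > 0"
 obtains w where "w \<in> carrier A" "shifted z t \<otimes> w = \<one>" "w \<otimes> shifted z t = \<one>"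
proof -
 have "\<exists>w\<in>carrier A. shifted z s \<otimes> w = \<one> \<and> w \<otimes> shifted z s = \<one>"
  if "s > 0" "s > cnorm A z * (1/2) ^ n" for n s
  using that
 proof (induction n arbitrary: s)
  case 0
  define c where "c = \<i> * complex_of_real s"
  have c: "c \<noteq> 0" "cmod c = s" using 0 by (simp_all add: c_def norm_mult)
  have ci: "(c \<odot> \<one>) \<otimes> (inverse c \<odot> \<one>) = \<one>" "(inverse c \<odot> \<one>) \<otimes> (c \<odot> \<one>) = \<one>"
   using c by (simp_all add: smult_mult_left smult_assoc)
  have cc: "c \<odot> \<one> \<in> carrier A" "inverse c \<odot> \<one> \<in> carrier A" "\<ominus> z \<in> carrier A" using z by auto
  have "cnorm A (\<ominus> z \<otimes> (inverse c \<odot> \<one>)) = cnorm A z / s"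
   using z c by (simp add: smult_mult_right p_smult norm_inverse divide_inverse)
  also have "\<dots> < 1" using 0 by simp
  finally obtain v where "v \<in> carrier A" "(c \<odot> \<one> \<ominus> \<ominus> z) \<otimes> v = \<one>" "v \<otimes> (c \<odot> \<one> \<ominus> \<ominus> z) = \<one>"
   using inverse_perturbation[OF cc ci] by blast
  moreover have "c \<odot> \<one> \<ominus> \<ominus> z = shifted z s"
   using z by (simp add: shifted_def c_def minus_eq a_comm)
  ultimately show ?case by auto
 next
  case (Suc n)
  have "\<exists>w\<in>carrier A. shifted z (2 * s) \<otimes> w = \<one> \<and> w \<otimes> shifted z (2 * s) = \<one>"
   by (rule Suc.IH) (use Suc.prems in \<open>simp_all add: field_simps\<close>)
  then obtain w where w: "w \<in> carrier A" "shifted z (2 * s) \<otimes> w = \<one>" "w \<otimes> shifted z (2 * s) = \<one>"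
   by blast
  let ?c = "\<i> * complex_of_real s"
  have "s * cnorm A w \<le> s * (1 / (2 * s))"
   using resolvent_norm[OF z _ w] Suc.prems by (intro mult_left_mono) auto
  also have "\<dots> < 1" using Suc.prems by simp
  finally have lt: "cnorm A ((?c \<odot> \<one>) \<otimes> w) < 1"
   using Suc.prems w by (simp add: smult_mult_left p_smult norm_mult)
  obtain v where v: "v \<in> carrier A" "(shifted z (2 * s) \<ominus> ?c \<odot> \<one>) \<otimes> v = \<one>"
    "v \<otimes> (shifted z (2 * s) \<ominus> ?c \<odot> \<one>) = \<one>"
   using inverse_perturbation[OF shifted_closed[OF z(1)] w(1) smult_closed[OF one_closed] w(2,3) lt] by blast
  have "shifted z (2 * s) \<ominus> ?c \<odot> \<one> = z \<oplus> ((2 * ?c) \<odot> \<one> \<oplus> (- ?c) \<odot> \<one>)"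
   using z by (simp add: shifted_def minus_eq uminus_smult a_assoc mult.left_commute)
  also have "\<dots> = shifted z s" by (simp add: shifted_def smult_l_distr[symmetric])
  finally show ?case using v by auto
 qed
 moreover obtain n where "cnorm A z * (1/2) ^ n < t"
 proof -
  have "(\<lambda>n. cnorm A z * (1/2) ^ n) \<longlonglongrightarrow> 0"
   by (intro tendsto_mult_right_zero LIMSEQ_power_zero) simp
  then have "\<forall>\<^sub>F n in sequentially. cnorm A z * (1/2) ^ n < t" using t by (rule order_tendstoD)
  then show thesis using that by (auto simp: eventually_sequentially)
 qed
 ultimately show thesis using that t by blast
qed

text \<open>The element \<open>g\<close> is \<open>t\<^sup>2 (z\<^sup>2 + t\<^sup>2)\<^sup>-\<^sup>1\<close>; as \<open>t \<rightarrow> 0\<close> the elements \<open>1 - g\<close> form an approximate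
 unit for the closed ideal generated by \<open>z\<close>.\<close>

lemma approximate_unit:
 assumes z: "z \<in> carrier A" "star A z = z" and t: "t > 0"
 obtains g v where "g \<in> carrier A" "star A g = g" "cnorm A g \<le> 1" "cnorm A (z \<otimes> g) \<le> t"
  "v \<in> carrier A" "\<one> \<ominus> g = z \<otimes> v"
proof -
 obtain w where w: "w \<in> carrier A" "shifted z t \<otimes> w = \<one>" "w \<otimes> shifted z t = \<one>"
  using resolvent_exists[OF z t] .
 have wn: "cnorm A w \<le> 1 / t" by (rule resolvent_norm[OF z t w])
 let ?i = "\<i> * complex_of_real t"
 let ?t = "complex_of_real (t\<^sup>2)"
 let ?ww = "w \<otimes> star A w"
 \<comment> \<open>\<open>?ww\<close> is the inverse of
   \<open>z \<otimes> z \<oplus> ?t \<odot> \<one>\<close>, so \<open>g\<close> and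
   \<open>z \<otimes> v\<close> are complementary parts of the unit.\<close>
 define g where "g = ?t \<odot> ?ww"
 define v where "v = z \<otimes> ?ww"
 have zw: "z \<otimes> w \<oplus> ?i \<odot> w = \<one>" using w(2) z w(1) by (simp add: shifted_def l_distr smult_mult_left)
 have zw': "z \<otimes> star A w \<oplus> (- ?i) \<odot> star A w = \<one>"
 proof -
  have "star A (w \<otimes> shifted z t) = \<one>" by (simp add: w)
  then show ?thesis
   using z w(1) by (simp add: shifted_def r_distr star_add star_mult star_smult smult_mult_right)
 qed
 have cg: "?ww \<in> carrier A" using w by auto
 have gc: "g \<in> carrier A" using cg by (simp add: g_def)
 have sg: "star A g = g" using w by (simp add: g_def star_smult star_mult)
 have "cnorm A ?ww \<le> 1 / t * (1 / t)"
  using p_mult[of w "star A w"] w wn t by (intro order_trans[OF p_mult] mult_mono) auto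
 then have gn: "cnorm A g \<le> 1"
  using cg t by (simp add: g_def p_smult power2_eq_square norm_mult field_simps)
 have "z \<otimes> w = \<one> \<ominus> ?i \<odot> w"
  using zw z w by (metis add.inv_solve_right minus_eq m_closed smult_closed one_closed)
 \<comment> \<open>This element is the mean of the unit and the Cayley transform, both of norm at
   most 1.\<close>
 moreover have "cnorm A (\<one> \<ominus> ?i \<odot> w) \<le> 1"
 proof -
  have "(\<one> \<ominus> ?i \<odot> w) \<oplus> (\<one> \<ominus> ?i \<odot> w) = \<one> \<oplus> (\<one> \<ominus> (?i \<odot> w \<oplus> ?i \<odot> w))"
   using smult_closed[OF w(1), of ?i] by algebra
  also have "?i \<odot> w \<oplus> ?i \<odot> w = (2 * \<i> * complex_of_real t) \<odot> w"
   using w by (simp add: smult_l_distr[symmetric] mult.assoc)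
  finally have eq: "(1 + 1) \<odot> (\<one> \<ominus> ?i \<odot> w) = \<one> \<oplus> (\<one> \<ominus> (2 * \<i> * complex_of_real t) \<odot> w)"
   using w by (subst smult_l_distr) simp_all
  have "2 * cnorm A (\<one> \<ominus> ?i \<odot> w) = cnorm A ((1 + 1) \<odot> (\<one> \<ominus> ?i \<odot> w))" using w by (simp add: p_smult)
  also have "\<dots> \<le> cnorm A \<one> + cnorm A (\<one> \<ominus> (2 * \<i> * complex_of_real t) \<odot> w)"
   unfolding eq using w by (intro p_add) auto
  also have "\<dots> \<le> 2" using p_one_le cayley_norm[OF z w] by linarith
  finally show ?thesis by simp
 qed
 ultimately have "cnorm A (z \<otimes> w) \<le> 1" by simp
 moreover have "z \<otimes> ?ww = (z \<otimes> w) \<otimes> star A w" using z w by (simp add: m_assoc)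
 moreover have "cnorm A ((z \<otimes> w) \<otimes> star A w) \<le> cnorm A (z \<otimes> w) * cnorm A (star A w)"
  using z w by (intro p_mult) auto
 moreover have "cnorm A (z \<otimes> w) * cnorm A (star A w) \<le> 1 * (1 / t)"
  using w wn \<open>cnorm A (z \<otimes> w) \<le> 1\<close> by (intro mult_mono) auto
 ultimately have "cnorm A (z \<otimes> ?ww) \<le> 1 * (1 / t)" by simp
 then have zg: "cnorm A (z \<otimes> g) \<le> t"
  using z cg t by (simp add: g_def smult_mult_right p_smult norm_mult power2_eq_square field_simps)
 have "\<one> = (z \<otimes> w \<oplus> ?i \<odot> w) \<otimes> (z \<otimes> star A w \<oplus> (- ?i) \<odot> star A w)" by (simp add: zw zw')
 have wz: "w \<otimes> z = z \<otimes> w"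
 proof -
  have "z \<otimes> w \<oplus> ?i \<odot> w = w \<otimes> z \<oplus> ?i \<odot> w"
   using w z zw by (simp add: shifted_def r_distr smult_mult_right)
  then show ?thesis using w z by simp
 qed
 \<comment> \<open>Expanding the product of the two resolvent identities \<open>zw\<close> and
   \<open>zw'\<close>: the outer terms give \<open>z \<otimes> v\<close> and \<open>g\<close>, and
   the mixed terms cancel.\<close>
 have "z \<otimes> v \<oplus> g = (z \<otimes> w \<oplus> ?i \<odot> w) \<otimes> (z \<otimes> star A w \<oplus> (- ?i) \<odot> star A w)"
 proof -
  have c: "z \<otimes> (w \<otimes> star A w) \<in> carrier A" using z w by simp
  have "(z \<otimes> w \<oplus> ?i \<odot> w) \<otimes> (z \<otimes> star A w \<oplus> (- ?i) \<odot> star A w)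
    = (z \<otimes> w \<otimes> (z \<otimes> star A w) \<oplus> (- ?i) \<odot> (z \<otimes> w \<otimes> star A w))
     \<oplus> (?i \<odot> (w \<otimes> (z \<otimes> star A w)) \<oplus> (?i * - ?i) \<odot> (w \<otimes> star A w))"
   using z w(1) by (simp add: l_distr r_distr smult_mult_left smult_mult_right smult_assoc smult_r_distr a_ac)
  also have "z \<otimes> w \<otimes> (z \<otimes> star A w) = z \<otimes> v"
   using z w(1) unfolding v_def by (metis m_assoc m_closed star_closed wz)
  also have "z \<otimes> w \<otimes> star A w = z \<otimes> (w \<otimes> star A w)" using z w(1) by (simp add: m_assoc)
  also have "w \<otimes> (z \<otimes> star A w) = z \<otimes> (w \<otimes> star A w)"
   using z w(1) by (metis m_assoc star_closed wz)
  also have "?i * - ?i = ?t" by (simp add: power2_eq_square complex_eq_iff)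
  also have "(z \<otimes> v \<oplus> (- ?i) \<odot> (z \<otimes> ?ww)) \<oplus> (?i \<odot> (z \<otimes> ?ww) \<oplus> ?t \<odot> ?ww)
    = z \<otimes> v \<oplus> ((- ?i) \<odot> (z \<otimes> ?ww) \<oplus> ?i \<odot> (z \<otimes> ?ww)) \<oplus> g"
   using c cg z(1) by (simp add: g_def v_def a_assoc)
  also have "(- ?i) \<odot> (z \<otimes> ?ww) \<oplus> ?i \<odot> (z \<otimes> ?ww) = \<zero>"
   using c by (simp add: smult_l_distr[symmetric])
  finally show ?thesis using z(1) cg gc by (simp add: v_def)
 qed
 then have "z \<otimes> v \<oplus> g = \<one>" by (simp add: zw zw')
 moreover have vc: "v \<in> carrier A" using z cg by (simp add: v_def)
 ultimately have "\<one> \<ominus> g = z \<otimes> v"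
  using z gc by (metis add.inv_solve_right minus_eq m_closed one_closed)
 with gc sg gn zg vc show thesis by (intro that)
qed

end

section \<open>The quotient seminorm of a kernel\<close>

locale cstar_kernel = A: cstar_alg A + B: star_alg B
 for A :: "('a, 'm) cstar_alg_scheme" and B :: "('b, 'n) star_alg_scheme" +
 fixes h :: "'a \<Rightarrow> 'b"
 assumes h: "h \<in> star_map A B"
begin

definition ker :: "'a set" where "ker = {z \<in> carrier A. h z = \<zero>\<^bsub>B\<^esub>}"

text \<open>This is the norm of the quotient of \<open>A\<close> by \<open>ker\<close>, kept as a
  seminorm on \<open>A\<close> itself so that it can be compared with other C*-seminorms
  there.\<close>

definition quotient_norm :: "'a \<Rightarrow> real" where
 "quotient_norm x = Inf ((\<lambda>z. cnorm A (x \<oplus>\<^bsub>A\<^esub> z)) ` ker)"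

lemmas hD = star_mapD[OF h]

lemma ker_zero [simp]: "\<zero>\<^bsub>A\<^esub> \<in> ker"
 using A.star_map_zero[OF B.star_alg_axioms h] by (simp add: ker_def)

lemma ker_ops:
 "y \<in> ker ==> z \<in> ker ==> y \<oplus>\<^bsub>A\<^esub> z \<in> ker" "z \<in> ker ==> c \<odot>\<^bsub>A\<^esub> z \<in> ker" "z \<in> ker ==> star A z \<in> ker"
 "z \<in> ker ==> x \<in> carrier A ==> z \<otimes>\<^bsub>A\<^esub> x \<in> ker" "z \<in> ker ==> x \<in> carrier A ==> x \<otimes>\<^bsub>A\<^esub> z \<in> ker"
 by (simp_all add: ker_def hD)

lemma ker_closed [simp]: "z \<in> ker ==> z \<in> carrier A"
 by (simp add: ker_def)

lemma quotient_norm_le: assumes "x \<in> carrier A" "z \<in> ker" shows "quotient_norm x \<le> cnorm A (x \<oplus>\<^bsub>A\<^esub> z)"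
 unfolding quotient_norm_def
 by (rule cINF_lower) (use assms in \<open>auto intro!: bdd_belowI[of _ 0]\<close>)

lemma quotient_norm_nonneg: "x \<in> carrier A ==> 0 \<le> quotient_norm x"
 unfolding quotient_norm_def by (rule cINF_greatest) (use ker_zero in \<open>auto simp del: ker_zero\<close>)

lemma quotient_norm_approx:
 assumes "x \<in> carrier A" "quotient_norm x < r"
 obtains z where "z \<in> ker" "cnorm A (x \<oplus>\<^bsub>A\<^esub> z) < r"
 using cInf_lessD[of "(\<lambda>z. cnorm A (x \<oplus>\<^bsub>A\<^esub> z)) ` ker" r] assms ker_zero
 unfolding quotient_norm_def by blast

lemma quotient_norm_ker: assumes "z \<in> ker" shows "quotient_norm z = 0"
proof -
 have "(- 1) \<odot>\<^bsub>A\<^esub> z \<in> ker" using assms by (rule ker_ops)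
 then have "quotient_norm z \<le> cnorm A (z \<oplus>\<^bsub>A\<^esub> \<ominus>\<^bsub>A\<^esub> z)"
  using quotient_norm_le[of z "(- 1) \<odot>\<^bsub>A\<^esub> z"] assms by (simp add: A.smult_minus_one)
 then show ?thesis using assms quotient_norm_nonneg[of z] by (simp add: A.r_neg)
qed

lemma quotient_norm_smult_le:
 assumes x: "x \<in> carrier A" shows "quotient_norm (c \<odot>\<^bsub>A\<^esub> x) \<le> cmod c * quotient_norm x"
proof (rule field_le_epsilon)
 fix e :: real assume e: "e > 0"
 \<comment> \<open>The summand 1 in the denominator covers the case c = 0.\<close>
 define d where "d = e / (cmod c + 1)"
 have c1: "cmod c + 1 > 0" by (simp add: add_nonneg_pos)
 have d: "d > 0" using e c1 by (simp add: d_def)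
 have "cmod c * d \<le> (cmod c + 1) * d" using d by (intro mult_right_mono) auto
 also have "(cmod c + 1) * d = e" using c1 by (simp add: d_def)
 finally have cd: "cmod c * d \<le> e" .
 obtain z where z: "z \<in> ker" "cnorm A (x \<oplus>\<^bsub>A\<^esub> z) < quotient_norm x + d"
  using quotient_norm_approx[OF x, of "quotient_norm x + d"] d by auto
 have "quotient_norm (c \<odot>\<^bsub>A\<^esub> x) \<le> cnorm A (c \<odot>\<^bsub>A\<^esub> x \<oplus>\<^bsub>A\<^esub> c \<odot>\<^bsub>A\<^esub> z)"
  by (rule quotient_norm_le) (use x z ker_ops in auto)
 also have "\<dots> = cmod c * cnorm A (x \<oplus>\<^bsub>A\<^esub> z)"
  using x z by (simp add: A.smult_r_distr[symmetric] A.p_smult)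
 also have "\<dots> \<le> cmod c * (quotient_norm x + d)" using z by (intro mult_left_mono) auto
 also have "\<dots> \<le> cmod c * quotient_norm x + e" using cd by (simp add: distrib_left)
 finally show "quotient_norm (c \<odot>\<^bsub>A\<^esub> x) \<le> cmod c * quotient_norm x + e" .
qed

lemma quotient_norm_star_le:
 assumes x: "x \<in> carrier A" shows "quotient_norm (star A x) \<le> quotient_norm x"
proof (rule dense_ge)
 fix r assume "quotient_norm x < r"
 then obtain z where z: "z \<in> ker" "cnorm A (x \<oplus>\<^bsub>A\<^esub> z) < r" using quotient_norm_approx[OF x] by blast
 have "quotient_norm (star A x) \<le> cnorm A (star A x \<oplus>\<^bsub>A\<^esub> star A z)"
  by (rule quotient_norm_le) (use x z ker_ops in auto)
 also have "\<dots> = cnorm A (x \<oplus>\<^bsub>A\<^esub> z)" using x z by (simp add: A.star_add[symmetric])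
 finally show "quotient_norm (star A x) \<le> r" using z by simp
qed

lemma quotient_norm_add:
 assumes "x \<in> carrier A" "y \<in> carrier A"
 shows "quotient_norm (x \<oplus>\<^bsub>A\<^esub> y) \<le> quotient_norm x + quotient_norm y"
proof (rule field_le_epsilon)
 fix e :: real assume e: "e > 0"
 obtain z where z: "z \<in> ker" "cnorm A (x \<oplus>\<^bsub>A\<^esub> z) < quotient_norm x + e / 2"
  using quotient_norm_approx[OF assms(1), of "quotient_norm x + e / 2"] e by auto
 obtain z' where z': "z' \<in> ker" "cnorm A (y \<oplus>\<^bsub>A\<^esub> z') < quotient_norm y + e / 2"
  using quotient_norm_approx[OF assms(2), of "quotient_norm y + e / 2"] e by auto
 have "quotient_norm (x \<oplus>\<^bsub>A\<^esub> y) \<le> cnorm A (x \<oplus>\<^bsub>A\<^esub> y \<oplus>\<^bsub>A\<^esub> (z \<oplus>\<^bsub>A\<^esub> z'))"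
  by (rule quotient_norm_le) (use assms z z' ker_ops in auto)
 also have "x \<oplus>\<^bsub>A\<^esub> y \<oplus>\<^bsub>A\<^esub> (z \<oplus>\<^bsub>A\<^esub> z') = (x \<oplus>\<^bsub>A\<^esub> z) \<oplus>\<^bsub>A\<^esub> (y \<oplus>\<^bsub>A\<^esub> z')"
  using assms z z' by (simp add: A.a_ac)
 also have "cnorm A \<dots> \<le> cnorm A (x \<oplus>\<^bsub>A\<^esub> z) + cnorm A (y \<oplus>\<^bsub>A\<^esub> z')"
  using assms z z' by (intro A.p_add) auto
 finally show "quotient_norm (x \<oplus>\<^bsub>A\<^esub> y) \<le> quotient_norm x + quotient_norm y + e" using z z' by simp
qed

text \<open>The product of two corrected elements \<open>x + z\<close> and \<open>y + z'\<close>
  differs from \<open>x y\<close> by an element of the ideal, so nearly optimal corrections of the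
  factors give an admissible correction of the product.\<close>

lemma quotient_norm_mult:
 assumes "x \<in> carrier A" "y \<in> carrier A"
 shows "quotient_norm (x \<otimes>\<^bsub>A\<^esub> y) \<le> quotient_norm x * quotient_norm y"
proof -
 have le: "quotient_norm (x \<otimes>\<^bsub>A\<^esub> y) \<le> (quotient_norm x + e) * (quotient_norm y + e)" if e: "e > 0" for e
 proof -
  obtain z where z: "z \<in> ker" "cnorm A (x \<oplus>\<^bsub>A\<^esub> z) < quotient_norm x + e"
   using quotient_norm_approx[OF assms(1), of "quotient_norm x + e"] e by auto
  obtain z' where z': "z' \<in> ker" "cnorm A (y \<oplus>\<^bsub>A\<^esub> z') < quotient_norm y + e"
   using quotient_norm_approx[OF assms(2), of "quotient_norm y + e"] e by auto
  have c: "z \<in> carrier A" "z' \<in> carrier A" using z z' by auto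
  have "quotient_norm (x \<otimes>\<^bsub>A\<^esub> y)
    \<le> cnorm A (x \<otimes>\<^bsub>A\<^esub> y \<oplus>\<^bsub>A\<^esub> (x \<otimes>\<^bsub>A\<^esub> z' \<oplus>\<^bsub>A\<^esub> (z \<otimes>\<^bsub>A\<^esub> y \<oplus>\<^bsub>A\<^esub> z \<otimes>\<^bsub>A\<^esub> z')))"
   by (rule quotient_norm_le) (use assms z z' ker_ops in auto)
  also have "x \<otimes>\<^bsub>A\<^esub> y \<oplus>\<^bsub>A\<^esub> (x \<otimes>\<^bsub>A\<^esub> z' \<oplus>\<^bsub>A\<^esub> (z \<otimes>\<^bsub>A\<^esub> y \<oplus>\<^bsub>A\<^esub> z \<otimes>\<^bsub>A\<^esub> z'))
    = (x \<oplus>\<^bsub>A\<^esub> z) \<otimes>\<^bsub>A\<^esub> (y \<oplus>\<^bsub>A\<^esub> z')"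
   using assms c by (simp add: A.l_distr A.r_distr A.a_ac)
  also have "cnorm A \<dots> \<le> cnorm A (x \<oplus>\<^bsub>A\<^esub> z) * cnorm A (y \<oplus>\<^bsub>A\<^esub> z')"
   using assms c by (intro A.p_mult) auto
  also have "\<dots> \<le> (quotient_norm x + e) * (quotient_norm y + e)"
   using z z' c assms quotient_norm_nonneg[of x] e by (intro mult_mono) auto
  finally show ?thesis .
 qed
 have "(\<lambda>n. (quotient_norm x + inverse (real (Suc n))) * (quotient_norm y + inverse (real (Suc n))))
   \<longlonglongrightarrow> (quotient_norm x + 0) * (quotient_norm y + 0)"
  by (intro tendsto_intros LIMSEQ_inverse_real_of_nat)
 then have "quotient_norm (x \<otimes>\<^bsub>A\<^esub> y) \<le> (quotient_norm x + 0) * (quotient_norm y + 0)"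
  by (rule LIMSEQ_le_const) (use le in auto)
 then show ?thesis by simp
qed

text \<open>Let \<open>y = star A x \<otimes> x\<close> have a nearly optimal self-adjoint
  correction \<open>s\<close>, and let \<open>g\<close> come from the approximate unit of
  \<open>s\<close>. Then \<open>x g\<close> equals \<open>x\<close> modulo the kernel, since
  \<open>1 - g = s v\<close>. The squared norm of \<open>x g\<close> is the norm of
  \<open>g y g\<close>, hence at most that of \<open>y g = (y + s) g - s g\<close>, where the last
  term is small.\<close>

lemma quotient_norm_cstar_ge:
 assumes x: "x \<in> carrier A"
 shows "(quotient_norm x)\<^sup>2 \<le> quotient_norm (star A x \<otimes>\<^bsub>A\<^esub> x)"
proof (rule field_le_epsilon)
 fix e :: real assume e: "e > 0"
 define y where "y = star A x \<otimes>\<^bsub>A\<^esub> x"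
 have y: "y \<in> carrier A" "star A y = y" using x by (simp_all add: y_def A.star_mult)
 obtain z where z: "z \<in> ker" "cnorm A (y \<oplus>\<^bsub>A\<^esub> z) < quotient_norm y + e / 2"
  using quotient_norm_approx[OF y(1), of "quotient_norm y + e / 2"] e by auto
 have zc: "z \<in> carrier A" using z by simp
 \<comment> \<open>The approximate unit requires a self-adjoint element. As \<open>y\<close> is
   self-adjoint, averaging \<open>z\<close> with its adjoint does not increase the norm of the
   corrected element.\<close>
 define s where "s = (1/2) \<odot>\<^bsub>A\<^esub> (z \<oplus>\<^bsub>A\<^esub> star A z)"
 have sk: "s \<in> ker" using z by (simp add: s_def ker_ops)
 have s: "s \<in> carrier A" "star A s = s"
  using zc by (simp_all add: s_def A.star_smult A.star_add A.a_comm)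
 have "y \<oplus>\<^bsub>A\<^esub> y = (1 + 1) \<odot>\<^bsub>A\<^esub> y" using y by (subst A.smult_l_distr) simp_all
 then have "y = (1/2) \<odot>\<^bsub>A\<^esub> (y \<oplus>\<^bsub>A\<^esub> y)" using y by (simp add: A.smult_assoc)
 then have "y \<oplus>\<^bsub>A\<^esub> s = (1/2) \<odot>\<^bsub>A\<^esub> ((y \<oplus>\<^bsub>A\<^esub> y) \<oplus>\<^bsub>A\<^esub> (z \<oplus>\<^bsub>A\<^esub> star A z))"
  unfolding s_def using y zc by (subst A.smult_r_distr) simp_all
 also have "(y \<oplus>\<^bsub>A\<^esub> y) \<oplus>\<^bsub>A\<^esub> (z \<oplus>\<^bsub>A\<^esub> star A z) = (y \<oplus>\<^bsub>A\<^esub> z) \<oplus>\<^bsub>A\<^esub> star A (y \<oplus>\<^bsub>A\<^esub> z)"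
  using y zc by (simp add: A.star_add A.a_ac)
 finally have "cnorm A (y \<oplus>\<^bsub>A\<^esub> s) \<le> 1/2 * (cnorm A (y \<oplus>\<^bsub>A\<^esub> z) + cnorm A (star A (y \<oplus>\<^bsub>A\<^esub> z)))"
  using y zc by (simp add: A.p_smult A.p_add del: A.p_star)
 then have ys: "cnorm A (y \<oplus>\<^bsub>A\<^esub> s) < quotient_norm y + e / 2" using z y by simp
 obtain g v where g: "g \<in> carrier A" "star A g = g" "cnorm A g \<le> 1" "cnorm A (s \<otimes>\<^bsub>A\<^esub> g) \<le> e / 2"
  and v: "v \<in> carrier A" "\<one>\<^bsub>A\<^esub> \<ominus>\<^bsub>A\<^esub> g = s \<otimes>\<^bsub>A\<^esub> v"
  using A.approximate_unit[OF s, of "e / 2"] e by auto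
 have "(- 1) \<odot>\<^bsub>A\<^esub> (x \<otimes>\<^bsub>A\<^esub> (s \<otimes>\<^bsub>A\<^esub> v)) \<in> ker" using sk v x by (intro ker_ops)
 then have "quotient_norm x \<le> cnorm A (x \<oplus>\<^bsub>A\<^esub> (- 1) \<odot>\<^bsub>A\<^esub> (x \<otimes>\<^bsub>A\<^esub> (s \<otimes>\<^bsub>A\<^esub> v)))"
  by (rule quotient_norm_le[OF x])
 also have "x \<oplus>\<^bsub>A\<^esub> (- 1) \<odot>\<^bsub>A\<^esub> (x \<otimes>\<^bsub>A\<^esub> (s \<otimes>\<^bsub>A\<^esub> v)) = x \<ominus>\<^bsub>A\<^esub> x \<otimes>\<^bsub>A\<^esub> (\<one>\<^bsub>A\<^esub> \<ominus>\<^bsub>A\<^esub> g)"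
  using x g by (simp add: v(2)[symmetric] A.smult_minus_one A.minus_eq)
 also have "\<dots> = x \<otimes>\<^bsub>A\<^esub> g"
  using x g(1) by (simp add: A.r_distr A.r_minus A.minus_eq A.minus_add A.a_assoc[symmetric] A.r_neg)
 finally have "(quotient_norm x)\<^sup>2 \<le> (cnorm A (x \<otimes>\<^bsub>A\<^esub> g))\<^sup>2"
  using quotient_norm_nonneg[OF x] by (intro power_mono)
 also have "\<dots> = cnorm A (g \<otimes>\<^bsub>A\<^esub> (y \<otimes>\<^bsub>A\<^esub> g))"
  using A.p_cstar[of "x \<otimes>\<^bsub>A\<^esub> g"] x g by (simp add: A.star_mult y_def A.m_assoc)
 also have "\<dots> \<le> cnorm A g * cnorm A (y \<otimes>\<^bsub>A\<^esub> g)" using y g by (intro A.p_mult) auto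
 also have "\<dots> \<le> 1 * cnorm A (y \<otimes>\<^bsub>A\<^esub> g)" using y g by (intro mult_right_mono) auto
 also have "y \<otimes>\<^bsub>A\<^esub> g = (y \<oplus>\<^bsub>A\<^esub> s) \<otimes>\<^bsub>A\<^esub> g \<ominus>\<^bsub>A\<^esub> s \<otimes>\<^bsub>A\<^esub> g"
  using y(1) g(1) s(1) by (simp add: A.l_distr A.minus_eq A.a_assoc A.r_neg)
 also have "1 * cnorm A \<dots> \<le> cnorm A ((y \<oplus>\<^bsub>A\<^esub> s) \<otimes>\<^bsub>A\<^esub> g) + cnorm A (s \<otimes>\<^bsub>A\<^esub> g)"
  using A.p_diff[of "(y \<oplus>\<^bsub>A\<^esub> s) \<otimes>\<^bsub>A\<^esub> g" "s \<otimes>\<^bsub>A\<^esub> g"] y g s by simp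
 also have "cnorm A ((y \<oplus>\<^bsub>A\<^esub> s) \<otimes>\<^bsub>A\<^esub> g) \<le> cnorm A (y \<oplus>\<^bsub>A\<^esub> s) * cnorm A g"
  using y g s by (intro A.p_mult) auto
 also have "\<dots> \<le> cnorm A (y \<oplus>\<^bsub>A\<^esub> s) * 1" using y g s by (intro mult_left_mono) auto
 finally show "(quotient_norm x)\<^sup>2 \<le> quotient_norm (star A x \<otimes>\<^bsub>A\<^esub> x) + e"
  using ys g(4) unfolding y_def[symmetric] by simp
qed

theorem quotient_seminorm: "cstar_seminorm A quotient_norm"
 unfolding cstar_seminorm_def
proof (intro conjI ballI allI)
 fix x assume x: "x \<in> carrier A"
 have "quotient_norm (star A x \<otimes>\<^bsub>A\<^esub> x) \<le> quotient_norm (star A x) * quotient_norm x"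
  using x by (intro quotient_norm_mult) auto
 also have "\<dots> \<le> quotient_norm x * quotient_norm x"
  using x quotient_norm_star_le quotient_norm_nonneg by (intro mult_right_mono) auto
 finally show "quotient_norm (star A x \<otimes>\<^bsub>A\<^esub> x) = (quotient_norm x)\<^sup>2"
  using quotient_norm_cstar_ge[OF x] by (simp add: power2_eq_square)
 show "quotient_norm (c \<odot>\<^bsub>A\<^esub> x) = cmod c * quotient_norm x" for c
 proof (cases "c = 0")
  case True
  then show ?thesis using x quotient_norm_ker[OF ker_zero] by simp
 next
  case False
  have "quotient_norm (inverse c \<odot>\<^bsub>A\<^esub> (c \<odot>\<^bsub>A\<^esub> x)) \<le> cmod (inverse c) * quotient_norm (c \<odot>\<^bsub>A\<^esub> x)"
   using x by (intro quotient_norm_smult_le) auto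
  then have "cmod c * quotient_norm x \<le> quotient_norm (c \<odot>\<^bsub>A\<^esub> x)"
   using x False by (simp add: A.smult_assoc norm_inverse norm_divide field_simps)
  with quotient_norm_smult_le[OF x, of c] show ?thesis by simp
 qed
qed (simp_all add: quotient_norm_nonneg quotient_norm_add quotient_norm_mult)

end

text \<open>The hypothesis \<open>univ\<close>, applied to the quotient seminorm of the kernel of
  \<open>h\<close>, shows that a small element of \<open>B\<close> coming from \<open>S\<close> has
  a small lift to \<open>A\<close>. An approximating sequence in \<open>B\<close> is lifted
  increment by increment, and completeness of \<open>A\<close> supplies a preimage of its
  limit.\<close>

theorem star_map_surjective:
 assumes "cstar_alg A" "cstar_alg B" "star_alg S"
  and \<alpha>: "\<alpha> \<in> star_map S A" and \<beta>: "\<beta> \<in> star_map S B" "norm_dense B (\<beta> ` carrier S)"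
  and h: "h \<in> star_map A B" "\<And>s. s \<in> carrier S ==> h (\<alpha> s) = \<beta> s"
  and univ: "\<And>q s. cstar_seminorm A q ==> (\<And>z. z \<in> carrier A ==> h z = \<zero>\<^bsub>B\<^esub> ==> q z = 0) ==>
   s \<in> carrier S ==> q (\<alpha> s) \<le> cnorm B (\<beta> s)"
 shows "h ` carrier A = carrier B"
proof -
 interpret A: cstar_alg A by fact
 interpret B: cstar_alg B by fact
 interpret S: star_alg S by fact
 interpret K: cstar_kernel A B h by unfold_locales fact
 have q_le: "K.quotient_norm (\<alpha> s) \<le> cnorm B (\<beta> s)" if "s \<in> carrier S" for s
  proof (rule univ[OF K.quotient_seminorm _ that])
  fix z assume "z \<in> carrier A" "h z = \<zero>\<^bsub>B\<^esub>"
  then have "z \<in> K.ker" unfolding K.ker_def by blast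
  then show "K.quotient_norm z = 0" by (rule K.quotient_norm_ker)
 qed
 have "y \<in> h ` carrier A" if y: "y \<in> carrier B" for y
 proof -
  have "\<exists>s. s \<in> carrier S \<and> cnorm B (y \<ominus>\<^bsub>B\<^esub> \<beta> s) < (1/2) ^ n" for n
  proof -
   have "(1/2) ^ n > (0::real)" by simp
   then show ?thesis using \<beta>(2) y unfolding norm_dense_def by blast
  qed
  then obtain \<tau> where \<tau>: "\<And>n. \<tau> n \<in> carrier S" "\<And>n. cnorm B (y \<ominus>\<^bsub>B\<^esub> \<beta> (\<tau> n)) < (1/2) ^ n" by metis
  have \<beta>c: "\<beta> (\<tau> n) \<in> carrier B" and \<alpha>c: "\<alpha> (\<tau> n) \<in> carrier A" for n
   using \<tau>(1) star_mapD(1)[OF \<alpha>] star_mapD(1)[OF \<beta>(1)] by auto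
  define d where "d n = \<tau> (Suc n) \<ominus>\<^bsub>S\<^esub> \<tau> n" for n
  have dc: "d n \<in> carrier S" for n using \<tau>(1) by (simp add: d_def)
  \<comment> \<open>Two neighbouring errors add up to 3/2 times the n-th power of 1/2; the rounder
    constant 3 still leaves a geometric bound.\<close>
  have "\<exists>z. z \<in> K.ker \<and> cnorm A (\<alpha> (d n) \<oplus>\<^bsub>A\<^esub> z) \<le> 3 * (1/2) ^ n" for n
  proof -
   have "cnorm B (\<beta> (d n)) = cnorm B (\<beta> (\<tau> (Suc n)) \<ominus>\<^bsub>B\<^esub> \<beta> (\<tau> n))"
    using \<tau>(1) by (simp add: d_def S.star_map_diff[OF B.star_alg_axioms \<beta>(1)])
   also have "\<dots> \<le> cnorm B (\<beta> (\<tau> (Suc n)) \<ominus>\<^bsub>B\<^esub> y) + cnorm B (y \<ominus>\<^bsub>B\<^esub> \<beta> (\<tau> n))"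
    using \<beta>c y by (intro B.p_triangle) auto
   also have "\<dots> < (1/2) ^ Suc n + (1/2) ^ n"
    using \<tau>(2)[of n] \<tau>(2)[of "Suc n"] B.p_diff_commute[OF \<beta>c y, of "Suc n"] by linarith
   also have "\<dots> < 3 * (1/2) ^ n" by simp
   finally have "K.quotient_norm (\<alpha> (d n)) < 3 * (1/2) ^ n" using q_le[OF dc, of n] by linarith
   moreover have "\<alpha> (d n) \<in> carrier A" using star_mapD(1)[OF \<alpha> dc] .
   ultimately show ?thesis using K.quotient_norm_approx less_imp_le by metis
  qed
  then obtain z where z: "\<And>n. z n \<in> K.ker" "\<And>n. cnorm A (\<alpha> (d n) \<oplus>\<^bsub>A\<^esub> z n) \<le> 3 * (1/2) ^ n" by metis
  have \<alpha>d: "\<alpha> (d n) \<in> carrier A" "z n \<in> carrier A" "h (z n) = \<zero>\<^bsub>B\<^esub>" for n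
   using star_mapD(1)[OF \<alpha> dc] z(1)[of n] unfolding K.ker_def by auto
  \<comment> \<open>Each increment is made small by a kernel element, which \<open>h\<close> does
    not see, so \<open>h (a n)\<close> remains \<open>\<beta> (\<tau> n)\<close>.\<close>
  define a where "a n = rec_nat (\<alpha> (\<tau> 0)) (\<lambda>n x. x \<oplus>\<^bsub>A\<^esub> (\<alpha> (d n) \<oplus>\<^bsub>A\<^esub> z n)) n" for n
  have a0: "a 0 = \<alpha> (\<tau> 0)" and aS: "a (Suc n) = a n \<oplus>\<^bsub>A\<^esub> (\<alpha> (d n) \<oplus>\<^bsub>A\<^esub> z n)" for n
   by (simp_all add: a_def)
  have ac: "a n \<in> carrier A" for n by (induction n) (simp_all add: a0 aS \<alpha>d \<alpha>c)
  have ha: "h (a n) = \<beta> (\<tau> n)" for n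
  proof (induction n)
   case (Suc n)
   have "h (a (Suc n)) = \<beta> (\<tau> n) \<oplus>\<^bsub>B\<^esub> \<beta> (d n)"
    using Suc ac \<alpha>d star_mapD(1)[OF \<beta>(1) dc] by (simp add: aS star_mapD[OF h(1)] h(2)[OF dc])
   also have "\<beta> (d n) = \<beta> (\<tau> (Suc n)) \<ominus>\<^bsub>B\<^esub> \<beta> (\<tau> n)"
    using \<tau>(1) by (simp add: d_def S.star_map_diff[OF B.star_alg_axioms \<beta>(1)])
   also have "\<beta> (\<tau> n) \<oplus>\<^bsub>B\<^esub> (\<beta> (\<tau> (Suc n)) \<ominus>\<^bsub>B\<^esub> \<beta> (\<tau> n)) = \<beta> (\<tau> (Suc n))"
    using \<beta>c[of n] \<beta>c[of "Suc n"] by algebra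
   finally show ?case .
  qed (simp add: a0 h(2)[OF \<tau>(1)])
  have "seminorm_Cauchy A (cnorm A) a"
  proof (rule A.Cauchy_if_geometric[where c = "1/2" and K = 3])
   fix n
   have "a (Suc n) \<ominus>\<^bsub>A\<^esub> a n = \<alpha> (d n) \<oplus>\<^bsub>A\<^esub> z n"
    unfolding aS using ac[of n] \<alpha>d[of n] by algebra
   then show "cnorm A (a (Suc n) \<ominus>\<^bsub>A\<^esub> a n) \<le> 3 * (1/2) ^ n" using z(2)[of n] by simp
  qed (simp_all add: ac)
  then obtain x where x: "A.lim_to a x" using A.complete by blast
  have "B.lim_to (\<lambda>n. h (a n)) (h x)"
   by (rule A.lin_map_lim[OF assms(2) A.star_map_lin_map[OF assms(2) h(1)] x])
  moreover have "B.lim_to (\<lambda>n. h (a n)) y"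
   unfolding ha
  proof (rule B.lim_toI[OF \<beta>c y])
   show "cnorm B (\<beta> (\<tau> n) \<ominus>\<^bsub>B\<^esub> y) \<le> (1/2) ^ n" for n
    using \<tau>(2)[of n] B.p_diff_commute[OF \<beta>c y, of n] by simp
  qed (simp add: LIMSEQ_power_zero)
  ultimately have "h x = y" by (rule B.lim_to_unique)
  then show ?thesis using A.lim_to_closed(2)[OF x] by blast
 qed
 then show ?thesis using star_mapD(1)[OF h(1)] by blast
qed

section \<open>Monoid algebras and universal C*-algebras\<close>

lemma poly_sum_superset:
 fixes G :: "'m \<Rightarrow> complex \<Rightarrow> 'b::comm_monoid_add"
 assumes "finite K" "Poly_Mapping.keys f \<subseteq> K" "\<And>u. G u 0 = 0"
 shows "(\<Sum>u\<in>Poly_Mapping.keys f. G u (Poly_Mapping.lookup f u)) = (\<Sum>u\<in>K. G u (Poly_Mapping.lookup f u))"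
 by (rule sum.mono_neutral_left) (use assms in \<open>auto simp: in_keys_iff\<close>)

text \<open>Both supports are enlarged to their union. There \<open>G u 0 = 0\<close> makes the
  additional terms vanish, and cancellation of coefficients in \<open>f + g\<close> does no
  harm.\<close>

lemma poly_sum_add:
 fixes G :: "'m \<Rightarrow> complex \<Rightarrow> 'b::comm_monoid_add"
 assumes "\<And>u. G u 0 = 0" "\<And>u a b. G u (a + b) = G u a + G u b"
 shows "(\<Sum>u\<in>Poly_Mapping.keys (f + g). G u (Poly_Mapping.lookup (f + g) u)) =
  (\<Sum>u\<in>Poly_Mapping.keys f. G u (Poly_Mapping.lookup f u)) + (\<Sum>u\<in>Poly_Mapping.keys g. G u (Poly_Mapping.lookup g u))"
proof -
 let ?K = "Poly_Mapping.keys f \<union> Poly_Mapping.keys g"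
 have K: "finite ?K" "Poly_Mapping.keys (f + g) \<subseteq> ?K" using Poly_Mapping.keys_add[of f g] by auto
 show ?thesis
  using K poly_sum_superset[of ?K "f + g" G] poly_sum_superset[of ?K f G] poly_sum_superset[of ?K g G]
  by (simp add: assms lookup_add sum.distrib)
qed

lemma poly_mapping_sum_singles:
 "f = (\<Sum>m\<in>Poly_Mapping.keys f. Poly_Mapping.single m (Poly_Mapping.lookup f m))"
proof (rule poly_mapping_eqI)
 fix k
 have "(\<Sum>m\<in>Poly_Mapping.keys f. Poly_Mapping.lookup (Poly_Mapping.single m (Poly_Mapping.lookup f m)) k) =
   (\<Sum>m\<in>Poly_Mapping.keys f. if m = k then Poly_Mapping.lookup f m else 0)"
  by (intro sum.cong) (simp_all add: lookup_single when_def)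
 also have "\<dots> = Poly_Mapping.lookup f k" by (simp add: sum.delta in_keys_iff)
 finally show "Poly_Mapping.lookup f k =
   Poly_Mapping.lookup (\<Sum>m\<in>Poly_Mapping.keys f. Poly_Mapping.single m (Poly_Mapping.lookup f m)) k"
  by (simp add: lookup_sum)
qed

definition lin :: "('b, 'n) star_alg_scheme \<Rightarrow> ('m \<Rightarrow> 'b) \<Rightarrow> ('m \<Rightarrow>\<^sub>0 complex) \<Rightarrow> 'b" where
 "lin D \<phi> f = finsum D (\<lambda>m. Poly_Mapping.lookup f m \<odot>\<^bsub>D\<^esub> \<phi> m) (Poly_Mapping.keys f)"

text \<open>Words with reversal, and pairs or triples of elements of C*-algebras with the
  componentwise adjoint, are instances. The free *-algebra and the formal tensor algebras thus share
  one theory.\<close>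

locale star_monoid = Group.monoid M for M :: "('m, 'z) monoid_scheme" (structure) +
 fixes s :: "'m \<Rightarrow> 'm"
 assumes s_closed [simp]: "x \<in> carrier M ==> s x \<in> carrier M"
  and s_s [simp]: "x \<in> carrier M ==> s (s x) = x"
  and s_mult: "x \<in> carrier M ==> y \<in> carrier M ==> s (x \<otimes> y) = s y \<otimes> s x"
begin

abbreviation MA where "MA \<equiv> monoid_star_alg M s"

lemma carrier_MA: "carrier MA = {f. Poly_Mapping.keys f \<subseteq> carrier M}"
 and add_MA [simp]: "f \<oplus>\<^bsub>MA\<^esub> g = f + g"
 and zero_MA [simp]: "\<zero>\<^bsub>MA\<^esub> = 0"
 and one_MA: "\<one>\<^bsub>MA\<^esub> = Poly_Mapping.single \<one> 1"
 and smult_MA: "c \<odot>\<^bsub>MA\<^esub> f = Poly_Mapping.map (\<lambda>z. c * z) f"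
 by (simp_all add: monoid_star_alg_def)

lemma mult_MA: "f \<otimes>\<^bsub>MA\<^esub> g = (\<Sum>u\<in>Poly_Mapping.keys f. \<Sum>v\<in>Poly_Mapping.keys g.
  Poly_Mapping.single (u \<otimes> v) (Poly_Mapping.lookup f u * Poly_Mapping.lookup g v))"
 and star_MA: "star MA f = (\<Sum>u\<in>Poly_Mapping.keys f. Poly_Mapping.single (s u) (cnj (Poly_Mapping.lookup f u)))"
 by (simp_all add: monoid_star_alg_def)

lemma zero_carrier_MA [simp]: "0 \<in> carrier MA"
 and single_carrier_MA [simp]: "m \<in> carrier M ==> Poly_Mapping.single m c \<in> carrier MA"
 by (auto simp: carrier_MA split: if_splits)

lemma add_carrier_MA [simp]: "f \<in> carrier MA ==> g \<in> carrier MA ==> f + g \<in> carrier MA"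
 using Poly_Mapping.keys_add[of f g] by (auto simp: carrier_MA)

text \<open>All laws of the algebra are additive in each argument, so they only have to be checked
  on multiples of basis elements.\<close>

lemma MA_induct [consumes 1, case_names zero single add]:
 assumes f: "f \<in> carrier MA" and "P 0"
  and 1: "\<And>m c. m \<in> carrier M ==> P (Poly_Mapping.single m c)"
  and 2: "\<And>f g. f \<in> carrier MA ==> g \<in> carrier MA ==> P f ==> P g ==> P (f + g)"
 shows "P f"
proof -
 let ?S = "\<lambda>K. \<Sum>m\<in>K. Poly_Mapping.single m (Poly_Mapping.lookup f m)"
 have "finite K ==> K \<subseteq> carrier M ==> ?S K \<in> carrier MA \<and> P (?S K)" for K
  by (induction K rule: finite_induct) (use assms in auto)
 then have "P (?S (Poly_Mapping.keys f))" using f by (simp add: carrier_MA)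
 then show ?thesis by (simp flip: poly_mapping_sum_singles)
qed

lemma lookup_smult_MA: "Poly_Mapping.lookup (c \<odot>\<^bsub>MA\<^esub> f) k = c * Poly_Mapping.lookup f k"
 by (simp add: smult_MA Poly_Mapping.map.rep_eq when_def)

lemma smult_add_MA: "c \<odot>\<^bsub>MA\<^esub> (f + g) = c \<odot>\<^bsub>MA\<^esub> f + c \<odot>\<^bsub>MA\<^esub> g"
 by (rule poly_mapping_eqI) (simp add: lookup_smult_MA lookup_add distrib_left)

lemma smult_single_MA [simp]: "c \<odot>\<^bsub>MA\<^esub> Poly_Mapping.single m a = Poly_Mapping.single m (c * a)"
 by (rule poly_mapping_eqI) (simp add: lookup_smult_MA lookup_single when_def)

lemma smult_zero_MA [simp]: "c \<odot>\<^bsub>MA\<^esub> 0 = 0"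
 by (rule poly_mapping_eqI) (simp add: lookup_smult_MA)

lemma smult_carrier_MA [simp]: "f \<in> carrier MA ==> c \<odot>\<^bsub>MA\<^esub> f \<in> carrier MA"
 by (induction f rule: MA_induct) (simp_all add: smult_add_MA)

lemma mult_add_left_MA: "(f + f') \<otimes>\<^bsub>MA\<^esub> g = f \<otimes>\<^bsub>MA\<^esub> g + f' \<otimes>\<^bsub>MA\<^esub> g"
 unfolding mult_MA
 by (rule poly_sum_add[where G = "\<lambda>u a. \<Sum>v\<in>Poly_Mapping.keys g. Poly_Mapping.single (u \<otimes> v) (a * Poly_Mapping.lookup g v)"])
  (simp_all add: distrib_right single_add sum.distrib)

lemma mult_add_right_MA: "f \<otimes>\<^bsub>MA\<^esub> (g + g') = f \<otimes>\<^bsub>MA\<^esub> g + f \<otimes>\<^bsub>MA\<^esub> g'"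
 unfolding mult_MA sum.distrib[symmetric]
 by (intro sum.cong[OF refl] poly_sum_add[where G = "\<lambda>v b. Poly_Mapping.single (u \<otimes> v) (Poly_Mapping.lookup f u * b)" for u])
  (simp_all add: distrib_left single_add)

lemma mult_zero_MA [simp]: "0 \<otimes>\<^bsub>MA\<^esub> g = 0" "f \<otimes>\<^bsub>MA\<^esub> 0 = 0"
 by (simp_all add: mult_MA)

lemma mult_single_MA [simp]:
 "Poly_Mapping.single m a \<otimes>\<^bsub>MA\<^esub> Poly_Mapping.single n b = Poly_Mapping.single (m \<otimes> n) (a * b)"
 by (cases "a = 0"; cases "b = 0") (simp_all add: mult_MA)

lemma star_add_MA: "star MA (f + g) = star MA f + star MA g"
 unfolding star_MA
 by (rule poly_sum_add[where G = "\<lambda>u a. Poly_Mapping.single (s u) (cnj a)"]) (simp_all add: single_add)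

lemma star_zero_MA [simp]: "star MA 0 = 0"
 by (simp add: star_MA)

lemma star_single_MA [simp]: "star MA (Poly_Mapping.single m a) = Poly_Mapping.single (s m) (cnj a)"
 by (cases "a = 0") (simp_all add: star_MA)

lemmas MA_add_simps = smult_add_MA mult_add_left_MA mult_add_right_MA star_add_MA

lemma star_carrier_MA [simp]: "f \<in> carrier MA ==> star MA f \<in> carrier MA"
 by (induction f rule: MA_induct) (simp_all add: MA_add_simps)

lemma mult_carrier_MA [simp]:
 assumes "f \<in> carrier MA" "g \<in> carrier MA" shows "f \<otimes>\<^bsub>MA\<^esub> g \<in> carrier MA"
 using assms
proof (induction f rule: MA_induct)
 case (single m c)
 from single(2,1) show ?case by (induction g rule: MA_induct) (simp_all add: MA_add_simps)
qed (simp_all add: MA_add_simps)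

lemma mult_assoc_MA:
 assumes "f \<in> carrier MA" "g \<in> carrier MA" "h \<in> carrier MA"
 shows "f \<otimes>\<^bsub>MA\<^esub> g \<otimes>\<^bsub>MA\<^esub> h = f \<otimes>\<^bsub>MA\<^esub> (g \<otimes>\<^bsub>MA\<^esub> h)"
 using assms
proof (induction f rule: MA_induct)
 case (single m c)
 from single(2,1,3) show ?case
 proof (induction g rule: MA_induct)
  case (single n d)
  from single(3,1,2) show ?case
   by (induction h rule: MA_induct) (simp_all add: MA_add_simps m_assoc mult.assoc)
 qed (simp_all add: MA_add_simps)
qed (simp_all add: MA_add_simps)

lemma mult_one_MA:
 assumes "f \<in> carrier MA" shows "\<one>\<^bsub>MA\<^esub> \<otimes>\<^bsub>MA\<^esub> f = f" "f \<otimes>\<^bsub>MA\<^esub> \<one>\<^bsub>MA\<^esub> = f"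
 using assms by (induction f rule: MA_induct) (simp_all add: MA_add_simps one_MA)

lemma smult_mult_MA:
 assumes "f \<in> carrier MA" "g \<in> carrier MA"
 shows "(c \<odot>\<^bsub>MA\<^esub> f) \<otimes>\<^bsub>MA\<^esub> g = c \<odot>\<^bsub>MA\<^esub> (f \<otimes>\<^bsub>MA\<^esub> g)" "f \<otimes>\<^bsub>MA\<^esub> (c \<odot>\<^bsub>MA\<^esub> g) = c \<odot>\<^bsub>MA\<^esub> (f \<otimes>\<^bsub>MA\<^esub> g)"
proof -
 show "(c \<odot>\<^bsub>MA\<^esub> f) \<otimes>\<^bsub>MA\<^esub> g = c \<odot>\<^bsub>MA\<^esub> (f \<otimes>\<^bsub>MA\<^esub> g)"
  using assms
 proof (induction f rule: MA_induct)
  case (single m d)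
  from single(2,1) show ?case by (induction g rule: MA_induct) (simp_all add: MA_add_simps mult_ac)
 qed (simp_all add: MA_add_simps)
 show "f \<otimes>\<^bsub>MA\<^esub> (c \<odot>\<^bsub>MA\<^esub> g) = c \<odot>\<^bsub>MA\<^esub> (f \<otimes>\<^bsub>MA\<^esub> g)"
  using assms
 proof (induction f rule: MA_induct)
  case (single m d)
  from single(2,1) show ?case by (induction g rule: MA_induct) (simp_all add: MA_add_simps mult_ac)
 qed (simp_all add: MA_add_simps)
qed

lemma star_star_MA: "f \<in> carrier MA ==> star MA (star MA f) = f"
 by (induction f rule: MA_induct) (simp_all add: MA_add_simps)

lemma star_smult_MA: "f \<in> carrier MA ==> star MA (c \<odot>\<^bsub>MA\<^esub> f) = cnj c \<odot>\<^bsub>MA\<^esub> star MA f"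
 by (induction f rule: MA_induct) (simp_all add: MA_add_simps)

lemma star_mult_MA:
 assumes "f \<in> carrier MA" "g \<in> carrier MA"
 shows "star MA (f \<otimes>\<^bsub>MA\<^esub> g) = star MA g \<otimes>\<^bsub>MA\<^esub> star MA f"
 using assms
proof (induction f rule: MA_induct)
 case (single m c)
 from single(2,1) show ?case
  by (induction g rule: MA_induct) (simp_all add: MA_add_simps s_mult mult.commute)
qed (simp_all add: MA_add_simps)

lemma star_algebra_MA: "star_algebra MA"
 unfolding star_algebra_def
proof (intro conjI)
 have *: "\<exists>g\<in>carrier MA. g \<oplus>\<^bsub>MA\<^esub> f = \<zero>\<^bsub>MA\<^esub>" if f: "f \<in> carrier MA" for f
 proof (rule bexI[of _ "(- 1) \<odot>\<^bsub>MA\<^esub> f"])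
  show "(- 1) \<odot>\<^bsub>MA\<^esub> f \<oplus>\<^bsub>MA\<^esub> f = \<zero>\<^bsub>MA\<^esub>"
   by (rule poly_mapping_eqI) (simp add: lookup_add lookup_smult_MA)
 qed (use f in simp)
 have ab: "abelian_group MA"
  by (rule abelian_groupI) (use * in \<open>simp_all add: add_ac\<close>)
 have "Group.monoid MA"
  by (rule monoidI) (simp_all add: mult_assoc_MA mult_one_MA, simp add: one_MA)
 with ab show "ring MA"
  by (rule ringI) (simp_all add: MA_add_simps)
 show "Module.module complex_ring MA"
  by (rule moduleI[OF cring_complex_ring ab])
   (auto simp: complex_ring_def smult_add_MA lookup_smult_MA lookup_add algebra_simps intro!: poly_mapping_eqI)
qed (simp_all add: smult_mult_MA star_star_MA star_smult_MA star_add_MA star_mult_MA)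

sublocale MA: star_alg MA
 by unfold_locales (rule star_algebra_MA)

lemma lin_superset:
 assumes "star_alg D" "\<phi> \<in> carrier M \<rightarrow> carrier D" "finite K" "Poly_Mapping.keys f \<subseteq> K" "K \<subseteq> carrier M"
 shows "lin D \<phi> f = finsum D (\<lambda>m. Poly_Mapping.lookup f m \<odot>\<^bsub>D\<^esub> \<phi> m) K"
proof -
 interpret D: star_alg D by fact
 have "\<phi> m \<in> carrier D" if "m \<in> K" for m using that assms by auto
 then show ?thesis
  unfolding lin_def using assms
  by (intro D.add.finprod_mono_neutral_cong_left) (auto simp: in_keys_iff)
qed

context
 fixes D :: "('b, 'n) star_alg_scheme" and \<phi> :: "'m \<Rightarrow> 'b"
 assumes D: "star_alg D" and \<phi>: "\<phi> \<in> carrier M \<rightarrow> carrier D"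
begin

interpretation D: star_alg D by (rule D)

lemma lin_closed [simp]: "f \<in> carrier MA ==> lin D \<phi> f \<in> carrier D"
 unfolding lin_def using \<phi> by (intro D.finsum_closed) (auto simp: carrier_MA)

lemma lin_zero [simp]: "lin D \<phi> 0 = \<zero>\<^bsub>D\<^esub>"
 by (simp add: lin_def)

lemma lin_single [simp]: "m \<in> carrier M ==> lin D \<phi> (Poly_Mapping.single m c) = c \<odot>\<^bsub>D\<^esub> \<phi> m"
proof -
 assume m: "m \<in> carrier M"
 then have "\<phi> m \<in> carrier D" using \<phi> by auto
 then show ?thesis
  using lin_superset[OF D \<phi>, of "{m}" "Poly_Mapping.single m c"] m by simp
qed

lemma lin_add: assumes "f \<in> carrier MA" "g \<in> carrier MA"
 shows "lin D \<phi> (f + g) = lin D \<phi> f \<oplus>\<^bsub>D\<^esub> lin D \<phi> g"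
proof -
 let ?K = "Poly_Mapping.keys f \<union> Poly_Mapping.keys g"
 have K: "finite ?K" "Poly_Mapping.keys (f + g) \<subseteq> ?K" "?K \<subseteq> carrier M"
  using Poly_Mapping.keys_add[of f g] assms by (auto simp: carrier_MA)
 have c: "\<phi> m \<in> carrier D" if "m \<in> ?K" for m using that K(3) \<phi> by auto
 have "lin D \<phi> (f + g) = (\<Oplus>\<^bsub>D\<^esub>m\<in>?K. Poly_Mapping.lookup f m \<odot>\<^bsub>D\<^esub> \<phi> m \<oplus>\<^bsub>D\<^esub> Poly_Mapping.lookup g m \<odot>\<^bsub>D\<^esub> \<phi> m)"
  unfolding lin_superset[OF D \<phi> K] using c
  by (intro D.finsum_cong') (auto simp: lookup_add D.smult_l_distr)
 also have "\<dots> = lin D \<phi> f \<oplus>\<^bsub>D\<^esub> lin D \<phi> g"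
  unfolding lin_superset[OF D \<phi> K(1) Un_upper1 K(3)] lin_superset[OF D \<phi> K(1) Un_upper2 K(3)]
  using c by (intro D.finsum_addf) auto
 finally show ?thesis .
qed

lemma lin_smult: "f \<in> carrier MA ==> lin D \<phi> (c \<odot>\<^bsub>MA\<^esub> f) = c \<odot>\<^bsub>D\<^esub> lin D \<phi> f"
proof (induction f rule: MA_induct)
 case (single m d)
 then show ?case using funcset_mem[OF \<phi>] by (simp add: D.smult_assoc)
qed (simp_all add: smult_add_MA lin_add D.smult_r_distr)

lemma lin_star_map:
 assumes mult: "\<And>m n. m \<in> carrier M ==> n \<in> carrier M ==> \<phi> (m \<otimes> n) = \<phi> m \<otimes>\<^bsub>D\<^esub> \<phi> n"
  and star: "\<And>m. m \<in> carrier M ==> \<phi> (s m) = star D (\<phi> m)"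
 shows "lin D \<phi> \<in> star_map MA D"
proof (rule star_mapI)
 have \<phi>c: "\<phi> m \<in> carrier D" if "m \<in> carrier M" for m using that \<phi> by auto
 fix f assume f: "f \<in> carrier MA"
 then show "lin D \<phi> (star MA f) = star D (lin D \<phi> f)"
  by (induction f rule: MA_induct)
   (simp_all add: MA_add_simps lin_add D.star_add D.star_smult star \<phi>c)
 fix g assume g: "g \<in> carrier MA"
 from f g show "lin D \<phi> (f \<otimes>\<^bsub>MA\<^esub> g) = lin D \<phi> f \<otimes>\<^bsub>D\<^esub> lin D \<phi> g"
 proof (induction f rule: MA_induct)
  case (single m c)
  from single(2,1) show ?case
   by (induction g rule: MA_induct)
    (simp_all add: MA_add_simps lin_add D.r_distr mult \<phi>c D.smult_mult_left D.smult_mult_right D.smult_assoc mult.commute)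
 qed (simp_all add: MA_add_simps lin_add D.l_distr)
qed (simp_all add: lin_add lin_smult)

lemma lin_one: "\<phi> \<one> = \<one>\<^bsub>D\<^esub> ==> lin D \<phi> \<one>\<^bsub>MA\<^esub> = \<one>\<^bsub>D\<^esub>"
 by (simp add: one_MA)

lemma lin_eqI:
 assumes "h \<in> star_map MA D" "\<And>m. m \<in> carrier M ==> h (Poly_Mapping.single m 1) = \<phi> m" "f \<in> carrier MA"
 shows "h f = lin D \<phi> f"
 using assms(3)
proof (induction f rule: MA_induct)
 case zero
 show ?case using MA.star_map_zero[OF D assms(1)] by simp
next
 case (single m c)
 then show ?case using star_mapD(4)[OF assms(1), of "Poly_Mapping.single m 1" c] assms(2) by simp
next
 case (add f g)
 then show ?case using star_mapD(2)[OF assms(1), of f g] by (simp add: lin_add)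
qed

end

end

section \<open>Completions of monoid algebras\<close>

locale star_monoid_semi = star_monoid M s for M :: "('m, 'z) monoid_scheme" (structure) and s +
 fixes p :: "('m \<Rightarrow>\<^sub>0 complex) \<Rightarrow> real"
 assumes cstar_seminorm_p: "cstar_seminorm (monoid_star_alg M s) p"
begin

sublocale MA: cstar_semi MA p
 by unfold_locales (rule cstar_seminorm_p)

abbreviation MC where "MC \<equiv> cstar_completion MA p"

sublocale MC: cstar_alg MC
 by (rule MA.cstar_alg_C)

definition elem :: "'m \<Rightarrow> (nat \<Rightarrow> ('m \<Rightarrow>\<^sub>0 complex)) set" where
 "elem m = to_completion MA p (Poly_Mapping.single m 1)"

lemmas to_MC = MA.to_completion_star_hom
lemmas to_MC_map = star_homD(1)[OF to_MC]

lemma elem_closed [simp]: "m \<in> carrier M ==> elem m \<in> carrier MC"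
 unfolding elem_def by (rule star_mapD[OF to_MC_map]) simp

lemma elem_mult: "m \<in> carrier M ==> n \<in> carrier M ==> elem (m \<otimes> n) = elem m \<otimes>\<^bsub>MC\<^esub> elem n"
 using star_mapD(3)[OF to_MC_map, of "Poly_Mapping.single m 1" "Poly_Mapping.single n 1"]
 by (simp add: elem_def)

lemma elem_star: "m \<in> carrier M ==> elem (s m) = star MC (elem m)"
 using star_mapD(5)[OF to_MC_map, of "Poly_Mapping.single m 1"] by (simp add: elem_def)

lemma elem_one: "elem \<one> = \<one>\<^bsub>MC\<^esub>"
 using star_homD(2)[OF to_MC] by (simp add: elem_def one_MA)

lemma to_MC_lin: "f \<in> carrier MA ==> to_completion MA p f = lin MC elem f"
 by (rule lin_eqI[OF MC.star_alg_axioms _ to_MC_map]) (auto simp: elem_def intro!: star_mapD[OF to_MC_map])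

lemma MC_lin_map_eqI:
 assumes B: "cstar_alg B" and f: "f \<in> lin_map MC B" and g: "g \<in> lin_map MC B"
  and eq: "\<And>m. m \<in> carrier M ==> f (elem m) = g (elem m)" and x: "x \<in> carrier MC"
 shows "f x = g x"
proof (rule MC.lin_map_eqI[OF B f g MA.to_completion_dense _ x])
 interpret B: cstar_alg B by fact
 note T = star_mapD[OF to_MC_map]
 have f_add: "f (x \<oplus>\<^bsub>MC\<^esub> y) = f x \<oplus>\<^bsub>B\<^esub> f y" and g_add: "g (x \<oplus>\<^bsub>MC\<^esub> y) = g x \<oplus>\<^bsub>B\<^esub> g y"
  and f_smult: "f (c \<odot>\<^bsub>MC\<^esub> x) = c \<odot>\<^bsub>B\<^esub> f x" and g_smult: "g (c \<odot>\<^bsub>MC\<^esub> x) = c \<odot>\<^bsub>B\<^esub> g x"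
  and fg: "f x \<in> carrier B" "g x \<in> carrier B"
  if "x \<in> carrier MC" "y \<in> carrier MC" for x y c
  using f g that by (auto simp: lin_map_def)
 fix d assume "d \<in> to_completion MA p ` carrier MA"
 then obtain a where a: "a \<in> carrier MA" and d: "d = to_completion MA p a" by blast
 from a have "f (to_completion MA p a) = g (to_completion MA p a)"
 proof (induction a rule: MA_induct)
  case zero
  have "to_completion MA p 0 = \<zero>\<^bsub>MC\<^esub>" using MA.star_map_zero[OF MC.star_alg_axioms to_MC_map] by simp
  moreover have "f (0 \<odot>\<^bsub>MC\<^esub> \<zero>\<^bsub>MC\<^esub>) = g (0 \<odot>\<^bsub>MC\<^esub> \<zero>\<^bsub>MC\<^esub>)"
   unfolding f_smult[OF MC.zero_closed MC.zero_closed] g_smult[OF MC.zero_closed MC.zero_closed]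
   using fg[OF MC.zero_closed MC.zero_closed] by simp
  ultimately show ?case by simp
 next
  case (single m c)
  have "to_completion MA p (Poly_Mapping.single m c) = c \<odot>\<^bsub>MC\<^esub> elem m"
   using T(4)[of "Poly_Mapping.single m 1" c] single by (simp add: elem_def)
  then show ?case
   using f_smult[OF elem_closed elem_closed] g_smult[OF elem_closed elem_closed] eq single by simp
 next
  case (add a b)
  have "to_completion MA p (a + b) = to_completion MA p a \<oplus>\<^bsub>MC\<^esub> to_completion MA p b"
   using T(2)[of a b] add by simp
  then show ?case using f_add g_add T(1) add by simp
 qed
 then show "f d = g d" by (simp add: d)
qed

text \<open>Multiplicativity and compatibility with the involution are checked on the monoid; the
  only analytic condition is the domination \<open>le\<close> by the seminorm of the
  completion.\<close>

lemma MC_lift: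
 assumes B: "cstar_alg B" and \<phi>: "\<phi> \<in> carrier M \<rightarrow> carrier B"
  and mult: "\<And>m n. m \<in> carrier M ==> n \<in> carrier M ==> \<phi> (m \<otimes> n) = \<phi> m \<otimes>\<^bsub>B\<^esub> \<phi> n"
  and star: "\<And>m. m \<in> carrier M ==> \<phi> (s m) = star B (\<phi> m)"
  and le: "\<And>f. f \<in> carrier MA ==> cnorm B (lin B \<phi> f) \<le> p f"
 obtains h where "h \<in> star_map MC B" "\<And>m. m \<in> carrier M ==> h (elem m) = \<phi> m"
  "\<And>f. f \<in> carrier MA ==> h (to_completion MA p f) = lin B \<phi> f"
proof -
 interpret B: cstar_alg B by fact
 obtain h where h: "h \<in> star_map MC B" "\<And>f. f \<in> carrier MA ==> h (to_completion MA p f) = lin B \<phi> f"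
  using MC.star_map_extension[OF MA.star_alg_axioms to_MC_map MA.to_completion_dense B
    lin_star_map[OF B.star_alg_axioms \<phi> mult star]] le by (auto simp: MA.cnorm_to_completion)
 moreover have "h (elem m) = \<phi> m" if "m \<in> carrier M" for m
  using h(2)[of "Poly_Mapping.single m 1"] that funcset_mem[OF \<phi> that]
  by (simp add: elem_def lin_single[OF B.star_alg_axioms \<phi>])
 ultimately show thesis using that by blast
qed

lemma MC_lin_dense: "norm_dense MC (lin MC elem ` carrier MA)"
proof -
 have "lin MC elem ` carrier MA = to_completion MA p ` carrier MA"
  by (intro image_cong) (simp_all add: to_MC_lin)
 then show ?thesis using MA.to_completion_dense by simp
qed

end

text \<open>The universal and the spatial seminorm are both of this form. Pointwise boundedness
  makes the real supremum genuine, and the C*-identity survives because squaring and square roots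
  are monotone on nonnegative reals.\<close>

lemma (in star_alg) cstar_seminorm_Sup:
 assumes ne: "P \<noteq> {}" and P: "\<And>q. q \<in> P ==> cstar_seminorm A q"
  and bdd: "\<And>x. x \<in> carrier A ==> \<exists>K. \<forall>q\<in>P. q x \<le> K"
 shows "cstar_seminorm A (\<lambda>x. SUP q\<in>P. q x)"
proof -
 let ?S = "\<lambda>x. SUP q\<in>P. q x"
 have semi: "cstar_semi A q" if "q \<in> P" for q using P[OF that] by unfold_locales
 have upper: "q x \<le> ?S x" if "q \<in> P" "x \<in> carrier A" for q x
 proof -
  obtain K where "\<forall>q\<in>P. q x \<le> K" using bdd[OF \<open>x \<in> carrier A\<close>] ..
  then have "bdd_above ((\<lambda>q. q x) ` P)" by (intro bdd_aboveI2[of P "\<lambda>q. q x" K]) simp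
  then show ?thesis by (rule cSUP_upper[OF \<open>q \<in> P\<close>])
 qed
 have least: "?S x \<le> K" if "\<And>q. q \<in> P ==> q x \<le> K" for x K
  using that by (intro cSUP_least[OF ne]) auto
 obtain q0 where q0: "q0 \<in> P" using ne by blast
 have nonneg: "0 \<le> ?S x" if "x \<in> carrier A" for x
  using cstar_semi.p_nonneg[OF semi[OF q0] that] upper[OF q0 that] by linarith
 have smult_le: "?S (c \<odot> x) \<le> cmod c * ?S x" if "x \<in> carrier A" for c x
 proof (rule least)
  fix q assume q: "q \<in> P"
  show "q (c \<odot> x) \<le> cmod c * ?S x"
   unfolding cstar_semi.p_smult[OF semi[OF q] that] using upper[OF q that] by (intro mult_left_mono) auto
 qed
 show ?thesis
  unfolding cstar_seminorm_def
 proof (intro conjI ballI allI)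
  fix x assume x: "x \<in> carrier A"
  show "0 \<le> ?S x" by (rule nonneg[OF x])
  show "?S (star A x \<otimes> x) = (?S x)\<^sup>2"
  proof (rule antisym)
   show "?S (star A x \<otimes> x) \<le> (?S x)\<^sup>2"
   proof (rule least)
    fix q assume q: "q \<in> P"
    show "q (star A x \<otimes> x) \<le> (?S x)\<^sup>2"
     unfolding cstar_semi.p_cstar[OF semi[OF q] x]
     using upper[OF q x] cstar_semi.p_nonneg[OF semi[OF q] x] by (intro power_mono) auto
   qed
   have "?S x \<le> sqrt (?S (star A x \<otimes> x))"
   proof (rule least)
    fix q assume q: "q \<in> P"
    have "(q x)\<^sup>2 \<le> ?S (star A x \<otimes> x)"
     using upper[OF q, of "star A x \<otimes> x"] x by (simp add: cstar_semi.p_cstar[OF semi[OF q] x])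
    then show "q x \<le> sqrt (?S (star A x \<otimes> x))" by (rule real_le_rsqrt)
   qed
   then have "(?S x)\<^sup>2 \<le> (sqrt (?S (star A x \<otimes> x)))\<^sup>2" using nonneg[OF x] by (intro power_mono) auto
   then show "(?S x)\<^sup>2 \<le> ?S (star A x \<otimes> x)" using nonneg[of "star A x \<otimes> x"] x by simp
  qed
  show "?S (c \<odot> x) = cmod c * ?S x" for c
  proof (cases "c = 0")
   case True
   then have "?S (c \<odot> x) = (SUP q\<in>P. 0)"
    using x by (intro SUP_cong refl) (simp add: cstar_semi.p_zero[OF semi])
   then show ?thesis using True ne by simp
  next
   case False
   \<comment> \<open>The reverse inequality comes from scaling back by the inverse of
     \<open>c\<close>.\<close>
   have "?S (inverse c \<odot> (c \<odot> x)) \<le> cmod (inverse c) * ?S (c \<odot> x)"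
    using x by (intro smult_le) auto
   then have "?S x \<le> inverse (cmod c) * ?S (c \<odot> x)"
    using x False by (simp add: smult_assoc norm_inverse)
   then have "cmod c * ?S x \<le> cmod c * (inverse (cmod c) * ?S (c \<odot> x))"
    by (intro mult_left_mono) auto
   also have "\<dots> = ?S (c \<odot> x)" using False by simp
   finally show ?thesis using smult_le[OF x, of c] by simp
  qed
  fix y assume y: "y \<in> carrier A"
  show "?S (x \<oplus> y) \<le> ?S x + ?S y"
  proof (rule least)
   fix q assume q: "q \<in> P"
   show "q (x \<oplus> y) \<le> ?S x + ?S y"
    using cstar_semi.p_add[OF semi[OF q] x y] upper[OF q x] upper[OF q y] by linarith
  qed
  show "?S (x \<otimes> y) \<le> ?S x * ?S y"
  proof (rule least)
   fix q assume q: "q \<in> P"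
   have "q (x \<otimes> y) \<le> q x * q y" by (rule cstar_semi.p_mult[OF semi[OF q] x y])
   also have "\<dots> \<le> ?S x * ?S y"
    using upper[OF q] x y nonneg cstar_semi.p_nonneg[OF semi[OF q]] by (intro mult_mono) auto
   finally show "q (x \<otimes> y) \<le> ?S x * ?S y" .
  qed
 qed
qed

section \<open>Free algebras and the universal property\<close>

lemma word_star_append: "word_star (u @ v) = word_star v @ word_star u"
 by (simp add: word_star_def)

lemma word_star_word_star: "word_star (word_star w) = w"
 by (induction w) (auto simp: word_star_def rev_map)

definition word_value :: "('a, 'm) star_alg_scheme \<Rightarrow> ('g \<Rightarrow> 'a) \<Rightarrow> ('g \<times> bool) list \<Rightarrow> 'a" where
 "word_value B b w = foldr (\<lambda>(g, c) y. (if c then star B (b g) else b g) \<otimes>\<^bsub>B\<^esub> y) w \<one>\<^bsub>B\<^esub>"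

text \<open>The condition \<open>gen_bound\<close> keeps the supremum in
  \<open>universal_seminorm\<close> finite, first on words and then on all polynomials. For graphs
  it holds because the generators are projections modulo the relations.\<close>

locale universal =
 fixes E :: "'g set" and R :: "('g star_poly \<times> 'g star_poly) set"
 assumes R_carrier: "R \<subseteq> carrier (free_star_alg E) \<times> carrier (free_star_alg E)"
  and gen_bound: "\<And>q g. \<lbrakk>cstar_seminorm (free_star_alg E) q;
   \<And>u v. (u, v) \<in> R ==> q (u \<ominus>\<^bsub>free_star_alg E\<^esub> v) = 0; g \<in> E\<rbrakk> \<Longrightarrow> q (free_gen g) \<le> 1"
begin

abbreviation WM where "WM \<equiv> \<lparr>carrier = lists (E \<times> (UNIV :: bool set)), monoid.mult = (@), one = []\<rparr>"

sublocale W: star_monoid WM word_star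
proof -
 interpret Group.monoid WM by unfold_locales auto
 show "star_monoid WM word_star"
  by unfold_locales (auto simp: word_star_append word_star_word_star, auto simp: word_star_def)
qed

lemma free_star_alg_eq: "free_star_alg E = W.MA"
 by (simp add: free_star_alg_def)

definition admissible :: "('g star_poly \<Rightarrow> real) set" where
 "admissible = {q. cstar_seminorm (free_star_alg E) q \<and> (\<forall>(u, v)\<in>R. q (u \<ominus>\<^bsub>free_star_alg E\<^esub> v) = 0)}"

lemma universal_seminorm_eq: "universal_seminorm E R = (\<lambda>x. SUP q\<in>admissible. q x)"
 by (simp add: universal_seminorm_def admissible_def fun_eq_iff setcompr_eq_image)

text \<open>Shows that the supremum defining the universal seminorm ranges over a nonempty
  set.\<close>

lemma zero_admissible: "(\<lambda>_. 0) \<in> admissible"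
 by (auto simp: admissible_def cstar_seminorm_def)

lemma admissible_word:
 assumes q: "q \<in> admissible" and w: "w \<in> lists (E \<times> UNIV)"
 shows "q (Poly_Mapping.single w 1) \<le> 1"
proof -
 interpret Q: cstar_semi W.MA q
  using q by unfold_locales (simp add: admissible_def free_star_alg_eq)
 have gen: "q (free_gen g) \<le> 1" if "g \<in> E" for g
  using q that by (intro gen_bound) (auto simp: admissible_def)
 have letter: "q (Poly_Mapping.single [(g, c)] 1) \<le> 1" if "g \<in> E" for g c
 proof (cases c)
  case True
  have gc: "free_gen g \<in> carrier W.MA"
   unfolding free_gen_def by (rule W.single_carrier_MA) (use that in simp)
  have "Poly_Mapping.single [(g, c)] 1 = star W.MA (free_gen g)"
   using True by (simp add: free_gen_def word_star_def)
  then show ?thesis using gen[OF that] Q.p_star[OF gc] by (simp only:)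
 qed (use gen[OF that] in \<open>simp add: free_gen_def\<close>)
 show ?thesis using w
 proof (induction w)
  case Nil
  show ?case using Q.p_one_le by (simp add: W.one_MA)
 next
  case (Cons x w)
  obtain g c where x: "x = (g, c)" "g \<in> E" using Cons by (cases x) auto
  have c: "Poly_Mapping.single [x] 1 \<in> carrier W.MA" "Poly_Mapping.single w 1 \<in> carrier W.MA"
   using Cons x by (auto intro!: W.single_carrier_MA)
  have "q (Poly_Mapping.single (x # w) 1) = q (Poly_Mapping.single [x] 1 \<otimes>\<^bsub>W.MA\<^esub> Poly_Mapping.single w 1)"
   by simp
  also have "\<dots> \<le> q (Poly_Mapping.single [x] 1) * q (Poly_Mapping.single w 1)"
   by (rule Q.p_mult[OF c])
  also have "\<dots> \<le> 1 * 1" using letter[OF x(2), of c] x Cons c by (intro mult_mono) auto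
  finally show ?case by simp
 qed
qed

lemma admissible_bounded: assumes "f \<in> carrier W.MA" shows "\<exists>K. \<forall>q\<in>admissible. q f \<le> K"
 using assms
proof (induction f rule: W.MA_induct)
 case zero
 have "q 0 \<le> 0" if "q \<in> admissible" for q
 proof -
  interpret Q: cstar_semi W.MA q
   using that by unfold_locales (simp add: admissible_def free_star_alg_eq)
  show ?thesis using Q.p_zero by simp
 qed
 then show ?case by blast
next
 case (single m c)
 have "q (Poly_Mapping.single m c) \<le> cmod c" if q: "q \<in> admissible" for q
 proof -
  interpret Q: cstar_semi W.MA q
   using that by unfold_locales (simp add: admissible_def free_star_alg_eq)
  have "q (c \<odot>\<^bsub>W.MA\<^esub> Poly_Mapping.single m 1) = cmod c * q (Poly_Mapping.single m 1)"
   by (rule Q.p_smult, rule W.single_carrier_MA) (use single in simp)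
  also have "\<dots> \<le> cmod c * 1" using admissible_word[OF q, of m] single by (intro mult_left_mono) auto
  finally show ?thesis by simp
 qed
 then show ?case by blast
next
 case (add f g)
 then obtain K L where KL: "\<And>q. q \<in> admissible ==> q f \<le> K" "\<And>q. q \<in> admissible ==> q g \<le> L" by blast
 have "q (f + g) \<le> K + L" if q: "q \<in> admissible" for q
 proof -
  interpret Q: cstar_semi W.MA q
   using that by unfold_locales (simp add: admissible_def free_star_alg_eq)
  show ?thesis using Q.p_add[of f g] KL[OF q] add by simp
 qed
 then show ?case by blast
qed

sublocale U: star_monoid_semi WM word_star "universal_seminorm E R"
proof unfold_locales
 show "cstar_seminorm W.MA (universal_seminorm E R)"
  unfolding universal_seminorm_eq
  by (rule W.MA.cstar_seminorm_Sup)
   (use zero_admissible admissible_bounded in \<open>auto simp: admissible_def free_star_alg_eq\<close>)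
qed

lemma universal_cstar_eq: "universal_cstar E R = U.MC"
 by (simp add: universal_cstar_def free_star_alg_eq)

lemma cstar_alg_universal: "cstar_alg (universal_cstar E R)"
 unfolding universal_cstar_eq by (rule U.MC.cstar_alg_axioms)

lemma admissible_le: "q \<in> admissible ==> f \<in> carrier W.MA ==> q f \<le> universal_seminorm E R f"
proof -
 assume q: "q \<in> admissible" and f: "f \<in> carrier W.MA"
 obtain K where "\<forall>q\<in>admissible. q f \<le> K" using admissible_bounded[OF f] ..
 then have "bdd_above ((\<lambda>q. q f) ` admissible)" by (intro bdd_aboveI2[of admissible "\<lambda>q. q f" K]) simp
 then show ?thesis unfolding universal_seminorm_eq by (rule cSUP_upper[OF q])
qed

definition to_univ :: "'g star_poly \<Rightarrow> 'g univ_elem" where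
 "to_univ = to_completion (free_star_alg E) (universal_seminorm E R)"

lemma to_univ_star_hom: "to_univ \<in> star_hom (free_star_alg E) (universal_cstar E R)"
 unfolding to_univ_def universal_cstar_eq free_star_alg_eq by (rule U.to_MC)

lemma to_univ_dense: "norm_dense (universal_cstar E R) (to_univ ` carrier (free_star_alg E))"
 unfolding to_univ_def universal_cstar_eq free_star_alg_eq by (rule U.MA.to_completion_dense)

lemma cnorm_to_univ:
 "f \<in> carrier (free_star_alg E) ==> cnorm (universal_cstar E R) (to_univ f) = universal_seminorm E R f"
 unfolding to_univ_def universal_cstar_eq free_star_alg_eq by (rule U.MA.cnorm_to_completion)

lemma free_gen_closed [simp]: "g \<in> E ==> free_gen g \<in> carrier (free_star_alg E)"
 unfolding free_star_alg_eq free_gen_def by (rule W.single_carrier_MA) simp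

lemma to_univ_gen: "to_univ (free_gen g) = universal_gen E R g"
 by (simp add: to_univ_def universal_gen_def)

lemma to_univ_relation: assumes "(u, v) \<in> R" shows "to_univ u = to_univ v"
proof -
 interpret C: cstar_alg "universal_cstar E R" by (rule cstar_alg_universal)
 have uv: "u \<in> carrier W.MA" "v \<in> carrier W.MA" using R_carrier assms by (auto simp: free_star_alg_eq)
 have "universal_seminorm E R (u \<ominus>\<^bsub>W.MA\<^esub> v) = (SUP q\<in>admissible. 0)"
  unfolding universal_seminorm_eq using assms
  by (intro SUP_cong refl) (auto simp: admissible_def free_star_alg_eq)
 also have "\<dots> = 0" using zero_admissible by (intro cSUP_const) auto
 finally have "cnorm (universal_cstar E R) (to_univ u \<ominus>\<^bsub>universal_cstar E R\<^esub> to_univ v) = 0"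
  using W.MA.star_map_diff[OF C.star_alg_axioms star_homD(1)[OF to_univ_star_hom[unfolded free_star_alg_eq]] uv]
   cnorm_to_univ[of "u \<ominus>\<^bsub>W.MA\<^esub> v"] uv by (simp add: free_star_alg_eq)
 then show ?thesis
  using uv star_mapD(1)[OF star_homD(1)[OF to_univ_star_hom]]
  by (intro C.cnorm_diff_eq_0D) (auto simp: free_star_alg_eq)
qed

lemma free_lift:
 assumes B: "star_alg B" and b: "\<And>g. g \<in> E ==> b g \<in> carrier B"
 obtains e where "e \<in> star_hom (free_star_alg E) B" "\<And>g. g \<in> E ==> e (free_gen g) = b g"
proof
 interpret B: star_alg B by fact
 have letter: "(if c then star B (b g) else b g) \<in> carrier B" if "g \<in> E" for g c using b that by auto
 have wc: "word_value B b w \<in> carrier B" if "w \<in> lists (E \<times> UNIV)" for w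
  using that by (induction w) (auto simp: word_value_def b)
 have app: "word_value B b (u @ v) = word_value B b u \<otimes>\<^bsub>B\<^esub> word_value B b v"
  if "u \<in> lists (E \<times> UNIV)" "v \<in> lists (E \<times> UNIV)" for u v
  using that
 proof (induction u)
  case (Cons x u)
  obtain g c where x: "x = (g, c)" "g \<in> E" using Cons by (cases x) auto
  then show ?case using Cons wc b by (auto simp: word_value_def B.m_assoc)
 qed (use wc in \<open>auto simp: word_value_def\<close>)
 have st: "word_value B b (word_star w) = star B (word_value B b w)" if "w \<in> lists (E \<times> UNIV)" for w
  using that
 proof (induction w)
  case (Cons x w)
  obtain g c where x: "x = (g, c)" "g \<in> E" using Cons by (cases x) auto
  have ws: "word_star w \<in> lists (E \<times> UNIV)" using W.s_closed[of w] Cons by simp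
  have "word_star (x # w) = word_star w @ [(g, \<not> c)]" by (simp add: word_star_def x)
  then have "word_value B b (word_star (x # w)) = star B (word_value B b w) \<otimes>\<^bsub>B\<^esub> word_value B b [(g, \<not> c)]"
   using app[OF ws, of "[(g, \<not> c)]"] Cons x by simp
  also have "\<dots> = star B (word_value B b (x # w))"
   using x Cons wc b by (auto simp: word_value_def B.star_mult)
  finally show ?case .
 qed (simp add: word_value_def word_star_def)
 have \<phi>: "word_value B b \<in> carrier WM \<rightarrow> carrier B" using wc by auto
 show "lin B (word_value B b) \<in> star_hom (free_star_alg E) B"
  unfolding free_star_alg_eq
  by (intro star_homI W.lin_star_map[OF B \<phi>] W.lin_one[OF B \<phi>]) (use app st in \<open>auto simp: word_value_def\<close>)
 show "lin B (word_value B b) (free_gen g) = b g" if "g \<in> E" for g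
  using W.lin_single[OF B \<phi>, of "[(g, False)]" 1] that b by (simp add: free_gen_def word_value_def)
qed

lemma free_map_eqI:
 assumes B: "star_alg B" and f: "f \<in> star_hom (free_star_alg E) B" and h: "h \<in> star_hom (free_star_alg E) B"
  and eq: "\<And>g. g \<in> E ==> f (free_gen g) = h (free_gen g)" and x: "x \<in> carrier (free_star_alg E)"
 shows "f x = h x"
proof -
 interpret B: star_alg B by fact
 note fm = star_homD(1)[OF f, unfolded free_star_alg_eq] and hm = star_homD(1)[OF h, unfolded free_star_alg_eq]
 have word: "f (Poly_Mapping.single w 1) = h (Poly_Mapping.single w 1)" if "w \<in> lists (E \<times> UNIV)" for w
  using that
 proof (induction w)
  case Nil
  show ?case using star_homD(2)[OF f] star_homD(2)[OF h] by (simp add: free_star_alg_eq W.one_MA)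
 next
  case (Cons x w)
  obtain g c where x: "x = (g, c)" "g \<in> E" using Cons by (cases x) auto
  have gc: "free_gen g \<in> carrier W.MA" using free_gen_closed[OF x(2)] by (simp add: free_star_alg_eq)
  have letter: "f (Poly_Mapping.single [x] 1) = h (Poly_Mapping.single [x] 1)"
  proof (cases c)
   case True
   then have "Poly_Mapping.single [x] 1 = star W.MA (free_gen g)"
    by (simp add: free_gen_def word_star_def x)
   then show ?thesis using star_mapD(5)[OF fm gc] star_mapD(5)[OF hm gc] eq[OF x(2)] by simp
  qed (use eq[OF x(2)] x in \<open>simp add: free_gen_def\<close>)
  have c: "Poly_Mapping.single [x] 1 \<in> carrier W.MA" "Poly_Mapping.single w 1 \<in> carrier W.MA"
   using Cons x by (auto intro!: W.single_carrier_MA)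
  show ?case
   using star_mapD(3)[OF fm c] star_mapD(3)[OF hm c] letter Cons by simp
 qed
 have xc: "x \<in> carrier W.MA" using x by (simp add: free_star_alg_eq)
 define \<phi> where "\<phi> w = f (Poly_Mapping.single w 1)" for w
 have \<phi>: "\<phi> \<in> carrier WM \<rightarrow> carrier B"
 proof (rule funcsetI)
  fix w assume "w \<in> carrier WM"
  then have "Poly_Mapping.single w 1 \<in> carrier W.MA" using W.single_carrier_MA[of w 1] by simp
  then show "\<phi> w \<in> carrier B" unfolding \<phi>_def by (rule star_mapD(1)[OF fm])
 qed
 have "f x = lin B \<phi> x" by (rule W.lin_eqI[OF B \<phi> fm _ xc]) (simp add: \<phi>_def)
 moreover have "h x = lin B \<phi> x" by (rule W.lin_eqI[OF B \<phi> hm _ xc]) (simp add: \<phi>_def word)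
 ultimately show ?thesis by simp
qed

text \<open>The norm of \<open>B\<close> pulled back along \<open>e\<close> is an admissible
  seminorm, hence lies below the universal one. This is the bound required for extension from the
  dense image of the free algebra.\<close>

theorem universal_lift:
 assumes B: "cstar_alg B" and e: "e \<in> star_hom (free_star_alg E) B"
  and rel: "\<And>u v. (u, v) \<in> R ==> e u = e v"
 obtains h where "h \<in> star_hom (universal_cstar E R) B"
  "\<And>f. f \<in> carrier (free_star_alg E) ==> h (to_univ f) = e f"
proof -
 interpret B: cstar_alg B by fact
 note em = star_homD(1)[OF e]
 interpret C: cstar_alg "universal_cstar E R" by (rule cstar_alg_universal)
 interpret F: star_alg "free_star_alg E" unfolding free_star_alg_eq by (rule W.MA.star_alg_axioms)
 have "(\<lambda>x. cnorm B (e x)) \<in> admissible"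
  unfolding admissible_def
 proof (intro CollectI conjI ballI, goal_cases)
  case 1
  show ?case by (rule B.pullback_seminorm[OF F.star_alg_axioms em])
 next
  case (2 r)
  obtain u v where r: "r = (u, v)" by (cases r)
  then have uv: "u \<in> carrier (free_star_alg E)" "v \<in> carrier (free_star_alg E)"
   using R_carrier 2 by auto
  have "e (u \<ominus>\<^bsub>free_star_alg E\<^esub> v) = \<zero>\<^bsub>B\<^esub>"
   using F.star_map_diff[OF B.star_alg_axioms em uv] rel[of u v] 2 r star_mapD(1)[OF em uv(2)] by simp
  then show ?case by (simp add: r)
 qed
 then have le: "cnorm B (e x) \<le> cnorm (universal_cstar E R) (to_univ x)" if "x \<in> carrier (free_star_alg E)" for x
  using admissible_le that by (simp add: cnorm_to_univ free_star_alg_eq)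
 obtain h where h: "h \<in> star_map (universal_cstar E R) B"
  "\<And>f. f \<in> carrier (free_star_alg E) ==> h (to_univ f) = e f"
  using C.star_map_extension[OF F.star_alg_axioms star_homD(1)[OF to_univ_star_hom] to_univ_dense B em le] by blast
 have "h \<one>\<^bsub>universal_cstar E R\<^esub> = \<one>\<^bsub>B\<^esub>"
  using h(2)[of "\<one>\<^bsub>free_star_alg E\<^esub>"] star_homD(2)[OF e] star_homD(2)[OF to_univ_star_hom] by simp
 with h show thesis by (intro that star_homI)
qed

lemma universal_eqI:
 assumes B: "cstar_alg B" and f: "f \<in> star_hom (universal_cstar E R) B" and h: "h \<in> star_hom (universal_cstar E R) B"
  and eq: "\<And>g. g \<in> E ==> f (universal_gen E R g) = h (universal_gen E R g)"
  and x: "x \<in> carrier (universal_cstar E R)"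
 shows "f x = h x"
proof -
 interpret B: cstar_alg B by fact
 interpret C: cstar_alg "universal_cstar E R" by (rule cstar_alg_universal)
 show ?thesis
 proof (rule C.lin_map_eqI[OF B C.star_map_lin_map[OF B star_homD(1)[OF f]]
    C.star_map_lin_map[OF B star_homD(1)[OF h]] to_univ_dense _ x])
  fix d assume "d \<in> to_univ ` carrier (free_star_alg E)"
  then obtain a where a: "a \<in> carrier (free_star_alg E)" "d = to_univ a" by blast
  have "f (to_univ a) = h (to_univ a)"
   by (rule free_map_eqI[OF B.star_alg_axioms star_hom_comp[OF to_univ_star_hom f]
      star_hom_comp[OF to_univ_star_hom h] _ a(1)]) (simp add: to_univ_gen eq)
  then show "f d = h d" by (simp add: a)
 qed
qed

end

section \<open>Operators on \<open>\<ell>\<^sup>2\<close>\<close>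

text \<open>Square-summability is tested on finite sets of coordinates, where the Minkowski and
  Cauchy-Schwarz inequalities for \<open>L2_set\<close> apply; the infinite versions are suprema of
  these.\<close>

abbreviation fin_norm :: "('h \<Rightarrow> complex) \<Rightarrow> 'h set \<Rightarrow> real" where
 "fin_norm f F \<equiv> L2_set (\<lambda>h. cmod (f h)) F"

lemma ell2I:
 assumes "K \<ge> 0" "\<And>F. finite F ==> fin_norm f F \<le> K"
 shows "f \<in> ell2" "ell2_norm f \<le> K"
proof -
 have le: "(\<Sum>h\<in>F. (cmod (f h))\<^sup>2) \<le> K\<^sup>2" if "finite F" for F
 proof -
  have "sqrt (\<Sum>h\<in>F. (cmod (f h))\<^sup>2) \<le> K" using assms(2)[OF that] by (simp add: L2_set_def)
  then show ?thesis by (rule sqrt_le_D)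
 qed
 have "(\<lambda>h. (cmod (f h))\<^sup>2) summable_on UNIV"
  by (rule nonneg_bdd_above_summable_on) (use le in \<open>auto intro!: bdd_aboveI[of _ "K\<^sup>2"]\<close>)
 then show "f \<in> ell2" by (simp add: ell2_def)
 have "(\<Sum>\<^sub>\<infinity>h. (cmod (f h))\<^sup>2) \<le> K\<^sup>2"
  by (rule infsum_le_finite_sums[OF \<open>_ summable_on UNIV\<close>]) (rule le)
 then show "ell2_norm f \<le> K" unfolding ell2_norm_def using assms(1) by (rule real_le_lsqrt[rotated])
qed

lemma fin_norm_le: assumes "f \<in> ell2" "finite F" shows "fin_norm f F \<le> ell2_norm f"
 unfolding ell2_norm_def L2_set_def
 using assms by (intro real_sqrt_le_mono finite_sum_le_infsum) (auto simp: ell2_def)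

lemma ell2_norm_nonneg [simp]: "0 \<le> ell2_norm f"
 by (simp add: ell2_norm_def infsum_nonneg)

lemma ell2_norm_sq: "(ell2_norm f)\<^sup>2 = (\<Sum>\<^sub>\<infinity>h. (cmod (f h))\<^sup>2)"
 by (simp add: ell2_norm_def infsum_nonneg)

lemma cmod_le_ell2_norm: "f \<in> ell2 ==> cmod (f h) \<le> ell2_norm f"
 using fin_norm_le[of f "{h}"] by simp

lemma ell2_add:
 assumes "f \<in> ell2" "g \<in> ell2"
 shows "(\<lambda>h. f h + g h) \<in> ell2" "ell2_norm (\<lambda>h. f h + g h) \<le> ell2_norm f + ell2_norm g"
proof -
 have "fin_norm (\<lambda>h. f h + g h) F \<le> ell2_norm f + ell2_norm g" if F: "finite F" for F
 proof -
  have "fin_norm (\<lambda>h. f h + g h) F \<le> L2_set (\<lambda>h. cmod (f h) + cmod (g h)) F"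
   by (intro L2_set_mono norm_triangle_ineq) simp
  also have "\<dots> \<le> fin_norm f F + fin_norm g F" by (rule L2_set_triangle_ineq)
  finally show ?thesis using fin_norm_le[OF assms(1) F] fin_norm_le[OF assms(2) F] by linarith
 qed
 from ell2I[OF _ this] show "(\<lambda>h. f h + g h) \<in> ell2"
  "ell2_norm (\<lambda>h. f h + g h) \<le> ell2_norm f + ell2_norm g" by simp_all
qed

lemma ell2_smult_le:
 assumes "f \<in> ell2"
 shows "(\<lambda>h. c * f h) \<in> ell2" "ell2_norm (\<lambda>h. c * f h) \<le> cmod c * ell2_norm f"
proof -
 have "fin_norm (\<lambda>h. c * f h) F \<le> cmod c * ell2_norm f" if F: "finite F" for F
 proof -
  have "fin_norm (\<lambda>h. c * f h) F = cmod c * fin_norm f F"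
   by (simp add: norm_mult L2_set_right_distrib)
  then show ?thesis using fin_norm_le[OF assms F] by (simp add: mult_left_mono)
 qed
 from ell2I[OF _ this] show "(\<lambda>h. c * f h) \<in> ell2" "ell2_norm (\<lambda>h. c * f h) \<le> cmod c * ell2_norm f"
  by simp_all
qed

lemma ell2_zero [simp]: "(\<lambda>_. 0) \<in> ell2" "ell2_norm (\<lambda>_. 0) = 0"
 by (simp_all add: ell2_def ell2_norm_def)

lemma ell2_delta: "(\<lambda>x. if x = h then 1 else 0) \<in> ell2"
proof (rule ell2I(1)[of 1])
 fix F :: "'a set" assume "finite F"
 then have "(\<Sum>x\<in>F. (cmod (if x = h then 1 else 0))\<^sup>2) = (if h \<in> F then 1 else 0)"
  by (simp add: if_distrib[of cmod] if_distrib[of "\<lambda>x. x\<^sup>2"] cong: if_cong)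
 then show "fin_norm (\<lambda>x. if x = h then 1 else 0) F \<le> 1" by (simp add: L2_set_def)
qed simp

lemma ell2_mult_abs_summable:
 assumes "f \<in> ell2" "g \<in> ell2"
 shows "(\<lambda>h. cnj (f h) * g h) abs_summable_on UNIV"
  and "(\<Sum>\<^sub>\<infinity>h. cmod (cnj (f h) * g h)) \<le> ell2_norm f * ell2_norm g"
proof -
 have le: "(\<Sum>h\<in>F. cmod (cnj (f h) * g h)) \<le> ell2_norm f * ell2_norm g" if F: "finite F" for F
 proof -
  have "(\<Sum>h\<in>F. cmod (cnj (f h) * g h)) \<le> fin_norm f F * fin_norm g F"
   using L2_set_mult_ineq[of "\<lambda>h. cmod (f h)" "\<lambda>h. cmod (g h)" F] by (simp add: norm_mult)
  also have "\<dots> \<le> ell2_norm f * ell2_norm g"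
   by (intro mult_mono fin_norm_le assms F) simp_all
  finally show ?thesis .
 qed
 show s: "(\<lambda>h. cnj (f h) * g h) abs_summable_on UNIV"
  by (rule nonneg_bdd_above_summable_on) (use le in \<open>auto intro!: bdd_aboveI[of _ "ell2_norm f * ell2_norm g"]\<close>)
 show "(\<Sum>\<^sub>\<infinity>h. cmod (cnj (f h) * g h)) \<le> ell2_norm f * ell2_norm g"
  by (rule infsum_le_finite_sums[OF s]) (rule le)
qed

lemma ell2_mult_summable: "f \<in> ell2 ==> g \<in> ell2 ==> (\<lambda>h. cnj (f h) * g h) summable_on UNIV"
 by (rule abs_summable_summable[OF ell2_mult_abs_summable(1)])

lemma ell2_inner_le: "f \<in> ell2 ==> g \<in> ell2 ==> cmod (ell2_inner f g) \<le> ell2_norm f * ell2_norm g"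
 unfolding ell2_inner_def
 by (rule order_trans[OF norm_infsum_bound[OF ell2_mult_abs_summable(1)] ell2_mult_abs_summable(2)])

lemma ell2_inner_self: "f \<in> ell2 ==> ell2_inner f f = complex_of_real ((ell2_norm f)\<^sup>2)"
proof -
 assume "f \<in> ell2"
 then have "((\<lambda>h. (cmod (f h))\<^sup>2) has_sum (ell2_norm f)\<^sup>2) UNIV"
  by (simp add: ell2_norm_sq ell2_def)
 moreover have "cnj z * z = complex_of_real ((cmod z)\<^sup>2)" for z
  by (simp only: complex_norm_square mult.commute)
 ultimately have "((\<lambda>h. cnj (f h) * f h) has_sum complex_of_real ((ell2_norm f)\<^sup>2)) UNIV"
  by (simp only: has_sum_of_real)
 then show ?thesis by (simp add: ell2_inner_def infsumI)
qed

lemma ell2_inner_commute: "ell2_inner f g = cnj (ell2_inner g f)"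
 unfolding ell2_inner_def by (simp flip: infsum_cnj add: mult.commute)

lemma ell2_inner_add_right:
 "\<lbrakk>f \<in> ell2; g \<in> ell2; k \<in> ell2\<rbrakk> \<Longrightarrow> ell2_inner f (\<lambda>h. g h + k h) = ell2_inner f g + ell2_inner f k"
 unfolding ell2_inner_def by (simp add: distrib_left infsum_add ell2_mult_summable)

lemma ell2_inner_smult_right: "ell2_inner f (\<lambda>h. c * g h) = c * ell2_inner f g"
 unfolding ell2_inner_def by (simp add: mult.left_commute infsum_cmult_right')

lemma ell2_inner_add_left:
 "\<lbrakk>f \<in> ell2; g \<in> ell2; k \<in> ell2\<rbrakk> \<Longrightarrow> ell2_inner (\<lambda>h. f h + g h) k = ell2_inner f k + ell2_inner g k"
 using ell2_inner_add_right[of k f g] by (simp add: ell2_inner_commute[of _ k] )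

lemma ell2_inner_smult_left: "ell2_inner (\<lambda>h. c * f h) g = cnj c * ell2_inner f g"
 using ell2_inner_smult_right[of g c f] by (simp add: ell2_inner_commute[of _ g])

lemma ell2_inner_delta: "ell2_inner (\<lambda>x. if x = h then 1 else 0) f = f h"
proof -
 have "ell2_inner (\<lambda>x. if x = h then 1 else 0) f = (\<Sum>\<^sub>\<infinity>x\<in>{h}. f x)"
  unfolding ell2_inner_def by (rule infsum_cong_neutral) auto
 then show ?thesis by simp
qed

text \<open>Pairing with point masses recovers every value.\<close>

lemma ell2_eqI:
 assumes "\<And>k. k \<in> ell2 ==> ell2_inner f k = ell2_inner g k" shows "f = g"
proof
 fix h
 have "ell2_inner f (\<lambda>x. if x = h then 1 else 0) = ell2_inner g (\<lambda>x. if x = h then 1 else 0)"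
  by (rule assms[OF ell2_delta])
 then show "f h = g h"
  by (simp add: ell2_inner_commute[of f] ell2_inner_commute[of g] ell2_inner_delta)
qed

lemma bounded_opD:
 assumes "bounded_op T"
 shows "f \<in> ell2 ==> T f \<in> ell2"
  and "f \<in> ell2 ==> g \<in> ell2 ==> T (\<lambda>h. f h + g h) = (\<lambda>h. T f h + T g h)"
  and "f \<in> ell2 ==> T (\<lambda>h. c * f h) = (\<lambda>h. c * T f h)"
 using assms by (simp_all add: bounded_op_def)

lemma bounded_op_zero: assumes "bounded_op T" shows "T (\<lambda>_. 0) = (\<lambda>_. 0)"
 using bounded_opD(3)[OF assms ell2_zero(1), of 0] by simp

lemma ell2_norm_zeroD: "f \<in> ell2 ==> ell2_norm f = 0 ==> f = (\<lambda>_. 0)"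
 using cmod_le_ell2_norm[of f] by fastforce

lemma op_norm_set_bdd:
 assumes "bounded_op T" shows "bdd_above {ell2_norm (T f) | f. f \<in> ell2 \<and> ell2_norm f \<le> 1}"
proof -
 obtain K where K: "\<forall>f\<in>ell2. ell2_norm (T f) \<le> K * ell2_norm f" using assms by (auto simp: bounded_op_def)
 have "ell2_norm (T f) \<le> \<bar>K\<bar>" if "f \<in> ell2" "ell2_norm f \<le> 1" for f
 proof -
  have "ell2_norm (T f) \<le> \<bar>K\<bar> * ell2_norm f"
   using bspec[OF K that(1)] mult_right_mono[OF abs_ge_self[of K] ell2_norm_nonneg[of f]] by linarith
  also have "\<dots> \<le> \<bar>K\<bar> * 1" using that by (intro mult_left_mono) auto
  finally show ?thesis by simp
 qed
 then show ?thesis by (auto intro!: bdd_aboveI[of _ "\<bar>K\<bar>"])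
qed

lemma op_norm_nonneg: assumes "bounded_op T" shows "0 \<le> op_norm T"
proof -
 have "ell2_norm (T (\<lambda>_. 0)) \<le> op_norm T"
  unfolding op_norm_def by (rule cSup_upper[OF _ op_norm_set_bdd[OF assms]]) (auto intro!: exI[of _ "\<lambda>_. 0"])
 then show ?thesis using ell2_norm_nonneg[of "T (\<lambda>_. 0)"] by linarith
qed

lemma op_norm_bound:
 assumes T: "bounded_op T" and f: "f \<in> ell2" shows "ell2_norm (T f) \<le> op_norm T * ell2_norm f"
proof (cases "ell2_norm f = 0")
 case True
 then show ?thesis using ell2_norm_zeroD[OF f] bounded_op_zero[OF T] by simp
next
 case False
 then have pos: "ell2_norm f > 0" using ell2_norm_nonneg[of f] by linarith
 define c where "c = complex_of_real (inverse (ell2_norm f))"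
 have cc: "cmod c = inverse (ell2_norm f)" using pos by (simp add: c_def norm_inverse)
 have g: "(\<lambda>h. c * f h) \<in> ell2" "ell2_norm (\<lambda>h. c * f h) \<le> 1"
  using ell2_smult_le[OF f, of c] pos cc by auto
 have "ell2_norm (T (\<lambda>h. c * f h)) \<le> op_norm T"
  unfolding op_norm_def by (rule cSup_upper[OF _ op_norm_set_bdd[OF T]]) (use g in blast)
 then have le: "ell2_norm (\<lambda>h. c * T f h) \<le> op_norm T" using bounded_opD(3)[OF T f] by simp
 have "T f = (\<lambda>h. inverse c * (c * T f h))" using pos by (auto simp: c_def)
 then have "ell2_norm (T f) = ell2_norm (\<lambda>h. inverse c * (c * T f h))" by simp
 also have "\<dots> \<le> cmod (inverse c) * ell2_norm (\<lambda>h. c * T f h)"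
  by (intro ell2_smult_le(2) ell2_smult_le(1) bounded_opD(1)[OF T f])
 also have "\<dots> \<le> cmod (inverse c) * op_norm T" using le by (intro mult_left_mono) auto
 also have "cmod (inverse c) = ell2_norm f" using cc by (simp add: norm_inverse)
 finally show ?thesis by (simp add: mult.commute)
qed

lemma op_norm_least:
 assumes "K \<ge> 0" "\<And>f. f \<in> ell2 ==> ell2_norm (T f) \<le> K * ell2_norm f" shows "op_norm T \<le> K"
 unfolding op_norm_def
proof (rule cSup_least)
 show "{ell2_norm (T f) | f. f \<in> ell2 \<and> ell2_norm f \<le> 1} \<noteq> {}"
  by (auto intro!: exI[of _ "\<lambda>_. 0"])
 fix r assume "r \<in> {ell2_norm (T f) | f. f \<in> ell2 \<and> ell2_norm f \<le> 1}"
 then obtain f where f: "r = ell2_norm (T f)" "f \<in> ell2" "ell2_norm f \<le> 1" by blast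
 have "K * ell2_norm f \<le> K * 1" using f assms(1) by (intro mult_left_mono) auto
 then show "r \<le> K" using assms(2)[OF f(2)] f(1) by simp
qed

lemma op_norm_cong: "(\<And>f. f \<in> ell2 ==> T f = S f) ==> op_norm T = op_norm S"
 unfolding op_norm_def by (rule arg_cong[where f = Sup]) force

section \<open>The C*-algebra of adjointable operators\<close>

text \<open>The adjoint is carried as data, as a representation supplies it:
  \<open>\<pi> (star A a)\<close> is the adjoint of \<open>\<pi> a\<close>.\<close>

definition op_adj :: "'h ell2_op \<Rightarrow> 'h ell2_op \<Rightarrow> bool" where
 "op_adj T T' \<longleftrightarrow> bounded_op T \<and> bounded_op T' \<and>
   (\<forall>f\<in>ell2. \<forall>g\<in>ell2. ell2_inner (T' f) g = ell2_inner f (T g))"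

definition op_supp :: "'h ell2_op \<Rightarrow> bool" where
 "op_supp T \<longleftrightarrow> (\<forall>f. f \<notin> ell2 \<longrightarrow> T f = (\<lambda>_. 0))"

definition op_cut :: "'h ell2_op \<Rightarrow> 'h ell2_op" where
 "op_cut T f = (if f \<in> ell2 then T f else (\<lambda>_. 0))"

text \<open>The adjointable operators, made unique as HOL functions by value 0 outside \<^const>\<open>ell2\<close>.\<close>

definition ell2_ops :: "'h ell2_op cstar_alg" where
 "ell2_ops =
   \<lparr>carrier = {T. op_supp T \<and> (\<exists>T'. op_supp T' \<and> op_adj T T')},
   monoid.mult = (\<lambda>S T f. S (T f)), one = op_cut (\<lambda>f. f),
   zero = (\<lambda>_ _. 0), add = (\<lambda>S T f h. S f h + T f h),
   smult = (\<lambda>c T f h. c * T f h),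
   star = (\<lambda>T. THE T'. op_supp T' \<and> op_adj T T'),
   cnorm = op_norm\<rparr>"

lemma op_cut_supp [simp]: "op_supp (op_cut T)"
 by (simp add: op_supp_def op_cut_def)

lemma op_cut_in [simp]: "f \<in> ell2 ==> op_cut T f = T f"
 by (simp add: op_cut_def)

lemma bounded_opI:
 assumes "\<And>f. f \<in> ell2 ==> T f \<in> ell2"
  and "\<And>f g. f \<in> ell2 ==> g \<in> ell2 ==> T (\<lambda>h. f h + g h) = (\<lambda>h. T f h + T g h)"
  and "\<And>c f. f \<in> ell2 ==> T (\<lambda>h. c * f h) = (\<lambda>h. c * T f h)"
  and "\<And>f. f \<in> ell2 ==> ell2_norm (T f) \<le> K * ell2_norm f"
 shows "bounded_op T"
 unfolding bounded_op_def using assms by blast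

lemma op_adj_bounded: "op_adj T T' ==> bounded_op T" "op_adj T T' ==> bounded_op T'"
 and op_adjD: "op_adj T T' ==> f \<in> ell2 ==> g \<in> ell2 ==> ell2_inner (T' f) g = ell2_inner f (T g)"
 by (simp_all add: op_adj_def)

lemma op_adj_sym: "op_adj T T' ==> op_adj T' T"
 unfolding op_adj_def by (metis ell2_inner_commute)

lemma op_adj_unique:
 assumes "op_supp S" "op_adj T S" "op_supp S'" "op_adj T S'" shows "S = S'"
proof
 fix f
 show "S f = S' f"
 proof (cases "f \<in> ell2")
  case True
  then show ?thesis using assms by (intro ell2_eqI) (simp add: op_adjD)
 qed (use assms in \<open>simp add: op_supp_def\<close>)
qed

lemma ops_simps:
 "monoid.mult ell2_ops S T = (\<lambda>f. S (T f))" "one ell2_ops = op_cut (\<lambda>f. f)" "zero ell2_ops = (\<lambda>_ _. 0)"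
 "add ell2_ops S T = (\<lambda>f h. S f h + T f h)" "smult ell2_ops c T = (\<lambda>f h. c * T f h)"
 "cnorm ell2_ops = op_norm"
 by (simp_all add: ell2_ops_def)

lemma ops_carrierI: "op_supp T ==> op_supp T' ==> op_adj T T' ==> T \<in> carrier ell2_ops"
 by (auto simp: ell2_ops_def)

lemma ops_starI: assumes "op_supp T'" "op_adj T T'" shows "star ell2_ops T = T'"
proof -
 have "star ell2_ops T = (THE T'. op_supp T' \<and> op_adj T T')" by (simp add: ell2_ops_def)
 also have "\<dots> = T'"
 proof (rule the_equality)
  fix S assume "op_supp S \<and> op_adj T S"
  then show "S = T'" using op_adj_unique[OF _ _ assms(1,2), of S] by simp
 qed (simp add: assms)
 finally show ?thesis .
qed

lemma ops_star:
 assumes "T \<in> carrier ell2_ops"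
 shows "op_supp T" "op_supp (star ell2_ops T)" "op_adj T (star ell2_ops T)" "bounded_op T"
  "bounded_op (star ell2_ops T)"
proof -
 obtain T' where T': "op_supp T" "op_supp T'" "op_adj T T'" using assms by (auto simp: ell2_ops_def)
 then have "star ell2_ops T = T'" by (intro ops_starI)
 with T' show "op_supp T" "op_supp (star ell2_ops T)" "op_adj T (star ell2_ops T)" "bounded_op T"
  "bounded_op (star ell2_ops T)" by (simp_all add: op_adj_bounded)
qed

lemma ops_eqI:
 assumes "T \<in> carrier ell2_ops" "S \<in> carrier ell2_ops" "\<And>f. f \<in> ell2 ==> T f = S f"
 shows "T = S"
proof
 fix f show "T f = S f"
  using assms ops_star(1)[OF assms(1)] ops_star(1)[OF assms(2)] by (cases "f \<in> ell2") (auto simp: op_supp_def)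
qed

lemma ops_zero_out: "T \<in> carrier ell2_ops ==> f \<notin> ell2 ==> T f = (\<lambda>_. 0)"
 using ops_star(1)[of T] by (simp add: op_supp_def)

lemma bounded_op_add:
 assumes S: "bounded_op S" and T: "bounded_op T" shows "bounded_op (\<lambda>f h. S f h + T f h)"
proof (rule bounded_opI[where K = "op_norm S + op_norm T"])
 fix f :: "'a \<Rightarrow> complex" assume f: "f \<in> ell2"
 show "(\<lambda>h. S f h + T f h) \<in> ell2" by (rule ell2_add(1)[OF bounded_opD(1)[OF S f] bounded_opD(1)[OF T f]])
 show "ell2_norm (\<lambda>h. S f h + T f h) \<le> (op_norm S + op_norm T) * ell2_norm f"
  using ell2_add(2)[OF bounded_opD(1)[OF S f] bounded_opD(1)[OF T f]]
   op_norm_bound[OF S f] op_norm_bound[OF T f] by (simp add: distrib_right)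
 show "(\<lambda>h. S (\<lambda>h. c * f h) h + T (\<lambda>h. c * f h) h) = (\<lambda>h. c * (S f h + T f h))" for c
  unfolding bounded_opD(3)[OF S f] bounded_opD(3)[OF T f] by (simp add: distrib_left)
 fix g :: "'a \<Rightarrow> complex" assume g: "g \<in> ell2"
 show "(\<lambda>h. S (\<lambda>h. f h + g h) h + T (\<lambda>h. f h + g h) h) = (\<lambda>h. S f h + T f h + (S g h + T g h))"
  unfolding bounded_opD(2)[OF S f g] bounded_opD(2)[OF T f g] by (simp add: add_ac)
qed

lemma bounded_op_smult:
 assumes T: "bounded_op T" shows "bounded_op (\<lambda>f h. c * T f h)"
proof (rule bounded_opI[where K = "cmod c * op_norm T"])
 fix f :: "'a \<Rightarrow> complex" assume f: "f \<in> ell2"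
 show "(\<lambda>h. c * T f h) \<in> ell2" by (rule ell2_smult_le(1)[OF bounded_opD(1)[OF T f]])
 have "ell2_norm (\<lambda>h. c * T f h) \<le> cmod c * ell2_norm (T f)"
  by (rule ell2_smult_le(2)[OF bounded_opD(1)[OF T f]])
 also have "\<dots> \<le> cmod c * (op_norm T * ell2_norm f)" by (intro mult_left_mono op_norm_bound T f) simp
 finally show "ell2_norm (\<lambda>h. c * T f h) \<le> cmod c * op_norm T * ell2_norm f" by simp
 show "(\<lambda>h. c * T (\<lambda>h. d * f h) h) = (\<lambda>h. d * (c * T f h))" for d
  unfolding bounded_opD(3)[OF T f] by (simp add: mult_ac)
 fix g :: "'a \<Rightarrow> complex" assume g: "g \<in> ell2"
 show "(\<lambda>h. c * T (\<lambda>h. f h + g h) h) = (\<lambda>h. c * T f h + c * T g h)"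
  unfolding bounded_opD(2)[OF T f g] by (simp add: distrib_left)
qed

lemma bounded_op_comp:
 assumes S: "bounded_op S" and T: "bounded_op T" shows "bounded_op (\<lambda>f. S (T f))"
proof (rule bounded_opI[where K = "op_norm S * op_norm T"])
 fix f :: "'a \<Rightarrow> complex" assume f: "f \<in> ell2"
 note Tf = bounded_opD(1)[OF T f]
 show "S (T f) \<in> ell2" by (rule bounded_opD(1)[OF S Tf])
 have "ell2_norm (S (T f)) \<le> op_norm S * ell2_norm (T f)" by (rule op_norm_bound[OF S Tf])
 also have "\<dots> \<le> op_norm S * (op_norm T * ell2_norm f)"
  by (intro mult_left_mono op_norm_bound S T f op_norm_nonneg)
 finally show "ell2_norm (S (T f)) \<le> op_norm S * op_norm T * ell2_norm f" by simp
 show "S (T (\<lambda>h. c * f h)) = (\<lambda>h. c * S (T f) h)" for c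
  by (simp add: bounded_opD(3)[OF T f] bounded_opD(3)[OF S Tf])
 fix g :: "'a \<Rightarrow> complex" assume g: "g \<in> ell2"
 show "S (T (\<lambda>h. f h + g h)) = (\<lambda>h. S (T f) h + S (T g) h)"
  by (simp add: bounded_opD(2)[OF T f g] bounded_opD(2)[OF S Tf bounded_opD(1)[OF T g]])
qed

lemma op_adj_add: assumes S: "op_adj S S'" and T: "op_adj T T'" shows "op_adj (\<lambda>f h. S f h + T f h) (\<lambda>f h. S' f h + T' f h)"
 unfolding op_adj_def
proof (intro conjI ballI)
 show "bounded_op (\<lambda>f h. S f h + T f h)" "bounded_op (\<lambda>f h. S' f h + T' f h)"
  using op_adj_bounded[OF S] op_adj_bounded[OF T] by (simp_all add: bounded_op_add)
 fix f g :: "'a \<Rightarrow> complex" assume f: "f \<in> ell2" and g: "g \<in> ell2"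
 note B = op_adj_bounded[OF S] op_adj_bounded[OF T]
 show "ell2_inner (\<lambda>h. S' f h + T' f h) g = ell2_inner f (\<lambda>h. S g h + T g h)"
  using op_adjD[OF S f g] op_adjD[OF T f g]
   ell2_inner_add_left[OF bounded_opD(1)[OF B(2) f] bounded_opD(1)[OF B(4) f] g]
   ell2_inner_add_right[OF f bounded_opD(1)[OF B(1) g] bounded_opD(1)[OF B(3) g]] by simp
qed

lemma op_adj_smult: assumes "op_adj T T'" shows "op_adj (\<lambda>f h. c * T f h) (\<lambda>f h. cnj c * T' f h)"
 using assms by (auto simp: op_adj_def bounded_op_smult ell2_inner_smult_left ell2_inner_smult_right)

lemma op_adj_comp: assumes S: "op_adj S S'" and T: "op_adj T T'" shows "op_adj (\<lambda>f. S (T f)) (\<lambda>f. T' (S' f))"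
 unfolding op_adj_def
proof (intro conjI ballI)
 show "bounded_op (\<lambda>f. S (T f))" "bounded_op (\<lambda>f. T' (S' f))"
  by (rule bounded_op_comp[OF op_adj_bounded(1)[OF S] op_adj_bounded(1)[OF T]], rule bounded_op_comp[OF op_adj_bounded(2)[OF T] op_adj_bounded(2)[OF S]])
 fix f g :: "'a \<Rightarrow> complex" assume f: "f \<in> ell2" and g: "g \<in> ell2"
 note B = op_adj_bounded[OF S] op_adj_bounded[OF T]
 show "ell2_inner (T' (S' f)) g = ell2_inner f (S (T g))"
  using op_adjD[OF T bounded_opD(1)[OF B(2) f] g] op_adjD[OF S f bounded_opD(1)[OF B(3) g]] by simp
qed

lemma op_supp_comp: "op_supp T ==> bounded_op S ==> op_supp (\<lambda>f. S (T f))"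
 by (simp add: op_supp_def bounded_op_zero)

lemma bounded_op_cut: assumes "bounded_op T" shows "bounded_op (op_cut T)"
 by (rule bounded_opI[where K = "op_norm T"])
  (simp_all add: ell2_add(1) ell2_smult_le(1) bounded_opD[OF assms] op_norm_bound[OF assms])

lemma op_adj_cut: "op_adj T T' ==> op_adj (op_cut T) (op_cut T')"
 by (simp add: op_adj_def bounded_op_cut)

lemma op_adj_id: "op_adj (op_cut (\<lambda>f. f)) (op_cut (\<lambda>f. f))"
proof -
 have "bounded_op (\<lambda>f :: 'a \<Rightarrow> complex. f)"
  unfolding bounded_op_def by (auto intro!: exI[of _ 1])
 then show ?thesis by (simp add: op_adj_def bounded_op_cut)
qed

lemma ops_closed:
 assumes "S \<in> carrier ell2_ops" "T \<in> carrier ell2_ops"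
 shows "(\<lambda>f h. S f h + T f h) \<in> carrier ell2_ops" "(\<lambda>f h. c * T f h) \<in> carrier ell2_ops"
  "(\<lambda>f. S (T f)) \<in> carrier ell2_ops" "star ell2_ops T \<in> carrier ell2_ops"
  "star ell2_ops (star ell2_ops T) = T"
  "star ell2_ops (\<lambda>f h. S f h + T f h) = (\<lambda>f h. star ell2_ops S f h + star ell2_ops T f h)"
  "star ell2_ops (\<lambda>f h. c * T f h) = (\<lambda>f h. cnj c * star ell2_ops T f h)"
  "star ell2_ops (\<lambda>f. S (T f)) = (\<lambda>f. star ell2_ops T (star ell2_ops S f))"
proof -
 note S = ops_star[OF assms(1)] and T = ops_star[OF assms(2)]
 have a: "op_supp (\<lambda>f h. S f h + T f h)" "op_supp (\<lambda>f h. star ell2_ops S f h + star ell2_ops T f h)"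
  "op_supp (\<lambda>f h. c * T f h)" "op_supp (\<lambda>f h. cnj c * star ell2_ops T f h)"
  using S(1,2) T(1,2) by (auto simp: op_supp_def)
 have m: "op_supp (\<lambda>f. S (T f))" "op_supp (\<lambda>f. star ell2_ops T (star ell2_ops S f))"
  using S T by (auto intro: op_supp_comp)
 show "(\<lambda>f h. S f h + T f h) \<in> carrier ell2_ops" by (rule ops_carrierI[OF a(1,2) op_adj_add[OF S(3) T(3)]])
 show "(\<lambda>f h. c * T f h) \<in> carrier ell2_ops" by (rule ops_carrierI[OF a(3,4) op_adj_smult[OF T(3)]])
 show "(\<lambda>f. S (T f)) \<in> carrier ell2_ops" by (rule ops_carrierI[OF m op_adj_comp[OF S(3) T(3)]])
 show "star ell2_ops T \<in> carrier ell2_ops" by (rule ops_carrierI[OF T(2,1) op_adj_sym[OF T(3)]])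
 show "star ell2_ops (star ell2_ops T) = T" by (rule ops_starI[OF T(1) op_adj_sym[OF T(3)]])
 show "star ell2_ops (\<lambda>f h. S f h + T f h) = (\<lambda>f h. star ell2_ops S f h + star ell2_ops T f h)"
  by (rule ops_starI[OF a(2) op_adj_add[OF S(3) T(3)]])
 show "star ell2_ops (\<lambda>f h. c * T f h) = (\<lambda>f h. cnj c * star ell2_ops T f h)"
  by (rule ops_starI[OF a(4) op_adj_smult[OF T(3)]])
 show "star ell2_ops (\<lambda>f. S (T f)) = (\<lambda>f. star ell2_ops T (star ell2_ops S f))"
  by (rule ops_starI[OF m(2) op_adj_comp[OF S(3) T(3)]])
qed

lemma ops_zero_closed: "(\<lambda>_ _. 0) \<in> carrier ell2_ops"
proof -
 have "bounded_op (\<lambda>_ _. 0 :: complex)" unfolding bounded_op_def by (auto intro!: exI[of _ 0])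
 then have "op_adj (\<lambda>_ _. 0) (\<lambda>_ _. 0 :: complex)" by (simp add: op_adj_def ell2_inner_def)
 then show ?thesis by (intro ops_carrierI[of _ "\<lambda>_ _. 0"]) (auto simp: op_supp_def)
qed

lemma ops_one_closed: "op_cut (\<lambda>f. f) \<in> carrier ell2_ops"
 by (rule ops_carrierI[OF _ _ op_adj_id]) simp_all

lemma star_algebra_ops: "star_algebra (ell2_ops :: 'h ell2_op cstar_alg)"
 unfolding star_algebra_def
proof (intro conjI)
 let ?A = "ell2_ops :: 'h ell2_op cstar_alg"
 note D = bounded_opD[OF ops_star(4)]
 have ab: "abelian_group ?A"
 proof (rule abelian_groupI)
  fix T assume "T \<in> carrier ?A"
  then show "\<exists>S\<in>carrier ?A. S \<oplus>\<^bsub>?A\<^esub> T = \<zero>\<^bsub>?A\<^esub>"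
   by (intro bexI[of _ "\<lambda>f h. - 1 * T f h"]) (auto simp: ops_simps intro!: ops_closed(2)[of T T "- 1", simplified])
 qed (auto simp: ops_simps ops_closed ops_zero_closed add_ac)
 \<comment> \<open>Outside \<open>ell2\<close> the unit returns the zero function and the elements
   of the carrier vanish, so the unit laws hold as equations between functions.\<close>
 have one: "op_cut (\<lambda>f. f) (T f) = T f" "T (op_cut (\<lambda>f. f) f) = T f" if "T \<in> carrier ?A" for T f
  using ops_zero_out[OF that, of f] D(1)[OF that, of f] bounded_op_zero[OF ops_star(4)[OF that]]
  by (cases "f \<in> ell2"; simp add: op_cut_def)+
 have mon: "Group.monoid ?A"
  by (rule monoidI) (auto simp: ops_simps ops_closed ops_one_closed one)
 have add: "U (\<lambda>h. S f h + T f h) = (\<lambda>h. U (S f) h + U (T f) h)"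
  if "U \<in> carrier ?A" "S \<in> carrier ?A" "T \<in> carrier ?A" for U S T f
  using D(1)[OF that(2), of f] D(1)[OF that(3), of f] D(2)[OF that(1)]
   bounded_op_zero[OF ops_star(4)[OF that(1)]] ops_zero_out[OF that(2), of f] ops_zero_out[OF that(3), of f]
  by (cases "f \<in> ell2") auto
 show "ring ?A"
  by (rule ringI[OF ab mon]) (auto simp: ops_simps add)
 show "Module.module complex_ring ?A"
  by (rule moduleI[OF cring_complex_ring ab])
   (auto simp: complex_ring_def ops_simps ops_closed algebra_simps)
 have sm: "U (\<lambda>h. c * T f h) = (\<lambda>h. c * U (T f) h)"
  if "U \<in> carrier ?A" "T \<in> carrier ?A" for U T c f
  using D(1)[OF that(2), of f] D(3)[OF that(1)] bounded_op_zero[OF ops_star(4)[OF that(1)]]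
   ops_zero_out[OF that(2), of f]
  by (cases "f \<in> ell2") auto
 show "\<forall>c. \<forall>x\<in>carrier ?A. \<forall>y\<in>carrier ?A.
    (c \<odot>\<^bsub>?A\<^esub> x) \<otimes>\<^bsub>?A\<^esub> y = c \<odot>\<^bsub>?A\<^esub> (x \<otimes>\<^bsub>?A\<^esub> y) \<and> x \<otimes>\<^bsub>?A\<^esub> (c \<odot>\<^bsub>?A\<^esub> y) = c \<odot>\<^bsub>?A\<^esub> (x \<otimes>\<^bsub>?A\<^esub> y)"
  by (auto simp: ops_simps sm)
 show "\<forall>x\<in>carrier ?A. star ?A x \<in> carrier ?A \<and> star ?A (star ?A x) = x \<and>
    (\<forall>c. star ?A (c \<odot>\<^bsub>?A\<^esub> x) = cnj c \<odot>\<^bsub>?A\<^esub> star ?A x)"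
  by (auto simp: ops_simps ops_closed)
 show "\<forall>x\<in>carrier ?A. \<forall>y\<in>carrier ?A. star ?A (x \<oplus>\<^bsub>?A\<^esub> y) = star ?A x \<oplus>\<^bsub>?A\<^esub> star ?A y \<and>
    star ?A (x \<otimes>\<^bsub>?A\<^esub> y) = star ?A y \<otimes>\<^bsub>?A\<^esub> star ?A x"
  by (auto simp: ops_simps ops_closed)
qed

lemma star_alg_ops: "star_alg ell2_ops"
 by unfold_locales (rule star_algebra_ops)

lemma ops_diff: assumes "S \<in> carrier ell2_ops" "T \<in> carrier ell2_ops"
 shows "S \<ominus>\<^bsub>ell2_ops\<^esub> T = (\<lambda>f h. S f h - T f h)"
proof -
 interpret star_alg ell2_ops by (rule star_alg_ops)
 show ?thesis using assms by (simp add: minus_eq smult_minus_one[symmetric], simp add: ops_simps)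
qed

text \<open>The square of the norm of \<open>T' f\<close> is the inner product of \<open>f\<close>
  with \<open>T (T' f)\<close>; by Cauchy-Schwarz one factor \<open>ell2_norm (T' f)\<close>
  cancels.\<close>

lemma op_norm_adj_le: assumes "op_adj T T'" shows "op_norm T' \<le> op_norm T"
proof (rule op_norm_least[OF op_norm_nonneg[OF op_adj_bounded(1)[OF assms]]])
 note B = op_adj_bounded[OF assms]
 fix f :: "'a \<Rightarrow> complex" assume f: "f \<in> ell2"
 have T'f: "T' f \<in> ell2" by (rule bounded_opD(1)[OF B(2) f])
 have "complex_of_real ((ell2_norm (T' f))\<^sup>2) = ell2_inner f (T (T' f))"
  using op_adjD[OF assms f T'f] ell2_inner_self[OF T'f] by simp
 then have "(ell2_norm (T' f))\<^sup>2 = cmod (ell2_inner f (T (T' f)))"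
  by (metis norm_of_real abs_of_nonneg zero_le_power2)
 also have "\<dots> \<le> ell2_norm f * ell2_norm (T (T' f))"
  by (rule ell2_inner_le[OF f bounded_opD(1)[OF B(1) T'f]])
 also have "\<dots> \<le> ell2_norm f * (op_norm T * ell2_norm (T' f))"
  by (intro mult_left_mono op_norm_bound B T'f) simp
 finally have "ell2_norm (T' f) * ell2_norm (T' f) \<le> (op_norm T * ell2_norm f) * ell2_norm (T' f)"
  by (simp add: power2_eq_square mult_ac)
 then show "ell2_norm (T' f) \<le> op_norm T * ell2_norm f"
  using ell2_norm_nonneg[of "T' f"] op_norm_nonneg[OF B(1)]
  by (cases "ell2_norm (T' f) = 0") (auto simp: mult_le_cancel_right)
qed

lemma cstar_seminorm_ops: "cstar_seminorm ell2_ops op_norm"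
proof -
 interpret star_alg ell2_ops by (rule star_alg_ops)
 have mult: "op_norm (\<lambda>f. S (T f)) \<le> op_norm S * op_norm T" if "bounded_op S" "bounded_op T" for S T :: "'h ell2_op"
 proof (rule op_norm_least)
  fix f :: "'h \<Rightarrow> complex" assume f: "f \<in> ell2"
  have "ell2_norm (S (T f)) \<le> op_norm S * ell2_norm (T f)"
   by (rule op_norm_bound[OF that(1) bounded_opD(1)[OF that(2) f]])
  also have "\<dots> \<le> op_norm S * (op_norm T * ell2_norm f)"
   by (intro mult_left_mono op_norm_bound that f op_norm_nonneg)
  finally show "ell2_norm (S (T f)) \<le> op_norm S * op_norm T * ell2_norm f" by simp
 qed (intro mult_nonneg_nonneg op_norm_nonneg that)
 have smult_le: "op_norm (\<lambda>f h. c * T f h) \<le> cmod c * op_norm T" if T: "bounded_op T" for T :: "'h ell2_op" and c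
 proof (rule op_norm_least)
  fix f :: "'h \<Rightarrow> complex" assume f: "f \<in> ell2"
  have "ell2_norm (\<lambda>h. c * T f h) \<le> cmod c * ell2_norm (T f)"
   by (rule ell2_smult_le(2)[OF bounded_opD(1)[OF T f]])
  also have "\<dots> \<le> cmod c * (op_norm T * ell2_norm f)" by (intro mult_left_mono op_norm_bound T f) simp
  finally show "ell2_norm (\<lambda>h. c * T f h) \<le> cmod c * op_norm T * ell2_norm f" by simp
 qed (simp add: op_norm_nonneg[OF T])
 show ?thesis
  unfolding cstar_seminorm_def
 proof (intro conjI ballI allI)
  fix T :: "'h ell2_op" assume T: "T \<in> carrier ell2_ops"
  note T' = ops_star[OF T]
  show "0 \<le> op_norm T" by (rule op_norm_nonneg[OF T'(4)])
  have le: "op_norm (star ell2_ops T) \<le> op_norm T" by (rule op_norm_adj_le[OF T'(3)])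
  have bc: "bounded_op (\<lambda>f. star ell2_ops T (T f))" by (rule bounded_op_comp[OF T'(5,4)])
  \<comment> \<open>The nontrivial half of the C*-identity: the squared norm of \<open>T f\<close>
    is the inner product of the vector \<open>star ell2_ops T (T f)\<close> with
    \<open>f\<close>.\<close>
  have "op_norm T \<le> sqrt (op_norm (\<lambda>f. star ell2_ops T (T f)))"
  proof (rule op_norm_least)
   fix f :: "'h \<Rightarrow> complex" assume f: "f \<in> ell2"
   have Tf: "T f \<in> ell2" by (rule bounded_opD(1)[OF T'(4) f])
   have "complex_of_real ((ell2_norm (T f))\<^sup>2) = ell2_inner (star ell2_ops T (T f)) f"
    using op_adjD[OF T'(3) Tf f] ell2_inner_self[OF Tf] by simp
   then have "(ell2_norm (T f))\<^sup>2 = cmod (ell2_inner (star ell2_ops T (T f)) f)"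
    by (metis norm_of_real abs_of_nonneg zero_le_power2)
   also have "\<dots> \<le> ell2_norm (star ell2_ops T (T f)) * ell2_norm f"
    by (rule ell2_inner_le[OF bounded_opD(1)[OF bc f] f])
   also have "\<dots> \<le> (op_norm (\<lambda>f. star ell2_ops T (T f)) * ell2_norm f) * ell2_norm f"
    by (intro mult_right_mono op_norm_bound[OF bc f]) simp
   also have "\<dots> = (sqrt (op_norm (\<lambda>f. star ell2_ops T (T f))) * ell2_norm f)\<^sup>2"
    using op_norm_nonneg[OF bc] by (simp add: power_mult_distrib power2_eq_square)
   finally show "ell2_norm (T f) \<le> sqrt (op_norm (\<lambda>f. star ell2_ops T (T f))) * ell2_norm f"
    by (rule power2_le_imp_le) (simp add: op_norm_nonneg[OF bc])
  qed (simp add: op_norm_nonneg[OF bc])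
  then have "(op_norm T)\<^sup>2 \<le> (sqrt (op_norm (\<lambda>f. star ell2_ops T (T f))))\<^sup>2"
   by (rule power_mono) (rule op_norm_nonneg[OF T'(4)])
  then have "(op_norm T)\<^sup>2 \<le> op_norm (\<lambda>f. star ell2_ops T (T f))" using op_norm_nonneg[OF bc] by simp
  moreover have "op_norm (\<lambda>f. star ell2_ops T (T f)) \<le> op_norm T * op_norm T"
   using mult[OF T'(5,4)] mult_right_mono[OF le op_norm_nonneg[OF T'(4)]] by linarith
  ultimately show "op_norm (star ell2_ops T \<otimes>\<^bsub>ell2_ops\<^esub> T) = (op_norm T)\<^sup>2"
   by (simp add: ops_simps power2_eq_square)
  show "op_norm (c \<odot>\<^bsub>ell2_ops\<^esub> T) = cmod c * op_norm T" for c
  proof (cases "c = 0")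
   case True
   have "op_norm (\<lambda>f h. c * T f h) \<le> 0" using smult_le[OF T'(4), of c] True by simp
   moreover have "0 \<le> op_norm (\<lambda>f h. c * T f h)" by (rule op_norm_nonneg[OF bounded_op_smult[OF T'(4)]])
   ultimately show ?thesis using True by (simp add: ops_simps)
  next
   case False
   have "op_norm (\<lambda>f h. inverse c * (c * T f h)) \<le> cmod (inverse c) * op_norm (\<lambda>f h. c * T f h)"
    by (rule smult_le[OF bounded_op_smult[OF T'(4)]])
   then have "op_norm T \<le> inverse (cmod c) * op_norm (\<lambda>f h. c * T f h)"
    using False by (simp add: norm_inverse mult.assoc[symmetric])
   then have "cmod c * op_norm T \<le> cmod c * (inverse (cmod c) * op_norm (\<lambda>f h. c * T f h))"
    by (intro mult_left_mono) auto
   also have "\<dots> = op_norm (\<lambda>f h. c * T f h)" using False by simp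
   finally show ?thesis using smult_le[OF T'(4), of c] by (simp add: ops_simps)
  qed
  fix S :: "'h ell2_op" assume S: "S \<in> carrier ell2_ops"
  note S' = ops_star[OF S]
  show "op_norm (T \<otimes>\<^bsub>ell2_ops\<^esub> S) \<le> op_norm T * op_norm S"
   using mult[OF T'(4) S'(4)] by (simp add: ops_simps)
  have "op_norm (\<lambda>f h. T f h + S f h) \<le> op_norm T + op_norm S"
  proof (rule op_norm_least)
   fix f :: "'h \<Rightarrow> complex" assume f: "f \<in> ell2"
   show "ell2_norm (\<lambda>h. T f h + S f h) \<le> (op_norm T + op_norm S) * ell2_norm f"
    using ell2_add(2)[OF bounded_opD(1)[OF T'(4) f] bounded_opD(1)[OF S'(4) f]]
     op_norm_bound[OF T'(4) f] op_norm_bound[OF S'(4) f] by (simp add: distrib_right)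
  qed (simp add: op_norm_nonneg S'(4) T'(4))
  then show "op_norm (T \<oplus>\<^bsub>ell2_ops\<^esub> S) \<le> op_norm T + op_norm S" by (simp add: ops_simps)
 qed
qed

text \<open>The limit operator is defined coordinate by coordinate. Uniform estimates on finite sets
  of coordinates pass to the limit and then give both boundedness and convergence in norm.\<close>

lemma ops_Cauchy_limit:
 assumes T: "\<And>n. bounded_op (T n :: 'h ell2_op)" and supp: "\<And>n. op_supp (T n)"
  and C: "\<And>e. e > 0 ==> \<exists>N. \<forall>m\<ge>N. \<forall>n\<ge>N. op_norm (\<lambda>f h. T m f h - T n f h) < e"
 obtains L where "bounded_op L" "op_supp L" "\<And>n. bounded_op (\<lambda>f h. T n f h - L f h)"
  "(\<lambda>n. op_norm (\<lambda>f h. T n f h - L f h)) \<longlonglongrightarrow> 0"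
proof -
 have bd: "bounded_op (\<lambda>f h. T m f h - T n f h)" for m n
  using bounded_op_add[OF T bounded_op_smult[OF T, of "-1"], of m n] by simp
 have Cp: "convergent (\<lambda>n. T n f h)" if f: "f \<in> ell2" for f h
 proof (rule Cauchy_convergent, rule CauchyI)
  fix e :: real assume e: "e > 0"
  define d where "d = e / (ell2_norm f + 1)"
  have n1: "ell2_norm f + 1 > 0" by (simp add: add_nonneg_pos)
  have "d > 0" using e n1 by (simp add: d_def)
  then obtain N where N: "\<And>m n. m \<ge> N ==> n \<ge> N ==> op_norm (\<lambda>f h. T m f h - T n f h) < d" using C by blast
  have "norm (T m f h - T n f h) < e" if "m \<ge> N" "n \<ge> N" for m n
  proof -
   have "norm (T m f h - T n f h) \<le> ell2_norm (\<lambda>h. T m f h - T n f h)"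
    by (rule cmod_le_ell2_norm[of "\<lambda>h. T m f h - T n f h", OF bounded_opD(1)[OF bd f]])
   also have "\<dots> \<le> op_norm (\<lambda>f h. T m f h - T n f h) * ell2_norm f" by (rule op_norm_bound[OF bd f])
   also have "\<dots> \<le> d * ell2_norm f" using N[OF that] by (intro mult_right_mono) auto
   also have "\<dots> < d * (ell2_norm f + 1)" using \<open>d > 0\<close> by (intro mult_strict_left_mono) auto
   also have "\<dots> = e" using n1 by (simp add: d_def)
   finally show ?thesis .
  qed
  then show "\<exists>M. \<forall>m\<ge>M. \<forall>n\<ge>M. norm (T m f h - T n f h) < e" by blast
 qed
 define L where "L = op_cut (\<lambda>f h. lim (\<lambda>n. T n f h))"
 have L: "(\<lambda>n. T n f h) \<longlonglongrightarrow> L f h" if "f \<in> ell2" for f h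
  using Cp[OF that] that by (simp add: L_def convergent_LIMSEQ_iff)
 \<comment> \<open>For a fixed finite set of coordinates the index m tends to infinity; only
   afterwards is the supremum over finite sets taken.\<close>
 have est: "(\<lambda>h. T n f h - L f h) \<in> ell2 \<and> ell2_norm (\<lambda>h. T n f h - L f h) \<le> e * ell2_norm f"
  if e: "e > 0" and N: "\<And>m. m \<ge> N ==> op_norm (\<lambda>f h. T n f h - T m f h) < e" and f: "f \<in> ell2" for e N n f
 proof -
  have "fin_norm (\<lambda>h. T n f h - L f h) F \<le> e * ell2_norm f" if F: "finite F" for F
  proof (rule LIMSEQ_le_const2)
   show "(\<lambda>m. fin_norm (\<lambda>h. T n f h - T m f h) F) \<longlonglongrightarrow> fin_norm (\<lambda>h. T n f h - L f h) F"
    unfolding L2_set_def by (intro tendsto_intros L f)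
   have "fin_norm (\<lambda>h. T n f h - T m f h) F \<le> e * ell2_norm f" if m: "m \<ge> N" for m
   proof -
    have "fin_norm (\<lambda>h. T n f h - T m f h) F \<le> ell2_norm (\<lambda>h. T n f h - T m f h)"
     by (rule fin_norm_le[OF bounded_opD(1)[OF bd f] F])
    also have "\<dots> \<le> op_norm (\<lambda>f h. T n f h - T m f h) * ell2_norm f" by (rule op_norm_bound[OF bd f])
    also have "\<dots> \<le> e * ell2_norm f" using N[OF m] by (intro mult_right_mono) auto
    finally show ?thesis .
   qed
   then show "\<exists>N. \<forall>m\<ge>N. fin_norm (\<lambda>h. T n f h - T m f h) F \<le> e * ell2_norm f" by blast
  qed
  from ell2I[OF _ this] show ?thesis using e by simp
 qed
 obtain N where N: "\<And>m n. m \<ge> N ==> n \<ge> N ==> op_norm (\<lambda>f h. T m f h - T n f h) < 1"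
  using C[of 1] by auto
 \<comment> \<open>Writing \<open>L\<close> as \<open>T N\<close> minus an error of norm at most 1
   transfers square-summability and boundedness to \<open>L\<close>.\<close>
 have eq: "L f = (\<lambda>h. T N f h + - 1 * (T N f h - L f h))" for f by auto
 have Lbd: "bounded_op L"
 proof (rule bounded_opI[where K = "op_norm (T N) + 1"])
  fix f :: "'h \<Rightarrow> complex" assume f: "f \<in> ell2"
  have 1: "(\<lambda>h. T N f h - L f h) \<in> ell2" "ell2_norm (\<lambda>h. T N f h - L f h) \<le> 1 * ell2_norm f"
   using est[of 1 N N f] N f by auto
  have 2: "T N f \<in> ell2" by (rule bounded_opD(1)[OF T f])
  show "L f \<in> ell2" by (subst eq) (intro ell2_add(1) ell2_smult_le(1) 1 2)
  have "ell2_norm (L f) \<le> ell2_norm (T N f) + ell2_norm (\<lambda>h. - 1 * (T N f h - L f h))"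
   by (subst eq) (intro ell2_add(2) ell2_smult_le(1) 1 2)
  also have "ell2_norm (\<lambda>h. - 1 * (T N f h - L f h)) \<le> cmod (-1) * ell2_norm (\<lambda>h. T N f h - L f h)"
   by (rule ell2_smult_le(2)[OF 1(1)])
  finally show "ell2_norm (L f) \<le> (op_norm (T N) + 1) * ell2_norm f"
   using 1(2) op_norm_bound[OF T f, of N] by (simp add: distrib_right)
  show "L (\<lambda>h. c * f h) = (\<lambda>h. c * L f h)" for c
  proof
   fix h
   have "(\<lambda>n. T n (\<lambda>h. c * f h) h) \<longlonglongrightarrow> c * L f h"
    using tendsto_mult_left[OF L[OF f, of h], of c] bounded_opD(3)[OF T f] by simp
   then show "L (\<lambda>h. c * f h) h = c * L f h" using L[OF ell2_smult_le(1)[OF f]] LIMSEQ_unique by blast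
  qed
  fix g :: "'h \<Rightarrow> complex" assume g: "g \<in> ell2"
  show "L (\<lambda>h. f h + g h) = (\<lambda>h. L f h + L g h)"
  proof
   fix h
   have "(\<lambda>n. T n (\<lambda>h. f h + g h) h) \<longlonglongrightarrow> L f h + L g h"
    using tendsto_add[OF L[OF f, of h] L[OF g, of h]] bounded_opD(2)[OF T f g] by simp
   then show "L (\<lambda>h. f h + g h) h = L f h + L g h" using L[OF ell2_add(1)[OF f g]] LIMSEQ_unique by blast
  qed
 qed
 have dbd: "bounded_op (\<lambda>f h. T n f h - L f h)" for n
  using bounded_op_add[OF T bounded_op_smult[OF Lbd, of "-1"], of n] by simp
 have "(\<lambda>n. op_norm (\<lambda>f h. T n f h - L f h)) \<longlonglongrightarrow> 0"
 proof (rule LIMSEQ_I)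
  fix e :: real assume e: "e > 0"
  then have e2: "e / 2 > 0" by simp
  then obtain N where N: "\<And>m n. m \<ge> N ==> n \<ge> N ==> op_norm (\<lambda>f h. T m f h - T n f h) < e / 2" using C by blast
  have "norm (op_norm (\<lambda>f h. T n f h - L f h) - 0) < e" if n: "n \<ge> N" for n
  proof -
   have "op_norm (\<lambda>f h. T n f h - L f h) \<le> e / 2"
    by (rule op_norm_least) (use est[OF e2 N[OF n]] e2 in auto)
   then show ?thesis using op_norm_nonneg[OF dbd, of n] e by simp
  qed
  then show "\<exists>no. \<forall>n\<ge>no. norm (op_norm (\<lambda>f h. T n f h - L f h) - 0) < e" by blast
 qed
 moreover have "op_supp L" by (simp add: L_def)
 ultimately show thesis using that Lbd dbd by blast
qed

lemma ell2_inner_op_limit: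
 assumes D: "\<And>n. bounded_op (\<lambda>f h. T n f h - L f h)" and T: "\<And>n. bounded_op (T n)" and L: "bounded_op L"
  and lim: "(\<lambda>n. op_norm (\<lambda>f h. T n f h - L f h)) \<longlonglongrightarrow> 0" and f: "f \<in> ell2" and g: "g \<in> ell2"
 shows "(\<lambda>n. ell2_inner g (T n f)) \<longlonglongrightarrow> ell2_inner g (L f)"
proof -
 have "(\<lambda>n. ell2_inner g (T n f) - ell2_inner g (L f)) \<longlonglongrightarrow> 0"
 proof (rule tendsto_norm_zero_cancel, rule real_tendsto_sandwich[where f = "\<lambda>_. 0"
    and h = "\<lambda>n. ell2_norm g * (op_norm (\<lambda>f h. T n f h - L f h) * ell2_norm f)"])
  show "(\<lambda>n. ell2_norm g * (op_norm (\<lambda>f h. T n f h - L f h) * ell2_norm f)) \<longlonglongrightarrow> 0"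
   by (intro tendsto_mult_right_zero tendsto_mult_left_zero lim)
  have "norm (ell2_inner g (T n f) - ell2_inner g (L f))
    \<le> ell2_norm g * (op_norm (\<lambda>f h. T n f h - L f h) * ell2_norm f)" for n
  proof -
   have "T n f = (\<lambda>h. L f h + (T n f h - L f h))" by auto
   then have "ell2_inner g (T n f) = ell2_inner g (L f) + ell2_inner g (\<lambda>h. T n f h - L f h)"
    using ell2_inner_add_right[OF g bounded_opD(1)[OF L f] bounded_opD(1)[OF D f], of n] by simp
   then have "norm (ell2_inner g (T n f) - ell2_inner g (L f)) = cmod (ell2_inner g (\<lambda>h. T n f h - L f h))" by simp
   also have "\<dots> \<le> ell2_norm g * ell2_norm (\<lambda>h. T n f h - L f h)"
    by (rule ell2_inner_le[OF g bounded_opD(1)[OF D f]])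
   also have "\<dots> \<le> ell2_norm g * (op_norm (\<lambda>f h. T n f h - L f h) * ell2_norm f)"
    by (intro mult_left_mono op_norm_bound[OF D f]) simp
   finally show ?thesis .
  qed
  then show "\<forall>\<^sub>F n in sequentially. norm (ell2_inner g (T n f) - ell2_inner g (L f))
    \<le> ell2_norm g * (op_norm (\<lambda>f h. T n f h - L f h) * ell2_norm f)" by simp
 qed auto
 then show ?thesis by (simp add: LIM_zero_iff)
qed

theorem cstar_alg_ops: "cstar_alg (ell2_ops :: 'h ell2_op cstar_alg)"
proof
 let ?A = "ell2_ops :: 'h ell2_op cstar_alg"
 interpret cstar_semi ?A op_norm
  by (intro_locales, rule star_alg_ops) (unfold_locales, rule cstar_seminorm_ops)
 show "cstar_algebra ?A"
  unfolding cstar_algebra_def ops_simps(6)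
 proof (intro conjI ballI allI impI)
  fix T assume T: "T \<in> carrier ?A" and 0: "op_norm T = 0"
  have "ell2_norm (T f) = 0" if "f \<in> ell2" for f
   using op_norm_bound[OF ops_star(4)[OF T] that] 0 ell2_norm_nonneg[of "T f"] by simp
  then have "T f = (\<lambda>_. 0)" for f
   using ell2_norm_zeroD bounded_opD(1)[OF ops_star(4)[OF T], of f] ops_zero_out[OF T, of f] by (cases "f \<in> ell2") auto
  then show "T = \<zero>\<^bsub>?A\<^esub>" by (auto simp: ops_simps)
 next
  fix T assume C: "seminorm_Cauchy ?A op_norm T"
  have Tc: "T n \<in> carrier ?A" for n using C by simp
  have C1: "\<exists>N. \<forall>m\<ge>N. \<forall>n\<ge>N. op_norm (\<lambda>f h. T m f h - T n f h) < e" if "e > 0" for e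
   using C that unfolding seminorm_Cauchy_def by (simp add: ops_diff[OF Tc Tc])
  \<comment> \<open>The limit has to be adjointable again. The adjoints also form a Cauchy sequence,
    and their limit turns out to be the adjoint of \<open>L\<close>.\<close>
  have C2: "\<exists>N. \<forall>m\<ge>N. \<forall>n\<ge>N. op_norm (\<lambda>f h. star ?A (T m) f h - star ?A (T n) f h) < e" if "e > 0" for e
  proof -
   have "seminorm_Cauchy ?A op_norm (\<lambda>n. star ?A (T n))" by (rule Cau_star[OF C])
   then show ?thesis using that unfolding seminorm_Cauchy_def
    by (simp add: ops_diff[OF ops_closed(4)[OF Tc Tc] ops_closed(4)[OF Tc Tc]])
  qed
  note S = ops_star[OF Tc]
  obtain L where L: "bounded_op L" "op_supp L" "\<And>n. bounded_op (\<lambda>f h. T n f h - L f h)"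
   "(\<lambda>n. op_norm (\<lambda>f h. T n f h - L f h)) \<longlonglongrightarrow> 0"
   using ops_Cauchy_limit[OF S(4) S(1) C1] by blast
  obtain L' where L': "bounded_op L'" "op_supp L'" "\<And>n. bounded_op (\<lambda>f h. star ?A (T n) f h - L' f h)"
   "(\<lambda>n. op_norm (\<lambda>f h. star ?A (T n) f h - L' f h)) \<longlonglongrightarrow> 0"
   using ops_Cauchy_limit[OF S(5) S(2) C2] by blast
  have "ell2_inner (L' f) g = ell2_inner f (L g)" if f: "f \<in> ell2" and g: "g \<in> ell2" for f g
  proof (rule LIMSEQ_unique)
   have "(\<lambda>n. cnj (ell2_inner g (star ?A (T n) f))) \<longlonglongrightarrow> cnj (ell2_inner g (L' f))"
    by (intro tendsto_cnj ell2_inner_op_limit[OF L'(3) S(5) L'(1,4) f g])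
   then show "(\<lambda>n. ell2_inner f (T n g)) \<longlonglongrightarrow> ell2_inner (L' f) g"
    by (simp flip: ell2_inner_commute add: op_adjD[OF S(3) f g])
  qed (rule ell2_inner_op_limit[OF L(3) S(4) L(1,4) g f])
  then have "L \<in> carrier ?A" using L L' by (intro ops_carrierI[of _ L']) (auto simp: op_adj_def)
  then show "\<exists>L\<in>carrier ?A. (\<lambda>n. op_norm (T n \<ominus>\<^bsub>?A\<^esub> L)) \<longlonglongrightarrow> 0"
   using L(4) by (intro bexI[of _ L]) (simp_all add: ops_diff Tc)
 qed (rule star_algebra_ops cstar_seminorm_ops)+
qed

section \<open>Operators acting on one variable of a product index set\<close>

text \<open>A finite set of pairs lies in a finite rectangle, so bounds on finitely many rows
  control all finite partial sums.\<close>

lemma ell2_rowsI: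
 assumes rows: "\<And>x. (\<lambda>y. F (x, y)) \<in> ell2" and K: "K \<ge> 0"
  and le: "\<And>X. finite X ==> (\<Sum>x\<in>X. (ell2_norm (\<lambda>y. F (x, y)))\<^sup>2) \<le> K\<^sup>2"
 shows "F \<in> ell2" "ell2_norm F \<le> K"
proof -
 have "fin_norm F Z \<le> K" if Z: "finite Z" for Z
 proof -
  have "(\<Sum>z\<in>Z. (cmod (F z))\<^sup>2) \<le> (\<Sum>z\<in>fst ` Z \<times> snd ` Z. (cmod (F z))\<^sup>2)"
   by (rule sum_mono2) (use Z in \<open>auto simp: subset_fst_snd\<close>)
  also have "\<dots> = (\<Sum>x\<in>fst ` Z. \<Sum>y\<in>snd ` Z. (cmod (F (x, y)))\<^sup>2)"
   by (simp add: sum.cartesian_product)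
  also have "\<dots> \<le> (\<Sum>x\<in>fst ` Z. (ell2_norm (\<lambda>y. F (x, y)))\<^sup>2)"
  proof (rule sum_mono)
   fix x
   have "(fin_norm (\<lambda>y. F (x, y)) (snd ` Z))\<^sup>2 \<le> (ell2_norm (\<lambda>y. F (x, y)))\<^sup>2"
    using Z by (intro power_mono fin_norm_le rows) auto
   then show "(\<Sum>y\<in>snd ` Z. (cmod (F (x, y)))\<^sup>2) \<le> (ell2_norm (\<lambda>y. F (x, y)))\<^sup>2"
    by (simp add: L2_set_def sum_nonneg)
  qed
  also have "\<dots> \<le> K\<^sup>2" using Z by (intro le) auto
  finally show ?thesis unfolding L2_set_def using K by (rule real_le_lsqrt[rotated])
 qed
 from ell2I[OF K this] show "F \<in> ell2" "ell2_norm F \<le> K" by simp_all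
qed

lemma ell2_row: assumes F: "F \<in> ell2" shows "(\<lambda>y. F (x, y)) \<in> ell2"
proof (rule ell2I(1)[of "ell2_norm F"])
 fix Y :: "'b set" assume "finite Y"
 have "(\<Sum>y\<in>Y. (cmod (F (x, y)))\<^sup>2) = (\<Sum>z\<in>{x} \<times> Y. (cmod (F z))\<^sup>2)"
  using sum.cartesian_product[of "\<lambda>x y. (cmod (F (x, y)))\<^sup>2" Y "{x}"] by simp
 then have "fin_norm (\<lambda>y. F (x, y)) Y = fin_norm F ({x} \<times> Y)" by (simp add: L2_set_def)
 also have "\<dots> \<le> ell2_norm F" by (rule fin_norm_le[OF F]) (use \<open>finite Y\<close> in simp)
 finally show "fin_norm (\<lambda>y. F (x, y)) Y \<le> ell2_norm F" .
qed simp

text \<open>With the finite set of rows fixed, the second index is exhausted by finite sets; each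
  resulting rectangle contributes at most the squared norm of \<open>F\<close>.\<close>

lemma ell2_rows_sum:
 assumes F: "F \<in> ell2" and X: "finite X"
 shows "(\<Sum>x\<in>X. (ell2_norm (\<lambda>y. F (x, y)))\<^sup>2) \<le> (ell2_norm F)\<^sup>2"
proof -
 have hs: "((\<lambda>y. (cmod (F (x, y)))\<^sup>2) has_sum (ell2_norm (\<lambda>y. F (x, y)))\<^sup>2) UNIV" for x
  using ell2_row[OF F, of x] by (simp add: ell2_norm_sq ell2_def)
 have "((\<lambda>Y. \<Sum>x\<in>X. \<Sum>y\<in>Y. (cmod (F (x, y)))\<^sup>2) \<longlongrightarrow> (\<Sum>x\<in>X. (ell2_norm (\<lambda>y. F (x, y)))\<^sup>2))
   (finite_subsets_at_top UNIV)"
  using hs by (intro tendsto_sum) (simp add: has_sum_def)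
 then show ?thesis
 proof (rule tendsto_upperbound)
  show "\<forall>\<^sub>F Y in finite_subsets_at_top UNIV. (\<Sum>x\<in>X. \<Sum>y\<in>Y. (cmod (F (x, y)))\<^sup>2) \<le> (ell2_norm F)\<^sup>2"
  proof (rule eventually_finite_subsets_at_top_weakI)
   fix Y :: "'b set" assume "finite Y"
   have "(\<Sum>x\<in>X. \<Sum>y\<in>Y. (cmod (F (x, y)))\<^sup>2) = (fin_norm F (X \<times> Y))\<^sup>2"
    by (simp add: L2_set_def sum_nonneg sum.cartesian_product)
   also have "\<dots> \<le> (ell2_norm F)\<^sup>2"
    using X \<open>finite Y\<close> by (intro power_mono fin_norm_le F) auto
   finally show "(\<Sum>x\<in>X. \<Sum>y\<in>Y. (cmod (F (x, y)))\<^sup>2) \<le> (ell2_norm F)\<^sup>2" .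
  qed
 qed (rule finite_subsets_at_top_neq_bot)
qed

lemma ell2_inner_rows:
 assumes "F \<in> ell2" "G \<in> ell2"
 shows "ell2_inner F G = (\<Sum>\<^sub>\<infinity>x. ell2_inner (\<lambda>y. F (x, y)) (\<lambda>y. G (x, y)))"
 unfolding ell2_inner_def
 using infsum_Sigma_banach[of "\<lambda>z. cnj (F z) * G z" UNIV "\<lambda>_. UNIV"] ell2_mult_summable[OF assms] by simp

text \<open>The amplification of \<open>T\<close> by the identity on the first variable, that is, 1
  tensor T.\<close>

definition row_raw :: "'k ell2_op \<Rightarrow> ('h \<times> 'k) ell2_op" where
 "row_raw T F = (\<lambda>(x, y). T (\<lambda>y'. F (x, y')) y)"

definition row_op :: "'k ell2_op \<Rightarrow> ('h \<times> 'k) ell2_op" where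
 "row_op T = op_cut (row_raw T)"

lemma row_raw_row: "(\<lambda>y. row_raw T F (x, y)) = T (\<lambda>y. F (x, y))"
 by (simp add: row_raw_def)

lemma row_raw_ell2:
 assumes T: "bounded_op T" and F: "F \<in> ell2"
 shows "row_raw T F \<in> ell2" "ell2_norm (row_raw T F) \<le> op_norm T * ell2_norm F"
proof -
 have rows: "(\<lambda>y. row_raw T F (x, y)) \<in> ell2" for x
  unfolding row_raw_row by (rule bounded_opD(1)[OF T ell2_row[OF F]])
 have le: "(\<Sum>x\<in>X. (ell2_norm (\<lambda>y. row_raw T F (x, y)))\<^sup>2) \<le> (op_norm T * ell2_norm F)\<^sup>2" if X: "finite X" for X
 proof -
  have "(\<Sum>x\<in>X. (ell2_norm (\<lambda>y. row_raw T F (x, y)))\<^sup>2) \<le> (\<Sum>x\<in>X. (op_norm T * ell2_norm (\<lambda>y. F (x, y)))\<^sup>2)"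
   unfolding row_raw_row by (intro sum_mono power_mono op_norm_bound[OF T] ell2_row[OF F]) simp
  also have "\<dots> = (op_norm T)\<^sup>2 * (\<Sum>x\<in>X. (ell2_norm (\<lambda>y. F (x, y)))\<^sup>2)"
   by (simp add: power_mult_distrib sum_distrib_left)
  also have "\<dots> \<le> (op_norm T)\<^sup>2 * (ell2_norm F)\<^sup>2"
   by (intro mult_left_mono ell2_rows_sum[OF F X]) simp
  finally show ?thesis by (simp add: power_mult_distrib)
 qed
 from ell2_rowsI[OF rows _ le] op_norm_nonneg[OF T]
 show "row_raw T F \<in> ell2" "ell2_norm (row_raw T F) \<le> op_norm T * ell2_norm F" by simp_all
qed

lemma bounded_op_row_raw: assumes T: "bounded_op T" shows "bounded_op (row_raw T)"
proof (rule bounded_opI[where K = "op_norm T"])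
 fix F :: "'b \<times> 'a \<Rightarrow> complex" assume F: "F \<in> ell2"
 show "row_raw T F \<in> ell2" "ell2_norm (row_raw T F) \<le> op_norm T * ell2_norm F"
  by (rule row_raw_ell2[OF T F])+
 show "row_raw T (\<lambda>h. c * F h) = (\<lambda>h. c * row_raw T F h)" for c
  by (auto simp: row_raw_def fun_eq_iff bounded_opD(3)[OF T ell2_row[OF F]])
 fix G :: "'b \<times> 'a \<Rightarrow> complex" assume G: "G \<in> ell2"
 show "row_raw T (\<lambda>h. F h + G h) = (\<lambda>h. row_raw T F h + row_raw T G h)"
  by (auto simp: row_raw_def fun_eq_iff bounded_opD(2)[OF T ell2_row[OF F] ell2_row[OF G]])
qed

lemma op_adj_row_raw: assumes T: "op_adj T T'" shows "op_adj (row_raw T) (row_raw T')"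
 unfolding op_adj_def
proof (intro conjI ballI)
 note B = op_adj_bounded[OF T]
 show "bounded_op (row_raw T)" "bounded_op (row_raw T')" by (rule bounded_op_row_raw[OF B(1)], rule bounded_op_row_raw[OF B(2)])
 fix F G :: "'b \<times> 'a \<Rightarrow> complex" assume F: "F \<in> ell2" and G: "G \<in> ell2"
 show "ell2_inner (row_raw T' F) G = ell2_inner F (row_raw T G)"
  unfolding ell2_inner_rows[OF row_raw_ell2(1)[OF B(2) F] G] ell2_inner_rows[OF F row_raw_ell2(1)[OF B(1) G]] row_raw_row
  by (simp add: op_adjD[OF T ell2_row[OF F] ell2_row[OF G]])
qed

lemma row_op_closed [simp]: assumes "T \<in> carrier ell2_ops" shows "row_op T \<in> carrier ell2_ops"
 unfolding row_op_def
 by (rule ops_carrierI[OF op_cut_supp op_cut_supp op_adj_cut[OF op_adj_row_raw[OF ops_star(3)[OF assms]]]])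

lemma row_op_apply: "F \<in> ell2 ==> row_op T F = row_raw T F"
 by (simp add: row_op_def)

theorem row_op_star_hom: "(row_op :: 'k ell2_op \<Rightarrow> ('h \<times> 'k) ell2_op) \<in> star_hom ell2_ops ell2_ops"
proof (intro star_homI star_mapI)
 fix S T :: "'k ell2_op" assume S: "S \<in> carrier ell2_ops" and T: "T \<in> carrier ell2_ops"
 note bT = ops_star(4)[OF T]
 show "(row_op :: 'k ell2_op \<Rightarrow> ('h \<times> 'k) ell2_op) (S \<oplus>\<^bsub>ell2_ops\<^esub> T) = row_op S \<oplus>\<^bsub>ell2_ops\<^esub> row_op T"
  by (auto simp: ops_simps row_op_def op_cut_def row_raw_def fun_eq_iff)
 show "(row_op :: 'k ell2_op \<Rightarrow> ('h \<times> 'k) ell2_op) (S \<otimes>\<^bsub>ell2_ops\<^esub> T) = row_op S \<otimes>\<^bsub>ell2_ops\<^esub> row_op T"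
 proof (rule ops_eqI)
  fix F :: "'h \<times> 'k \<Rightarrow> complex" assume F: "F \<in> ell2"
  show "(row_op :: 'k ell2_op \<Rightarrow> ('h \<times> 'k) ell2_op) (S \<otimes>\<^bsub>ell2_ops\<^esub> T) F = (row_op S \<otimes>\<^bsub>ell2_ops\<^esub> row_op T) F"
   using row_raw_ell2(1)[OF bT F]
   by (simp add: ops_simps row_op_apply F) (simp add: row_raw_def fun_eq_iff)
 qed (use ops_closed(3)[OF S T] ops_closed(3)[OF row_op_closed[OF S] row_op_closed[OF T]] in \<open>simp_all add: ops_simps\<close>)
next
 fix T :: "'k ell2_op" and c assume T: "T \<in> carrier ell2_ops"
 show "(row_op :: 'k ell2_op \<Rightarrow> ('h \<times> 'k) ell2_op) (c \<odot>\<^bsub>ell2_ops\<^esub> T) = c \<odot>\<^bsub>ell2_ops\<^esub> row_op T"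
  by (auto simp: ops_simps row_op_def op_cut_def row_raw_def fun_eq_iff)
 show "(row_op :: 'k ell2_op \<Rightarrow> ('h \<times> 'k) ell2_op) (star ell2_ops T) = star ell2_ops (row_op T)"
  unfolding row_op_def
  by (rule ops_starI[symmetric, OF op_cut_supp op_adj_cut[OF op_adj_row_raw[OF ops_star(3)[OF T]]]])
next
 show "(row_op :: 'k ell2_op \<Rightarrow> ('h \<times> 'k) ell2_op) \<one>\<^bsub>ell2_ops\<^esub> = \<one>\<^bsub>ell2_ops\<^esub>"
  by (auto simp: ops_simps row_op_def op_cut_def row_raw_def fun_eq_iff ell2_row)
qed simp

text \<open>Conjugation by the unitary \<open>f \<mapsto> f \<circ> g\<close> that identifies the
  two function spaces.\<close>

definition reindex_op :: "('k \<Rightarrow> 'h) \<Rightarrow> 'h ell2_op \<Rightarrow> 'k ell2_op" where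
 "reindex_op g T f = (\<lambda>x. T (\<lambda>h. f (inv_into UNIV g h)) (g x))"

lemma ell2_reindex:
 assumes "bij g"
 shows "(\<lambda>x. f (g x)) \<in> ell2 \<longleftrightarrow> f \<in> ell2" "ell2_norm (\<lambda>x. f (g x)) = ell2_norm f"
  "ell2_inner (\<lambda>x. f (g x)) (\<lambda>x. k (g x)) = ell2_inner f k"
 using summable_on_reindex_bij_betw[OF assms, of "\<lambda>h. (cmod (f h))\<^sup>2"]
  infsum_reindex_bij_betw[OF assms, of "\<lambda>h. (cmod (f h))\<^sup>2"]
  infsum_reindex_bij_betw[OF assms, of "\<lambda>h. cnj (f h) * k h"]
 by (simp_all add: ell2_def ell2_norm_def ell2_inner_def)

lemma op_adj_reindex:
 fixes g :: "'k \<Rightarrow> 'h"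
 assumes g: "bij g" and T: "op_adj T T'" shows "op_adj (reindex_op g T) (reindex_op g T')"
proof -
 have gi: "bij (inv_into UNIV g)" using g by (rule bij_imp_bij_inv)
 note r = ell2_reindex[OF g] and i = ell2_reindex[OF gi]
 have bd: "bounded_op (reindex_op g S)" if S: "bounded_op S" for S
 proof (rule bounded_opI[where K = "op_norm S"])
  fix f :: "'k \<Rightarrow> complex" assume "f \<in> ell2"
  then have f: "(\<lambda>h. f (inv_into UNIV g h)) \<in> ell2" by (simp add: i)
  show "reindex_op g S f \<in> ell2" using bounded_opD(1)[OF S f] by (simp add: reindex_op_def r)
  show "ell2_norm (reindex_op g S f) \<le> op_norm S * ell2_norm f"
   using op_norm_bound[OF S f] by (simp add: reindex_op_def r i)
  show "reindex_op g S (\<lambda>h. c * f h) = (\<lambda>h. c * reindex_op g S f h)" for c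
   using bounded_opD(3)[OF S f] by (simp add: reindex_op_def)
  fix k :: "'k \<Rightarrow> complex" assume "k \<in> ell2"
  then have k: "(\<lambda>h. k (inv_into UNIV g h)) \<in> ell2" by (simp add: i)
  show "reindex_op g S (\<lambda>h. f h + k h) = (\<lambda>h. reindex_op g S f h + reindex_op g S k h)"
   using bounded_opD(2)[OF S f k] by (simp add: reindex_op_def)
 qed
 have "ell2_inner (reindex_op g T' f) k = ell2_inner f (reindex_op g T k)"
  if "f \<in> ell2" "k \<in> ell2" for f k :: "'k \<Rightarrow> complex"
 proof -
  have fk: "(\<lambda>h. f (inv_into UNIV g h)) \<in> ell2" "(\<lambda>h. k (inv_into UNIV g h)) \<in> ell2" using that by (simp_all add: i)
  have eq: "f = (\<lambda>x. f (inv_into UNIV g (g x)))" "k = (\<lambda>x. k (inv_into UNIV g (g x)))" using g by (simp_all add: bij_is_inj)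
  have "ell2_inner (reindex_op g T' f) k = ell2_inner (T' (\<lambda>h. f (inv_into UNIV g h))) (\<lambda>h. k (inv_into UNIV g h))"
   by (subst eq(2)) (simp only: reindex_op_def r(3)[of _ "\<lambda>h. k (inv_into UNIV g h)"])
  also have "\<dots> = ell2_inner (\<lambda>h. f (inv_into UNIV g h)) (T (\<lambda>h. k (inv_into UNIV g h)))" by (rule op_adjD[OF T fk])
  also have "\<dots> = ell2_inner f (reindex_op g T k)"
   by (subst (2) eq(1)) (simp only: reindex_op_def r(3)[of "\<lambda>h. f (inv_into UNIV g h)"])
  finally show ?thesis .
 qed
 then show ?thesis using op_adj_bounded[OF T] bd by (simp add: op_adj_def)
qed

theorem reindex_star_hom:
 fixes g :: "'k \<Rightarrow> 'h"
 assumes g: "bij g" shows "reindex_op g \<in> star_hom ell2_ops ell2_ops"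
proof -
 have gi: "bij (inv_into UNIV g)" using g by (rule bij_imp_bij_inv)
 note r = ell2_reindex[OF g] and i = ell2_reindex[OF gi]
 have supp: "op_supp (reindex_op g T)" if "op_supp T" for T
  using that by (simp add: op_supp_def reindex_op_def i)
 have cl: "reindex_op g T \<in> carrier ell2_ops" if T: "T \<in> carrier ell2_ops" for T
  by (rule ops_carrierI[OF supp[OF ops_star(1)[OF T]] supp[OF ops_star(2)[OF T]] op_adj_reindex[OF g ops_star(3)[OF T]]])
 show ?thesis
 proof (intro star_homI star_mapI cl)
  fix T :: "'h ell2_op" assume T: "T \<in> carrier ell2_ops"
  show "reindex_op g (star ell2_ops T) = star ell2_ops (reindex_op g T)"
   by (rule ops_starI[symmetric, OF supp[OF ops_star(2)[OF T]] op_adj_reindex[OF g ops_star(3)[OF T]]])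
 next
  show "reindex_op g \<one>\<^bsub>ell2_ops\<^esub> = \<one>\<^bsub>ell2_ops\<^esub>"
   using g by (auto simp: ops_simps reindex_op_def op_cut_def i fun_eq_iff bij_is_inj)
 qed (use g in \<open>auto simp: ops_simps reindex_op_def fun_eq_iff bij_is_surj surj_f_inv_f\<close>)
qed

text \<open>S tensor 1, obtained from the amplification in the other variable by swapping; its
  homomorphism property then needs only the one for \<open>row_op\<close> and reindexing.\<close>

definition col_op :: "'h ell2_op \<Rightarrow> ('h \<times> 'k) ell2_op" where
 "col_op S = reindex_op prod.swap (row_op S)"

lemma bij_swap: "bij (prod.swap :: 'a \<times> 'b \<Rightarrow> 'b \<times> 'a)"
 by (rule o_bij[of prod.swap]) (simp_all add: fun_eq_iff)

lemma inv_swap: "inv_into UNIV (prod.swap :: 'a \<times> 'b \<Rightarrow> 'b \<times> 'a) = prod.swap"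
 by (rule inv_unique_comp) (simp_all add: fun_eq_iff)

lemma col_op_star_hom: "col_op \<in> star_hom ell2_ops ell2_ops"
 unfolding col_op_def[abs_def] by (rule star_hom_comp[OF row_op_star_hom reindex_star_hom[OF bij_swap]])

lemma col_op_closed [simp]: "S \<in> carrier ell2_ops ==> col_op S \<in> carrier ell2_ops"
 by (rule star_mapD(1)[OF star_homD(1)[OF col_op_star_hom]])

lemma ell2_swap: "F \<in> ell2 ==> (\<lambda>z. F (prod.swap z)) \<in> ell2"
 by (simp add: ell2_reindex[OF bij_swap])

lemma ell2_col: "F \<in> ell2 ==> (\<lambda>x. F (x, y)) \<in> ell2"
 using ell2_row[OF ell2_swap, of F y] by simp

lemma col_op_apply: "F \<in> ell2 ==> col_op S F (x, y) = S (\<lambda>x'. F (x', y)) x"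
 by (simp add: col_op_def reindex_op_def inv_swap row_op_apply[OF ell2_swap] row_raw_def)

lemma row_op_apply': "F \<in> ell2 ==> row_op T F (x, y) = T (\<lambda>y'. F (x, y')) y"
 by (simp add: row_op_apply row_raw_def)

lemma ell2_tensor: assumes a: "a \<in> ell2" and b: "b \<in> ell2" shows "(\<lambda>(x, y). a x * b y) \<in> ell2"
proof (rule ell2_rowsI(1)[where K = "ell2_norm a * ell2_norm b"])
 fix X :: "'a set" assume X: "finite X"
 have "(\<Sum>x\<in>X. (ell2_norm (\<lambda>y. a x * b y))\<^sup>2) \<le> (\<Sum>x\<in>X. (cmod (a x) * ell2_norm b)\<^sup>2)"
  by (intro sum_mono power_mono ell2_smult_le(2) b) simp
 also have "\<dots> = (fin_norm a X)\<^sup>2 * (ell2_norm b)\<^sup>2"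
  by (simp add: L2_set_def sum_nonneg power_mult_distrib sum_distrib_right)
 also have "\<dots> \<le> (ell2_norm a)\<^sup>2 * (ell2_norm b)\<^sup>2"
  by (intro mult_right_mono power_mono fin_norm_le a X) simp_all
 finally show "(\<Sum>x\<in>X. (ell2_norm (\<lambda>y. case (x, y) of (x, y) \<Rightarrow> a x * b y))\<^sup>2) \<le> (ell2_norm a * ell2_norm b)\<^sup>2"
  by (simp add: power_mult_distrib)
qed (simp_all add: ell2_smult_le(1)[OF b])

text \<open>Each coordinate of \<open>T f\<close> becomes a summable series, which makes Fubini
  applicable when two such operators are interchanged.\<close>

lemma ops_apply_inner:
 assumes "T \<in> carrier ell2_ops" "f \<in> ell2"
 shows "T f h = ell2_inner (star ell2_ops T (\<lambda>x. if x = h then 1 else 0)) f"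
 using op_adjD[OF ops_star(3)[OF assms(1)] ell2_delta assms(2), of h] by (simp add: ell2_inner_delta)

text \<open>Evaluated at \<open>(x, y)\<close>, both sides are the double series over
  \<open>F\<close> with weights \<open>cnj (a x')\<close> and \<open>cnj (b y')\<close>, where
  \<open>a\<close> and \<open>b\<close> are the images of point masses under the adjoints. The two
  sides differ in the order of summation only.\<close>

theorem col_row_commute:
 assumes S: "S \<in> carrier ell2_ops" and T: "T \<in> carrier ell2_ops"
 shows "col_op S \<otimes>\<^bsub>ell2_ops\<^esub> row_op T = row_op T \<otimes>\<^bsub>ell2_ops\<^esub> col_op S"
proof -
 have CS: "col_op S \<in> carrier ell2_ops" and RT: "row_op T \<in> carrier ell2_ops" using S T by simp_all
 have "col_op S (row_op T F) = row_op T (col_op S F)" if F: "F \<in> ell2" for F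
 proof (rule ext, clarify)
  fix x y
  define a where "a = star ell2_ops S (\<lambda>z. if z = x then 1 else 0)"
  define b where "b = star ell2_ops T (\<lambda>z. if z = y then 1 else 0)"
  have a: "a \<in> ell2" unfolding a_def by (rule bounded_opD(1)[OF ops_star(5)[OF S] ell2_delta])
  have b: "b \<in> ell2" unfolding b_def by (rule bounded_opD(1)[OF ops_star(5)[OF T] ell2_delta])
  have RF: "row_op T F \<in> ell2" by (rule bounded_opD(1)[OF ops_star(4)[OF RT] F])
  have CF: "col_op S F \<in> ell2" by (rule bounded_opD(1)[OF ops_star(4)[OF CS] F])
  have sum: "(\<lambda>z. cnj (case z of (x', y') \<Rightarrow> a x' * b y') * F z) summable_on UNIV"
   by (rule ell2_mult_summable[OF ell2_tensor[OF a b] F])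
  have sum: "(\<lambda>(x', y'). cnj (a x') * (cnj (b y') * F (x', y'))) summable_on UNIV \<times> UNIV"
   using sum by (simp add: case_prod_unfold mult.assoc)
  have "col_op S (row_op T F) (x, y) = S (\<lambda>x'. row_op T F (x', y)) x" by (rule col_op_apply[OF RF])
  also have "\<dots> = ell2_inner a (\<lambda>x'. row_op T F (x', y))"
   unfolding a_def by (rule ops_apply_inner[OF S ell2_col[OF RF]])
  also have "(\<lambda>x'. row_op T F (x', y)) = (\<lambda>x'. ell2_inner b (\<lambda>y'. F (x', y')))"
   unfolding row_op_apply'[OF F] b_def by (rule ext, rule ops_apply_inner[OF T ell2_row[OF F]])
  also have "ell2_inner a \<dots> = (\<Sum>\<^sub>\<infinity>x'. \<Sum>\<^sub>\<infinity>y'. cnj (a x') * (cnj (b y') * F (x', y')))"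
   by (simp add: ell2_inner_def infsum_cmult_right')
  also have "\<dots> = (\<Sum>\<^sub>\<infinity>y'. \<Sum>\<^sub>\<infinity>x'. cnj (a x') * (cnj (b y') * F (x', y')))"
   by (rule infsum_swap_banach[OF sum])
  also have "\<dots> = ell2_inner b (\<lambda>y'. ell2_inner a (\<lambda>x'. F (x', y')))"
   by (simp add: ell2_inner_def infsum_cmult_right'[symmetric] mult.left_commute)
  also have "(\<lambda>y'. ell2_inner a (\<lambda>x'. F (x', y'))) = (\<lambda>y'. col_op S F (x, y'))"
   unfolding col_op_apply[OF F] a_def by (rule ext, rule ops_apply_inner[OF S ell2_col[OF F], symmetric])
  also have "ell2_inner b \<dots> = T (\<lambda>y'. col_op S F (x, y')) y"
   unfolding b_def by (rule ops_apply_inner[OF T ell2_row[OF CF], symmetric])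
  also have "\<dots> = row_op T (col_op S F) (x, y)" by (rule row_op_apply'[OF CF, symmetric])
  finally show "col_op S (row_op T F) (x, y) = row_op T (col_op S F) (x, y)" .
 qed
 then show ?thesis
  by (intro ops_eqI) (use ops_closed(3)[OF CS RT] ops_closed(3)[OF RT CS] in \<open>simp_all add: ops_simps\<close>)
qed

text \<open>Translates the pointwise \<open>op_tensor\<close> into a product of two commuting
  elements of the operator algebra, where algebraic computation is possible.\<close>

lemma op_tensor_eq:
 assumes S': "S' \<in> carrier ell2_ops" "\<And>f. f \<in> ell2 ==> S f = S' f"
  and T': "T' \<in> carrier ell2_ops" "\<And>f. f \<in> ell2 ==> T f = T' f" and F: "F \<in> ell2"
 shows "op_tensor S T F = (col_op S' \<otimes>\<^bsub>ell2_ops\<^esub> row_op T') F"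
proof (rule ext, clarify)
 fix x y
 have RF: "row_op T' F \<in> ell2" by (rule bounded_opD(1)[OF ops_star(4)[OF row_op_closed[OF T'(1)]] F])
 have "op_tensor S T F (x, y) = S (\<lambda>x'. row_op T' F (x', y)) x"
  using T'(2)[OF ell2_row[OF F]] by (simp add: op_tensor_def row_op_apply'[OF F])
 also have "\<dots> = col_op S' (row_op T' F) (x, y)"
  using S'(2)[OF ell2_col[OF RF]] by (simp add: col_op_apply[OF RF])
 finally show "op_tensor S T F (x, y) = (col_op S' \<otimes>\<^bsub>ell2_ops\<^esub> row_op T') F (x, y)" by (simp add: ops_simps)
qed

section \<open>Representations and the seminorms they define\<close>

text \<open>A representation is constrained on \<open>ell2\<close> only. Setting its operators to 0
  elsewhere turns its laws into equations between functions.\<close>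

lemma (in star_alg) representation_star_map:
 assumes "representation A \<pi>" shows "(\<lambda>a. op_cut (\<pi> a)) \<in> star_map A ell2_ops"
proof -
 have bd: "bounded_op (\<pi> a)" if "a \<in> carrier A" for a using assms that by (simp add: representation_def)
 have adj: "op_adj (\<pi> a) (\<pi> (star A a))" if "a \<in> carrier A" for a
  using assms that by (simp add: representation_def op_adj_def)
 show ?thesis
 proof (rule star_mapI)
  fix a assume a: "a \<in> carrier A"
  show "op_cut (\<pi> a) \<in> carrier ell2_ops"
   by (rule ops_carrierI[OF op_cut_supp op_cut_supp op_adj_cut[OF adj[OF a]]])
  show "op_cut (\<pi> (star A a)) = star ell2_ops (op_cut (\<pi> a))"
   by (rule ops_starI[symmetric, OF op_cut_supp op_adj_cut[OF adj[OF a]]])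
  show "op_cut (\<pi> (c \<odot> a)) = c \<odot>\<^bsub>ell2_ops\<^esub> op_cut (\<pi> a)" for c
   using assms a by (auto simp: representation_def op_cut_def ops_simps fun_eq_iff)
  fix b assume b: "b \<in> carrier A"
  show "op_cut (\<pi> (a \<oplus> b)) = op_cut (\<pi> a) \<oplus>\<^bsub>ell2_ops\<^esub> op_cut (\<pi> b)"
   using assms a b by (auto simp: representation_def op_cut_def ops_simps fun_eq_iff)
  have "op_cut (\<pi> (a \<otimes> b)) f = op_cut (\<pi> a) (op_cut (\<pi> b) f)" for f
   using assms a b bounded_opD(1)[OF bd[OF b], of f] bounded_op_zero[OF bd[OF a]]
   by (cases "f \<in> ell2") (auto simp: representation_def op_cut_def)
  then show "op_cut (\<pi> (a \<otimes> b)) = op_cut (\<pi> a) \<otimes>\<^bsub>ell2_ops\<^esub> op_cut (\<pi> b)"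
   by (simp add: ops_simps fun_eq_iff)
 qed
qed

lemma star_map_representation:
 fixes h :: "'a \<Rightarrow> 'h ell2_op"
 assumes h: "h \<in> star_map A ell2_ops" shows "representation A h" and "a \<in> carrier A ==> op_cut (h a) = h a"
proof -
 show "representation A h"
  unfolding representation_def
 proof (intro conjI ballI allI)
  fix a and f g :: "'h \<Rightarrow> complex" assume a: "a \<in> carrier A" and f: "f \<in> ell2" and g: "g \<in> ell2"
  show "ell2_inner (h (star A a) f) g = ell2_inner f (h a g)"
   using op_adjD[OF ops_star(3)[OF star_mapD(1)[OF h a]] f g] by (simp add: star_mapD(5)[OF h a])
 qed (simp_all add: star_mapD[OF h] ops_star ops_simps)
 assume "a \<in> carrier A"
 then show "op_cut (h a) = h a"
  using ops_star(1)[OF star_mapD(1)[OF h]] by (auto simp: op_cut_def op_supp_def fun_eq_iff)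
qed

lemma ops_finsum_apply:
 assumes "finite I" "T \<in> I \<rightarrow> carrier ell2_ops"
 shows "finsum ell2_ops T I f h = (\<Sum>i\<in>I. T i f h)"
proof -
 interpret star_alg ell2_ops by (rule star_alg_ops)
 show ?thesis using assms
  by (induction I rule: finite_induct) (simp_all add: Pi_iff ops_simps(3,4))
qed

text \<open>A monoid with involution and a family of *-representations \<open>rho i\<close> of it, each of which
 agrees on \<^const>\<open>ell2\<close> with \<open>raw i\<close>.\<close>

locale spatial = star_monoid M s for M :: "('m, 'z) monoid_scheme" (structure) and s +
 fixes I :: "'i set" and raw rho :: "'i \<Rightarrow> 'm \<Rightarrow> 'h ell2_op"
 assumes I_ne: "I \<noteq> {}"
  and rho_closed: "i \<in> I ==> m \<in> carrier M ==> rho i m \<in> carrier ell2_ops"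
  and raw_rho: "i \<in> I ==> m \<in> carrier M ==> f \<in> ell2 ==> raw i m f = rho i m f"
  and rho_mult: "i \<in> I ==> m \<in> carrier M ==> n \<in> carrier M ==> rho i (m \<otimes> n) = rho i m \<otimes>\<^bsub>ell2_ops\<^esub> rho i n"
  and rho_star: "i \<in> I ==> m \<in> carrier M ==> rho i (s m) = star ell2_ops (rho i m)"
  and rho_bound: "m \<in> carrier M ==> \<exists>K. \<forall>i\<in>I. op_norm (rho i m) \<le> K"
begin

interpretation Ops: cstar_alg "ell2_ops :: 'h ell2_op cstar_alg" by (rule cstar_alg_ops)

lemma rho_funcset: "i \<in> I ==> rho i \<in> carrier M \<rightarrow> carrier ell2_ops"
 using rho_closed by auto

lemma lin_rho: "i \<in> I ==> lin ell2_ops (rho i) \<in> star_map MA ell2_ops"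
 by (rule lin_star_map[OF Ops.star_alg_axioms rho_funcset]) (simp_all add: rho_mult rho_star)

lemma rep_seminorm_eq:
 assumes x: "x \<in> carrier MA"
 shows "rep_seminorm (raw ` I) x = (SUP i\<in>I. op_norm (lin ell2_ops (rho i) x))"
 unfolding rep_seminorm_def image_image
proof (rule SUP_cong[OF refl], rule op_norm_cong)
 fix i and f :: "'h \<Rightarrow> complex" assume i: "i \<in> I" and f: "f \<in> ell2"
 have k: "m \<in> carrier M" if "m \<in> Poly_Mapping.keys x" for m using x that by (auto simp: carrier_MA)
 have "lin ell2_ops (rho i) x f h
   = (\<Sum>m\<in>Poly_Mapping.keys x. (Poly_Mapping.lookup x m \<odot>\<^bsub>ell2_ops\<^esub> rho i m) f h)" for h
  unfolding lin_def by (rule ops_finsum_apply) (use k rho_closed[OF i] in auto)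
 then show "(\<lambda>h. \<Sum>m\<in>Poly_Mapping.keys x. Poly_Mapping.lookup x m * raw i m f h) = lin ell2_ops (rho i) x f"
  using k by (auto simp: ops_simps raw_rho[OF i _ f] fun_eq_iff intro!: sum.cong)
qed

text \<open>The uniform bound \<open>rho_bound\<close> on basis elements spreads to finite
  combinations, so the supremum over the representations is genuine.\<close>

lemma lin_rho_bounded: "x \<in> carrier MA ==> \<exists>K. \<forall>i\<in>I. op_norm (lin ell2_ops (rho i) x) \<le> K"
proof (induction x rule: MA_induct)
 case zero
 then show ?case
  using Ops.p_zero by (intro exI[of _ 0]) (simp add: lin_zero[OF Ops.star_alg_axioms rho_funcset] ops_simps(6))
next
 case (single m c)
 obtain K where K: "\<And>i. i \<in> I ==> op_norm (rho i m) \<le> K" using rho_bound[OF single] by blast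
 have "op_norm (lin ell2_ops (rho i) (Poly_Mapping.single m c)) \<le> cmod c * K" if i: "i \<in> I" for i
  using Ops.p_smult[OF rho_closed[OF i single], of c] K[OF i]
  by (simp add: lin_single[OF Ops.star_alg_axioms rho_funcset[OF i] single] ops_simps(6) mult_left_mono)
 then show ?case by blast
next
 case (add x y)
 obtain K where K: "\<And>i. i \<in> I ==> op_norm (lin ell2_ops (rho i) x) \<le> K" using add by blast
 obtain L where L: "\<And>i. i \<in> I ==> op_norm (lin ell2_ops (rho i) y) \<le> L" using add by blast
 have "op_norm (lin ell2_ops (rho i) (x + y)) \<le> K + L" if i: "i \<in> I" for i
  using Ops.p_add[of "lin ell2_ops (rho i) x" "lin ell2_ops (rho i) y"] K[OF i] L[OF i]
   lin_closed[OF Ops.star_alg_axioms rho_funcset[OF i] add(1)]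
   lin_closed[OF Ops.star_alg_axioms rho_funcset[OF i] add(2)]
  by (simp add: lin_add[OF Ops.star_alg_axioms rho_funcset[OF i] add(1,2)] ops_simps(6))
 then show ?case by blast
qed

lemma cstar_seminorm_rep: "cstar_seminorm MA (rep_seminorm (raw ` I))"
proof -
 let ?P = "(\<lambda>i x. op_norm (lin ell2_ops (rho i) x)) ` I"
 have "cstar_seminorm MA (\<lambda>x. SUP q\<in>?P. q x)"
 proof (rule MA.cstar_seminorm_Sup)
  fix q assume "q \<in> ?P"
  then obtain i where i: "i \<in> I" "q = (\<lambda>x. op_norm (lin ell2_ops (rho i) x))" by blast
  show "cstar_seminorm MA q"
   using Ops.pullback_seminorm[OF MA.star_alg_axioms lin_rho[OF i(1)]] by (simp add: i(2) ops_simps(6))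
 qed (use I_ne lin_rho_bounded in auto)
 then have "cstar_seminorm MA (\<lambda>x. SUP i\<in>I. op_norm (lin ell2_ops (rho i) x))"
  by (simp add: image_image)
 then show ?thesis
  unfolding cstar_seminorm_def
  using rep_seminorm_eq MA.m_closed MA.star_closed MA.smult_closed MA.a_closed by simp
qed

sublocale star_monoid_semi M s "rep_seminorm (raw ` I)"
 by unfold_locales (rule cstar_seminorm_rep)

lemma lin_rho_le: "i \<in> I ==> x \<in> carrier MA ==> op_norm (lin ell2_ops (rho i) x) \<le> rep_seminorm (raw ` I) x"
proof -
 assume i: "i \<in> I" and x: "x \<in> carrier MA"
 obtain K where "\<forall>i\<in>I. op_norm (lin ell2_ops (rho i) x) \<le> K" using lin_rho_bounded[OF x] ..
 then have "bdd_above ((\<lambda>i. op_norm (lin ell2_ops (rho i) x)) ` I)"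
  by (intro bdd_aboveI2[of I _ K]) simp
 then show ?thesis unfolding rep_seminorm_eq[OF x] by (rule cSUP_upper[OF i])
qed

lemma rho_extension:
 assumes i: "i \<in> I"
 obtains h where "h \<in> star_map MC ell2_ops" "\<And>m. m \<in> carrier M ==> h (elem m) = rho i m"
proof -
 have "cnorm ell2_ops (lin ell2_ops (rho i) x) \<le> rep_seminorm (raw ` I) x" if "x \<in> carrier MA" for x
  using lin_rho_le[OF i that] by (simp add: ops_simps(6))
 from MC_lift[OF cstar_alg_ops rho_funcset[OF i] rho_mult[OF i] rho_star[OF i] this] that show thesis by blast
qed

text \<open>The norm of the completion is the supremum over the extended representations. An element
  is approximated within \<open>e / 2\<close> from the dense algebra; this error enters once inside
  the representation, by contractivity, and once in the completion.\<close>

lemma cnorm_leI: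
 assumes y: "y \<in> carrier MC"
  and le: "\<And>i h. \<lbrakk>i \<in> I; h \<in> star_map MC ell2_ops; \<And>m. m \<in> carrier M ==> h (elem m) = rho i m\<rbrakk> \<Longrightarrow> op_norm (h y) \<le> K"
 shows "cnorm MC y \<le> K"
proof (rule field_le_epsilon)
 fix e :: real assume e: "e > 0"
 have "e / 2 > 0" using e by simp
 then obtain x where x: "x \<in> carrier MA" "cnorm MC (y \<ominus>\<^bsub>MC\<^esub> to_completion MA (rep_seminorm (raw ` I)) x) < e / 2"
  using MA.to_completion_dense y unfolding norm_dense_def by blast
 define t where "t = to_completion MA (rep_seminorm (raw ` I)) x"
 have t: "t \<in> carrier MC" unfolding t_def by (rule star_mapD(1)[OF to_MC_map x(1)])
 have "rep_seminorm (raw ` I) x \<le> K + e / 2"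
  unfolding rep_seminorm_eq[OF x(1)]
 proof (rule cSUP_least[OF I_ne])
  fix i assume i: "i \<in> I"
  obtain h where h: "h \<in> star_map MC ell2_ops" "\<And>m. m \<in> carrier M ==> h (elem m) = rho i m"
   using rho_extension[OF i] by blast
  have "lin ell2_ops (rho i) x = h t"
   unfolding t_def
   by (rule lin_eqI[OF Ops.star_alg_axioms rho_funcset[OF i] star_map_comp[OF to_MC_map h(1)] _ x(1), symmetric])
    (use h(2) in \<open>simp add: elem_def\<close>)
  moreover have "op_norm (h t) \<le> op_norm (h y) + op_norm (h (y \<ominus>\<^bsub>MC\<^esub> t))"
   using Ops.p_le_diff[of "h t" "h y"] Ops.p_diff_commute[of "h t" "h y"] star_mapD(1)[OF h(1)] y t
   by (simp add: MC.star_map_diff[OF Ops.star_alg_axioms h(1)] ops_simps(6))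
  moreover have "op_norm (h (y \<ominus>\<^bsub>MC\<^esub> t)) \<le> cnorm MC (y \<ominus>\<^bsub>MC\<^esub> t)"
   using MC.star_map_contractive[OF Ops.cstar_semi_axioms h(1), of "y \<ominus>\<^bsub>MC\<^esub> t"] y t by (simp add: ops_simps(6))
  ultimately show "op_norm (lin ell2_ops (rho i) x) \<le> K + e / 2"
   using le[OF i h] x(2) by (simp add: t_def)
 qed
 then have "cnorm MC t \<le> K + e / 2" unfolding t_def using MA.cnorm_to_completion[OF x(1)] by simp
 then show "cnorm MC y \<le> K + e"
  using MC.p_le_diff[OF y t] x(2) unfolding t_def by simp
qed

end

section \<open>Minimal tensor products\<close>

text \<open>Lets a transport of one tensor leg along a bijection be undone without disturbing the
  other leg.\<close>

lemma reindex_col: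
 assumes j: "bij j" and l: "bij l" and S: "S \<in> carrier ell2_ops"
 shows "reindex_op (map_prod j l) (col_op S) = col_op (reindex_op j S)"
  and "reindex_op (map_prod j l) (row_op S') = row_op (reindex_op l S')"
proof -
 have b: "bij (map_prod j l)" using j l by (simp add: bij_def prod.inj_map map_prod_surj)
 have bi: "bij (inv_into UNIV (map_prod j l))" using b by (rule bij_imp_bij_inv)
 have inv: "inv_into UNIV (map_prod j l) = map_prod (inv_into UNIV j) (inv_into UNIV l)"
  by (rule inv_unique_comp) (use j l in \<open>auto simp: fun_eq_iff bij_is_inj bij_is_surj surj_f_inv_f\<close>)
 have e: "(\<lambda>h. F (inv_into UNIV (map_prod j l) h)) \<in> ell2 \<longleftrightarrow> F \<in> ell2" for F by (rule ell2_reindex(1)[OF bi])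
 show "reindex_op (map_prod j l) (row_op S') = row_op (reindex_op l S')"
 proof (rule ext, rule ext, clarify)
  fix F x y
  show "reindex_op (map_prod j l) (row_op S') F (x, y) = row_op (reindex_op l S') F (x, y)"
   using j by (auto simp: reindex_op_def row_op_def op_cut_def e row_raw_def)
    (auto simp: inv bij_is_inj)
 qed
 have cl: "reindex_op j S \<in> carrier ell2_ops"
  by (rule star_mapD(1)[OF star_homD(1)[OF reindex_star_hom[OF j]] S])
 have cl2: "reindex_op (map_prod j l) (col_op S) \<in> carrier ell2_ops"
  by (rule star_mapD(1)[OF star_homD(1)[OF reindex_star_hom[OF b]] col_op_closed[OF S]])
 show "reindex_op (map_prod j l) (col_op S) = col_op (reindex_op j S)"
 proof (rule ops_eqI[OF cl2 col_op_closed[OF cl]], rule ext, clarify)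
  fix F :: "'a \<times> 'c \<Rightarrow> complex" and x y assume F: "F \<in> ell2"
  have F': "(\<lambda>h. F (inv_into UNIV (map_prod j l) h)) \<in> ell2" using F by (simp add: e)
  show "reindex_op (map_prod j l) (col_op S) F (x, y) = col_op (reindex_op j S) F (x, y)"
   unfolding col_op_apply[OF F]
   using l by (simp add: reindex_op_def col_op_apply[OF F']) (simp add: inv bij_is_inj)
 qed
qed

lemma reindex_op_inverse: "bij k ==> reindex_op (inv_into UNIV k) (reindex_op k T) = T"
 by (auto simp: reindex_op_def fun_eq_iff bij_is_inj bij_is_surj surj_f_inv_f inv_inv_eq)

text \<open>Functions of three variables are nested to the right, while a map on the first two legs
  produces nesting to the left; this bijection mediates.\<close>

definition assoc :: "'a \<times> ('b \<times> 'c) \<Rightarrow> ('a \<times> 'b) \<times> 'c" where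
 "assoc = (\<lambda>(x, (y, z)). ((x, y), z))"

lemma bij_assoc: "bij assoc"
 by (rule o_bij[of "\<lambda>((x, y), z). (x, (y, z))"]) (auto simp: assoc_def fun_eq_iff)

lemma inv_assoc: "inv_into UNIV assoc = (\<lambda>((x, y), z). (x, (y, z)))"
 by (rule inv_unique_comp) (auto simp: assoc_def fun_eq_iff)

lemma reindex_assoc_closed: "S \<in> carrier ell2_ops ==> reindex_op assoc S \<in> carrier ell2_ops"
 by (rule star_mapD(1)[OF star_homD(1)[OF reindex_star_hom[OF bij_assoc]]])

lemma ell2_assoc: "F \<in> ell2 ==> (\<lambda>h. F (inv_into UNIV assoc h)) \<in> ell2"
 using ell2_reindex(1)[OF bij_imp_bij_inv[OF bij_assoc]] by blast

lemma reindex_assoc: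
 fixes T :: "'t ell2_op"
 assumes T: "T \<in> carrier ell2_ops"
 shows "reindex_op (assoc :: 'h \<times> ('k \<times> 't) \<Rightarrow> _) (row_op T) = row_op (row_op T)"
  and "reindex_op (assoc :: 'h \<times> ('t \<times> 'l) \<Rightarrow> _) (col_op (row_op T)) = row_op (col_op T)"
  and "reindex_op (assoc :: 't \<times> ('k \<times> 'l) \<Rightarrow> _) (col_op (col_op T)) = col_op T"
proof -
 note U = reindex_assoc_closed and F' = ell2_assoc
 have 1: "assoc (x, y, z) = ((x, y), z)" for x :: 'h and y :: 'k and z :: 't by (simp add: assoc_def)
 have 2: "assoc (x, y, z) = ((x, y), z)" for x :: 'h and y :: 't and z :: 'l by (simp add: assoc_def)
 have 3: "assoc (x, y, z) = ((x, y), z)" for x :: 't and y :: 'k and z :: 'l by (simp add: assoc_def)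
 show "reindex_op (assoc :: 'h \<times> ('k \<times> 't) \<Rightarrow> _) (row_op T) = row_op (row_op T)"
 proof (rule ops_eqI[OF U[OF row_op_closed[OF T]] row_op_closed[OF row_op_closed[OF T]]], rule ext, clarify)
  fix F :: "'h \<times> 'k \<times> 't \<Rightarrow> complex" and x y z assume F: "F \<in> ell2"
  show "reindex_op assoc (row_op T) F (x, y, z) = row_op (row_op T) F (x, y, z)"
   unfolding row_op_apply'[OF F] row_op_apply'[OF ell2_row[OF F]] reindex_op_def 1 row_op_apply'[OF F'[OF F]]
   by (simp add: inv_assoc)
 qed
 show "reindex_op (assoc :: 'h \<times> ('t \<times> 'l) \<Rightarrow> _) (col_op (row_op T)) = row_op (col_op T)"
 proof (rule ops_eqI[OF U[OF col_op_closed[OF row_op_closed[OF T]]] row_op_closed[OF col_op_closed[OF T]]], rule ext, clarify)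
  fix F :: "'h \<times> 't \<times> 'l \<Rightarrow> complex" and x y z assume F: "F \<in> ell2"
  show "reindex_op assoc (col_op (row_op T)) F (x, y, z) = row_op (col_op T) F (x, y, z)"
   unfolding row_op_apply'[OF F] col_op_apply[OF ell2_row[OF F]] reindex_op_def 2
    col_op_apply[OF F'[OF F]] row_op_apply'[OF ell2_col[OF F'[OF F]]]
   by (simp add: inv_assoc)
 qed
 show "reindex_op (assoc :: 't \<times> ('k \<times> 'l) \<Rightarrow> _) (col_op (col_op T)) = col_op T"
 proof (rule ops_eqI[OF U[OF col_op_closed[OF col_op_closed[OF T]]] col_op_closed[OF T]], rule ext, clarify)
  fix F :: "'t \<times> 'k \<times> 'l \<Rightarrow> complex" and x y z assume F: "F \<in> ell2"
  show "reindex_op assoc (col_op (col_op T)) F (x, y, z) = col_op T F (x, y, z)"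
   unfolding col_op_apply[OF F] reindex_op_def 3
    col_op_apply[OF F'[OF F]] col_op_apply[OF ell2_col[OF F'[OF F]]]
   by (simp add: inv_assoc)
 qed
qed

lemma ops_star_closed [simp]: "T \<in> carrier ell2_ops ==> star ell2_ops T \<in> carrier ell2_ops"
 by (rule ops_closed(4))

text \<open>Stated for a monoid with involution, because pairs form a basis of the formal tensor
  algebra; bilinearity in the pairs appears only after completion.\<close>

definition star_rep :: "('m, 'z) monoid_scheme \<Rightarrow> ('m \<Rightarrow> 'm) \<Rightarrow> ('m \<Rightarrow> 'h ell2_op) \<Rightarrow> bool" where
 "star_rep M s \<rho> \<longleftrightarrow> (\<forall>m\<in>carrier M. \<rho> m \<in> carrier ell2_ops \<and> \<rho> (s m) = star ell2_ops (\<rho> m) \<and>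
   (\<forall>n\<in>carrier M. \<rho> (m \<otimes>\<^bsub>M\<^esub> n) = \<rho> m \<otimes>\<^bsub>ell2_ops\<^esub> \<rho> n))"

text \<open>The tensor product of two representations on elementary tensors, as a product of its
  legs. Iterating it gives the threefold case.\<close>

definition prod_rep :: "('m \<Rightarrow> 'h ell2_op) \<Rightarrow> ('n \<Rightarrow> 'k ell2_op) \<Rightarrow> 'm \<times> 'n \<Rightarrow> ('h \<times> 'k) ell2_op" where
 "prod_rep \<alpha> \<beta> = (\<lambda>(a, b). col_op (\<alpha> a) \<otimes>\<^bsub>ell2_ops\<^esub> row_op (\<beta> b))"

lemma star_map_star_rep: "\<pi> \<in> star_map A ell2_ops ==> star_rep A (star A) \<pi>"
 by (simp add: star_rep_def star_mapD)

lemma star_rep_prod: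
 fixes \<alpha> :: "'m \<Rightarrow> 'h ell2_op" and \<beta> :: "'n \<Rightarrow> 'k ell2_op"
 assumes \<alpha>: "star_rep M s \<alpha>" and \<beta>: "star_rep N t \<beta>"
 shows "star_rep (M \<times>\<times> N) (\<lambda>(a, b). (s a, t b)) (prod_rep \<alpha> \<beta>)"
proof -
 interpret Ops: cstar_alg "ell2_ops :: ('h \<times> 'k) ell2_op cstar_alg" by (rule cstar_alg_ops)
 note C = star_mapD[OF star_homD(1)[OF col_op_star_hom]] and R = star_mapD[OF star_homD(1)[OF row_op_star_hom]]
 have c: "\<alpha> a \<in> carrier ell2_ops" if "a \<in> carrier M" for a using \<alpha> that by (simp add: star_rep_def)
 have d: "\<beta> b \<in> carrier ell2_ops" if "b \<in> carrier N" for b using \<beta> that by (simp add: star_rep_def)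
 show ?thesis
  unfolding star_rep_def
 proof (intro ballI conjI, goal_cases)
  case (1 x)
  then show ?case using c d by (cases x) (auto simp: prod_rep_def C R)
 next
  case (2 x)
  then obtain a b where x: "x = (a, b)" "a \<in> carrier M" "b \<in> carrier N" by (cases x) auto
  have "star ell2_ops (col_op (\<alpha> a) \<otimes>\<^bsub>ell2_ops\<^esub> row_op (\<beta> b))
    = row_op (star ell2_ops (\<beta> b)) \<otimes>\<^bsub>ell2_ops\<^esub> col_op (star ell2_ops (\<alpha> a))"
   using x c d by (simp add: Ops.star_mult C R)
  also have "\<dots> = col_op (star ell2_ops (\<alpha> a)) \<otimes>\<^bsub>ell2_ops\<^esub> row_op (star ell2_ops (\<beta> b))"
   using x c d by (intro col_row_commute[symmetric]) auto
  finally show ?case using \<alpha> \<beta> x by (simp add: prod_rep_def star_rep_def)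
 next
  case (3 x y)
  then obtain a b a' b' where x: "x = (a, b)" "a \<in> carrier M" "b \<in> carrier N"
   and y: "y = (a', b')" "a' \<in> carrier M" "b' \<in> carrier N" by (cases x; cases y) auto
  have "prod_rep \<alpha> \<beta> (x \<otimes>\<^bsub>M \<times>\<times> N\<^esub> y)
    = (col_op (\<alpha> a) \<otimes>\<^bsub>ell2_ops\<^esub> col_op (\<alpha> a')) \<otimes>\<^bsub>ell2_ops\<^esub> (row_op (\<beta> b) \<otimes>\<^bsub>ell2_ops\<^esub> row_op (\<beta> b'))"
   using \<alpha> \<beta> x y by (simp add: prod_rep_def star_rep_def C R)
  also have "\<dots> = col_op (\<alpha> a) \<otimes>\<^bsub>ell2_ops\<^esub> (col_op (\<alpha> a') \<otimes>\<^bsub>ell2_ops\<^esub> row_op (\<beta> b)) \<otimes>\<^bsub>ell2_ops\<^esub> row_op (\<beta> b')"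
   using x y c d by (simp add: Ops.m_assoc)
  also have "col_op (\<alpha> a') \<otimes>\<^bsub>ell2_ops\<^esub> row_op (\<beta> b) = row_op (\<beta> b) \<otimes>\<^bsub>ell2_ops\<^esub> col_op (\<alpha> a')"
   using x y c d by (intro col_row_commute) auto
  also have "col_op (\<alpha> a) \<otimes>\<^bsub>ell2_ops\<^esub> (row_op (\<beta> b) \<otimes>\<^bsub>ell2_ops\<^esub> col_op (\<alpha> a')) \<otimes>\<^bsub>ell2_ops\<^esub> row_op (\<beta> b')
    = prod_rep \<alpha> \<beta> x \<otimes>\<^bsub>ell2_ops\<^esub> prod_rep \<alpha> \<beta> y"
   using x y c d by (simp add: prod_rep_def Ops.m_assoc)
  finally show ?case .
 qed
qed

lemma op_norm_star_map:
 assumes "W \<in> star_map ell2_ops ell2_ops" "T \<in> carrier ell2_ops" shows "op_norm (W T) \<le> op_norm T"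
 using cstar_alg.star_map_contractive[OF cstar_alg_ops
   cstar_semi.intro[OF star_alg_ops cstar_semi_axioms.intro[OF cstar_seminorm_ops]] assms]
 by (simp add: ops_simps(6))

lemma prod_rep_norm:
 fixes \<alpha> :: "'m \<Rightarrow> 'h ell2_op" and \<beta> :: "'n \<Rightarrow> 'k ell2_op"
 assumes a: "\<alpha> a \<in> carrier ell2_ops" "op_norm (\<alpha> a) \<le> K" and b: "\<beta> b \<in> carrier ell2_ops" "op_norm (\<beta> b) \<le> L"
 shows "op_norm (prod_rep \<alpha> \<beta> (a, b)) \<le> K * L"
proof -
 let ?C = "col_op (\<alpha> a) :: ('h \<times> 'k) ell2_op" and ?R = "row_op (\<beta> b) :: ('h \<times> 'k) ell2_op"
 interpret Ops: cstar_alg "ell2_ops :: ('h \<times> 'k) ell2_op cstar_alg" by (rule cstar_alg_ops)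
 have C: "op_norm ?C \<le> K"
  using op_norm_star_map[OF star_homD(1)[OF col_op_star_hom] a(1)] a(2) by (rule order_trans)
 have R: "op_norm ?R \<le> L"
  using op_norm_star_map[OF star_homD(1)[OF row_op_star_hom] b(1)] b(2) by (rule order_trans)
 have "op_norm (prod_rep \<alpha> \<beta> (a, b)) \<le> op_norm ?C * op_norm ?R"
  using Ops.p_mult[of ?C ?R] a b by (simp add: prod_rep_def ops_simps(6))
 also have "\<dots> \<le> K * L"
  using C R op_norm_nonneg[OF ops_star(4)[OF a(1)]] a(2) op_norm_nonneg[OF ops_star(4)[OF row_op_closed[OF b(1)]]]
  by (intro mult_mono) auto
 finally show ?thesis .
qed

lemma star_monoid_DirProd:
 assumes "star_monoid M s" "star_monoid N t"
 shows "star_monoid (M \<times>\<times> N) (\<lambda>(a, b). (s a, t b))"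
proof -
 interpret M: star_monoid M s by fact
 interpret N: star_monoid N t by fact
 interpret Group.monoid "M \<times>\<times> N" by (rule DirProd_monoid) unfold_locales
 show ?thesis
  by unfold_locales (auto simp: M.s_mult N.s_mult)
qed

lemma (in star_alg) star_monoid: "star_monoid A (star A)"
 by unfold_locales (simp_all add: star_mult)

text \<open>Linear contractions rather than *-maps, so as to include multiplication by a fixed
  operator of norm at most 1. Such a factor arises as the image of the unit under a possibly
  degenerate representation.\<close>

definition contraction :: "('h ell2_op \<Rightarrow> 'k ell2_op) \<Rightarrow> bool" where
 "contraction W \<longleftrightarrow> W \<in> carrier ell2_ops \<rightarrow> carrier ell2_ops \<and>
   (\<forall>x\<in>carrier ell2_ops. op_norm (W x) \<le> op_norm x \<and> (\<forall>c. W (c \<odot>\<^bsub>ell2_ops\<^esub> x) = c \<odot>\<^bsub>ell2_ops\<^esub> W x) \<and>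
    (\<forall>y\<in>carrier ell2_ops. W (x \<oplus>\<^bsub>ell2_ops\<^esub> y) = W x \<oplus>\<^bsub>ell2_ops\<^esub> W y))"

lemma contraction_id: "contraction (\<lambda>x. x)"
 by (simp add: contraction_def)

lemma contraction_comp: "contraction V ==> contraction W ==> contraction (\<lambda>x. W (V x))"
proof -
 assume V: "contraction V" and W: "contraction W"
 have "op_norm (W (V x)) \<le> op_norm x" if "x \<in> carrier ell2_ops" for x
 proof -
  have "V x \<in> carrier ell2_ops" "op_norm (V x) \<le> op_norm x" using V that by (auto simp: contraction_def)
  moreover from this(1) have "op_norm (W (V x)) \<le> op_norm (V x)" using W by (simp add: contraction_def)
  ultimately show ?thesis by linarith
 qed
 with V W show ?thesis by (auto simp: contraction_def Pi_iff)
qed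

lemma contraction_star_map: assumes "W \<in> star_map ell2_ops ell2_ops" shows "contraction W"
proof -
 interpret Ops: cstar_alg "ell2_ops :: 'a ell2_op cstar_alg" by (rule cstar_alg_ops)
 interpret Ops': cstar_alg "ell2_ops :: 'b ell2_op cstar_alg" by (rule cstar_alg_ops)
 show ?thesis
  using Ops.star_map_contractive[OF Ops'.cstar_semi_axioms assms] star_mapD[OF assms]
  by (auto simp: contraction_def ops_simps(6))
qed

lemma contraction_mult:
 assumes T: "T \<in> carrier ell2_ops" "op_norm T \<le> 1"
 shows "contraction (\<lambda>x. x \<otimes>\<^bsub>ell2_ops\<^esub> T)" "contraction (\<lambda>x. T \<otimes>\<^bsub>ell2_ops\<^esub> x)"
proof -
 interpret Ops: cstar_alg ell2_ops by (rule cstar_alg_ops)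
 have "op_norm (x \<otimes>\<^bsub>ell2_ops\<^esub> T) \<le> op_norm x" "op_norm (T \<otimes>\<^bsub>ell2_ops\<^esub> x) \<le> op_norm x" if x: "x \<in> carrier ell2_ops" for x
 proof -
  have x0: "0 \<le> op_norm x" by (rule op_norm_nonneg[OF ops_star(4)[OF x]])
  have "op_norm (x \<otimes>\<^bsub>ell2_ops\<^esub> T) \<le> op_norm x * op_norm T" "op_norm (T \<otimes>\<^bsub>ell2_ops\<^esub> x) \<le> op_norm T * op_norm x"
   using Ops.p_mult[OF x T(1)] Ops.p_mult[OF T(1) x] by (simp_all add: ops_simps(6))
  moreover have "op_norm x * op_norm T \<le> op_norm x * 1" using T x0 by (intro mult_left_mono)
  ultimately show "op_norm (x \<otimes>\<^bsub>ell2_ops\<^esub> T) \<le> op_norm x" "op_norm (T \<otimes>\<^bsub>ell2_ops\<^esub> x) \<le> op_norm x"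
   by (simp_all add: mult.commute)
 qed
 then show "contraction (\<lambda>x. x \<otimes>\<^bsub>ell2_ops\<^esub> T)" "contraction (\<lambda>x. T \<otimes>\<^bsub>ell2_ops\<^esub> x)"
  using T by (simp_all add: contraction_def Ops.l_distr Ops.r_distr Ops.smult_mult_left Ops.smult_mult_right)
qed

text \<open>If a representation \<open>\<Psi>\<close> of the target, evaluated on
  \<open>\<phi>\<close>, is a contractive linear image of one of the representations
  \<open>rho i\<close>, then by linearity the same holds on all formal combinations, and the
  seminorm defined by the family bounds it.\<close>

lemma (in spatial) factor_bound:
 assumes D: "star_alg D" and \<phi>: "\<phi> \<in> carrier M \<rightarrow> carrier D" and i: "i \<in> I"
  and \<Psi>: "\<Psi> \<in> star_map D ell2_ops" and W: "contraction W"
  and eq: "\<And>m. m \<in> carrier M ==> \<Psi> (\<phi> m) = W (rho i m)" and x: "x \<in> carrier MA"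
 shows "op_norm (\<Psi> (lin D \<phi> x)) \<le> rep_seminorm (raw ` I) x"
proof -
 interpret D: star_alg D by fact
 interpret Ops: cstar_alg "ell2_ops :: 'h ell2_op cstar_alg" by (rule cstar_alg_ops)
 note R = Ops.star_alg_axioms rho_funcset[OF i]
 have W_in: "T \<in> carrier ell2_ops ==> W T \<in> carrier ell2_ops" for T using W by (auto simp: contraction_def)
 have "\<Psi> (lin D \<phi> x) = W (lin ell2_ops (rho i) x)"
  using x
 proof (induction x rule: MA_induct)
  case zero
  have z: "\<Psi> \<zero>\<^bsub>D\<^esub> = \<zero>\<^bsub>ell2_ops\<^esub>" by (rule D.star_map_zero[OF star_alg_ops \<Psi>])
  have "W (0 \<odot>\<^bsub>ell2_ops\<^esub> \<zero>\<^bsub>ell2_ops\<^esub>) = 0 \<odot>\<^bsub>ell2_ops\<^esub> W \<zero>\<^bsub>ell2_ops\<^esub>"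
   using W Ops.zero_closed unfolding contraction_def by blast
  also have "\<dots> = \<zero>\<^bsub>ell2_ops\<^esub>"
   by (rule star_alg.smult_zero_left[OF star_alg_ops W_in[OF Ops.zero_closed]])
  finally have "W \<zero>\<^bsub>ell2_ops\<^esub> = \<zero>\<^bsub>ell2_ops\<^esub>" by simp
  then show ?case using z by (simp add: lin_zero[OF R] lin_zero[OF D \<phi>])
 next
  case (single m c)
  then show ?case
   using W rho_closed[OF i single] funcset_mem[OF \<phi> single]
   by (simp add: lin_single[OF R] lin_single[OF D \<phi>] star_mapD(4)[OF \<Psi>] eq contraction_def)
 next
  case (add x y)
  then show ?case
   using W lin_closed[OF R add(1)] lin_closed[OF R add(2)] lin_closed[OF D \<phi> add(1)] lin_closed[OF D \<phi> add(2)]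
   by (simp add: lin_add[OF R] lin_add[OF D \<phi>] star_mapD(2)[OF \<Psi>] contraction_def)
 qed
 moreover have "op_norm (W (lin ell2_ops (rho i) x)) \<le> op_norm (lin ell2_ops (rho i) x)"
  using W lin_closed[OF R x] by (simp add: contraction_def)
 ultimately show ?thesis using lin_rho_le[OF i x] by simp
qed

section \<open>Twofold tensor products and their universal property\<close>

locale tens2 = A: cstar_alg A + B: cstar_alg B
 for A :: "('a, 'm) cstar_alg_scheme" and B :: "('b, 'n) cstar_alg_scheme"
begin

abbreviation s2 :: "'a \<times> 'b \<Rightarrow> 'a \<times> 'b" where "s2 \<equiv> \<lambda>(a, b). (star A a, star B b)"
abbreviation I2 :: "(('a \<Rightarrow> 'a ell2_op) \<times> ('b \<Rightarrow> 'b ell2_op)) set" where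
 "I2 \<equiv> {(\<pi>, \<rho>). representation A \<pi> \<and> representation B \<rho>}"
abbreviation raw2 :: "('a \<Rightarrow> 'a ell2_op) \<times> ('b \<Rightarrow> 'b ell2_op) \<Rightarrow> 'a \<times> 'b \<Rightarrow> ('a \<times> 'b) ell2_op" where
 "raw2 \<equiv> \<lambda>(\<pi>, \<rho>) (a, b). op_tensor (\<pi> a) (\<rho> b)"
abbreviation rho2 :: "('a \<Rightarrow> 'a ell2_op) \<times> ('b \<Rightarrow> 'b ell2_op) \<Rightarrow> 'a \<times> 'b \<Rightarrow> ('a \<times> 'b) ell2_op" where
 "rho2 \<equiv> \<lambda>(\<pi>, \<rho>). prod_rep (\<lambda>a. op_cut (\<pi> a)) (\<lambda>b. op_cut (\<rho> b))"

text \<open>Degenerate representations are allowed, so this one keeps the index set of the spatial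
  norm nonempty.\<close>

lemma zero_representation: "representation A (\<lambda>_ _ _. 0)"
 by (auto simp: representation_def bounded_op_def ell2_inner_def intro!: exI[of _ 0])

lemma rep_contractive:
 assumes "representation A \<pi>" "a \<in> carrier A"
 shows "op_cut (\<pi> a) \<in> carrier ell2_ops" "op_norm (op_cut (\<pi> a)) \<le> cnorm A a"
proof -
 note h = A.representation_star_map[OF assms(1)]
 show "op_cut (\<pi> a) \<in> carrier ell2_ops" by (rule star_mapD(1)[OF h assms(2)])
 have semi: "cstar_semi ell2_ops op_norm"
  by (rule cstar_semi.intro[OF star_alg_ops cstar_semi_axioms.intro[OF cstar_seminorm_ops]])
 show "op_norm (op_cut (\<pi> a)) \<le> cnorm A a"
  using A.star_map_contractive[OF semi h assms(2)] .
qed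

end

text \<open>By symmetry, the facts about representations of the first factor become available for
  the second.\<close>

sublocale tens2 \<subseteq> BA: tens2 B A by unfold_locales

sublocale tens2 \<subseteq> T: spatial "A \<times>\<times> B" s2 I2 raw2 rho2
proof -
 interpret star_monoid "A \<times>\<times> B" s2 by (rule star_monoid_DirProd[OF A.star_monoid B.star_monoid])
 have sr: "star_rep (A \<times>\<times> B) s2 (rho2 i)" if "i \<in> I2" for i
  using that star_rep_prod[OF star_map_star_rep[OF A.representation_star_map] star_map_star_rep[OF B.representation_star_map]]
  by (cases i) auto
 show "spatial (A \<times>\<times> B) s2 I2 raw2 rho2"
 proof unfold_locales
  show "I2 \<noteq> {}" using zero_representation BA.zero_representation by blast
 next
  fix i m assume i: "i \<in> I2" and m: "m \<in> carrier (A \<times>\<times> B)"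
  show "rho2 i m \<in> carrier ell2_ops" "rho2 i (s2 m) = star ell2_ops (rho2 i m)"
   using sr[OF i] m by (auto simp: star_rep_def)
  show "rho2 i (m \<otimes>\<^bsub>A \<times>\<times> B\<^esub> n) = rho2 i m \<otimes>\<^bsub>ell2_ops\<^esub> rho2 i n" if "n \<in> carrier (A \<times>\<times> B)" for n
   using sr[OF i] m that by (auto simp: star_rep_def)
  fix f :: "'a \<times> 'b \<Rightarrow> complex" assume f: "f \<in> ell2"
  show "raw2 i m f = rho2 i m f"
   using i m rep_contractive(1) BA.rep_contractive(1)
   by (cases i; cases m) (auto simp: prod_rep_def intro!: op_tensor_eq f)
 next
  fix m assume "m \<in> carrier (A \<times>\<times> B)"
  then obtain a b where m: "m = (a, b)" "a \<in> carrier A" "b \<in> carrier B" by (cases m) auto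
  have "op_norm (rho2 i m) \<le> cnorm A a * cnorm B b" if "i \<in> I2" for i
   using that rep_contractive BA.rep_contractive m by (cases i) (auto intro!: prod_rep_norm)
  then show "\<exists>K. \<forall>i\<in>I2. op_norm (rho2 i m) \<le> K" by blast
 qed
qed

context tens2
begin

lemma spatial2_eq: "spatial2 A B = rep_seminorm (raw2 ` I2)"
 unfolding spatial2_def by (rule arg_cong[where f = rep_seminorm]) (auto simp: image_iff)

lemma min_tensor2_eq: "min_tensor2 A B = T.MC"
 unfolding min_tensor2_def formal_tensor2_def spatial2_eq by (rule refl)

lemma tensor2_eq: "tensor2 A B a b = T.elem (a, b)"
 unfolding tensor2_def T.elem_def formal_tensor2_def spatial2_eq by (rule refl)

lemma cstar_alg_tensor2: "cstar_alg (min_tensor2 A B)"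
 unfolding min_tensor2_eq by (rule T.MC.cstar_alg_axioms)

lemma tensor2_closed [simp]: "a \<in> carrier A ==> b \<in> carrier B ==> tensor2 A B a b \<in> carrier (min_tensor2 A B)"
 unfolding min_tensor2_eq tensor2_eq by (rule T.elem_closed) simp

lemma tensor2_mult:
 "\<lbrakk>a \<in> carrier A; b \<in> carrier B; a' \<in> carrier A; b' \<in> carrier B\<rbrakk> \<Longrightarrow>
  tensor2 A B a b \<otimes>\<^bsub>min_tensor2 A B\<^esub> tensor2 A B a' b' = tensor2 A B (a \<otimes>\<^bsub>A\<^esub> a') (b \<otimes>\<^bsub>B\<^esub> b')"
 unfolding min_tensor2_eq tensor2_eq using T.elem_mult[of "(a, b)" "(a', b')"] by simp

lemma tensor2_star:
 "\<lbrakk>a \<in> carrier A; b \<in> carrier B\<rbrakk> \<Longrightarrow> star (min_tensor2 A B) (tensor2 A B a b) = tensor2 A B (star A a) (star B b)"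
 unfolding min_tensor2_eq tensor2_eq using T.elem_star[of "(a, b)"] by simp

lemma tensor2_one: "tensor2 A B \<one>\<^bsub>A\<^esub> \<one>\<^bsub>B\<^esub> = \<one>\<^bsub>min_tensor2 A B\<^esub>"
 unfolding min_tensor2_eq tensor2_eq using T.elem_one by simp

lemma tensor2_rep:
 assumes \<pi>: "\<pi> \<in> star_map A (ell2_ops :: 'a ell2_op cstar_alg)" and \<rho>: "\<rho> \<in> star_map B (ell2_ops :: 'b ell2_op cstar_alg)"
 obtains h where "h \<in> star_map (min_tensor2 A B) ell2_ops"
  "\<And>a b. a \<in> carrier A ==> b \<in> carrier B ==> h (tensor2 A B a b) = prod_rep \<pi> \<rho> (a, b)"
proof -
 have i: "(\<pi>, \<rho>) \<in> I2" using star_map_representation(1)[OF \<pi>] star_map_representation(1)[OF \<rho>] by simp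
 obtain h where h: "h \<in> star_map T.MC ell2_ops" "\<And>m. m \<in> carrier (A \<times>\<times> B) ==> h (T.elem m) = rho2 (\<pi>, \<rho>) m"
  using T.rho_extension[OF i] by blast
 show thesis
  by (rule that[of h])
   (use h star_map_representation(2)[OF \<pi>] star_map_representation(2)[OF \<rho>] in \<open>simp_all add: min_tensor2_eq tensor2_eq prod_rep_def\<close>)
qed

lemma tensor2_norm_leI:
 assumes y: "y \<in> carrier (min_tensor2 A B)"
  and le: "\<And>\<pi> \<rho> h. \<lbrakk>\<pi> \<in> star_map A (ell2_ops :: 'a ell2_op cstar_alg); \<rho> \<in> star_map B (ell2_ops :: 'b ell2_op cstar_alg);
   h \<in> star_map (min_tensor2 A B) ell2_ops;
   \<And>a b. a \<in> carrier A ==> b \<in> carrier B ==> h (tensor2 A B a b) = prod_rep \<pi> \<rho> (a, b)\<rbrakk> \<Longrightarrow> op_norm (h y) \<le> K"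
 shows "cnorm (min_tensor2 A B) y \<le> K"
 unfolding min_tensor2_eq
proof (rule T.cnorm_leI)
 show "y \<in> carrier T.MC" using y by (simp add: min_tensor2_eq)
 fix i h assume i: "i \<in> I2" and h: "h \<in> star_map T.MC ell2_ops" "\<And>m. m \<in> carrier (A \<times>\<times> B) ==> h (T.elem m) = rho2 i m"
 obtain \<pi> \<rho> where i': "i = (\<pi>, \<rho>)" "representation A \<pi>" "representation B \<rho>" using i by (cases i) auto
 show "op_norm (h y) \<le> K"
  by (rule le[OF A.representation_star_map[OF i'(2)] B.representation_star_map[OF i'(3)]])
   (use h i' in \<open>simp_all add: min_tensor2_eq tensor2_eq\<close>)
qed

lemma tensor2_lin_map_eqI:
 assumes "cstar_alg D" "f \<in> lin_map (min_tensor2 A B) D" "g \<in> lin_map (min_tensor2 A B) D"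
  and "\<And>a b. a \<in> carrier A ==> b \<in> carrier B ==> f (tensor2 A B a b) = g (tensor2 A B a b)"
  and "x \<in> carrier (min_tensor2 A B)"
 shows "f x = g x"
 by (rule T.MC_lin_map_eqI[OF assms(1)]) (use assms(2-) in \<open>auto simp: min_tensor2_eq tensor2_eq\<close>)

text \<open>\<open>Reps\<close> is a family of representations that computes the norm of the target,
  and \<open>factor\<close> brings each of them under \<open>factor_bound\<close>. Uniqueness in the
  definite description follows from density of the span of elementary tensors together with
  \<open>extensional\<close>.\<close>

theorem tensor_lift:
 fixes D :: "('d, 'l) cstar_alg_scheme" and Reps :: "('d \<Rightarrow> 'h ell2_op) set"
 assumes D: "cstar_alg D" and \<phi>: "\<And>a b. a \<in> carrier A ==> b \<in> carrier B ==> \<phi> a b \<in> carrier D"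
  and mult: "\<And>a b a' b'. \<lbrakk>a \<in> carrier A; b \<in> carrier B; a' \<in> carrier A; b' \<in> carrier B\<rbrakk> \<Longrightarrow>
   \<phi> (a \<otimes>\<^bsub>A\<^esub> a') (b \<otimes>\<^bsub>B\<^esub> b') = \<phi> a b \<otimes>\<^bsub>D\<^esub> \<phi> a' b'"
  and star: "\<And>a b. a \<in> carrier A ==> b \<in> carrier B ==> \<phi> (star A a) (star B b) = star D (\<phi> a b)"
  and one: "\<phi> \<one>\<^bsub>A\<^esub> \<one>\<^bsub>B\<^esub> = \<one>\<^bsub>D\<^esub>"
  and norming: "\<And>y K. y \<in> carrier D ==> (\<And>\<Psi>. \<Psi> \<in> Reps ==> op_norm (\<Psi> y) \<le> K) ==> cnorm D y \<le> K"
  and Reps: "\<And>\<Psi>. \<Psi> \<in> Reps ==> \<Psi> \<in> star_map D ell2_ops"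
  and factor: "\<And>\<Psi>. \<Psi> \<in> Reps ==> \<exists>\<pi>\<in>star_map A (ell2_ops :: 'a ell2_op cstar_alg).
   \<exists>\<rho>\<in>star_map B (ell2_ops :: 'b ell2_op cstar_alg). \<exists>W. contraction W \<and>
    (\<forall>a\<in>carrier A. \<forall>b\<in>carrier B. \<Psi> (\<phi> a b) = W (prod_rep \<pi> \<rho> (a, b)))"
 shows "tensor_lift A B D \<phi> \<in> star_hom (min_tensor2 A B) D"
  and "\<And>a b. a \<in> carrier A ==> b \<in> carrier B ==> tensor_lift A B D \<phi> (tensor2 A B a b) = \<phi> a b"
proof -
 interpret D: cstar_alg D by fact
 interpret M2: cstar_alg "min_tensor2 A B" by (rule cstar_alg_tensor2)
 define f where "f = (\<lambda>(a, b). \<phi> a b)"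
 have f: "f \<in> carrier (A \<times>\<times> B) \<rightarrow> carrier D" using \<phi> by (auto simp: f_def)
 have le: "cnorm D (lin D f x) \<le> rep_seminorm (raw2 ` I2) x" if x: "x \<in> carrier T.MA" for x
 proof (rule norming)
  show "lin D f x \<in> carrier D" by (rule T.lin_closed[OF D.star_alg_axioms f x])
  fix \<Psi> assume \<Psi>: "\<Psi> \<in> Reps"
  obtain \<pi> \<rho> W where \<pi>: "\<pi> \<in> star_map A (ell2_ops :: 'a ell2_op cstar_alg)"
   and \<rho>: "\<rho> \<in> star_map B (ell2_ops :: 'b ell2_op cstar_alg)" and W: "contraction W"
   and eq: "\<And>a b. a \<in> carrier A ==> b \<in> carrier B ==> \<Psi> (\<phi> a b) = W (prod_rep \<pi> \<rho> (a, b))"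
   using factor[OF \<Psi>] by blast
  have i: "(\<pi>, \<rho>) \<in> I2" using star_map_representation(1)[OF \<pi>] star_map_representation(1)[OF \<rho>] by simp
  show "op_norm (\<Psi> (lin D f x)) \<le> rep_seminorm (raw2 ` I2) x"
  proof (rule T.factor_bound[OF D.star_alg_axioms f i Reps[OF \<Psi>] W _ x])
   fix m assume "m \<in> carrier (A \<times>\<times> B)"
   then show "\<Psi> (f m) = W (rho2 (\<pi>, \<rho>) m)"
    using eq star_map_representation(2)[OF \<pi>] star_map_representation(2)[OF \<rho>]
    by (auto simp: f_def prod_rep_def)
  qed
 qed
 have f1: "f (m \<otimes>\<^bsub>A \<times>\<times> B\<^esub> n) = f m \<otimes>\<^bsub>D\<^esub> f n" if "m \<in> carrier (A \<times>\<times> B)" "n \<in> carrier (A \<times>\<times> B)" for m n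
  using that mult by (auto simp: f_def)
 have f2: "f (s2 m) = star D (f m)" if "m \<in> carrier (A \<times>\<times> B)" for m
  using that star by (auto simp: f_def)
 have "\<exists>h. h \<in> star_map T.MC D \<and> (\<forall>m\<in>carrier (A \<times>\<times> B). h (T.elem m) = f m)"
 proof (rule T.MC_lift[OF D f f1 f2 le])
  fix h assume "h \<in> star_map T.MC D" "\<And>m. m \<in> carrier (A \<times>\<times> B) ==> h (T.elem m) = f m"
  then show ?thesis by blast
 qed assumption+
 then obtain h where h: "h \<in> star_map T.MC D" "\<And>m. m \<in> carrier (A \<times>\<times> B) ==> h (T.elem m) = f m"
  by blast
 have h2: "h (tensor2 A B a b) = \<phi> a b" if "a \<in> carrier A" "b \<in> carrier B" for a b
 proof -
  have "(a, b) \<in> carrier (A \<times>\<times> B)" using that by simp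
  from h(2)[OF this] show ?thesis unfolding tensor2_eq f_def by simp
 qed
 have "h \<one>\<^bsub>min_tensor2 A B\<^esub> = \<one>\<^bsub>D\<^esub>"
  using h2[of "\<one>\<^bsub>A\<^esub>" "\<one>\<^bsub>B\<^esub>"] by (simp add: tensor2_one one)
 then have h1: "h \<in> star_hom (min_tensor2 A B) D"
  using h(1) unfolding min_tensor2_eq[symmetric] by (rule star_homI[rotated])
 \<comment> \<open>Restriction makes the map extensional, the form in which the definite description
   is unique.\<close>
 define r where "r = restrict h (carrier (min_tensor2 A B))"
 let ?Q = "\<lambda>h. h \<in> star_hom (min_tensor2 A B) D \<and> h \<in> extensional (carrier (min_tensor2 A B)) \<and>
       (\<forall>a\<in>carrier A. \<forall>b\<in>carrier B. h (tensor2 A B a b) = \<phi> a b)"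
 have "r \<in> star_map (min_tensor2 A B) D"
  by (rule M2.star_map_cong[OF star_homD(1)[OF h1]]) (simp add: r_def)
 then have r: "?Q r" using h1 h2 by (simp add: r_def star_hom_iff)
 have "tensor_lift A B D \<phi> = r"
  unfolding tensor_lift_def
 proof (rule the_equality)
  show "?Q r" by (rule r)
  fix g assume g: "?Q g"
  show "g = r"
  proof (rule extensionalityI)
   show "g \<in> extensional (carrier (min_tensor2 A B))" "r \<in> extensional (carrier (min_tensor2 A B))"
    using g r by blast+
   fix x assume x: "x \<in> carrier (min_tensor2 A B)"
   show "g x = r x"
    by (rule tensor2_lin_map_eqI[OF D _ _ _ x])
     (use g r in \<open>auto intro!: M2.star_map_lin_map[OF D] star_homD(1)\<close>)
  qed
 qed
 with r show "tensor_lift A B D \<phi> \<in> star_hom (min_tensor2 A B) D"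
  "\<And>a b. a \<in> carrier A ==> b \<in> carrier B ==> tensor_lift A B D \<phi> (tensor2 A B a b) = \<phi> a b" by simp_all
qed

end

context tens2
begin

interpretation M: cstar_alg "min_tensor2 A B" by (rule cstar_alg_tensor2)

text \<open>Product representations compute the norm and therefore separate points. Bilinearity of
  elementary tensors, which fails for formal combinations of pairs, is obtained from this.\<close>

lemma tensor2_eqI:
 assumes y: "y \<in> carrier (min_tensor2 A B)" "y' \<in> carrier (min_tensor2 A B)"
  and eq: "\<And>\<pi> \<rho> h. \<lbrakk>\<pi> \<in> star_map A (ell2_ops :: 'a ell2_op cstar_alg); \<rho> \<in> star_map B (ell2_ops :: 'b ell2_op cstar_alg);
   h \<in> star_map (min_tensor2 A B) ell2_ops;
   \<And>a b. a \<in> carrier A ==> b \<in> carrier B ==> h (tensor2 A B a b) = prod_rep \<pi> \<rho> (a, b)\<rbrakk> \<Longrightarrow> h y = h y'"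
 shows "y = y'"
proof (rule M.cnorm_diff_eq_0D[OF y])
 have "cnorm (min_tensor2 A B) (y \<ominus>\<^bsub>min_tensor2 A B\<^esub> y') \<le> 0"
 proof (rule tensor2_norm_leI)
  fix \<pi> \<rho> and h :: "('a, 'b) tensor2_elem \<Rightarrow> ('a \<times> 'b) ell2_op"
  assume h: "\<pi> \<in> star_map A (ell2_ops :: 'a ell2_op cstar_alg)" "\<rho> \<in> star_map B (ell2_ops :: 'b ell2_op cstar_alg)"
   "h \<in> star_map (min_tensor2 A B) ell2_ops"
   "\<And>a b. a \<in> carrier A ==> b \<in> carrier B ==> h (tensor2 A B a b) = prod_rep \<pi> \<rho> (a, b)"
  interpret Ops: cstar_alg "ell2_ops :: ('a \<times> 'b) ell2_op cstar_alg" by (rule cstar_alg_ops)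
  have "h (y \<ominus>\<^bsub>min_tensor2 A B\<^esub> y') = \<zero>\<^bsub>ell2_ops\<^esub>"
   using M.star_map_diff[OF Ops.star_alg_axioms h(3) y] eq[OF h] star_mapD(1)[OF h(3) y(2)] by simp
  then show "op_norm (h (y \<ominus>\<^bsub>min_tensor2 A B\<^esub> y')) \<le> 0" using Ops.p_zero by (simp add: ops_simps(6))
 qed (use y in simp)
 then show "cnorm (min_tensor2 A B) (y \<ominus>\<^bsub>min_tensor2 A B\<^esub> y') = 0"
  by (rule antisym[OF _ M.p_nonneg]) (use y in simp)
qed

lemma tensor2_add_left:
 assumes "a \<in> carrier A" "a' \<in> carrier A" "b \<in> carrier B"
 shows "tensor2 A B (a \<oplus>\<^bsub>A\<^esub> a') b = tensor2 A B a b \<oplus>\<^bsub>min_tensor2 A B\<^esub> tensor2 A B a' b"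
proof -
 interpret Ops: cstar_alg "ell2_ops :: ('a \<times> 'b) ell2_op cstar_alg" by (rule cstar_alg_ops)
 note C = star_mapD[OF star_homD(1)[OF col_op_star_hom]] and R = star_mapD[OF star_homD(1)[OF row_op_star_hom]]
 show ?thesis
  by (rule tensor2_eqI)
   (use assms in \<open>simp_all add: star_mapD prod_rep_def C R Ops.l_distr\<close>)
qed

lemma tensor2_add_right:
 assumes "a \<in> carrier A" "b \<in> carrier B" "b' \<in> carrier B"
 shows "tensor2 A B a (b \<oplus>\<^bsub>B\<^esub> b') = tensor2 A B a b \<oplus>\<^bsub>min_tensor2 A B\<^esub> tensor2 A B a b'"
proof -
 interpret Ops: cstar_alg "ell2_ops :: ('a \<times> 'b) ell2_op cstar_alg" by (rule cstar_alg_ops)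
 note C = star_mapD[OF star_homD(1)[OF col_op_star_hom]] and R = star_mapD[OF star_homD(1)[OF row_op_star_hom]]
 show ?thesis
  by (rule tensor2_eqI)
   (use assms in \<open>simp_all add: star_mapD prod_rep_def C R Ops.r_distr\<close>)
qed

lemma tensor2_smult_left:
 assumes "a \<in> carrier A" "b \<in> carrier B"
 shows "tensor2 A B (c \<odot>\<^bsub>A\<^esub> a) b = c \<odot>\<^bsub>min_tensor2 A B\<^esub> tensor2 A B a b"
proof -
 interpret Ops: cstar_alg "ell2_ops :: ('a \<times> 'b) ell2_op cstar_alg" by (rule cstar_alg_ops)
 note C = star_mapD[OF star_homD(1)[OF col_op_star_hom]] and R = star_mapD[OF star_homD(1)[OF row_op_star_hom]]
 show ?thesis
  by (rule tensor2_eqI)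
   (use assms in \<open>simp_all add: star_mapD prod_rep_def C R Ops.smult_mult_left\<close>)
qed

lemma tensor2_smult_right:
 assumes "a \<in> carrier A" "b \<in> carrier B"
 shows "tensor2 A B a (c \<odot>\<^bsub>B\<^esub> b) = c \<odot>\<^bsub>min_tensor2 A B\<^esub> tensor2 A B a b"
proof -
 interpret Ops: cstar_alg "ell2_ops :: ('a \<times> 'b) ell2_op cstar_alg" by (rule cstar_alg_ops)
 note C = star_mapD[OF star_homD(1)[OF col_op_star_hom]] and R = star_mapD[OF star_homD(1)[OF row_op_star_hom]]
 show ?thesis
  by (rule tensor2_eqI)
   (use assms in \<open>simp_all add: star_mapD prod_rep_def C R Ops.smult_mult_right\<close>)
qed

lemmas tensor2_bilinear = tensor2_add_left tensor2_add_right tensor2_smult_left tensor2_smult_right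

lemma left_leg: "(\<lambda>a. tensor2 A B a \<one>\<^bsub>B\<^esub>) \<in> star_hom A (min_tensor2 A B)"
 by (intro star_homI star_mapI) (simp_all add: tensor2_one tensor2_mult tensor2_star tensor2_bilinear)

lemma right_leg: "(\<lambda>b. tensor2 A B \<one>\<^bsub>A\<^esub> b) \<in> star_hom B (min_tensor2 A B)"
 by (intro star_homI star_mapI) (simp_all add: tensor2_one tensor2_mult tensor2_star tensor2_bilinear)

definition reps2 :: "(('a, 'b) tensor2_elem \<Rightarrow> ('a \<times> 'b) ell2_op) set" where
 "reps2 = {h \<in> star_map (min_tensor2 A B) ell2_ops.
   \<exists>\<pi>\<in>star_map A (ell2_ops :: 'a ell2_op cstar_alg). \<exists>\<rho>\<in>star_map B (ell2_ops :: 'b ell2_op cstar_alg).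
    \<forall>a\<in>carrier A. \<forall>b\<in>carrier B. h (tensor2 A B a b) = prod_rep \<pi> \<rho> (a, b)}"

lemma reps2_norming:
 assumes "y \<in> carrier (min_tensor2 A B)" "\<And>h. h \<in> reps2 ==> op_norm (h y) \<le> K"
 shows "cnorm (min_tensor2 A B) y \<le> K"
 by (rule tensor2_norm_leI[OF assms(1)], rule assms(2)) (auto simp: reps2_def)

end

text \<open>Functoriality needs \<open>A\<close>, \<open>C\<close> and \<open>B\<close>, \<open>D\<close> to have the same element types, so that a
 representation of the target pulls back to one on the \<open>\<ell>\<^sup>2\<close> space used for the source.\<close>

lemma tensor_map_star_hom:
 fixes A :: "('a, 'm) cstar_alg_scheme" and B :: "('b, 'n) cstar_alg_scheme"
  and C :: "('a, 'k) cstar_alg_scheme" and D :: "('b, 'l) cstar_alg_scheme"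
 assumes "cstar_alg A" "cstar_alg B" "cstar_alg C" "cstar_alg D"
  and f: "f \<in> star_hom A C" and g: "g \<in> star_hom B D"
 shows "tensor_map A B C D f g \<in> star_hom (min_tensor2 A B) (min_tensor2 C D)"
  and "\<And>a b. a \<in> carrier A ==> b \<in> carrier B ==> tensor_map A B C D f g (tensor2 A B a b) = tensor2 C D (f a) (g b)"
proof -
 interpret AB: tens2 A B using assms by (simp add: tens2_def)
 interpret CD: tens2 C D using assms by (simp add: tens2_def)
 note F = star_mapD[OF star_homD(1)[OF f]] star_homD(2)[OF f]
 note G = star_mapD[OF star_homD(1)[OF g]] star_homD(2)[OF g]
 have factor: "\<exists>\<pi>\<in>star_map A (ell2_ops :: 'a ell2_op cstar_alg). \<exists>\<rho>\<in>star_map B (ell2_ops :: 'b ell2_op cstar_alg). \<exists>W. contraction W \<and>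
   (\<forall>a\<in>carrier A. \<forall>b\<in>carrier B. \<Psi> (tensor2 C D (f a) (g b)) = W (prod_rep \<pi> \<rho> (a, b)))"
  if \<Psi>: "\<Psi> \<in> CD.reps2" for \<Psi>
 proof -
  obtain \<pi> \<rho> where \<pi>: "\<pi> \<in> star_map C (ell2_ops :: 'a ell2_op cstar_alg)" and \<rho>: "\<rho> \<in> star_map D (ell2_ops :: 'b ell2_op cstar_alg)"
   and eq: "\<And>a b. a \<in> carrier C ==> b \<in> carrier D ==> \<Psi> (tensor2 C D a b) = prod_rep \<pi> \<rho> (a, b)"
   using \<Psi> unfolding CD.reps2_def by blast
  show ?thesis
  proof (intro bexI exI conjI ballI)
   show "(\<lambda>a. \<pi> (f a)) \<in> star_map A ell2_ops" by (rule star_map_comp[OF star_homD(1)[OF f] \<pi>])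
   show "(\<lambda>b. \<rho> (g b)) \<in> star_map B ell2_ops" by (rule star_map_comp[OF star_homD(1)[OF g] \<rho>])
   show "contraction (\<lambda>x. x)" by (rule contraction_id)
   fix a b assume "a \<in> carrier A" "b \<in> carrier B"
   then show "\<Psi> (tensor2 C D (f a) (g b)) = prod_rep (\<lambda>a. \<pi> (f a)) (\<lambda>b. \<rho> (g b)) (a, b)"
    by (simp add: eq F G prod_rep_def)
  qed
 qed
 show "tensor_map A B C D f g \<in> star_hom (min_tensor2 A B) (min_tensor2 C D)"
  unfolding tensor_map_def
  by (rule AB.tensor_lift(1)[OF CD.cstar_alg_tensor2 _ _ _ _ CD.reps2_norming _ factor])
   (simp_all add: F G CD.tensor2_mult CD.tensor2_star CD.tensor2_one, simp add: CD.reps2_def)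
 show "\<And>a b. a \<in> carrier A ==> b \<in> carrier B ==> tensor_map A B C D f g (tensor2 A B a b) = tensor2 C D (f a) (g b)"
  unfolding tensor_map_def
  by (rule AB.tensor_lift(2)[OF CD.cstar_alg_tensor2 _ _ _ _ CD.reps2_norming _ factor])
   (simp_all add: F G CD.tensor2_mult CD.tensor2_star CD.tensor2_one, simp add: CD.reps2_def)
qed

section \<open>Threefold tensor products and the leg maps\<close>

locale tens3 = tens2 A A for A :: "('a, 'm) cstar_alg_scheme"
begin

abbreviation s3 :: "'a \<times> 'a \<times> 'a \<Rightarrow> 'a \<times> 'a \<times> 'a" where "s3 \<equiv> \<lambda>(a, b, c). (star A a, star A b, star A c)"
abbreviation I3 :: "(('a \<Rightarrow> 'a ell2_op) \<times> ('a \<Rightarrow> 'a ell2_op) \<times> ('a \<Rightarrow> 'a ell2_op)) set" where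
 "I3 \<equiv> {(\<pi>, \<rho>, \<tau>). representation A \<pi> \<and> representation A \<rho> \<and> representation A \<tau>}"
abbreviation raw3 :: "('a \<Rightarrow> 'a ell2_op) \<times> ('a \<Rightarrow> 'a ell2_op) \<times> ('a \<Rightarrow> 'a ell2_op) \<Rightarrow> 'a \<times> 'a \<times> 'a \<Rightarrow> ('a \<times> 'a \<times> 'a) ell2_op" where
 "raw3 \<equiv> \<lambda>(\<pi>, \<rho>, \<tau>) (a, b, c). op_tensor (\<pi> a) (op_tensor (\<rho> b) (\<tau> c))"
abbreviation rho3 :: "('a \<Rightarrow> 'a ell2_op) \<times> ('a \<Rightarrow> 'a ell2_op) \<times> ('a \<Rightarrow> 'a ell2_op) \<Rightarrow> 'a \<times> 'a \<times> 'a \<Rightarrow> ('a \<times> 'a \<times> 'a) ell2_op" where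
 "rho3 \<equiv> \<lambda>(\<pi>, \<rho>, \<tau>). prod_rep (\<lambda>a. op_cut (\<pi> a)) (prod_rep (\<lambda>a. op_cut (\<rho> a)) (\<lambda>a. op_cut (\<tau> a)))"

end

sublocale tens3 \<subseteq> T3: spatial "A \<times>\<times> A \<times>\<times> A" s3 I3 raw3 rho3
proof -
 have s3: "s3 = (\<lambda>(a, x). (star A a, s2 x))" by (auto simp: fun_eq_iff)
 interpret star_monoid "A \<times>\<times> A \<times>\<times> A" s3
  unfolding s3 by (rule star_monoid_DirProd[OF A.star_monoid star_monoid_DirProd[OF A.star_monoid A.star_monoid]])
 have sr: "star_rep (A \<times>\<times> A \<times>\<times> A) s3 (rho3 i)" if iI: "i \<in> I3" for i
 proof -
  obtain \<pi> \<rho> \<tau> where i: "i = (\<pi>, \<rho>, \<tau>)" "representation A \<pi>" "representation A \<rho>" "representation A \<tau>"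
   using iI by (cases i) auto
  note r = star_map_star_rep[OF A.representation_star_map]
  show ?thesis
   unfolding s3 using star_rep_prod[OF r[OF i(2)] star_rep_prod[OF r[OF i(3)] r[OF i(4)]]] by (simp add: i(1))
 qed
 show "spatial (A \<times>\<times> A \<times>\<times> A) s3 I3 raw3 rho3"
 proof unfold_locales
  show "I3 \<noteq> {}" using zero_representation by blast
 next
  fix i m assume i: "i \<in> I3" and m: "m \<in> carrier (A \<times>\<times> A \<times>\<times> A)"
  show "rho3 i m \<in> carrier ell2_ops" "rho3 i (s3 m) = star ell2_ops (rho3 i m)"
   using sr[OF i] m unfolding star_rep_def by blast+
  show "rho3 i (m \<otimes>\<^bsub>A \<times>\<times> A \<times>\<times> A\<^esub> n) = rho3 i m \<otimes>\<^bsub>ell2_ops\<^esub> rho3 i n" if "n \<in> carrier (A \<times>\<times> A \<times>\<times> A)" for n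
   using sr[OF i] m that unfolding star_rep_def by blast
  fix f :: "'a \<times> 'a \<times> 'a \<Rightarrow> complex" assume f: "f \<in> ell2"
  obtain \<pi> \<rho> \<tau> where i': "i = (\<pi>, \<rho>, \<tau>)" "representation A \<pi>" "representation A \<rho>" "representation A \<tau>"
   using i by (cases i) auto
  obtain a b c where m': "m = (a, b, c)" "a \<in> carrier A" "b \<in> carrier A" "c \<in> carrier A" using m by (cases m) auto
  note cl = rep_contractive(1)[OF i'(2) m'(2)] rep_contractive(1)[OF i'(3) m'(3)] rep_contractive(1)[OF i'(4) m'(4)]
  interpret Ops: cstar_alg "ell2_ops :: ('a \<times> 'a) ell2_op cstar_alg" by (rule cstar_alg_ops)
  have "op_tensor (\<pi> a) (op_tensor (\<rho> b) (\<tau> c)) f =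
    (col_op (op_cut (\<pi> a)) \<otimes>\<^bsub>ell2_ops\<^esub> row_op (col_op (op_cut (\<rho> b)) \<otimes>\<^bsub>ell2_ops\<^esub> row_op (op_cut (\<tau> c)))) f"
   by (intro op_tensor_eq f cl Ops.m_closed col_op_closed row_op_closed) simp_all
  then show "raw3 i m f = rho3 i m f" by (simp add: i' m' prod_rep_def)
 next
  fix m assume "m \<in> carrier (A \<times>\<times> A \<times>\<times> A)"
  then obtain a b c where m: "m = (a, b, c)" "a \<in> carrier A" "b \<in> carrier A" "c \<in> carrier A" by (cases m) auto
  have "op_norm (rho3 i m) \<le> cnorm A a * (cnorm A b * cnorm A c)" if i: "i \<in> I3" for i
  proof -
   obtain \<pi> \<rho> \<tau> where i': "i = (\<pi>, \<rho>, \<tau>)" "representation A \<pi>" "representation A \<rho>" "representation A \<tau>"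
    using i by (cases i) auto
   note r = rep_contractive[OF i'(2) m(2)] rep_contractive[OF i'(3) m(3)] rep_contractive[OF i'(4) m(4)]
   interpret Ops: cstar_alg "ell2_ops :: ('a \<times> 'a) ell2_op cstar_alg" by (rule cstar_alg_ops)
   have "prod_rep (\<lambda>a. op_cut (\<rho> a)) (\<lambda>a. op_cut (\<tau> a)) (b, c) \<in> carrier ell2_ops"
    using r by (simp add: prod_rep_def)
   then show ?thesis
    unfolding i'(1) m(1) prod.case by (intro prod_rep_norm r)
  qed
  then show "\<exists>K. \<forall>i\<in>I3. op_norm (rho3 i m) \<le> K" by blast
 qed
qed

context tens3
begin

lemma spatial3_eq: "spatial3 A A A = rep_seminorm (raw3 ` I3)"
 unfolding spatial3_def by (rule arg_cong[where f = rep_seminorm]) (auto simp: image_iff, blast)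

lemma min_tensor3_eq: "min_tensor3 A A A = T3.MC"
 unfolding min_tensor3_def formal_tensor3_def spatial3_eq by (rule refl)

lemma tensor3_eq: "tensor3 A A A a b c = T3.elem (a, b, c)"
 unfolding tensor3_def T3.elem_def formal_tensor3_def spatial3_eq by (rule refl)

lemma cstar_alg_tensor3: "cstar_alg (min_tensor3 A A A)"
 unfolding min_tensor3_eq by (rule T3.MC.cstar_alg_axioms)

lemma tensor3_closed [simp]:
 "a \<in> carrier A ==> b \<in> carrier A ==> c \<in> carrier A ==> tensor3 A A A a b c \<in> carrier (min_tensor3 A A A)"
 unfolding min_tensor3_eq tensor3_eq by (rule T3.elem_closed) simp

lemma tensor3_mult:
 "\<lbrakk>a \<in> carrier A; b \<in> carrier A; c \<in> carrier A; a' \<in> carrier A; b' \<in> carrier A; c' \<in> carrier A\<rbrakk> \<Longrightarrow>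
  tensor3 A A A a b c \<otimes>\<^bsub>min_tensor3 A A A\<^esub> tensor3 A A A a' b' c'
   = tensor3 A A A (a \<otimes>\<^bsub>A\<^esub> a') (b \<otimes>\<^bsub>A\<^esub> b') (c \<otimes>\<^bsub>A\<^esub> c')"
 unfolding min_tensor3_eq tensor3_eq using T3.elem_mult[of "(a, b, c)" "(a', b', c')"] by simp

lemma tensor3_star:
 "\<lbrakk>a \<in> carrier A; b \<in> carrier A; c \<in> carrier A\<rbrakk> \<Longrightarrow>
  star (min_tensor3 A A A) (tensor3 A A A a b c) = tensor3 A A A (star A a) (star A b) (star A c)"
 unfolding min_tensor3_eq tensor3_eq using T3.elem_star[of "(a, b, c)"] by simp

lemma tensor3_one: "tensor3 A A A \<one>\<^bsub>A\<^esub> \<one>\<^bsub>A\<^esub> \<one>\<^bsub>A\<^esub> = \<one>\<^bsub>min_tensor3 A A A\<^esub>"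
 unfolding min_tensor3_eq tensor3_eq using T3.elem_one by simp

definition reps3 :: "(('a, 'a, 'a) tensor3_elem \<Rightarrow> ('a \<times> 'a \<times> 'a) ell2_op) set" where
 "reps3 = {h \<in> star_map (min_tensor3 A A A) ell2_ops.
   \<exists>\<pi>\<in>star_map A (ell2_ops :: 'a ell2_op cstar_alg). \<exists>\<rho>\<in>star_map A (ell2_ops :: 'a ell2_op cstar_alg).
   \<exists>\<tau>\<in>star_map A (ell2_ops :: 'a ell2_op cstar_alg). \<forall>a\<in>carrier A. \<forall>b\<in>carrier A. \<forall>c\<in>carrier A.
    h (tensor3 A A A a b c) = prod_rep \<pi> (prod_rep \<rho> \<tau>) (a, b, c)}"

lemma reps3E:
 assumes "\<Psi> \<in> reps3"
 obtains \<pi> \<rho> \<tau> where "\<pi> \<in> star_map A (ell2_ops :: 'a ell2_op cstar_alg)" "\<rho> \<in> star_map A (ell2_ops :: 'a ell2_op cstar_alg)"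
  "\<tau> \<in> star_map A (ell2_ops :: 'a ell2_op cstar_alg)" "\<Psi> \<in> star_map (min_tensor3 A A A) ell2_ops"
  "\<And>a b c. a \<in> carrier A ==> b \<in> carrier A ==> c \<in> carrier A ==>
   \<Psi> (tensor3 A A A a b c) = col_op (\<pi> a) \<otimes>\<^bsub>ell2_ops\<^esub> row_op (col_op (\<rho> b) \<otimes>\<^bsub>ell2_ops\<^esub> row_op (\<tau> c))"
 using assms that unfolding reps3_def prod_rep_def by force

lemma reps3_norming:
 assumes y: "y \<in> carrier (min_tensor3 A A A)" and le: "\<And>h. h \<in> reps3 ==> op_norm (h y) \<le> K"
 shows "cnorm (min_tensor3 A A A) y \<le> K"
 unfolding min_tensor3_eq
proof (rule T3.cnorm_leI)
 show "y \<in> carrier T3.MC" using y unfolding min_tensor3_eq .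
 fix i h assume i: "i \<in> I3" and h: "h \<in> star_map T3.MC ell2_ops" "\<And>m. m \<in> carrier (A \<times>\<times> A \<times>\<times> A) ==> h (T3.elem m) = rho3 i m"
 obtain \<pi> \<rho> \<tau> where i': "i = (\<pi>, \<rho>, \<tau>)" "representation A \<pi>" "representation A \<rho>" "representation A \<tau>"
  using i by (cases i) auto
 note r = A.representation_star_map[OF i'(2)] A.representation_star_map[OF i'(3)] A.representation_star_map[OF i'(4)]
 have "h (tensor3 A A A a b c) = prod_rep (\<lambda>a. op_cut (\<pi> a)) (prod_rep (\<lambda>a. op_cut (\<rho> a)) (\<lambda>a. op_cut (\<tau> a))) (a, b, c)"
  if "a \<in> carrier A" "b \<in> carrier A" "c \<in> carrier A" for a b c
 proof -
  have "(a, b, c) \<in> carrier (A \<times>\<times> A \<times>\<times> A)" using that by simp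
  from h(2)[OF this] show ?thesis unfolding tensor3_eq i'(1) by simp
 qed
 then have "h \<in> reps3"
  using h(1) r unfolding reps3_def min_tensor3_eq[symmetric] by blast
 then show "op_norm (h y) \<le> K" by (rule le)
qed

text \<open>On tensors with third entry 1, a product of three representations is the product of the
  first two, amplified, reassociated and multiplied by the image of the unit in the third leg. That
  image has norm at most 1, so the composite is a contraction.\<close>

lemma leg12:
 shows "leg12 A \<in> star_hom (min_tensor2 A A) (min_tensor3 A A A)"
  and "\<And>a b. a \<in> carrier A ==> b \<in> carrier A ==> leg12 A (tensor2 A A a b) = tensor3 A A A a b \<one>\<^bsub>A\<^esub>"
proof -
 have factor: "\<exists>\<pi>\<in>star_map A (ell2_ops :: 'a ell2_op cstar_alg). \<exists>\<rho>\<in>star_map A (ell2_ops :: 'a ell2_op cstar_alg). \<exists>W. contraction W \<and>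
   (\<forall>a\<in>carrier A. \<forall>b\<in>carrier A. \<Psi> (tensor3 A A A a b \<one>\<^bsub>A\<^esub>) = W (prod_rep \<pi> \<rho> (a, b)))"
  if \<Psi>: "\<Psi> \<in> reps3" for \<Psi>
 proof -
  interpret Ops: cstar_alg "ell2_ops :: ('a \<times> 'a \<times> 'a) ell2_op cstar_alg" by (rule cstar_alg_ops)
  obtain \<pi> \<rho> \<tau> where r: "\<pi> \<in> star_map A (ell2_ops :: 'a ell2_op cstar_alg)" "\<rho> \<in> star_map A (ell2_ops :: 'a ell2_op cstar_alg)"
   "\<tau> \<in> star_map A (ell2_ops :: 'a ell2_op cstar_alg)" "\<Psi> \<in> star_map (min_tensor3 A A A) ell2_ops"
   "\<And>a b c. a \<in> carrier A ==> b \<in> carrier A ==> c \<in> carrier A ==>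
   \<Psi> (tensor3 A A A a b c) = col_op (\<pi> a) \<otimes>\<^bsub>ell2_ops\<^esub> row_op (col_op (\<rho> b) \<otimes>\<^bsub>ell2_ops\<^esub> row_op (\<tau> c))"
   using reps3E[OF \<Psi>] by blast
  note C = star_mapD[OF star_homD(1)[OF col_op_star_hom]] and R = star_mapD[OF star_homD(1)[OF row_op_star_hom]]
  have U: "reindex_op assoc \<in> star_map ell2_ops ell2_ops" by (rule star_homD(1)[OF reindex_star_hom[OF bij_assoc]])
  have t1: "\<tau> \<one>\<^bsub>A\<^esub> \<in> carrier ell2_ops" using star_mapD(1)[OF r(3)] by simp
  have "op_norm (\<tau> \<one>\<^bsub>A\<^esub>) \<le> cnorm A \<one>\<^bsub>A\<^esub>"
   using A.star_map_contractive[OF cstar_semi.intro[OF star_alg_ops cstar_semi_axioms.intro[OF cstar_seminorm_ops]] r(3)] by simp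
  then have n1: "op_norm (\<tau> \<one>\<^bsub>A\<^esub>) \<le> 1" using A.p_one_le by linarith
  have rr: "op_norm (row_op (row_op (\<tau> \<one>\<^bsub>A\<^esub>) :: ('a \<times> 'a) ell2_op) :: ('a \<times> 'a \<times> 'a) ell2_op) \<le> 1"
   using op_norm_star_map[OF star_homD(1)[OF row_op_star_hom] row_op_closed[OF t1]]
    op_norm_star_map[OF star_homD(1)[OF row_op_star_hom] t1] n1 order_trans by meson
  let ?W = "\<lambda>x :: ('a \<times> 'a) ell2_op. (reindex_op assoc (col_op x) :: ('a \<times> 'a \<times> 'a) ell2_op) \<otimes>\<^bsub>ell2_ops\<^esub> row_op (row_op (\<tau> \<one>\<^bsub>A\<^esub>))"
  have W: "contraction ?W"
  proof -
   have c1: "contraction (col_op :: ('a \<times> 'a) ell2_op \<Rightarrow> (('a \<times> 'a) \<times> 'a) ell2_op)"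
    by (rule contraction_star_map[OF star_homD(1)[OF col_op_star_hom]])
   have c2: "contraction (reindex_op assoc :: (('a \<times> 'a) \<times> 'a) ell2_op \<Rightarrow> ('a \<times> 'a \<times> 'a) ell2_op)"
    by (rule contraction_star_map[OF U])
   have c3: "contraction (\<lambda>x :: ('a \<times> 'a \<times> 'a) ell2_op. x \<otimes>\<^bsub>ell2_ops\<^esub> row_op (row_op (\<tau> \<one>\<^bsub>A\<^esub>)))"
    by (rule contraction_mult(1)[OF row_op_closed[OF row_op_closed[OF t1]] rr])
   show ?thesis using contraction_comp[OF contraction_comp[OF c1 c2] c3] by simp
  qed
  have "\<Psi> (tensor3 A A A a b \<one>\<^bsub>A\<^esub>) = ?W (prod_rep \<pi> \<rho> (a, b))" if a: "a \<in> carrier A" and b: "b \<in> carrier A" for a b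
  proof -
   have pa: "\<pi> a \<in> carrier ell2_ops" and rb: "\<rho> b \<in> carrier ell2_ops"
    using star_mapD(1)[OF r(1) a] star_mapD(1)[OF r(2) b] .
   have "?W (prod_rep \<pi> \<rho> (a, b)) = (reindex_op assoc (col_op (col_op (\<pi> a))) \<otimes>\<^bsub>ell2_ops\<^esub> reindex_op assoc (col_op (row_op (\<rho> b))))
     \<otimes>\<^bsub>ell2_ops\<^esub> row_op (row_op (\<tau> \<one>\<^bsub>A\<^esub>))"
    using pa rb by (simp add: prod_rep_def C star_mapD[OF U])
   also have "\<dots> = (col_op (\<pi> a) \<otimes>\<^bsub>ell2_ops\<^esub> row_op (col_op (\<rho> b))) \<otimes>\<^bsub>ell2_ops\<^esub> row_op (row_op (\<tau> \<one>\<^bsub>A\<^esub>))"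
    by (simp add: reindex_assoc pa rb)
   also have "\<dots> = \<Psi> (tensor3 A A A a b \<one>\<^bsub>A\<^esub>)"
    using pa rb t1 by (simp add: r(5) a b R Ops.m_assoc)
   finally show ?thesis by simp
  qed
  then show ?thesis using r(1,2) W by blast
 qed
 show "leg12 A \<in> star_hom (min_tensor2 A A) (min_tensor3 A A A)"
  unfolding leg12_def
  by (rule tensor_lift(1)[OF cstar_alg_tensor3 _ _ _ _ reps3_norming _ factor])
   (simp_all add: tensor3_mult tensor3_star tensor3_one, simp add: reps3_def)
 show "\<And>a b. a \<in> carrier A ==> b \<in> carrier A ==> leg12 A (tensor2 A A a b) = tensor3 A A A a b \<one>\<^bsub>A\<^esub>"
  unfolding leg12_def
  by (rule tensor_lift(2)[OF cstar_alg_tensor3 _ _ _ _ reps3_norming _ factor])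
   (simp_all add: tensor3_mult tensor3_star tensor3_one, simp add: reps3_def)
qed

text \<open>The nesting already fits: the contraction is amplification to the last two variables,
  multiplied by the image of the unit in the first.\<close>

lemma leg23:
 shows "leg23 A \<in> star_hom (min_tensor2 A A) (min_tensor3 A A A)"
  and "\<And>a b. a \<in> carrier A ==> b \<in> carrier A ==> leg23 A (tensor2 A A a b) = tensor3 A A A \<one>\<^bsub>A\<^esub> a b"
proof -
 have factor: "\<exists>\<pi>\<in>star_map A (ell2_ops :: 'a ell2_op cstar_alg). \<exists>\<rho>\<in>star_map A (ell2_ops :: 'a ell2_op cstar_alg). \<exists>W. contraction W \<and>
   (\<forall>a\<in>carrier A. \<forall>b\<in>carrier A. \<Psi> (tensor3 A A A \<one>\<^bsub>A\<^esub> a b) = W (prod_rep \<pi> \<rho> (a, b)))"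
  if \<Psi>: "\<Psi> \<in> reps3" for \<Psi>
 proof -
  obtain \<pi> \<rho> \<tau> where r: "\<pi> \<in> star_map A (ell2_ops :: 'a ell2_op cstar_alg)" "\<rho> \<in> star_map A (ell2_ops :: 'a ell2_op cstar_alg)"
   "\<tau> \<in> star_map A (ell2_ops :: 'a ell2_op cstar_alg)" "\<Psi> \<in> star_map (min_tensor3 A A A) ell2_ops"
   "\<And>a b c. a \<in> carrier A ==> b \<in> carrier A ==> c \<in> carrier A ==>
   \<Psi> (tensor3 A A A a b c) = col_op (\<pi> a) \<otimes>\<^bsub>ell2_ops\<^esub> row_op (col_op (\<rho> b) \<otimes>\<^bsub>ell2_ops\<^esub> row_op (\<tau> c))"
   using reps3E[OF \<Psi>] by blast
  have t1: "\<pi> \<one>\<^bsub>A\<^esub> \<in> carrier ell2_ops" using star_mapD(1)[OF r(1)] by simp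
  have "op_norm (\<pi> \<one>\<^bsub>A\<^esub>) \<le> cnorm A \<one>\<^bsub>A\<^esub>"
   using A.star_map_contractive[OF cstar_semi.intro[OF star_alg_ops cstar_semi_axioms.intro[OF cstar_seminorm_ops]] r(1)] by simp
  then have n1: "op_norm (\<pi> \<one>\<^bsub>A\<^esub>) \<le> 1" using A.p_one_le by linarith
  have cc: "op_norm (col_op (\<pi> \<one>\<^bsub>A\<^esub>) :: ('a \<times> 'a \<times> 'a) ell2_op) \<le> 1"
   using op_norm_star_map[OF star_homD(1)[OF col_op_star_hom] t1] n1 by (rule order_trans)
  let ?W = "\<lambda>x :: ('a \<times> 'a) ell2_op. (col_op (\<pi> \<one>\<^bsub>A\<^esub>) :: ('a \<times> 'a \<times> 'a) ell2_op) \<otimes>\<^bsub>ell2_ops\<^esub> row_op x"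
  have W: "contraction ?W"
  proof -
   have c1: "contraction (row_op :: ('a \<times> 'a) ell2_op \<Rightarrow> ('a \<times> 'a \<times> 'a) ell2_op)"
    by (rule contraction_star_map[OF star_homD(1)[OF row_op_star_hom]])
   have c2: "contraction (\<lambda>x :: ('a \<times> 'a \<times> 'a) ell2_op. col_op (\<pi> \<one>\<^bsub>A\<^esub>) \<otimes>\<^bsub>ell2_ops\<^esub> x)"
    by (rule contraction_mult(2)[OF col_op_closed[OF t1] cc])
   show ?thesis using contraction_comp[OF c1 c2] by simp
  qed
  have "\<Psi> (tensor3 A A A \<one>\<^bsub>A\<^esub> a b) = ?W (prod_rep \<rho> \<tau> (a, b))" if "a \<in> carrier A" "b \<in> carrier A" for a b
   using that by (simp add: r(5) prod_rep_def)
  then show ?thesis using r(2,3) W by blast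
 qed
 show "leg23 A \<in> star_hom (min_tensor2 A A) (min_tensor3 A A A)"
  unfolding leg23_def
  by (rule tensor_lift(1)[OF cstar_alg_tensor3 _ _ _ _ reps3_norming _ factor])
   (simp_all add: tensor3_mult tensor3_star tensor3_one, simp add: reps3_def)
 show "\<And>a b. a \<in> carrier A ==> b \<in> carrier A ==> leg23 A (tensor2 A A a b) = tensor3 A A A \<one>\<^bsub>A\<^esub> a b"
  unfolding leg23_def
  by (rule tensor_lift(2)[OF cstar_alg_tensor3 _ _ _ _ reps3_norming _ factor])
   (simp_all add: tensor3_mult tensor3_star tensor3_one, simp add: reps3_def)
qed

end

section \<open>The maps \<open>\<Delta> \<otimes> id\<close> and \<open>id \<otimes> \<Delta>\<close>\<close>

locale coproduct = tens3 A for A :: "'a cstar_alg" +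
 fixes \<Delta> :: "'a \<Rightarrow> ('a, 'a) tensor2_elem"
 assumes inf: "infinite (UNIV :: 'a set)"
  and \<Delta>: "\<Delta> \<in> star_hom A (min_tensor2 A A)"
begin

interpretation M2: cstar_alg "min_tensor2 A A" by (rule cstar_alg_tensor2)
interpretation M3: cstar_alg "min_tensor3 A A A" by (rule cstar_alg_tensor3)

lemmas D = star_mapD[OF star_homD(1)[OF \<Delta>]] star_homD(2)[OF \<Delta>]
lemmas L12 = star_mapD[OF star_homD(1)[OF leg12(1)]] star_homD(2)[OF leg12(1)]
lemmas L23 = star_mapD[OF star_homD(1)[OF leg23(1)]] star_homD(2)[OF leg23(1)]

definition pairing :: "'a \<Rightarrow> 'a \<times> 'a" where "pairing = (SOME k. bij k)"

lemma bij_pairing: "bij pairing"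
proof -
 obtain f :: "'a \<times> 'a \<Rightarrow> 'a" where "bij_betw f (UNIV \<times> UNIV) UNIV"
  using card_of_Times_same_infinite[OF inf] unfolding card_of_ordIso[symmetric] by blast
 then have "bij f" by simp
 then have "\<exists>k :: 'a \<Rightarrow> 'a \<times> 'a. bij k" using bij_imp_bij_inv by blast
 then show ?thesis unfolding pairing_def by (rule someI_ex)
qed

text \<open>The bijection between \<open>'a\<close> and \<open>'a \<times> 'a\<close> turns \<open>(\<pi> \<otimes> \<rho>) \<circ> \<Delta>\<close> into a representation on the
 \<open>\<ell>\<^sup>2\<close> space that occurs in the spatial norm.\<close>

lemma transported_rep:
 assumes h: "h \<in> star_map (min_tensor2 A A) (ell2_ops :: ('a \<times> 'a) ell2_op cstar_alg)"
 obtains \<sigma> where "\<sigma> \<in> star_map A (ell2_ops :: 'a ell2_op cstar_alg)"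
  "\<And>a. a \<in> carrier A ==> reindex_op (inv_into UNIV pairing) (\<sigma> a) = h (\<Delta> a)"
proof
 show "(\<lambda>a. reindex_op pairing (h (\<Delta> a))) \<in> star_map A (ell2_ops :: 'a ell2_op cstar_alg)"
  by (rule star_map_comp[OF star_map_comp[OF star_homD(1)[OF \<Delta>] h] star_homD(1)[OF reindex_star_hom[OF bij_pairing]]])
qed (simp add: reindex_op_inverse[OF bij_pairing])

lemma split_map3:
 assumes U: "U \<in> lin_map (min_tensor2 A A) (ell2_ops :: 'x ell2_op cstar_alg)"
  and V: "V \<in> lin_map (min_tensor2 A A) ell2_ops"
  and "\<And>a b. a \<in> carrier A ==> b \<in> carrier A ==> U (tensor2 A A a b) = V (tensor2 A A a b)"
  and "y \<in> carrier (min_tensor2 A A)"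
 shows "U y = V y"
 by (rule tensor2_lin_map_eqI[OF cstar_alg_ops U V]) (use assms in auto)

text \<open>For representations \<open>\<pi>\<close>, \<open>\<rho>\<close>, \<open>\<tau>\<close>
  let \<open>\<Theta>\<close> extend the product of the first two and let \<open>\<sigma>\<close> be
  \<open>\<Theta>\<close> after \<open>\<Delta>\<close>, transported to the index type
  \<open>'a\<close>. The value on \<open>\<Delta>(a)\<close> tensor \<open>b\<close> arises from the
  product of \<open>\<sigma>\<close> and \<open>\<tau>\<close> by undoing the transport and
  reassociating, and these conjugations are contractions.\<close>

lemma coproduct_id:
 shows "coproduct_id A \<Delta> \<in> star_hom (min_tensor2 A A) (min_tensor3 A A A)"
  and "\<And>a b. a \<in> carrier A ==> b \<in> carrier A ==> coproduct_id A \<Delta> (tensor2 A A a b) =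
   leg12 A (\<Delta> a) \<otimes>\<^bsub>min_tensor3 A A A\<^esub> tensor3 A A A \<one>\<^bsub>A\<^esub> \<one>\<^bsub>A\<^esub> b"
proof -
 let ?t = "\<lambda>b. tensor3 A A A \<one>\<^bsub>A\<^esub> \<one>\<^bsub>A\<^esub> b"
 \<comment> \<open>The third leg commutes with the first two; multiplicativity and compatibility
   with the adjoint both rest on this.\<close>
 have com: "leg12 A y \<otimes>\<^bsub>min_tensor3 A A A\<^esub> ?t b = ?t b \<otimes>\<^bsub>min_tensor3 A A A\<^esub> leg12 A y"
  if b: "b \<in> carrier A" and y: "y \<in> carrier (min_tensor2 A A)" for b y
 proof (rule tensor2_lin_map_eqI[OF cstar_alg_tensor3 _ _ _ y])
  note l = M2.star_map_lin_map[OF cstar_alg_tensor3 star_homD(1)[OF leg12(1)]]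
  have tb: "?t b \<in> carrier (min_tensor3 A A A)" using b by simp
  show "(\<lambda>y. leg12 A y \<otimes>\<^bsub>min_tensor3 A A A\<^esub> ?t b) \<in> lin_map (min_tensor2 A A) (min_tensor3 A A A)"
   by (rule M2.lin_map_comp[OF cstar_alg_tensor3 cstar_alg_tensor3 l M3.lin_map_mult_right[OF tb]])
  show "(\<lambda>y. ?t b \<otimes>\<^bsub>min_tensor3 A A A\<^esub> leg12 A y) \<in> lin_map (min_tensor2 A A) (min_tensor3 A A A)"
   by (rule M2.lin_map_comp[OF cstar_alg_tensor3 cstar_alg_tensor3 l M3.lin_map_mult_left[OF tb]])
 qed (simp add: leg12(2) tensor3_mult b)
 have factor: "\<exists>\<pi>\<in>star_map A (ell2_ops :: 'a ell2_op cstar_alg). \<exists>\<rho>\<in>star_map A (ell2_ops :: 'a ell2_op cstar_alg). \<exists>W. contraction W \<and>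
   (\<forall>a\<in>carrier A. \<forall>b\<in>carrier A. \<Psi> (leg12 A (\<Delta> a) \<otimes>\<^bsub>min_tensor3 A A A\<^esub> ?t b) = W (prod_rep \<pi> \<rho> (a, b)))"
  if \<Psi>: "\<Psi> \<in> reps3" for \<Psi>
 proof -
  interpret Ops: cstar_alg "ell2_ops :: ('a \<times> 'a \<times> 'a) ell2_op cstar_alg" by (rule cstar_alg_ops)
  interpret Ops': cstar_alg "ell2_ops :: (('a \<times> 'a) \<times> 'a) ell2_op cstar_alg" by (rule cstar_alg_ops)
  interpret Ops2: cstar_alg "ell2_ops :: ('a \<times> 'a) ell2_op cstar_alg" by (rule cstar_alg_ops)
  obtain \<pi> \<rho> \<tau> where r: "\<pi> \<in> star_map A (ell2_ops :: 'a ell2_op cstar_alg)" "\<rho> \<in> star_map A (ell2_ops :: 'a ell2_op cstar_alg)"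
   "\<tau> \<in> star_map A (ell2_ops :: 'a ell2_op cstar_alg)" "\<Psi> \<in> star_map (min_tensor3 A A A) ell2_ops"
   "\<And>a b c. a \<in> carrier A ==> b \<in> carrier A ==> c \<in> carrier A ==>
   \<Psi> (tensor3 A A A a b c) = col_op (\<pi> a) \<otimes>\<^bsub>ell2_ops\<^esub> row_op (col_op (\<rho> b) \<otimes>\<^bsub>ell2_ops\<^esub> row_op (\<tau> c))"
   using reps3E[OF \<Psi>] by blast
  obtain \<Theta> where \<Theta>: "\<Theta> \<in> star_map (min_tensor2 A A) (ell2_ops :: ('a \<times> 'a) ell2_op cstar_alg)"
   "\<And>a b. a \<in> carrier A ==> b \<in> carrier A ==> \<Theta> (tensor2 A A a b) = prod_rep \<pi> \<rho> (a, b)"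
   using tensor2_rep[OF r(1,2)] by blast
  obtain \<sigma> where \<sigma>: "\<sigma> \<in> star_map A (ell2_ops :: 'a ell2_op cstar_alg)"
   "\<And>a. a \<in> carrier A ==> reindex_op (inv_into UNIV pairing) (\<sigma> a) = \<Theta> (\<Delta> a)"
   using transported_rep[OF \<Theta>(1)] by blast
  let ?j = "inv_into UNIV pairing"
  have j: "bij ?j" by (rule bij_imp_bij_inv[OF bij_pairing])
  have jl: "bij (map_prod ?j (\<lambda>x. x) :: ('a \<times> 'a) \<times> 'a \<Rightarrow> 'a \<times> 'a)"
   using j by (simp add: bij_def prod.inj_map map_prod_surj)
  note C = star_mapD[OF star_homD(1)[OF col_op_star_hom]] and R = star_mapD[OF star_homD(1)[OF row_op_star_hom]]
  have As: "reindex_op (assoc :: 'a \<times> 'a \<times> 'a \<Rightarrow> _) \<in> star_map ell2_ops ell2_ops"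
   by (rule star_homD(1)[OF reindex_star_hom[OF bij_assoc]])
  have Js: "reindex_op (map_prod ?j (\<lambda>x. x) :: ('a \<times> 'a) \<times> 'a \<Rightarrow> 'a \<times> 'a) \<in> star_map ell2_ops ell2_ops"
   by (rule star_homD(1)[OF reindex_star_hom[OF jl]])
  let ?W = "\<lambda>x. reindex_op (assoc :: 'a \<times> 'a \<times> 'a \<Rightarrow> _) (reindex_op (map_prod ?j (\<lambda>x. x)) x)"
  have W: "contraction ?W"
   by (rule contraction_star_map[OF star_map_comp[OF Js As]])
  \<comment> \<open>Claimed for all \<open>y\<close>, since \<open>\<Delta> a\<close> is in general
    only a limit of sums of elementary tensors; as an identity of bounded linear maps it is checked
    on elementary tensors.\<close>
  have key: "\<Psi> (leg12 A y \<otimes>\<^bsub>min_tensor3 A A A\<^esub> ?t b)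
    = reindex_op assoc (col_op (\<Theta> y)) \<otimes>\<^bsub>ell2_ops\<^esub> row_op (row_op (\<tau> b))"
   if b: "b \<in> carrier A" and y: "y \<in> carrier (min_tensor2 A A)" for b y
  proof (rule split_map3[OF _ _ _ y])
   have tb: "?t b \<in> carrier (min_tensor3 A A A)" using b by simp
   have \<tau>b: "\<tau> b \<in> carrier ell2_ops" using star_mapD(1)[OF r(3) b] .
   show "(\<lambda>y. \<Psi> (leg12 A y \<otimes>\<^bsub>min_tensor3 A A A\<^esub> ?t b)) \<in> lin_map (min_tensor2 A A) ell2_ops"
    by (rule M2.lin_map_comp[OF cstar_alg_tensor3 cstar_alg_ops M2.lin_map_comp[OF cstar_alg_tensor3 cstar_alg_tensor3
       M2.star_map_lin_map[OF cstar_alg_tensor3 star_homD(1)[OF leg12(1)]] M3.lin_map_mult_right[OF tb]]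
       M3.star_map_lin_map[OF cstar_alg_ops r(4)]])
   have "(\<lambda>y. reindex_op assoc (col_op (\<Theta> y))) \<in> star_map (min_tensor2 A A) (ell2_ops :: ('a \<times> 'a \<times> 'a) ell2_op cstar_alg)"
    by (rule star_map_comp[OF star_map_comp[OF \<Theta>(1) star_homD(1)[OF col_op_star_hom]] As])
   from M2.lin_map_comp[OF cstar_alg_ops cstar_alg_ops M2.star_map_lin_map[OF cstar_alg_ops this]
     Ops.lin_map_mult_right[OF row_op_closed[OF row_op_closed[OF \<tau>b]]]]
   show "(\<lambda>y. reindex_op assoc (col_op (\<Theta> y)) \<otimes>\<^bsub>ell2_ops\<^esub> row_op (row_op (\<tau> b)))
     \<in> lin_map (min_tensor2 A A) (ell2_ops :: ('a \<times> 'a \<times> 'a) ell2_op cstar_alg)" .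
   fix a c assume a: "a \<in> carrier A" and c: "c \<in> carrier A"
   have pa: "\<pi> a \<in> carrier ell2_ops" and rc: "\<rho> c \<in> carrier ell2_ops"
    using star_mapD(1)[OF r(1) a] star_mapD(1)[OF r(2) c] .
   have "\<Psi> (leg12 A (tensor2 A A a c) \<otimes>\<^bsub>min_tensor3 A A A\<^esub> ?t b)
     = col_op (\<pi> a) \<otimes>\<^bsub>ell2_ops\<^esub> row_op (col_op (\<rho> c) \<otimes>\<^bsub>ell2_ops\<^esub> row_op (\<tau> b))"
    using a b c by (simp add: leg12(2) tensor3_mult r(5))
   also have "\<dots> = (col_op (\<pi> a) \<otimes>\<^bsub>ell2_ops\<^esub> row_op (col_op (\<rho> c))) \<otimes>\<^bsub>ell2_ops\<^esub> row_op (row_op (\<tau> b))"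
    using pa rc \<tau>b by (simp add: R Ops.m_assoc)
   also have "\<dots> = (reindex_op assoc (col_op (col_op (\<pi> a))) \<otimes>\<^bsub>ell2_ops\<^esub> reindex_op assoc (col_op (row_op (\<rho> c))))
     \<otimes>\<^bsub>ell2_ops\<^esub> row_op (row_op (\<tau> b))"
    by (simp add: reindex_assoc pa rc)
   also have "\<dots> = reindex_op assoc (col_op (\<Theta> (tensor2 A A a c))) \<otimes>\<^bsub>ell2_ops\<^esub> row_op (row_op (\<tau> b))"
    using a c pa rc by (simp add: \<Theta>(2) prod_rep_def C star_mapD[OF As])
   finally show "\<Psi> (leg12 A (tensor2 A A a c) \<otimes>\<^bsub>min_tensor3 A A A\<^esub> ?t b)
     = reindex_op assoc (col_op (\<Theta> (tensor2 A A a c))) \<otimes>\<^bsub>ell2_ops\<^esub> row_op (row_op (\<tau> b))" .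
  qed
  have "\<Psi> (leg12 A (\<Delta> a) \<otimes>\<^bsub>min_tensor3 A A A\<^esub> ?t b) = ?W (prod_rep \<sigma> \<tau> (a, b))"
   if a: "a \<in> carrier A" and b: "b \<in> carrier A" for a b
  proof -
   have sa: "\<sigma> a \<in> carrier ell2_ops" and tb: "\<tau> b \<in> carrier ell2_ops"
    using star_mapD(1)[OF \<sigma>(1) a] star_mapD(1)[OF r(3) b] .
   have Da: "\<Theta> (\<Delta> a) \<in> carrier ell2_ops" using star_mapD(1)[OF \<Theta>(1) D(1)[OF a]] .
   have tid: "reindex_op (\<lambda>x. x) (\<tau> b) = \<tau> b"
    by (simp add: reindex_op_def inv_unique_comp[of "\<lambda>x. x" "\<lambda>x. x"] fun_eq_iff)
   have id: "bij (\<lambda>x :: 'a. x)" using bij_id by (simp add: id_def)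
   have "reindex_op (map_prod ?j (\<lambda>x. x)) (prod_rep \<sigma> \<tau> (a, b))
     = col_op (\<Theta> (\<Delta> a)) \<otimes>\<^bsub>ell2_ops\<^esub> row_op (\<tau> b)"
    using sa tb by (simp add: prod_rep_def star_mapD[OF Js] reindex_col[OF j id] \<sigma>(2)[OF a] tid)
   then have "?W (prod_rep \<sigma> \<tau> (a, b)) = reindex_op assoc (col_op (\<Theta> (\<Delta> a))) \<otimes>\<^bsub>ell2_ops\<^esub> row_op (row_op (\<tau> b))"
    using Da tb by (simp add: star_mapD[OF As] reindex_assoc)
   then show ?thesis using key[OF b D(1)[OF a]] by simp
  qed
  then show ?thesis using \<sigma>(1) r(3) W by blast
 qed
 have mult: "leg12 A (\<Delta> (a \<otimes>\<^bsub>A\<^esub> a')) \<otimes>\<^bsub>min_tensor3 A A A\<^esub> ?t (b \<otimes>\<^bsub>A\<^esub> b')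
   = (leg12 A (\<Delta> a) \<otimes>\<^bsub>min_tensor3 A A A\<^esub> ?t b) \<otimes>\<^bsub>min_tensor3 A A A\<^esub> (leg12 A (\<Delta> a') \<otimes>\<^bsub>min_tensor3 A A A\<^esub> ?t b')"
  if "a \<in> carrier A" "b \<in> carrier A" "a' \<in> carrier A" "b' \<in> carrier A" for a b a' b'
 proof -
  have t: "?t (b \<otimes>\<^bsub>A\<^esub> b') = ?t b \<otimes>\<^bsub>min_tensor3 A A A\<^esub> ?t b'" using that by (simp add: tensor3_mult)
  have c: "leg12 A (\<Delta> a) \<in> carrier (min_tensor3 A A A)" "leg12 A (\<Delta> a') \<in> carrier (min_tensor3 A A A)"
   "?t b \<in> carrier (min_tensor3 A A A)" "?t b' \<in> carrier (min_tensor3 A A A)" using that by (simp_all add: D L12)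
  have "leg12 A (\<Delta> (a \<otimes>\<^bsub>A\<^esub> a')) \<otimes>\<^bsub>min_tensor3 A A A\<^esub> ?t (b \<otimes>\<^bsub>A\<^esub> b')
    = leg12 A (\<Delta> a) \<otimes>\<^bsub>min_tensor3 A A A\<^esub> (leg12 A (\<Delta> a') \<otimes>\<^bsub>min_tensor3 A A A\<^esub> ?t b) \<otimes>\<^bsub>min_tensor3 A A A\<^esub> ?t b'"
   using that c by (simp add: t D L12 M3.m_assoc)
  also have "leg12 A (\<Delta> a') \<otimes>\<^bsub>min_tensor3 A A A\<^esub> ?t b = ?t b \<otimes>\<^bsub>min_tensor3 A A A\<^esub> leg12 A (\<Delta> a')"
   by (rule com) (use that in \<open>simp_all add: D\<close>)
  finally show ?thesis using c by (simp add: M3.m_assoc)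
 qed
 have star: "leg12 A (\<Delta> (star A a)) \<otimes>\<^bsub>min_tensor3 A A A\<^esub> ?t (star A b)
   = star (min_tensor3 A A A) (leg12 A (\<Delta> a) \<otimes>\<^bsub>min_tensor3 A A A\<^esub> ?t b)"
  if "a \<in> carrier A" "b \<in> carrier A" for a b
  using that com[of b "\<Delta> a"] by (simp add: D L12 M3.star_mult tensor3_star com)
 show "coproduct_id A \<Delta> \<in> star_hom (min_tensor2 A A) (min_tensor3 A A A)"
  unfolding coproduct_id_def
  by (rule tensor_lift(1)[OF cstar_alg_tensor3 _ mult star _ reps3_norming _ factor])
   (simp_all add: D L12 tensor3_one, simp add: reps3_def)
 show "\<And>a b. a \<in> carrier A ==> b \<in> carrier A ==> coproduct_id A \<Delta> (tensor2 A A a b) =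
   leg12 A (\<Delta> a) \<otimes>\<^bsub>min_tensor3 A A A\<^esub> ?t b"
  unfolding coproduct_id_def
  by (rule tensor_lift(2)[OF cstar_alg_tensor3 _ mult star _ reps3_norming _ factor])
   (simp_all add: D L12 tensor3_one, simp add: reps3_def)
qed

text \<open>The mirror image of the previous argument: the transported representation sits in the
  last two legs, where the right nesting already agrees with the threefold product.\<close>

lemma id_coproduct:
 shows "id_coproduct A \<Delta> \<in> star_hom (min_tensor2 A A) (min_tensor3 A A A)"
  and "\<And>a b. a \<in> carrier A ==> b \<in> carrier A ==> id_coproduct A \<Delta> (tensor2 A A a b) =
   tensor3 A A A a \<one>\<^bsub>A\<^esub> \<one>\<^bsub>A\<^esub> \<otimes>\<^bsub>min_tensor3 A A A\<^esub> leg23 A (\<Delta> b)"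
proof -
 let ?t = "\<lambda>a. tensor3 A A A a \<one>\<^bsub>A\<^esub> \<one>\<^bsub>A\<^esub>"
 have com: "leg23 A y \<otimes>\<^bsub>min_tensor3 A A A\<^esub> ?t b = ?t b \<otimes>\<^bsub>min_tensor3 A A A\<^esub> leg23 A y"
  if b: "b \<in> carrier A" and y: "y \<in> carrier (min_tensor2 A A)" for b y
 proof (rule tensor2_lin_map_eqI[OF cstar_alg_tensor3 _ _ _ y])
  note l = M2.star_map_lin_map[OF cstar_alg_tensor3 star_homD(1)[OF leg23(1)]]
  have tb: "?t b \<in> carrier (min_tensor3 A A A)" using b by simp
  show "(\<lambda>y. leg23 A y \<otimes>\<^bsub>min_tensor3 A A A\<^esub> ?t b) \<in> lin_map (min_tensor2 A A) (min_tensor3 A A A)"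
   by (rule M2.lin_map_comp[OF cstar_alg_tensor3 cstar_alg_tensor3 l M3.lin_map_mult_right[OF tb]])
  show "(\<lambda>y. ?t b \<otimes>\<^bsub>min_tensor3 A A A\<^esub> leg23 A y) \<in> lin_map (min_tensor2 A A) (min_tensor3 A A A)"
   by (rule M2.lin_map_comp[OF cstar_alg_tensor3 cstar_alg_tensor3 l M3.lin_map_mult_left[OF tb]])
 qed (simp add: leg23(2) tensor3_mult b)
 have factor: "\<exists>\<pi>\<in>star_map A (ell2_ops :: 'a ell2_op cstar_alg). \<exists>\<rho>\<in>star_map A (ell2_ops :: 'a ell2_op cstar_alg). \<exists>W. contraction W \<and>
   (\<forall>a\<in>carrier A. \<forall>b\<in>carrier A. \<Psi> (?t a \<otimes>\<^bsub>min_tensor3 A A A\<^esub> leg23 A (\<Delta> b)) = W (prod_rep \<pi> \<rho> (a, b)))"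
  if \<Psi>: "\<Psi> \<in> reps3" for \<Psi>
 proof -
  interpret Ops: cstar_alg "ell2_ops :: ('a \<times> 'a \<times> 'a) ell2_op cstar_alg" by (rule cstar_alg_ops)
  interpret Ops2: cstar_alg "ell2_ops :: ('a \<times> 'a) ell2_op cstar_alg" by (rule cstar_alg_ops)
  obtain \<pi> \<rho> \<tau> where r: "\<pi> \<in> star_map A (ell2_ops :: 'a ell2_op cstar_alg)" "\<rho> \<in> star_map A (ell2_ops :: 'a ell2_op cstar_alg)"
   "\<tau> \<in> star_map A (ell2_ops :: 'a ell2_op cstar_alg)" "\<Psi> \<in> star_map (min_tensor3 A A A) ell2_ops"
   "\<And>a b c. a \<in> carrier A ==> b \<in> carrier A ==> c \<in> carrier A ==>
   \<Psi> (tensor3 A A A a b c) = col_op (\<pi> a) \<otimes>\<^bsub>ell2_ops\<^esub> row_op (col_op (\<rho> b) \<otimes>\<^bsub>ell2_ops\<^esub> row_op (\<tau> c))"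
   using reps3E[OF \<Psi>] by blast
  obtain \<Theta> where \<Theta>: "\<Theta> \<in> star_map (min_tensor2 A A) (ell2_ops :: ('a \<times> 'a) ell2_op cstar_alg)"
   "\<And>a b. a \<in> carrier A ==> b \<in> carrier A ==> \<Theta> (tensor2 A A a b) = prod_rep \<rho> \<tau> (a, b)"
   using tensor2_rep[OF r(2,3)] by blast
  obtain \<sigma> where \<sigma>: "\<sigma> \<in> star_map A (ell2_ops :: 'a ell2_op cstar_alg)"
   "\<And>a. a \<in> carrier A ==> reindex_op (inv_into UNIV pairing) (\<sigma> a) = \<Theta> (\<Delta> a)"
   using transported_rep[OF \<Theta>(1)] by blast
  let ?j = "inv_into UNIV pairing"
  have j: "bij ?j" by (rule bij_imp_bij_inv[OF bij_pairing])
  have jl: "bij (map_prod (\<lambda>x. x) ?j :: 'a \<times> ('a \<times> 'a) \<Rightarrow> 'a \<times> 'a)"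
   using j by (simp add: bij_def prod.inj_map map_prod_surj)
  note C = star_mapD[OF star_homD(1)[OF col_op_star_hom]] and R = star_mapD[OF star_homD(1)[OF row_op_star_hom]]
  let ?W = "reindex_op (map_prod (\<lambda>x. x) ?j :: 'a \<times> ('a \<times> 'a) \<Rightarrow> 'a \<times> 'a)"
  have Js: "?W \<in> star_map ell2_ops ell2_ops" by (rule star_homD(1)[OF reindex_star_hom[OF jl]])
  have W: "contraction ?W" by (rule contraction_star_map[OF Js])
  have key: "\<Psi> (?t b \<otimes>\<^bsub>min_tensor3 A A A\<^esub> leg23 A y) = col_op (\<pi> b) \<otimes>\<^bsub>ell2_ops\<^esub> row_op (\<Theta> y)"
   if b: "b \<in> carrier A" and y: "y \<in> carrier (min_tensor2 A A)" for b y
  proof (rule split_map3[OF _ _ _ y])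
   have tb: "?t b \<in> carrier (min_tensor3 A A A)" using b by simp
   have pb: "\<pi> b \<in> carrier ell2_ops" using star_mapD(1)[OF r(1) b] .
   show "(\<lambda>y. \<Psi> (?t b \<otimes>\<^bsub>min_tensor3 A A A\<^esub> leg23 A y)) \<in> lin_map (min_tensor2 A A) ell2_ops"
    by (rule M2.lin_map_comp[OF cstar_alg_tensor3 cstar_alg_ops M2.lin_map_comp[OF cstar_alg_tensor3 cstar_alg_tensor3
       M2.star_map_lin_map[OF cstar_alg_tensor3 star_homD(1)[OF leg23(1)]] M3.lin_map_mult_left[OF tb]]
       M3.star_map_lin_map[OF cstar_alg_ops r(4)]])
   have "(\<lambda>y. row_op (\<Theta> y)) \<in> star_map (min_tensor2 A A) (ell2_ops :: ('a \<times> 'a \<times> 'a) ell2_op cstar_alg)"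
    by (rule star_map_comp[OF \<Theta>(1) star_homD(1)[OF row_op_star_hom]])
   from M2.lin_map_comp[OF cstar_alg_ops cstar_alg_ops M2.star_map_lin_map[OF cstar_alg_ops this]
     Ops.lin_map_mult_left[OF col_op_closed[OF pb]]]
   show "(\<lambda>y. col_op (\<pi> b) \<otimes>\<^bsub>ell2_ops\<^esub> row_op (\<Theta> y))
     \<in> lin_map (min_tensor2 A A) (ell2_ops :: ('a \<times> 'a \<times> 'a) ell2_op cstar_alg)" .
   fix a c assume a: "a \<in> carrier A" and c: "c \<in> carrier A"
   show "\<Psi> (?t b \<otimes>\<^bsub>min_tensor3 A A A\<^esub> leg23 A (tensor2 A A a c))
     = col_op (\<pi> b) \<otimes>\<^bsub>ell2_ops\<^esub> row_op (\<Theta> (tensor2 A A a c))"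
    using a b c by (simp add: leg23(2) tensor3_mult r(5) \<Theta>(2) prod_rep_def)
  qed
  have "\<Psi> (?t a \<otimes>\<^bsub>min_tensor3 A A A\<^esub> leg23 A (\<Delta> b)) = ?W (prod_rep \<pi> \<sigma> (a, b))"
   if a: "a \<in> carrier A" and b: "b \<in> carrier A" for a b
  proof -
   have pa: "\<pi> a \<in> carrier ell2_ops" and sb: "\<sigma> b \<in> carrier ell2_ops"
    using star_mapD(1)[OF r(1) a] star_mapD(1)[OF \<sigma>(1) b] .
   have pid: "reindex_op (\<lambda>x. x) (\<pi> a) = \<pi> a"
    by (simp add: reindex_op_def inv_unique_comp[of "\<lambda>x. x" "\<lambda>x. x"] fun_eq_iff)
   have id: "bij (\<lambda>x :: 'a. x)" using bij_id by (simp add: id_def)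
   have "?W (prod_rep \<pi> \<sigma> (a, b)) = col_op (\<pi> a) \<otimes>\<^bsub>ell2_ops\<^esub> row_op (\<Theta> (\<Delta> b))"
    using pa sb by (simp add: prod_rep_def star_mapD[OF Js] reindex_col[OF id j] \<sigma>(2)[OF b] pid)
   then show ?thesis using key[OF a D(1)[OF b]] by simp
  qed
  then show ?thesis using \<sigma>(1) r(1) W by blast
 qed
 have mult: "?t (a \<otimes>\<^bsub>A\<^esub> a') \<otimes>\<^bsub>min_tensor3 A A A\<^esub> leg23 A (\<Delta> (b \<otimes>\<^bsub>A\<^esub> b'))
   = (?t a \<otimes>\<^bsub>min_tensor3 A A A\<^esub> leg23 A (\<Delta> b)) \<otimes>\<^bsub>min_tensor3 A A A\<^esub> (?t a' \<otimes>\<^bsub>min_tensor3 A A A\<^esub> leg23 A (\<Delta> b'))"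
  if "a \<in> carrier A" "b \<in> carrier A" "a' \<in> carrier A" "b' \<in> carrier A" for a b a' b'
 proof -
  have t: "?t (a \<otimes>\<^bsub>A\<^esub> a') = ?t a \<otimes>\<^bsub>min_tensor3 A A A\<^esub> ?t a'" using that by (simp add: tensor3_mult)
  have c: "leg23 A (\<Delta> b) \<in> carrier (min_tensor3 A A A)" "leg23 A (\<Delta> b') \<in> carrier (min_tensor3 A A A)"
   "?t a \<in> carrier (min_tensor3 A A A)" "?t a' \<in> carrier (min_tensor3 A A A)" using that by (simp_all add: D L23)
  have "?t (a \<otimes>\<^bsub>A\<^esub> a') \<otimes>\<^bsub>min_tensor3 A A A\<^esub> leg23 A (\<Delta> (b \<otimes>\<^bsub>A\<^esub> b'))
    = ?t a \<otimes>\<^bsub>min_tensor3 A A A\<^esub> (?t a' \<otimes>\<^bsub>min_tensor3 A A A\<^esub> leg23 A (\<Delta> b)) \<otimes>\<^bsub>min_tensor3 A A A\<^esub> leg23 A (\<Delta> b')"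
   using that c by (simp add: t D L23 M3.m_assoc)
  also have "?t a' \<otimes>\<^bsub>min_tensor3 A A A\<^esub> leg23 A (\<Delta> b) = leg23 A (\<Delta> b) \<otimes>\<^bsub>min_tensor3 A A A\<^esub> ?t a'"
   by (rule com[symmetric]) (use that in \<open>simp_all add: D\<close>)
  finally show ?thesis using c by (simp add: M3.m_assoc)
 qed
 have star: "?t (star A a) \<otimes>\<^bsub>min_tensor3 A A A\<^esub> leg23 A (\<Delta> (star A b))
   = star (min_tensor3 A A A) (?t a \<otimes>\<^bsub>min_tensor3 A A A\<^esub> leg23 A (\<Delta> b))"
  if "a \<in> carrier A" "b \<in> carrier A" for a b
 proof -
  have "leg23 A (\<Delta> (star A b)) \<otimes>\<^bsub>min_tensor3 A A A\<^esub> ?t (star A a) = star (min_tensor3 A A A) (?t a \<otimes>\<^bsub>min_tensor3 A A A\<^esub> leg23 A (\<Delta> b))"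
   using that by (simp add: D L23 M3.star_mult tensor3_star)
  then show ?thesis using com[of "star A a" "\<Delta> (star A b)"] that D(1) by simp
 qed
 show "id_coproduct A \<Delta> \<in> star_hom (min_tensor2 A A) (min_tensor3 A A A)"
  unfolding id_coproduct_def
  by (rule tensor_lift(1)[OF cstar_alg_tensor3 _ mult star _ reps3_norming _ factor])
   (simp_all add: D L23 tensor3_one, simp add: reps3_def)
 show "\<And>a b. a \<in> carrier A ==> b \<in> carrier A ==> id_coproduct A \<Delta> (tensor2 A A a b) =
   ?t a \<otimes>\<^bsub>min_tensor3 A A A\<^esub> leg23 A (\<Delta> b)"
  unfolding id_coproduct_def
  by (rule tensor_lift(2)[OF cstar_alg_tensor3 _ mult star _ reps3_norming _ factor])
   (simp_all add: D L23 tensor3_one, simp add: reps3_def)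
qed

end

section \<open>Products of magic unitaries\<close>

context star_alg
begin

lemma finsum_mult_right:
 "\<lbrakk>finite I; f \<in> I \<rightarrow> carrier A; x \<in> carrier A\<rbrakk> \<Longrightarrow> x \<otimes> finsum A f I = (\<Oplus>i\<in>I. x \<otimes> f i)"
 by (induction I rule: finite_induct) (auto simp: Pi_iff r_distr)

lemma finsum_mult_left:
 "\<lbrakk>finite I; f \<in> I \<rightarrow> carrier A; x \<in> carrier A\<rbrakk> \<Longrightarrow> finsum A f I \<otimes> x = (\<Oplus>i\<in>I. f i \<otimes> x)"
 by (induction I rule: finite_induct) (auto simp: Pi_iff l_distr)

lemma finsum_swap:
 assumes "finite I" "finite J" "\<And>i j. i \<in> I ==> j \<in> J ==> f i j \<in> carrier A"
 shows "(\<Oplus>i\<in>I. \<Oplus>j\<in>J. f i j) = (\<Oplus>j\<in>J. \<Oplus>i\<in>I. f i j)"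
 using assms(1,3)
proof (induction I rule: finite_induct)
 case (insert x I)
 have "(\<Oplus>j\<in>J. \<Oplus>i\<in>insert x I. f i j) = (\<Oplus>j\<in>J. f x j \<oplus> (\<Oplus>i\<in>I. f i j))"
  using insert by (intro finsum_cong') (auto simp: Pi_iff)
 also have "\<dots> = (\<Oplus>j\<in>J. f x j) \<oplus> (\<Oplus>j\<in>J. \<Oplus>i\<in>I. f i j)"
  using insert by (intro finsum_addf) (auto simp: Pi_iff)
 finally show ?case using insert by (simp add: Pi_iff)
qed simp

definition magic :: "'v set \<Rightarrow> ('v \<Rightarrow> 'v \<Rightarrow> complex) \<Rightarrow> ('v \<Rightarrow> 'v \<Rightarrow> 'a) \<Rightarrow> bool" where
 "magic V \<epsilon> u \<longleftrightarrow>
   (\<forall>i\<in>V. \<forall>j\<in>V. u i j \<in> carrier A \<and> star A (u i j) = u i j) \<and>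
   (\<forall>i\<in>V. (\<Oplus>j\<in>V. u i j) = \<one> \<and> (\<Oplus>j\<in>V. u j i) = \<one>) \<and>
   (\<forall>i\<in>V. \<forall>j\<in>V. \<forall>l\<in>V. u i j \<otimes> u i l = (if j = l then u i j else \<zero>) \<and>
    u j i \<otimes> u l i = (if j = l then u j i else \<zero>)) \<and>
   (\<forall>i\<in>V. \<forall>j\<in>V. (\<Oplus>l\<in>V. \<epsilon> l j \<odot> u i l) = (\<Oplus>l\<in>V. \<epsilon> i l \<odot> u l j))"

lemma magicD:
 assumes "magic V \<epsilon> u" "i \<in> V" "j \<in> V"
 shows "u i j \<in> carrier A" "star A (u i j) = u i j" "(\<Oplus>j\<in>V. u i j) = \<one>" "(\<Oplus>j\<in>V. u j i) = \<one>"
  "l \<in> V ==> u i j \<otimes> u i l = (if j = l then u i j else \<zero>)"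
  "l \<in> V ==> u j i \<otimes> u l i = (if j = l then u j i else \<zero>)"
  "(\<Oplus>l\<in>V. \<epsilon> l j \<odot> u i l) = (\<Oplus>l\<in>V. \<epsilon> i l \<odot> u l j)"
 using assms unfolding magic_def by blast+

context
 fixes V :: "'v set" and \<epsilon> and a b :: "'v \<Rightarrow> 'v \<Rightarrow> 'a"
 assumes V: "finite V" and a: "magic V \<epsilon> a" and b: "magic V \<epsilon> b"
  and com: "\<And>i j k l. \<lbrakk>i \<in> V; j \<in> V; k \<in> V; l \<in> V\<rbrakk> \<Longrightarrow> a i j \<otimes> b k l = b k l \<otimes> a i j"
begin

text \<open>When \<open>a\<close> and \<open>b\<close> are the two legs of the tensor product, these
  are the right-hand sides of the coproduct formula.\<close>

definition mprod :: "'v \<Rightarrow> 'v \<Rightarrow> 'a" where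
 "mprod i j = (\<Oplus>l\<in>V. a i l \<otimes> b l j)"

lemmas ac = magicD(1)[OF a] and bc = magicD(1)[OF b]

lemma mprod_closed: "i \<in> V ==> j \<in> V ==> mprod i j \<in> carrier A"
 unfolding mprod_def using ac bc by (intro finsum_closed) auto

lemma four_swap:
 assumes "i \<in> V" "j \<in> V" "k \<in> V" "l \<in> V" "m \<in> V" "n \<in> V" "p \<in> V" "q \<in> V"
 shows "(a i j \<otimes> b k l) \<otimes> (a m n \<otimes> b p q) = (a i j \<otimes> a m n) \<otimes> (b k l \<otimes> b p q)"
proof -
 have "(a i j \<otimes> b k l) \<otimes> (a m n \<otimes> b p q) = a i j \<otimes> (b k l \<otimes> a m n) \<otimes> b p q"
  using assms ac bc by (simp add: m_assoc)
 also have "b k l \<otimes> a m n = a m n \<otimes> b k l" using assms by (intro com[symmetric])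
 finally show ?thesis using assms ac bc by (simp add: m_assoc)
qed

lemma three_swap:
 assumes "i \<in> V" "j \<in> V" "k \<in> V" "l \<in> V" "m \<in> V" "n \<in> V"
 shows "(a i j \<otimes> b k l) \<otimes> a m n = (a i j \<otimes> a m n) \<otimes> b k l"
proof -
 have "(a i j \<otimes> b k l) \<otimes> a m n = a i j \<otimes> (b k l \<otimes> a m n)" using assms ac bc by (simp add: m_assoc)
 also have "b k l \<otimes> a m n = a m n \<otimes> b k l" using assms by (intro com[symmetric])
 finally show ?thesis using assms ac bc by (simp add: m_assoc)
qed

lemma mprod_mult:
 assumes "i \<in> V" "j \<in> V" "k \<in> V" "l \<in> V"
 shows "mprod i j \<otimes> mprod k l = (\<Oplus>m\<in>V. \<Oplus>n\<in>V. (a i m \<otimes> a k n) \<otimes> (b m j \<otimes> b n l))"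
proof -
 have "mprod i j \<otimes> mprod k l = (\<Oplus>m\<in>V. (a i m \<otimes> b m j) \<otimes> mprod k l)"
  unfolding mprod_def[of i j] using assms ac bc V mprod_closed by (intro finsum_mult_left) auto
 also have "\<dots> = (\<Oplus>m\<in>V. \<Oplus>n\<in>V. (a i m \<otimes> a k n) \<otimes> (b m j \<otimes> b n l))"
 proof (rule finsum_cong'[OF refl])
  fix m assume m: "m \<in> V"
  have "(a i m \<otimes> b m j) \<otimes> mprod k l = (\<Oplus>n\<in>V. (a i m \<otimes> b m j) \<otimes> (a k n \<otimes> b n l))"
   unfolding mprod_def using assms m ac bc V by (intro finsum_mult_right) auto
  also have "\<dots> = (\<Oplus>n\<in>V. (a i m \<otimes> a k n) \<otimes> (b m j \<otimes> b n l))"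
   using assms m ac bc by (intro finsum_cong') (auto simp: four_swap)
  finally show "(a i m \<otimes> b m j) \<otimes> mprod k l = (\<Oplus>n\<in>V. (a i m \<otimes> a k n) \<otimes> (b m j \<otimes> b n l))" .
 qed (use assms ac bc in \<open>auto intro!: finsum_closed\<close>)
 finally show ?thesis .
qed

lemma finsum_delta:
 assumes "l \<in> V" "\<And>m. m \<in> V ==> f m \<in> carrier A"
 shows "(\<Oplus>m\<in>V. if l = m then f m else \<zero>) = f l"
 by (rule finsum_singleton[OF assms(1) V]) (use assms in auto)

text \<open>Commutation regroups a product of two entries into a product of entries of
  \<open>a\<close> times a product of entries of \<open>b\<close>, so the relations of the two
  factors can be applied in turn.\<close>

theorem magic_mprod: "magic V \<epsilon> mprod"
 unfolding magic_def
proof (intro conjI ballI)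
 fix i j assume i: "i \<in> V" and j: "j \<in> V"
 show "mprod i j \<in> carrier A" by (rule mprod_closed[OF i j])
 have "star A (mprod i j) = (\<Oplus>l\<in>V. star A (a i l \<otimes> b l j))"
  unfolding mprod_def using i j ac bc by (intro finsum_star[OF V]) auto
 also have "\<dots> = mprod i j"
  unfolding mprod_def using i j ac bc com
  by (intro finsum_cong') (auto simp: star_mult magicD(2)[OF a] magicD(2)[OF b])
 finally show "star A (mprod i j) = mprod i j" .
 \<comment> \<open>In matrix form the chain reads (a b) e = a (b e) = a (e b) = (a e) b = (e a) b =
   e (a b), with e for \<open>\<epsilon>\<close>.\<close>
 have "(\<Oplus>l\<in>V. \<epsilon> l j \<odot> mprod i l) = (\<Oplus>l\<in>V. \<Oplus>m\<in>V. a i m \<otimes> (\<epsilon> l j \<odot> b m l))"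
 proof (rule finsum_cong'[OF refl])
  fix l assume l: "l \<in> V"
  have "\<epsilon> l j \<odot> mprod i l = (\<Oplus>m\<in>V. \<epsilon> l j \<odot> (a i m \<otimes> b m l))"
   unfolding mprod_def using i l ac bc by (intro finsum_smult[OF V]) auto
  also have "\<dots> = (\<Oplus>m\<in>V. a i m \<otimes> (\<epsilon> l j \<odot> b m l))"
   using i l ac bc by (intro finsum_cong') (auto simp: smult_mult_right)
  finally show "\<epsilon> l j \<odot> mprod i l = (\<Oplus>m\<in>V. a i m \<otimes> (\<epsilon> l j \<odot> b m l))" .
 qed (use i j ac bc in \<open>auto intro!: finsum_closed\<close>)
 also have "\<dots> = (\<Oplus>m\<in>V. \<Oplus>l\<in>V. a i m \<otimes> (\<epsilon> l j \<odot> b m l))"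
  using i j ac bc by (intro finsum_swap[OF V V]) auto
 also have "\<dots> = (\<Oplus>m\<in>V. \<Oplus>l\<in>V. (\<epsilon> m l \<odot> a i m) \<otimes> b l j)"
 proof (rule finsum_cong'[OF refl])
  fix m assume m: "m \<in> V"
  have "(\<Oplus>l\<in>V. a i m \<otimes> (\<epsilon> l j \<odot> b m l)) = a i m \<otimes> (\<Oplus>l\<in>V. \<epsilon> l j \<odot> b m l)"
   using i j m ac bc by (intro finsum_mult_right[OF V, symmetric]) auto
  also have "\<dots> = a i m \<otimes> (\<Oplus>l\<in>V. \<epsilon> m l \<odot> b l j)" by (simp add: magicD(7)[OF b m j])
  also have "\<dots> = (\<Oplus>l\<in>V. a i m \<otimes> (\<epsilon> m l \<odot> b l j))"
   using i j m ac bc by (intro finsum_mult_right[OF V]) auto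
  also have "\<dots> = (\<Oplus>l\<in>V. (\<epsilon> m l \<odot> a i m) \<otimes> b l j)"
   using i j m ac bc by (intro finsum_cong') (auto simp: smult_mult_left smult_mult_right)
  finally show "(\<Oplus>l\<in>V. a i m \<otimes> (\<epsilon> l j \<odot> b m l)) = (\<Oplus>l\<in>V. (\<epsilon> m l \<odot> a i m) \<otimes> b l j)" .
 qed (use i j ac bc in \<open>auto intro!: finsum_closed\<close>)
 also have "\<dots> = (\<Oplus>l\<in>V. \<Oplus>m\<in>V. (\<epsilon> m l \<odot> a i m) \<otimes> b l j)"
  using i j ac bc by (intro finsum_swap[OF V V]) auto
 also have "\<dots> = (\<Oplus>l\<in>V. \<Oplus>m\<in>V. \<epsilon> i m \<odot> (a m l \<otimes> b l j))"
 proof (rule finsum_cong'[OF refl])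
  fix l assume l: "l \<in> V"
  have "(\<Oplus>m\<in>V. (\<epsilon> m l \<odot> a i m) \<otimes> b l j) = (\<Oplus>m\<in>V. \<epsilon> m l \<odot> a i m) \<otimes> b l j"
   using i j l ac bc by (intro finsum_mult_left[OF V, symmetric]) auto
  also have "\<dots> = (\<Oplus>m\<in>V. \<epsilon> i m \<odot> a m l) \<otimes> b l j" by (simp add: magicD(7)[OF a i l])
  also have "\<dots> = (\<Oplus>m\<in>V. (\<epsilon> i m \<odot> a m l) \<otimes> b l j)"
   using i j l ac bc by (intro finsum_mult_left[OF V]) auto
  also have "\<dots> = (\<Oplus>m\<in>V. \<epsilon> i m \<odot> (a m l \<otimes> b l j))"
   using i j l ac bc by (intro finsum_cong') (auto simp: smult_mult_left)
  finally show "(\<Oplus>m\<in>V. (\<epsilon> m l \<odot> a i m) \<otimes> b l j) = (\<Oplus>m\<in>V. \<epsilon> i m \<odot> (a m l \<otimes> b l j))" .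
 qed (use i j ac bc in \<open>auto intro!: finsum_closed\<close>)
 also have "\<dots> = (\<Oplus>m\<in>V. \<Oplus>l\<in>V. \<epsilon> i m \<odot> (a m l \<otimes> b l j))"
  using i j ac bc by (intro finsum_swap[OF V V]) auto
 also have "\<dots> = (\<Oplus>m\<in>V. \<epsilon> i m \<odot> mprod m j)"
  unfolding mprod_def using i j ac bc
  by (intro finsum_cong') (auto intro!: finsum_closed simp: finsum_smult[OF V] Pi_iff)
 finally show "(\<Oplus>l\<in>V. \<epsilon> l j \<odot> mprod i l) = (\<Oplus>l\<in>V. \<epsilon> i l \<odot> mprod l j)" .
 fix k assume k: "k \<in> V"
 have "mprod i j \<otimes> mprod i k = (\<Oplus>l\<in>V. if j = k then a i l \<otimes> b l j else \<zero>)"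
  unfolding mprod_mult[OF i j i k]
 proof (rule finsum_cong'[OF refl])
  fix l assume l: "l \<in> V"
  have "(\<Oplus>m\<in>V. (a i l \<otimes> a i m) \<otimes> (b l j \<otimes> b m k)) = (\<Oplus>m\<in>V. if l = m then a i m \<otimes> (b l j \<otimes> b m k) else \<zero>)"
   using i j k l ac bc by (intro finsum_cong') (auto simp: magicD(5)[OF a])
  also have "\<dots> = a i l \<otimes> (b l j \<otimes> b l k)" using i j k l ac bc by (intro finsum_delta) auto
  finally show "(\<Oplus>m\<in>V. (a i l \<otimes> a i m) \<otimes> (b l j \<otimes> b m k)) = (if j = k then a i l \<otimes> b l j else \<zero>)"
   using i j k l ac by (simp add: magicD(5)[OF b])
 qed (use i j k ac bc in auto)
 then show "mprod i j \<otimes> mprod i k = (if j = k then mprod i j else \<zero>)" by (simp add: mprod_def)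
 \<comment> \<open>For columns the orthogonality of \<open>b\<close> collapses the double sum first;
   for rows it was that of \<open>a\<close>.\<close>
 have "mprod j i \<otimes> mprod k i = (\<Oplus>l\<in>V. if j = k then a j l \<otimes> b l i else \<zero>)"
  unfolding mprod_mult[OF j i k i]
 proof (rule finsum_cong'[OF refl])
  fix l assume l: "l \<in> V"
  have "(\<Oplus>m\<in>V. (a j l \<otimes> a k m) \<otimes> (b l i \<otimes> b m i)) = (\<Oplus>m\<in>V. if l = m then (a j l \<otimes> a k m) \<otimes> b m i else \<zero>)"
   using i j k l ac bc by (intro finsum_cong') (auto simp: magicD(6)[OF b])
  also have "\<dots> = (a j l \<otimes> a k l) \<otimes> b l i" using i j k l ac bc by (intro finsum_delta) auto
  finally show "(\<Oplus>m\<in>V. (a j l \<otimes> a k m) \<otimes> (b l i \<otimes> b m i)) = (if j = k then a j l \<otimes> b l i else \<zero>)"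
   using i j k l bc by (simp add: magicD(6)[OF a])
 qed (use i j k ac bc in auto)
 then show "mprod j i \<otimes> mprod k i = (if j = k then mprod j i else \<zero>)" by (simp add: mprod_def)
next
 fix i assume i: "i \<in> V"
 have "(\<Oplus>j\<in>V. mprod i j) = (\<Oplus>l\<in>V. \<Oplus>j\<in>V. a i l \<otimes> b l j)"
  unfolding mprod_def using i ac bc by (intro finsum_swap[OF V V]) auto
 also have "\<dots> = (\<Oplus>l\<in>V. a i l)"
 proof (rule finsum_cong'[OF refl])
  fix l assume l: "l \<in> V"
  have "(\<Oplus>j\<in>V. a i l \<otimes> b l j) = a i l \<otimes> (\<Oplus>j\<in>V. b l j)"
   using i l ac bc by (intro finsum_mult_right[OF V, symmetric]) auto
  then show "(\<Oplus>j\<in>V. a i l \<otimes> b l j) = a i l" using i l ac by (simp add: magicD(3)[OF b l l])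
 qed (use i ac in auto)
 finally show "(\<Oplus>j\<in>V. mprod i j) = \<one>" using magicD(3)[OF a i i] by simp
 have "(\<Oplus>j\<in>V. mprod j i) = (\<Oplus>l\<in>V. \<Oplus>j\<in>V. a j l \<otimes> b l i)"
  unfolding mprod_def using i ac bc by (intro finsum_swap[OF V V]) auto
 also have "\<dots> = (\<Oplus>l\<in>V. b l i)"
 proof (rule finsum_cong'[OF refl])
  fix l assume l: "l \<in> V"
  have "(\<Oplus>j\<in>V. a j l \<otimes> b l i) = (\<Oplus>j\<in>V. a j l) \<otimes> b l i"
   using i l ac bc by (intro finsum_mult_left[OF V, symmetric]) auto
  then show "(\<Oplus>j\<in>V. a j l \<otimes> b l i) = b l i" using i l bc by (simp add: magicD(4)[OF a l l])
 qed (use i bc in auto)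
 finally show "(\<Oplus>j\<in>V. mprod j i) = \<one>" using magicD(4)[OF b i i] by simp
qed

text \<open>Column orthogonality of \<open>b\<close> leaves the single intermediate index
  \<open>j\<close>, and its row sums then remove \<open>b\<close>. The second identity uses row
  orthogonality and column sums of \<open>a\<close> in the same way.\<close>

lemma mprod_row_recover:
 assumes i: "i \<in> V" and j: "j \<in> V"
 shows "(\<Oplus>k\<in>V. mprod i k \<otimes> b j k) = a i j" and "(\<Oplus>k\<in>V. mprod k j \<otimes> a k i) = b i j"
proof -
 have "(\<Oplus>k\<in>V. mprod i k \<otimes> b j k) = (\<Oplus>k\<in>V. \<Oplus>l\<in>V. a i l \<otimes> (b l k \<otimes> b j k))"
 proof (rule finsum_cong'[OF refl])
  fix k assume k: "k \<in> V"
  have "mprod i k \<otimes> b j k = (\<Oplus>l\<in>V. (a i l \<otimes> b l k) \<otimes> b j k)"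
   unfolding mprod_def using i j k ac bc by (intro finsum_mult_left[OF V]) auto
  also have "\<dots> = (\<Oplus>l\<in>V. a i l \<otimes> (b l k \<otimes> b j k))"
   using i j k ac bc by (intro finsum_cong') (auto simp: m_assoc)
  finally show "mprod i k \<otimes> b j k = (\<Oplus>l\<in>V. a i l \<otimes> (b l k \<otimes> b j k))" .
 qed (use i j ac bc in \<open>auto intro!: finsum_closed\<close>)
 also have "\<dots> = (\<Oplus>l\<in>V. \<Oplus>k\<in>V. a i l \<otimes> (b l k \<otimes> b j k))"
  using i j ac bc by (intro finsum_swap[OF V V]) auto
 also have "\<dots> = (\<Oplus>l\<in>V. if j = l then a i l else \<zero>)"
 proof (rule finsum_cong'[OF refl])
  fix l assume l: "l \<in> V"
  have "(\<Oplus>k\<in>V. a i l \<otimes> (b l k \<otimes> b j k)) = (\<Oplus>k\<in>V. a i l \<otimes> (if j = l then b l k else \<zero>))"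
   using i j l ac bc by (intro finsum_cong') (auto simp: magicD(6)[OF b])
  also have "\<dots> = a i l \<otimes> (\<Oplus>k\<in>V. if j = l then b l k else \<zero>)"
   using i j l ac bc by (intro finsum_mult_right[OF V, symmetric]) auto
  finally show "(\<Oplus>k\<in>V. a i l \<otimes> (b l k \<otimes> b j k)) = (if j = l then a i l else \<zero>)"
   using i l ac by (simp add: magicD(3)[OF b l l])
 qed (use i ac in auto)
 also have "\<dots> = a i j" using i j ac by (intro finsum_delta) auto
 finally show "(\<Oplus>k\<in>V. mprod i k \<otimes> b j k) = a i j" .
 have "(\<Oplus>k\<in>V. mprod k j \<otimes> a k i) = (\<Oplus>k\<in>V. \<Oplus>l\<in>V. (a k l \<otimes> a k i) \<otimes> b l j)"
 proof (rule finsum_cong'[OF refl])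
  fix k assume k: "k \<in> V"
  have "mprod k j \<otimes> a k i = (\<Oplus>l\<in>V. (a k l \<otimes> b l j) \<otimes> a k i)"
   unfolding mprod_def using i j k ac bc by (intro finsum_mult_left[OF V]) auto
  also have "\<dots> = (\<Oplus>l\<in>V. (a k l \<otimes> a k i) \<otimes> b l j)"
   using i j k ac bc by (intro finsum_cong') (auto simp: three_swap)
  finally show "mprod k j \<otimes> a k i = (\<Oplus>l\<in>V. (a k l \<otimes> a k i) \<otimes> b l j)" .
 qed (use i j ac bc in \<open>auto intro!: finsum_closed\<close>)
 also have "\<dots> = (\<Oplus>l\<in>V. \<Oplus>k\<in>V. (a k l \<otimes> a k i) \<otimes> b l j)"
  using i j ac bc by (intro finsum_swap[OF V V]) auto
 also have "\<dots> = (\<Oplus>l\<in>V. if i = l then b l j else \<zero>)"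
 proof (rule finsum_cong'[OF refl])
  fix l assume l: "l \<in> V"
  have "(\<Oplus>k\<in>V. (a k l \<otimes> a k i) \<otimes> b l j) = (\<Oplus>k\<in>V. (if i = l then a k l else \<zero>) \<otimes> b l j)"
   using i j l ac bc by (intro finsum_cong') (auto simp: magicD(5)[OF a])
  also have "\<dots> = (\<Oplus>k\<in>V. if i = l then a k l else \<zero>) \<otimes> b l j"
   using i j l ac bc by (intro finsum_mult_left[OF V, symmetric]) auto
  finally show "(\<Oplus>k\<in>V. (a k l \<otimes> a k i) \<otimes> b l j) = (if i = l then b l j else \<zero>)"
   using j l bc by (simp add: magicD(4)[OF a l l])
 qed (use j bc in auto)
 also have "\<dots> = b i j" using i j bc by (intro finsum_delta) auto
 finally show "(\<Oplus>k\<in>V. mprod k j \<otimes> a k i) = b i j" .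
qed

section \<open>Products along paths\<close>

text \<open>The sum over all index tuples of length n, kept as an iterated sum so that each law
  reduces to one about a single index.\<close>

primrec nest :: "nat \<Rightarrow> ('v list \<Rightarrow> 'a) \<Rightarrow> 'a" where
 "nest 0 f = f []"
| "nest (Suc n) f = (\<Oplus>l\<in>V. nest n (\<lambda>ls. f (l # ls)))"

lemma nest_closed:
 "(\<And>ls. set ls \<subseteq> V ==> length ls = n ==> f ls \<in> carrier A) ==> nest n f \<in> carrier A"
proof (induction n arbitrary: f)
 case (Suc n)
 then show ?case by (auto intro!: finsum_closed)
qed simp

lemma nest_cong:
 assumes "\<And>ls. set ls \<subseteq> V ==> length ls = n ==> f ls = g ls"
  and "\<And>ls. set ls \<subseteq> V ==> length ls = n ==> g ls \<in> carrier A"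
 shows "nest n f = nest n g"
 using assms
proof (induction n arbitrary: f g)
 case (Suc n)
 have "nest n (\<lambda>ls. f (l # ls)) = nest n (\<lambda>ls. g (l # ls))" if "l \<in> V" for l
  using Suc.prems that by (intro Suc.IH) auto
 moreover have "nest n (\<lambda>ls. g (l # ls)) \<in> carrier A" if "l \<in> V" for l
  using Suc.prems that by (intro nest_closed) auto
 ultimately show ?case by (auto intro!: finsum_cong')
qed simp

lemma nest_star:
 "(\<And>ls. set ls \<subseteq> V ==> length ls = n ==> f ls \<in> carrier A) ==> star A (nest n f) = nest n (\<lambda>ls. star A (f ls))"
proof (induction n arbitrary: f)
 case (Suc n)
 have c: "nest n (\<lambda>ls. f (l # ls)) \<in> carrier A" if "l \<in> V" for l
  using Suc.prems that by (intro nest_closed) auto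
 have "star A (nest (Suc n) f) = (\<Oplus>l\<in>V. star A (nest n (\<lambda>ls. f (l # ls))))"
  using c by (simp add: finsum_star[OF V] Pi_iff)
 also have "\<dots> = (\<Oplus>l\<in>V. nest n (\<lambda>ls. star A (f (l # ls))))"
 proof (rule finsum_cong'[OF refl])
  show "star A (nest n (\<lambda>ls. f (l # ls))) = nest n (\<lambda>ls. star A (f (l # ls)))" if "l \<in> V" for l
   using Suc.prems that by (intro Suc.IH) auto
  show "(\<lambda>l. nest n (\<lambda>ls. star A (f (l # ls)))) \<in> V \<rightarrow> carrier A"
   using Suc.prems by (auto intro!: nest_closed)
 qed
 finally show ?case by simp
qed simp

lemma nest_mult:
 "\<lbrakk>\<And>ls. set ls \<subseteq> V ==> length ls = n ==> f ls \<in> carrier A; x \<in> carrier A\<rbrakk> \<Longrightarrow> x \<otimes> nest n f = nest n (\<lambda>ls. x \<otimes> f ls)"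
proof (induction n arbitrary: f)
 case (Suc n)
 have c: "nest n (\<lambda>ls. f (l # ls)) \<in> carrier A" if "l \<in> V" for l
  using Suc.prems that by (intro nest_closed) auto
 have "x \<otimes> nest (Suc n) f = (\<Oplus>l\<in>V. x \<otimes> nest n (\<lambda>ls. f (l # ls)))"
  using c Suc.prems by (simp add: finsum_mult_right[OF V] Pi_iff)
 also have "\<dots> = (\<Oplus>l\<in>V. nest n (\<lambda>ls. x \<otimes> f (l # ls)))"
 proof (rule finsum_cong'[OF refl])
  show "x \<otimes> nest n (\<lambda>ls. f (l # ls)) = nest n (\<lambda>ls. x \<otimes> f (l # ls))" if "l \<in> V" for l
   using Suc.prems that by (intro Suc.IH) auto
  show "(\<lambda>l. nest n (\<lambda>ls. x \<otimes> f (l # ls))) \<in> V \<rightarrow> carrier A"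
   using Suc.prems by (auto intro!: nest_closed)
 qed
 finally show ?case by simp
qed simp

abbreviation pprod :: "('v \<Rightarrow> 'v \<Rightarrow> 'a) \<Rightarrow> 'v list \<Rightarrow> 'v list \<Rightarrow> 'a" where
 "pprod u is js \<equiv> list_prod A (map2 u is js)"

lemma pprod_closed:
 assumes "\<And>i j. i \<in> V ==> j \<in> V ==> u i j \<in> carrier A" "set is \<subseteq> V" "set js \<subseteq> V"
 shows "pprod u is js \<in> carrier A"
 using assms(2,3)
proof (induction "is" arbitrary: js)
 case (Cons i "is")
 then show ?case using assms(1) by (cases js) (auto simp: list_prod_def)
qed (simp add: list_prod_def)

lemma pprod_com:
 assumes "set is \<subseteq> V" "set js \<subseteq> V" "k \<in> V" "l \<in> V"
 shows "b k l \<otimes> pprod a is js = pprod a is js \<otimes> b k l"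
 using assms(1,2)
proof (induction "is" arbitrary: js)
 case (Cons i "is")
 show ?case
 proof (cases js)
  case (Cons j js')
  have c: "a i j \<in> carrier A" "b k l \<in> carrier A" "pprod a is js' \<in> carrier A" "i \<in> V" "j \<in> V"
   using Cons Cons.prems assms ac bc pprod_closed[of a] by auto
  have IH: "b k l \<otimes> pprod a is js' = pprod a is js' \<otimes> b k l" using Cons Cons.prems Cons.IH[of js'] by auto
  have "b k l \<otimes> (a i j \<otimes> pprod a is js') = (b k l \<otimes> a i j) \<otimes> pprod a is js'" using c by (simp add: m_assoc)
  also have "b k l \<otimes> a i j = a i j \<otimes> b k l" using c assms by (intro com[symmetric])
  also have "a i j \<otimes> b k l \<otimes> pprod a is js' = a i j \<otimes> (pprod a is js' \<otimes> b k l)" using c by (simp add: m_assoc IH)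
  finally show ?thesis using c Cons by (simp add: list_prod_def m_assoc)
 qed (use assms bc in \<open>simp add: list_prod_def\<close>)
qed (use assms bc in \<open>simp add: list_prod_def\<close>)

lemma pprod_com':
 assumes "set is \<subseteq> V" "set js \<subseteq> V" "set ks \<subseteq> V" "set ls \<subseteq> V"
 shows "pprod b ks ls \<otimes> pprod a is js = pprod a is js \<otimes> pprod b ks ls"
 using assms(3,4)
proof (induction ks arbitrary: ls)
 case Nil
 then show ?case using pprod_closed[OF ac assms(1,2)] by (simp add: list_prod_def)
next
 case (Cons k ks)
 show ?case
 proof (cases ls)
  case Nil
  then show ?thesis using pprod_closed[OF ac assms(1,2)] by (simp add: list_prod_def)
 next
  case (Cons l ls')
  have kl: "k \<in> V" "l \<in> V" "set ks \<subseteq> V" "set ls' \<subseteq> V" using Cons Cons.prems by auto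
  have c: "pprod a is js \<in> carrier A" "pprod b ks ls' \<in> carrier A" "b k l \<in> carrier A"
   using pprod_closed[OF ac assms(1,2)] pprod_closed[OF bc kl(3,4)] bc kl by auto
  have "b k l \<otimes> pprod b ks ls' \<otimes> pprod a is js = (b k l \<otimes> pprod a is js) \<otimes> pprod b ks ls'"
   using c Cons.IH[OF kl(3,4)] by (simp add: m_assoc)
  also have "\<dots> = pprod a is js \<otimes> (b k l \<otimes> pprod b ks ls')"
   using c by (simp add: pprod_com[OF assms(1,2) kl(1,2)] m_assoc)
  finally show ?thesis using Cons by (simp add: list_prod_def)
 qed
qed

text \<open>Expanding all factors produces a sum over tuples of intermediate indices; moving each
  entry of \<open>b\<close> past the entries of \<open>a\<close> that follow it separates the two
  products.\<close>

lemma pprod_mprod: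
 assumes "set is \<subseteq> V" "set js \<subseteq> V" "length is = length js"
 shows "pprod mprod is js = nest (length is) (\<lambda>ls. pprod a is ls \<otimes> pprod b ls js)"
 using assms
proof (induction "is" arbitrary: js)
 case Nil
 then show ?case by (simp add: list_prod_def)
next
 case (Cons i "is" js)
 then obtain j js' where js: "js = j # js'" "j \<in> V" "set js' \<subseteq> V" "length is = length js'" and i: "i \<in> V" "set is \<subseteq> V"
  by (cases js) auto
 let ?n = "length is"
 have P: "pprod a is ls \<in> carrier A" "pprod b ls js' \<in> carrier A" if "set ls \<subseteq> V" for ls
  using that pprod_closed[OF ac i(2) that] pprod_closed[OF bc that js(3)] by auto
 let ?N = "nest ?n (\<lambda>ls. pprod a is ls \<otimes> pprod b ls js')"
 have N: "?N \<in> carrier A" using P by (intro nest_closed) auto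
 have "pprod mprod (i # is) js = mprod i j \<otimes> ?N"
  using Cons.IH[OF i(2) js(3,4)] by (simp add: js list_prod_def)
 also have "\<dots> = (\<Oplus>l\<in>V. (a i l \<otimes> b l j) \<otimes> ?N)"
  unfolding mprod_def using N i js ac bc by (intro finsum_mult_left[OF V]) auto
 also have "\<dots> = (\<Oplus>l\<in>V. nest ?n (\<lambda>ls. pprod a (i # is) (l # ls) \<otimes> pprod b (l # ls) js))"
 proof (rule finsum_cong'[OF refl])
  fix l assume l: "l \<in> V"
  have c: "a i l \<in> carrier A" "b l j \<in> carrier A" using i js l ac bc by auto
  have "(a i l \<otimes> b l j) \<otimes> ?N = nest ?n (\<lambda>ls. (a i l \<otimes> b l j) \<otimes> (pprod a is ls \<otimes> pprod b ls js'))"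
   using c P by (intro nest_mult) auto
  also have "\<dots> = nest ?n (\<lambda>ls. pprod a (i # is) (l # ls) \<otimes> pprod b (l # ls) js)"
  proof (rule nest_cong)
   fix ls assume ls: "set ls \<subseteq> V"
   have "(a i l \<otimes> b l j) \<otimes> (pprod a is ls \<otimes> pprod b ls js') = a i l \<otimes> (b l j \<otimes> pprod a is ls) \<otimes> pprod b ls js'"
    using c P[OF ls] by (simp add: m_assoc)
   also have "b l j \<otimes> pprod a is ls = pprod a is ls \<otimes> b l j" by (rule pprod_com[OF i(2) ls l js(2)])
   finally show "(a i l \<otimes> b l j) \<otimes> (pprod a is ls \<otimes> pprod b ls js') = pprod a (i # is) (l # ls) \<otimes> pprod b (l # ls) js"
    using c P[OF ls] by (simp add: js list_prod_def m_assoc)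
   show "pprod a (i # is) (l # ls) \<otimes> pprod b (l # ls) js \<in> carrier A"
    using c P[OF ls] by (simp add: js list_prod_def)
  qed
  finally show "(a i l \<otimes> b l j) \<otimes> ?N = nest ?n (\<lambda>ls. pprod a (i # is) (l # ls) \<otimes> pprod b (l # ls) js)" .
 next
  have "pprod a (i # is) (l # ls) \<otimes> pprod b (l # ls) js \<in> carrier A" if "l \<in> V" "set ls \<subseteq> V" for l ls
   using P[OF that(2)] that i js ac bc by (simp add: list_prod_def)
  then show "(\<lambda>l. nest ?n (\<lambda>ls. pprod a (i # is) (l # ls) \<otimes> pprod b (l # ls) js)) \<in> V \<rightarrow> carrier A"
   by (auto intro!: nest_closed)
 qed
 finally show ?case by simp
qed

text \<open>The sum that represents both sides of the adjacency relation at \<open>(i, l')\<close>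
  is inserted between the factors. Read as a combination of entries in row \<open>i\<close>, it is
  annihilated by \<open>a i l\<close> because \<open>\<epsilon> l l' = 0\<close>; read as a
  combination in column \<open>l'\<close>, it fixes \<open>a i' l'\<close> because
  \<open>\<epsilon> i i' = 1\<close>.\<close>

lemma edge_nonedge_zero:
 assumes v: "i \<in> V" "i' \<in> V" "l \<in> V" "l' \<in> V" and \<epsilon>: "\<epsilon> i i' = 1" "\<epsilon> l l' = 0"
 shows "a i l \<otimes> a i' l' = \<zero>"
proof -
 have "a i l \<otimes> (\<Oplus>m\<in>V. \<epsilon> m l' \<odot> a i m) = (\<Oplus>m\<in>V. a i l \<otimes> (\<epsilon> m l' \<odot> a i m))"
  using v ac by (intro finsum_mult_right[OF V]) auto
 also have "\<dots> = (\<Oplus>m\<in>V. if l = m then \<epsilon> m l' \<odot> a i m else \<zero>)"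
  using v ac by (intro finsum_cong') (auto simp: smult_mult_right magicD(5)[OF a])
 also have "\<dots> = \<epsilon> l l' \<odot> a i l" using v ac by (intro finsum_delta) auto
 finally have 1: "a i l \<otimes> (\<Oplus>m\<in>V. \<epsilon> i m \<odot> a m l') = \<zero>" using v ac \<epsilon> by (simp add: magicD(7)[OF a v(1) v(4)])
 have "(\<Oplus>m\<in>V. \<epsilon> i m \<odot> a m l') \<otimes> a i' l' = (\<Oplus>m\<in>V. (\<epsilon> i m \<odot> a m l') \<otimes> a i' l')"
  using v ac by (intro finsum_mult_left[OF V]) auto
 also have "\<dots> = (\<Oplus>m\<in>V. if i' = m then \<epsilon> i m \<odot> a m l' else \<zero>)"
  using v ac by (intro finsum_cong') (auto simp: smult_mult_left magicD(6)[OF a])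
 also have "\<dots> = \<epsilon> i i' \<odot> a i' l'" using v ac by (intro finsum_delta) auto
 finally have 2: "(\<Oplus>m\<in>V. \<epsilon> i m \<odot> a m l') \<otimes> a i' l' = a i' l'" using v ac \<epsilon> by simp
 have "(\<Oplus>m\<in>V. \<epsilon> i m \<odot> a m l') \<in> carrier A" using v ac by (intro finsum_closed) auto
 then have "a i l \<otimes> a i' l' = (a i l \<otimes> (\<Oplus>m\<in>V. \<epsilon> i m \<odot> a m l')) \<otimes> a i' l'"
  using v ac by (simp add: m_assoc 2)
 then show ?thesis using v ac by (simp add: 1)
qed

text \<open>Where \<open>ls\<close> first fails to be a path, \<open>is\<close> still has an edge,
  and the two neighbouring factors multiply to zero.\<close>

lemma pprod_nonpath_zero:
 assumes \<epsilon>: "\<And>i j. \<epsilon> i j = (if E i j then 1 else 0)"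
  and "successively E is" "\<not> successively E ls" "length is = length ls" "set is \<subseteq> V" "set ls \<subseteq> V"
 shows "pprod a is ls = \<zero>"
 using assms(2-)
proof (induction "is" arbitrary: ls)
 case (Cons i "is" ls)
 obtain l ls' where ls: "ls = l # ls'" using Cons.prems by (cases ls) auto
 show ?case
 proof (cases "is")
  case Nil
  then show ?thesis using Cons.prems ls by simp
 next
  case (Cons i' is')
  obtain l' ls'' where ls': "ls' = l' # ls''" using Cons Cons.prems ls by (cases ls') auto
  have c: "a i l \<in> carrier A" "a i' l' \<in> carrier A" "pprod a is' ls'' \<in> carrier A"
   using Cons Cons.prems ls ls' ac pprod_closed[of a is' ls''] by auto
  show ?thesis
  proof (cases "E l l'")
   case True
   then have "pprod a is ls' = \<zero>"
    using Cons Cons.prems ls ls' by (intro Cons.IH) auto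
   then show ?thesis using c ls by (simp add: list_prod_def)
  next
   case False
   have "a i l \<otimes> a i' l' = \<zero>"
    by (rule edge_nonedge_zero) (use False Cons Cons.prems ls ls' in \<open>simp_all add: \<epsilon>\<close>)
   then have "a i l \<otimes> (a i' l' \<otimes> pprod a is' ls'') = \<zero>" using c by (simp add: m_assoc[symmetric])
   then show ?thesis using Cons ls ls' by (simp add: list_prod_def)
  qed
 qed
qed simp

end

lemma list_prod_append:
 "set xs \<subseteq> carrier A ==> set ys \<subseteq> carrier A ==> list_prod A (xs @ ys) = list_prod A xs \<otimes> list_prod A ys"
 and list_prod_closed: "set xs \<subseteq> carrier A ==> list_prod A xs \<in> carrier A"
proof -
 show cl: "list_prod A xs \<in> carrier A" if "set xs \<subseteq> carrier A" for xs
  using that by (induction xs) (auto simp: list_prod_def)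
 show "list_prod A (xs @ ys) = list_prod A xs \<otimes> list_prod A ys" if "set xs \<subseteq> carrier A" "set ys \<subseteq> carrier A"
  using that
 proof (induction xs)
  case Nil
  then show ?case using cl[of ys] by (simp add: list_prod_def)
 next
  case (Cons x xs)
  then show ?case using cl[of xs] cl[of ys] by (simp add: list_prod_def m_assoc)
 qed
qed

text \<open>For self-adjoint factors reversal is the adjoint, so a path relation says that the
  product along the two paths is self-adjoint.\<close>

lemma list_prod_rev:
 "(\<And>x. x \<in> set xs ==> x \<in> carrier A \<and> star A x = x) ==> list_prod A (rev xs) = star A (list_prod A xs)"
proof (induction xs)
 case (Cons x xs)
 have c: "set xs \<subseteq> carrier A" "x \<in> carrier A" "star A x = x" using Cons.prems by auto
 have "list_prod A (rev (x # xs)) = list_prod A (rev xs) \<otimes> list_prod A [x]"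
  using c by (simp add: list_prod_append)
 also have "\<dots> = star A (list_prod A xs) \<otimes> x" using Cons c by (simp add: list_prod_def)
 also have "\<dots> = star A (x \<otimes> list_prod A xs)" using c list_prod_closed[OF c(1)] by (simp add: star_mult)
 finally show ?case by (simp add: list_prod_def)
qed (simp add: list_prod_def)

definition path_sym :: "('v, 'e) pre_digraph \<Rightarrow> nat \<Rightarrow> ('v \<Rightarrow> 'v \<Rightarrow> 'a) \<Rightarrow> bool" where
 "path_sym \<Gamma> k u \<longleftrightarrow> (\<forall>is js. vertex_path \<Gamma> is \<and> vertex_path \<Gamma> js \<and> length is = length js \<and> length is \<le> k + 1 \<longrightarrow>
   list_prod A (map2 u is js) = list_prod A (rev (map2 u is js)))"

text \<open>In the expansion of a product of entries of \<open>mprod\<close> along two paths, the terms whose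
 intermediate indices do not form a path vanish, and the others are products of two commuting
 self-adjoint elements.\<close>

theorem path_sym_mprod:
 fixes \<Gamma> :: "('v, 'e) pre_digraph" and a b :: "'v \<Rightarrow> 'v \<Rightarrow> 'a"
 assumes V: "finite (verts \<Gamma>)" and a: "magic (verts \<Gamma>) (adj_matrix \<Gamma>) a" and b: "magic (verts \<Gamma>) (adj_matrix \<Gamma>) b"
  and com: "\<And>i j k l. \<lbrakk>i \<in> verts \<Gamma>; j \<in> verts \<Gamma>; k \<in> verts \<Gamma>; l \<in> verts \<Gamma>\<rbrakk> \<Longrightarrow> a i j \<otimes> b k l = b k l \<otimes> a i j"
  and pa: "path_sym \<Gamma> k a" and pb: "path_sym \<Gamma> k b"
 shows "path_sym \<Gamma> k (mprod (verts \<Gamma>) a b)"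
 unfolding path_sym_def
proof (intro allI impI, elim conjE)
 note cx = V a b com
 let ?V = "verts \<Gamma>"
 fix "is" js assume p: "vertex_path \<Gamma> is" "vertex_path \<Gamma> js" "length is = length js" "length is \<le> k + 1"
 have V': "set is \<subseteq> ?V" "set js \<subseteq> ?V" using p by (simp_all add: vertex_path_def)
 let ?P = "\<lambda>u is js. list_prod A (map2 u is js)"
 have sa: "list_prod A (rev (map2 u is js)) = star A (?P u is js)"
  if "magic ?V (adj_matrix \<Gamma>) u" "set is \<subseteq> ?V" "set js \<subseteq> ?V" for u "is" js
 proof (rule list_prod_rev)
  fix x assume "x \<in> set (map2 u is js)"
  then obtain i j where x: "x = u i j" "(i, j) \<in> set (zip is js)" by auto
  then have "i \<in> ?V" "j \<in> ?V" using that(2,3) by (auto dest: set_zip_leftD set_zip_rightD)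
  then show "x \<in> carrier A \<and> star A x = x" using magicD(1,2)[OF that(1)] x(1) by auto
 qed
 let ?f = "\<lambda>ls. ?P a is ls \<otimes> ?P b ls js"
 have c: "?P a is ls \<in> carrier A" "?P b ls js \<in> carrier A" if "set ls \<subseteq> ?V" for ls
  using pprod_closed[OF cx magicD(1)[OF a] V'(1) that] pprod_closed[OF cx magicD(1)[OF b] that V'(2)] by auto
 have eq: "?P (mprod ?V a b) is js = nest ?V (length is) ?f" by (rule pprod_mprod[OF cx V' p(3)])
 have "star A (nest ?V (length is) ?f) = nest ?V (length is) (\<lambda>ls. star A (?f ls))"
  by (rule nest_star[OF cx]) (use c in auto)
 also have "\<dots> = nest ?V (length is) ?f"
 proof (rule nest_cong[OF cx])
  fix ls assume ls: "set ls \<subseteq> ?V" "length ls = length is"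
  show "?f ls \<in> carrier A" using c[OF ls(1)] by simp
  show "star A (?f ls) = ?f ls"
  proof (cases "successively (\<lambda>u v. u \<rightarrow>\<^bsub>\<Gamma>\<^esub> v) ls")
   case False
   have "?P a is ls = \<zero>"
    by (rule pprod_nonpath_zero[OF cx, where E = "\<lambda>u v. u \<rightarrow>\<^bsub>\<Gamma>\<^esub> v"])
     (use False p ls V' in \<open>simp_all add: adj_matrix_def vertex_path_def\<close>)
   then show ?thesis using c[OF ls(1)] by simp
  next
   case True
   then have pl: "vertex_path \<Gamma> ls" using ls p by (auto simp: vertex_path_def)
   have "star A (?P a is ls) = ?P a is ls"
    using pa p pl ls sa[OF a V'(1) ls(1)] unfolding path_sym_def by metis
   moreover have "star A (?P b ls js) = ?P b ls js"
    using pb p pl ls sa[OF b ls(1) V'(2)] unfolding path_sym_def by metis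
   ultimately show ?thesis
    using c[OF ls(1)] pprod_com'[OF cx V'(1) ls(1) ls(1) V'(2)] by (simp add: star_mult)
  qed
 qed
 finally show "?P (mprod ?V a b) is js = list_prod A (rev (map2 (mprod ?V a b) is js))"
  by (simp add: sa[OF magic_mprod[OF cx] V'] eq)
qed

end

section \<open>Quantum automorphism groups of graphs\<close>

lemma star_monoid_words:
 "star_monoid \<lparr>carrier = lists (E \<times> (UNIV :: bool set)), monoid.mult = (@), one = []\<rparr> word_star"
 (is "star_monoid ?W _")
proof -
 interpret Group.monoid ?W by unfold_locales auto
 show ?thesis by unfold_locales (auto simp: word_star_append word_star_word_star, auto simp: word_star_def)
qed

lemma star_alg_free: "star_alg (free_star_alg E)"
proof -
 interpret W: star_monoid "\<lparr>carrier = lists (E \<times> (UNIV :: bool set)), monoid.mult = (@), one = []\<rparr>" word_star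
  by (rule star_monoid_words)
 show ?thesis unfolding free_star_alg_def by (rule W.MA.star_alg_axioms)
qed

lemma free_gen_carrier: "g \<in> E ==> free_gen g \<in> carrier (free_star_alg E)"
 by (simp add: free_star_alg_def free_gen_def monoid_star_alg_def)

lemma free_star_alg_induct [consumes 1, case_names one gen star mult add smult]:
 assumes x: "x \<in> carrier (free_star_alg E)" and one: "P \<one>\<^bsub>free_star_alg E\<^esub>"
  and gen: "\<And>g. g \<in> E ==> P (free_gen g)" and star: "\<And>g. g \<in> E ==> P (star (free_star_alg E) (free_gen g))"
  and mult: "\<And>x y. \<lbrakk>x \<in> carrier (free_star_alg E); y \<in> carrier (free_star_alg E); P x; P y\<rbrakk> \<Longrightarrow> P (x \<otimes>\<^bsub>free_star_alg E\<^esub> y)"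
  and add: "\<And>x y. \<lbrakk>x \<in> carrier (free_star_alg E); y \<in> carrier (free_star_alg E); P x; P y\<rbrakk> \<Longrightarrow> P (x \<oplus>\<^bsub>free_star_alg E\<^esub> y)"
  and smult: "\<And>c x. \<lbrakk>x \<in> carrier (free_star_alg E); P x\<rbrakk> \<Longrightarrow> P (c \<odot>\<^bsub>free_star_alg E\<^esub> x)"
 shows "P x"
proof -
 interpret W: star_monoid "\<lparr>carrier = lists (E \<times> (UNIV :: bool set)), monoid.mult = (@), one = []\<rparr>" word_star
  by (rule star_monoid_words)
 have F: "free_star_alg E = W.MA" by (simp add: free_star_alg_def)
 have word: "P (Poly_Mapping.single w 1)" if "w \<in> lists (E \<times> UNIV)" for w
  using that
 proof (induction w)
  case Nil
  then show ?case using one by (simp add: F W.one_MA)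
 next
  case (Cons l w)
  obtain g c where l: "l = (g, c)" "g \<in> E" using Cons by (cases l) auto
  have "P (Poly_Mapping.single [l] 1)"
   using gen[OF l(2)] star[OF l(2)] by (cases c) (simp_all add: l F free_gen_def word_star_def)
  moreover have "Poly_Mapping.single [l] 1 \<in> carrier W.MA" "Poly_Mapping.single w 1 \<in> carrier W.MA"
   using Cons l by (auto intro!: W.single_carrier_MA)
  ultimately have "P (Poly_Mapping.single [l] 1 \<otimes>\<^bsub>W.MA\<^esub> Poly_Mapping.single w 1)"
   using mult Cons.IH by (simp only: F)
  then show ?case by simp
 qed
 have single: "P (Poly_Mapping.single w c)" if "w \<in> lists (E \<times> UNIV)" for w c
 proof -
  have "P (c \<odot>\<^bsub>W.MA\<^esub> Poly_Mapping.single w 1)"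
   using smult[of "Poly_Mapping.single w 1" c] word[OF that] W.single_carrier_MA[of w 1] that by (simp add: F)
  then show ?thesis by simp
 qed
 have "P 0" using single[of "[]" 0] by simp
 show ?thesis
  using x unfolding F
  by (rule W.MA_induct) (use \<open>P 0\<close> single add in \<open>simp_all add: F\<close>)
qed

lemma star_hom_list_prod:
 assumes F: "star_alg F" and e: "e \<in> star_hom F B" and xs: "set xs \<subseteq> carrier F"
 shows "e (list_prod F xs) = list_prod B (map e xs)"
proof -
 interpret F: star_alg F by fact
 show ?thesis using xs
 proof (induction xs)
  case (Cons x xs)
  have "e (x \<otimes>\<^bsub>F\<^esub> list_prod F xs) = e x \<otimes>\<^bsub>B\<^esub> e (list_prod F xs)"
   using Cons.prems F.list_prod_closed[of xs] by (intro star_mapD(3)[OF star_homD(1)[OF e]]) auto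
  then show ?case using Cons by (simp add: list_prod_def)
 qed (simp add: list_prod_def star_homD(2)[OF e])
qed

context
 fixes \<Gamma> :: "('v, 'e) pre_digraph"
 assumes V: "finite (verts \<Gamma>)"
begin

abbreviation FA where "FA \<equiv> free_star_alg (gen_indices \<Gamma>)"
abbreviation gn :: "'v \<Rightarrow> 'v \<Rightarrow> ('v \<times> 'v) star_poly" where "gn i j \<equiv> free_gen (i, j)"

interpretation F: star_alg FA by (rule star_alg_free)

lemma gn_closed: "i \<in> verts \<Gamma> ==> j \<in> verts \<Gamma> ==> gn i j \<in> carrier FA"
 by (rule free_gen_carrier) simp

lemma map2_gn_closed:
 "\<lbrakk>set is \<subseteq> verts \<Gamma>; set js \<subseteq> verts \<Gamma>\<rbrakk> \<Longrightarrow> set (map2 gn is js) \<subseteq> carrier FA"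
 by (auto intro!: gn_closed dest: set_zip_leftD set_zip_rightD)

lemma qaut_relations_iff:
 "(x, y) \<in> qaut_relations \<Gamma> \<longleftrightarrow>
   (\<exists>i\<in>verts \<Gamma>. \<exists>j\<in>verts \<Gamma>. x = gn i j \<and> y = star FA (gn i j)) \<or>
   (\<exists>i\<in>verts \<Gamma>. x = (\<Oplus>\<^bsub>FA\<^esub>j\<in>verts \<Gamma>. gn i j) \<and> y = \<one>\<^bsub>FA\<^esub>) \<or>
   (\<exists>i\<in>verts \<Gamma>. x = (\<Oplus>\<^bsub>FA\<^esub>j\<in>verts \<Gamma>. gn j i) \<and> y = \<one>\<^bsub>FA\<^esub>) \<or>
   (\<exists>i\<in>verts \<Gamma>. \<exists>j\<in>verts \<Gamma>. \<exists>l\<in>verts \<Gamma>. x = gn i j \<otimes>\<^bsub>FA\<^esub> gn i l \<and> y = (if j = l then gn i j else \<zero>\<^bsub>FA\<^esub>)) \<or>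
   (\<exists>i\<in>verts \<Gamma>. \<exists>j\<in>verts \<Gamma>. \<exists>l\<in>verts \<Gamma>. x = gn j i \<otimes>\<^bsub>FA\<^esub> gn l i \<and> y = (if j = l then gn j i else \<zero>\<^bsub>FA\<^esub>)) \<or>
   (\<exists>i\<in>verts \<Gamma>. \<exists>j\<in>verts \<Gamma>. x = (\<Oplus>\<^bsub>FA\<^esub>l\<in>verts \<Gamma>. adj_matrix \<Gamma> l j \<odot>\<^bsub>FA\<^esub> gn i l) \<and>
    y = (\<Oplus>\<^bsub>FA\<^esub>l\<in>verts \<Gamma>. adj_matrix \<Gamma> i l \<odot>\<^bsub>FA\<^esub> gn l j))"
 unfolding qaut_relations_def Let_def Un_iff mem_Collect_eq prod.inject by blast

lemma qaut_relations_closed: "qaut_relations \<Gamma> \<subseteq> carrier FA \<times> carrier FA"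
proof (rule subrelI)
 fix x y assume "(x, y) \<in> qaut_relations \<Gamma>"
 then show "(x, y) \<in> carrier FA \<times> carrier FA"
  unfolding qaut_relations_iff by (elim disjE bexE conjE) (auto intro!: F.finsum_closed gn_closed)
qed

lemma path_relations_closed: "path_relations \<Gamma> k \<subseteq> carrier FA \<times> carrier FA"
proof (rule subrelI)
 fix x y assume "(x, y) \<in> path_relations \<Gamma> k"
 then obtain "is" js where p: "x = list_prod FA (map2 gn is js)" "y = list_prod FA (rev (map2 gn is js))"
  "vertex_path \<Gamma> is" "vertex_path \<Gamma> js"
  unfolding path_relations_def Let_def by blast
 show "(x, y) \<in> carrier FA \<times> carrier FA"
  using F.list_prod_closed[OF map2_gn_closed[of "is" js]] F.list_prod_closed[of "rev (map2 gn is js)"]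
   map2_gn_closed[of "is" js] p(3,4) unfolding p(1,2) vertex_path_def by simp
qed

context
 fixes B :: "('b, 'n) star_alg_scheme" and e
 assumes B: "star_alg B" and e: "e \<in> star_hom FA B"
begin

interpretation B: star_alg B by (rule B)

lemmas e_map = star_mapD[OF star_homD(1)[OF e]] star_homD(2)[OF e]

lemma e_zero: "e \<zero>\<^bsub>FA\<^esub> = \<zero>\<^bsub>B\<^esub>"
 by (rule F.star_map_zero[OF B star_homD(1)[OF e]])

lemma e_sum: "(\<And>l. l \<in> verts \<Gamma> ==> f l \<in> carrier FA) ==> e (\<Oplus>\<^bsub>FA\<^esub>l\<in>verts \<Gamma>. f l) = (\<Oplus>\<^bsub>B\<^esub>l\<in>verts \<Gamma>. e (f l))"
 by (rule F.star_map_finsum[OF B star_homD(1)[OF e] V]) auto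

lemma e_smult_sum:
 assumes "\<And>l. l \<in> verts \<Gamma> ==> f l \<in> carrier FA"
 shows "e (\<Oplus>\<^bsub>FA\<^esub>l\<in>verts \<Gamma>. c l \<odot>\<^bsub>FA\<^esub> f l) = (\<Oplus>\<^bsub>B\<^esub>l\<in>verts \<Gamma>. c l \<odot>\<^bsub>B\<^esub> e (f l))"
 using assms by (subst e_sum) (auto intro!: B.finsum_cong' simp: e_map)

lemmas e_simps = e_map e_zero e_sum gn_closed

lemma qaut_relations_magic:
 assumes "\<And>x y. (x, y) \<in> qaut_relations \<Gamma> ==> e x = e y"
 shows "B.magic (verts \<Gamma>) (adj_matrix \<Gamma>) (\<lambda>i j. e (gn i j))"
proof -
 have r: "i \<in> verts \<Gamma> ==> j \<in> verts \<Gamma> ==> e (gn i j) = e (star FA (gn i j))"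
  "i \<in> verts \<Gamma> ==> e (\<Oplus>\<^bsub>FA\<^esub>j\<in>verts \<Gamma>. gn i j) = e \<one>\<^bsub>FA\<^esub>"
  "i \<in> verts \<Gamma> ==> e (\<Oplus>\<^bsub>FA\<^esub>j\<in>verts \<Gamma>. gn j i) = e \<one>\<^bsub>FA\<^esub>"
  "\<lbrakk>i \<in> verts \<Gamma>; j \<in> verts \<Gamma>; l \<in> verts \<Gamma>\<rbrakk> \<Longrightarrow> e (gn i j \<otimes>\<^bsub>FA\<^esub> gn i l) = e (if j = l then gn i j else \<zero>\<^bsub>FA\<^esub>)"
  "\<lbrakk>i \<in> verts \<Gamma>; j \<in> verts \<Gamma>; l \<in> verts \<Gamma>\<rbrakk> \<Longrightarrow> e (gn j i \<otimes>\<^bsub>FA\<^esub> gn l i) = e (if j = l then gn j i else \<zero>\<^bsub>FA\<^esub>)"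
  "i \<in> verts \<Gamma> ==> j \<in> verts \<Gamma> ==> e (\<Oplus>\<^bsub>FA\<^esub>l\<in>verts \<Gamma>. adj_matrix \<Gamma> l j \<odot>\<^bsub>FA\<^esub> gn i l) =
    e (\<Oplus>\<^bsub>FA\<^esub>l\<in>verts \<Gamma>. adj_matrix \<Gamma> i l \<odot>\<^bsub>FA\<^esub> gn l j)" for i j l
  by (rule assms, unfold qaut_relations_iff, blast)+
 have "(\<Oplus>\<^bsub>B\<^esub>l\<in>verts \<Gamma>. adj_matrix \<Gamma> l j \<odot>\<^bsub>B\<^esub> e (gn i l)) = (\<Oplus>\<^bsub>B\<^esub>l\<in>verts \<Gamma>. adj_matrix \<Gamma> i l \<odot>\<^bsub>B\<^esub> e (gn l j))"
  if "i \<in> verts \<Gamma>" "j \<in> verts \<Gamma>" for i j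
  using r(6)[OF that] that by (simp add: e_smult_sum gn_closed)
 then show ?thesis
  unfolding B.magic_def
  using r(1)[symmetric] r(2-5) by (simp add: e_simps)
qed

lemma magic_qaut_relations:
 assumes m: "B.magic (verts \<Gamma>) (adj_matrix \<Gamma>) (\<lambda>i j. e (gn i j))" and xy: "(x, y) \<in> qaut_relations \<Gamma>"
 shows "e x = e y"
 using xy unfolding qaut_relations_iff
 by (elim disjE bexE conjE; hypsubst)
  (simp_all add: e_smult_sum gn_closed B.magicD(7)[OF m], simp_all add: e_simps B.magicD[OF m])

text \<open>Both directions are used: from a homomorphism to its matrix of generators, and from a
  matrix to a homomorphism.\<close>

lemma path_relations_iff:
 "(\<forall>x y. (x, y) \<in> path_relations \<Gamma> k \<longrightarrow> e x = e y) \<longleftrightarrow> B.path_sym \<Gamma> k (\<lambda>i j. e (gn i j))"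
proof -
 have l: "e (list_prod FA (map2 gn is js)) = list_prod B (map2 (\<lambda>i j. e (gn i j)) is js)"
  "e (list_prod FA (rev (map2 gn is js))) = list_prod B (rev (map2 (\<lambda>i j. e (gn i j)) is js))"
  if "vertex_path \<Gamma> is" "vertex_path \<Gamma> js" for "is" js
 proof -
  have c: "set (map2 gn is js) \<subseteq> carrier FA" using that by (intro map2_gn_closed) (auto simp: vertex_path_def)
  have m: "map e (map2 gn is js) = map2 (\<lambda>i j. e (gn i j)) is js" by simp
  show "e (list_prod FA (map2 gn is js)) = list_prod B (map2 (\<lambda>i j. e (gn i j)) is js)"
   using star_hom_list_prod[OF star_alg_free e c] unfolding m .
  show "e (list_prod FA (rev (map2 gn is js))) = list_prod B (rev (map2 (\<lambda>i j. e (gn i j)) is js))"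
   using star_hom_list_prod[OF star_alg_free e, of "rev (map2 gn is js)"] c unfolding rev_map[symmetric] m by simp
 qed
 have "(\<forall>x y. (x, y) \<in> path_relations \<Gamma> k \<longrightarrow> e x = e y) \<longleftrightarrow>
  (\<forall>is js. vertex_path \<Gamma> is \<and> vertex_path \<Gamma> js \<and> length is = length js \<and> length is \<le> k + 1 \<longrightarrow>
   e (list_prod FA (map2 gn is js)) = e (list_prod FA (rev (map2 gn is js))))"
  unfolding path_relations_def Let_def mem_Collect_eq prod.inject by blast
 also have "\<dots> \<longleftrightarrow> B.path_sym \<Gamma> k (\<lambda>i j. e (gn i j))"
  unfolding B.path_sym_def using l by (metis (no_types, lifting))
 finally show ?thesis .
qed

end

text \<open>Modulo the relations a generator x is a self-adjoint idempotent, so the square of its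
  seminorm is at most the seminorm itself. This is the bound that makes the universal C*-algebra
  exist.\<close>

lemma universal_graph:
 assumes "R \<subseteq> carrier FA \<times> carrier FA" "qaut_relations \<Gamma> \<subseteq> R"
 shows "universal (gen_indices \<Gamma>) R"
proof
 fix q g assume q: "cstar_seminorm FA q" and rel: "\<And>u v. (u, v) \<in> R ==> q (u \<ominus>\<^bsub>FA\<^esub> v) = 0" and g: "g \<in> gen_indices \<Gamma>"
 interpret q: cstar_semi FA q by unfold_locales (rule q)
 obtain i j where ij: "g = (i, j)" "i \<in> verts \<Gamma>" "j \<in> verts \<Gamma>" using g by auto
 let ?x = "free_gen g" and ?s = "star FA (free_gen g)"
 have x: "?x \<in> carrier FA" "?s \<in> carrier FA" using gn_closed ij by auto
 have "(?x, ?s) \<in> R" "(?x \<otimes>\<^bsub>FA\<^esub> ?x, ?x) \<in> R"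
  by (rule subsetD[OF assms(2)], unfold qaut_relations_iff, use ij in force)+
 then have r: "q (?x \<ominus>\<^bsub>FA\<^esub> ?s) = 0" "q (?x \<otimes>\<^bsub>FA\<^esub> ?x \<ominus>\<^bsub>FA\<^esub> ?x) = 0" by (auto intro: rel)
 have "(q ?x)\<^sup>2 = q (?s \<otimes>\<^bsub>FA\<^esub> ?x)" using x by (simp add: q.p_cstar)
 also have "\<dots> \<le> q (?x \<otimes>\<^bsub>FA\<^esub> ?x) + q (?s \<otimes>\<^bsub>FA\<^esub> ?x \<ominus>\<^bsub>FA\<^esub> ?x \<otimes>\<^bsub>FA\<^esub> ?x)" using x by (intro q.p_le_diff) auto
 also have "?s \<otimes>\<^bsub>FA\<^esub> ?x \<ominus>\<^bsub>FA\<^esub> ?x \<otimes>\<^bsub>FA\<^esub> ?x = (?s \<ominus>\<^bsub>FA\<^esub> ?x) \<otimes>\<^bsub>FA\<^esub> ?x" using x by (simp add: F.diff_l_distr)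
 also have "q ((?s \<ominus>\<^bsub>FA\<^esub> ?x) \<otimes>\<^bsub>FA\<^esub> ?x) \<le> q (?s \<ominus>\<^bsub>FA\<^esub> ?x) * q ?x" using x by (intro q.p_mult) auto
 also have "q (?s \<ominus>\<^bsub>FA\<^esub> ?x) = 0" using r(1) q.p_diff_commute[OF x] by simp
 also have "q (?x \<otimes>\<^bsub>FA\<^esub> ?x) \<le> q ?x + q (?x \<otimes>\<^bsub>FA\<^esub> ?x \<ominus>\<^bsub>FA\<^esub> ?x)" using x by (intro q.p_le_diff) auto
 finally have "q ?x * q ?x \<le> 1 * q ?x" using r(2) by (simp add: power2_eq_square)
 then show "q ?x \<le> 1" using q.p_nonneg[OF x(1)] by (cases "q ?x = 0") (auto simp: mult_le_cancel_right)
qed (rule assms(1))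

end

section \<open>Linear spans and transfer of relations\<close>

context star_alg
begin

lemma lin_span_closed: "X \<subseteq> carrier A ==> lin_span A X \<subseteq> carrier A"
 unfolding lin_span_def by (auto intro!: finsum_closed)

lemma lin_span_base: "x \<in> X ==> x \<in> carrier A ==> x \<in> lin_span A X"
 unfolding lin_span_def mem_Collect_eq by (intro exI[of _ "\<lambda>_. 1"] exI[of _ "{x}"]) (simp add: Pi_iff)

lemma lin_span_zero: "\<zero> \<in> lin_span A X"
 unfolding lin_span_def mem_Collect_eq by (intro exI[of _ "\<lambda>_. 1"] exI[of _ "{}"]) simp

lemma lin_span_smult:
 assumes "X \<subseteq> carrier A" "x \<in> lin_span A X" shows "c \<odot> x \<in> lin_span A X"
proof -
 obtain d F where F: "x = (\<Oplus>y\<in>F. d y \<odot> y)" "finite F" "F \<subseteq> X" using assms(2) unfolding lin_span_def by blast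
 have "c \<odot> x = (\<Oplus>y\<in>F. c \<odot> (d y \<odot> y))"
  unfolding F(1) using F assms(1) by (intro finsum_smult) auto
 also have "\<dots> = (\<Oplus>y\<in>F. (c * d y) \<odot> y)" using F assms(1) by (intro finsum_cong') (auto simp: smult_assoc)
 finally show ?thesis unfolding lin_span_def mem_Collect_eq using F(2,3) by (intro exI[of _ "\<lambda>y. c * d y"] exI[of _ F]) simp
qed

lemma lin_span_add:
 assumes X: "X \<subseteq> carrier A" and "x \<in> lin_span A X" "y \<in> lin_span A X" shows "x \<oplus> y \<in> lin_span A X"
proof -
 have ext: "(\<Oplus>y\<in>F. c y \<odot> y) = (\<Oplus>y\<in>H. (if y \<in> F then c y else 0) \<odot> y)" if "F \<subseteq> H" "finite H" "H \<subseteq> X" for F H c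
  using that X by (intro add.finprod_mono_neutral_cong_left) auto
 obtain c F where F: "x = (\<Oplus>y\<in>F. c y \<odot> y)" "finite F" "F \<subseteq> X" using assms(2) unfolding lin_span_def by blast
 obtain d G where G: "y = (\<Oplus>y\<in>G. d y \<odot> y)" "finite G" "G \<subseteq> X" using assms(3) unfolding lin_span_def by blast
 let ?c = "\<lambda>y. if y \<in> F then c y else 0" and ?d = "\<lambda>y. if y \<in> G then d y else 0"
 have "x \<oplus> y = (\<Oplus>y\<in>F \<union> G. ?c y \<odot> y) \<oplus> (\<Oplus>y\<in>F \<union> G. ?d y \<odot> y)"
  unfolding F(1) G(1) using F G by (intro arg_cong2[where f = "(\<oplus>)"] ext) auto
 also have "\<dots> = (\<Oplus>y\<in>F \<union> G. ?c y \<odot> y \<oplus> ?d y \<odot> y)"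
  using F G X by (intro finsum_addf[symmetric]) auto
 also have "\<dots> = (\<Oplus>y\<in>F \<union> G. (?c y + ?d y) \<odot> y)"
  using F G X by (intro finsum_cong' smult_l_distr[symmetric] refl) auto
 finally show ?thesis unfolding lin_span_def mem_Collect_eq using F(2,3) G(2,3)
  by (intro exI[of _ "\<lambda>y. ?c y + ?d y"] exI[of _ "F \<union> G"]) simp
qed

lemma lin_span_finsum:
 assumes "X \<subseteq> carrier A" "finite I" "\<And>i. i \<in> I ==> f i \<in> lin_span A X"
 shows "finsum A f I \<in> lin_span A X"
 using assms(2,3)
proof (induction I rule: finite_induct)
 case (insert i I)
 then show ?case using lin_span_closed[OF assms(1)]
  by (subst finsum_insert) (auto intro!: lin_span_add[OF assms(1)])
qed (simp add: lin_span_zero)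

text \<open>By linearity it suffices to test \<open>T\<close> on the spanning set; it is applied to
  left and right multiplication by fixed elements.\<close>

lemma lin_span_invariant:
 assumes X: "X \<subseteq> carrier A" and y: "y \<in> lin_span A X"
  and T0: "\<And>x. x \<in> carrier A ==> T x \<in> carrier A"
  and add: "\<And>x y. x \<in> carrier A ==> y \<in> carrier A ==> T (x \<oplus> y) = T x \<oplus> T y"
  and smult: "\<And>c x. x \<in> carrier A ==> T (c \<odot> x) = c \<odot> T x"
  and T: "\<And>x. x \<in> X ==> T x \<in> lin_span A X"
 shows "T y \<in> lin_span A X"
proof -
 obtain c F where F: "y = (\<Oplus>y\<in>F. c y \<odot> y)" "finite F" "F \<subseteq> X" using y unfolding lin_span_def by blast
 have "T (\<Oplus>y\<in>F. c y \<odot> y) \<in> lin_span A X" using F(2,3)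
 proof (induction F rule: finite_induct)
  case empty
  have "T \<zero> = \<zero>" using smult[of \<zero> 0] T0[of \<zero>] by simp
  then show ?case by (simp add: lin_span_zero)
 next
  case (insert x F)
  then have x: "x \<in> carrier A" "F \<subseteq> carrier A" using X by auto
  have "T ((c x \<odot> x) \<oplus> (\<Oplus>y\<in>F. c y \<odot> y)) = c x \<odot> T x \<oplus> T (\<Oplus>y\<in>F. c y \<odot> y)"
   using x add smult by (simp add: Pi_iff subset_iff)
  then show ?case using insert x lin_span_add[OF X lin_span_smult[OF X T[of x]] insert.IH]
   by (subst finsum_insert) (auto simp: Pi_iff)
 qed
 then show ?thesis using F(1) by simp
qed

end

context star_alg
begin

text \<open>A homomorphism obtained by universality agrees with the given matrix for indices in
  \<open>V\<close> only, so the properties have to be carried over.\<close>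

lemma magic_cong:
 assumes V: "finite V" and m: "magic V \<epsilon> u" and eq: "\<And>i j. i \<in> V ==> j \<in> V ==> u' i j = u i j"
 shows "magic V \<epsilon> u'"
proof -
 have c: "i \<in> V ==> j \<in> V ==> u i j \<in> carrier A" for i j by (rule magicD(1)[OF m])
 have "i \<in> V ==> (\<Oplus>j\<in>V. u' i j) = (\<Oplus>j\<in>V. u i j)" "i \<in> V ==> (\<Oplus>j\<in>V. u' j i) = (\<Oplus>j\<in>V. u j i)"
  "i \<in> V ==> (\<Oplus>l\<in>V. \<epsilon> l j \<odot> u' i l) = (\<Oplus>l\<in>V. \<epsilon> l j \<odot> u i l)"
  "j \<in> V ==> (\<Oplus>l\<in>V. \<epsilon> i l \<odot> u' l j) = (\<Oplus>l\<in>V. \<epsilon> i l \<odot> u l j)" for i j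
  using c eq by (auto intro!: finsum_cong')
 then show ?thesis using m eq unfolding magic_def by simp
qed

lemma path_sym_cong:
 assumes p: "path_sym \<Gamma> k u" and eq: "\<And>i j. i \<in> verts \<Gamma> ==> j \<in> verts \<Gamma> ==> u' i j = u i j"
 shows "path_sym \<Gamma> k u'"
 unfolding path_sym_def
proof (intro allI impI)
 fix "is" js assume a: "vertex_path \<Gamma> is \<and> vertex_path \<Gamma> js \<and> length is = length js \<and> length is \<le> k + 1"
 then have m: "map2 u' is js = map2 u is js"
  by (auto simp: vertex_path_def intro!: eq dest: set_zip_leftD set_zip_rightD)
 have "list_prod A (map2 u is js) = list_prod A (rev (map2 u is js))"
  using p a unfolding path_sym_def by blast
 then show "list_prod A (map2 u' is js) = list_prod A (rev (map2 u' is js))" unfolding m .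
qed

lemma path_sym_0: "path_sym \<Gamma> 0 u"
 unfolding path_sym_def
proof (intro allI impI)
 fix "is" js assume "vertex_path \<Gamma> is \<and> vertex_path \<Gamma> js \<and> length is = length js \<and> length is \<le> 0 + 1"
 then have "length (map2 u is js) \<le> 1" by simp
 then show "list_prod A (map2 u is js) = list_prod A (rev (map2 u is js))"
  by (cases "map2 u is js") auto
qed

end

text \<open>The relations for paths of length at most 1 are trivial, so \<open>Aut\<^sup>+\<close> is the case \<open>k = 0\<close>.\<close>

lemma universal_seminorm_path_0:
 "universal_seminorm (gen_indices \<Gamma>) (qaut_relations \<Gamma> \<union> path_relations \<Gamma> 0) =
  universal_seminorm (gen_indices \<Gamma>) (qaut_relations \<Gamma>)"
proof (rule ext)
 fix x
 let ?F = "free_star_alg (gen_indices \<Gamma>)"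
 interpret F: star_alg ?F by (rule star_alg_free)
 have "p (u \<ominus>\<^bsub>?F\<^esub> v) = 0" if p: "cstar_seminorm ?F p" and uv: "(u, v) \<in> path_relations \<Gamma> 0" for p u v
 proof -
  interpret p: cstar_semi ?F p by unfold_locales (rule p)
  obtain "is" js where w: "u = list_prod ?F (map2 (\<lambda>i j. free_gen (i, j)) is js)"
   "v = list_prod ?F (rev (map2 (\<lambda>i j. free_gen (i, j)) is js))"
   "vertex_path \<Gamma> is" "vertex_path \<Gamma> js" "length is = length js" "length is \<le> 0 + 1"
   using uv unfolding path_relations_def Let_def by blast
  have "u = v" using F.path_sym_0[of \<Gamma> "\<lambda>i j. free_gen (i, j)"] w unfolding F.path_sym_def by blast
  moreover have "set (map2 (\<lambda>i j. free_gen (i, j)) is js) \<subseteq> carrier ?F"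
   using w(3,4) by (auto simp: vertex_path_def intro!: free_gen_carrier dest: set_zip_leftD set_zip_rightD)
  then have "u \<in> carrier ?F" unfolding w(1) by (rule F.list_prod_closed)
  ultimately show ?thesis by simp
 qed
 then have "{p x | p. cstar_seminorm ?F p \<and> (\<forall>(u, v)\<in>qaut_relations \<Gamma> \<union> path_relations \<Gamma> 0. p (u \<ominus>\<^bsub>?F\<^esub> v) = 0)} =
  {p x | p. cstar_seminorm ?F p \<and> (\<forall>(u, v)\<in>qaut_relations \<Gamma>. p (u \<ominus>\<^bsub>?F\<^esub> v) = 0)}" by blast
 then show "universal_seminorm (gen_indices \<Gamma>) (qaut_relations \<Gamma> \<union> path_relations \<Gamma> 0) x =
  universal_seminorm (gen_indices \<Gamma>) (qaut_relations \<Gamma>) x"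
  unfolding universal_seminorm_def by simp
qed

lemma C_Aut_eq: "C_Aut \<Gamma> = C_G \<Gamma> 0" and q_Aut_eq: "q_Aut \<Gamma> = q_G \<Gamma> 0"
 by (simp_all add: C_Aut_def C_G_def q_Aut_def q_G_def universal_cstar_def universal_gen_def
   universal_seminorm_path_0 fun_eq_iff)

text \<open>Supplies the infinite element type from which the bijection with pairs is built.
  Singletons of constant sequences already give one element of the type for each complex
  number.\<close>

lemma infinite_univ_elem: "infinite (UNIV :: 'g univ_elem set)"
proof
 assume fin: "finite (UNIV :: 'g univ_elem set)"
 let ?f = "\<lambda>c. {\<lambda>_. Poly_Mapping.single [] c} :: 'g univ_elem"
 have "inj ?f" by (rule injI) (metis singleton_inject lookup_single_eq)
 moreover have "finite (range ?f)" using fin by (rule finite_subset[OF subset_UNIV])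
 ultimately have "finite (UNIV :: complex set)" by (rule finite_imageD[rotated])
 then show False by (simp add: infinite_UNIV_char_0)
qed

section \<open>The quantum groups for all k, including k = 0\<close>

locale graph_quantum =
 fixes \<Gamma> :: "('v, 'e) pre_digraph" and k :: nat
 assumes fin: "finite (verts \<Gamma>)"
begin

abbreviation V where "V \<equiv> verts \<Gamma>"
abbreviation F where "F \<equiv> free_star_alg (gen_indices \<Gamma>)"
abbreviation C where "C \<equiv> C_G \<Gamma> k"
abbreviation q where "q \<equiv> q_G \<Gamma> k"
abbreviation M where "M \<equiv> min_tensor2 C C"
abbreviation M3 where "M3 \<equiv> min_tensor3 C C C"

sublocale Un: universal "gen_indices \<Gamma>" "qaut_relations \<Gamma> \<union> path_relations \<Gamma> k"
 by (rule universal_graph[OF fin]) (use qaut_relations_closed[OF fin] path_relations_closed[OF fin] in auto)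

lemma cstar_alg_C: "cstar_alg C"
 unfolding C_G_def by (rule Un.cstar_alg_universal)

end

sublocale graph_quantum \<subseteq> T: tens3 "C_G \<Gamma> k"
 using cstar_alg_C by (simp add: tens3_def tens2_def)

context graph_quantum
begin

interpretation M: cstar_alg M by (rule T.cstar_alg_tensor2)
interpretation M3: cstar_alg M3 by (rule T.cstar_alg_tensor3)

lemma to_univ_hom: "Un.to_univ \<in> star_hom F C"
 unfolding C_G_def by (rule Un.to_univ_star_hom)

lemma to_univ_gen: "Un.to_univ (free_gen (i, j)) = q i j"
 by (simp add: q_G_def Un.to_univ_gen)

lemmas tu = star_mapD[OF star_homD(1)[OF to_univ_hom]] star_homD(2)[OF to_univ_hom]

lemma q_closed [simp]: "i \<in> V ==> j \<in> V ==> q i j \<in> carrier C"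
 using tu(1)[OF free_gen_carrier[of "(i, j)"]] by (simp add: to_univ_gen)

lemma hom_magic:
 assumes B: "star_alg B" and h: "h \<in> star_hom C B"
 shows "star_alg.magic B V (adj_matrix \<Gamma>) (\<lambda>i j. h (q i j))" and "star_alg.path_sym B \<Gamma> k (\<lambda>i j. h (q i j))"
proof -
 let ?e = "\<lambda>x. h (Un.to_univ x)"
 have e: "?e \<in> star_hom F B" by (rule star_hom_comp[OF to_univ_hom h])
 have rel: "?e x = ?e y" if "(x, y) \<in> qaut_relations \<Gamma> \<union> path_relations \<Gamma> k" for x y
  by (simp add: Un.to_univ_relation[OF that])
 show "star_alg.magic B V (adj_matrix \<Gamma>) (\<lambda>i j. h (q i j))"
  using qaut_relations_magic[OF fin B e] rel by (simp add: to_univ_gen)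
 show "star_alg.path_sym B \<Gamma> k (\<lambda>i j. h (q i j))"
  using path_relations_iff[OF fin B e, of k] rel by (simp add: to_univ_gen)
qed

lemma hom_exists:
 assumes B: "cstar_alg B" and m: "star_alg.magic B V (adj_matrix \<Gamma>) u" and p: "star_alg.path_sym B \<Gamma> k u"
 obtains h where "h \<in> star_hom C B" "\<And>i j. i \<in> V ==> j \<in> V ==> h (q i j) = u i j"
proof -
 interpret B: cstar_alg B by fact
 have "(case g of (i, j) \<Rightarrow> u i j) \<in> carrier B" if "g \<in> gen_indices \<Gamma>" for g
  using that B.magicD(1)[OF m] by auto
 then obtain e where e: "e \<in> star_hom F B" "\<And>g. g \<in> gen_indices \<Gamma> ==> e (free_gen g) = (case g of (i, j) \<Rightarrow> u i j)"
  using Un.free_lift[OF B.star_alg_axioms, of "\<lambda>(i, j). u i j"] by blast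
 have eq: "e (free_gen (i, j)) = u i j" if "i \<in> V" "j \<in> V" for i j using e(2)[of "(i, j)"] that by simp
 have "e x = e y" if "(x, y) \<in> qaut_relations \<Gamma> \<union> path_relations \<Gamma> k" for x y
  using that magic_qaut_relations[OF fin B.star_alg_axioms e(1) B.magic_cong[OF fin m eq]]
   path_relations_iff[OF fin B.star_alg_axioms e(1), of k] B.path_sym_cong[OF p eq] by blast
 then obtain h where h: "h \<in> star_hom C B" "\<And>f. f \<in> carrier F ==> h (Un.to_univ f) = e f"
  using Un.universal_lift[OF B e(1)] unfolding C_G_def by blast
 have "h (q i j) = u i j" if "i \<in> V" "j \<in> V" for i j
  using h(2)[OF free_gen_carrier[of "(i, j)"]] eq that by (simp add: to_univ_gen)
 then show ?thesis using that h(1) by blast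
qed

lemma hom_eqI:
 assumes "cstar_alg B" "f \<in> star_hom C B" "h \<in> star_hom C B"
  and "\<And>i j. i \<in> V ==> j \<in> V ==> f (q i j) = h (q i j)" and "x \<in> carrier C"
 shows "f x = h x"
 using assms unfolding C_G_def q_G_def by (intro Un.universal_eqI[of B f h x]) auto

abbreviation lf where "lf a \<equiv> tensor2 C C a \<one>\<^bsub>C\<^esub>"
abbreviation rt where "rt b \<equiv> tensor2 C C \<one>\<^bsub>C\<^esub> b"

lemma legs: "a \<in> carrier C ==> b \<in> carrier C ==> lf a \<otimes>\<^bsub>M\<^esub> rt b = tensor2 C C a b"
 "a \<in> carrier C ==> b \<in> carrier C ==> rt b \<otimes>\<^bsub>M\<^esub> lf a = tensor2 C C a b"
 by (simp_all add: T.tensor2_mult)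

abbreviation P where "P \<equiv> M.mprod V (\<lambda>i j. lf (q i j)) (\<lambda>i j. rt (q i j))"

lemmas lf_magic = hom_magic[OF M.star_alg_axioms T.left_leg]
 and rt_magic = hom_magic[OF M.star_alg_axioms T.right_leg]

lemma lf_rt_commute:
 "\<lbrakk>i \<in> V; j \<in> V; m \<in> V; n \<in> V\<rbrakk> \<Longrightarrow> lf (q i j) \<otimes>\<^bsub>M\<^esub> rt (q m n) = rt (q m n) \<otimes>\<^bsub>M\<^esub> lf (q i j)"
 by (simp add: legs)

lemmas cx = fin lf_magic(1) rt_magic(1) lf_rt_commute

lemma P_eq:
 assumes "i \<in> V" "j \<in> V"
 shows "P i j = (\<Oplus>\<^bsub>M\<^esub>l\<in>V. tensor2 C C (q i l) (q l j))"
proof -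
 have "P i j = (\<Oplus>\<^bsub>M\<^esub>l\<in>V. lf (q i l) \<otimes>\<^bsub>M\<^esub> rt (q l j))" by (rule M.mprod_def[OF cx])
 also have "\<dots> = (\<Oplus>\<^bsub>M\<^esub>l\<in>V. tensor2 C C (q i l) (q l j))"
  using assms by (intro M.finsum_cong') (auto simp: legs)
 finally show ?thesis .
qed

lemma ex1_coproduct:
 "\<exists>!\<Delta>. \<Delta> \<in> star_hom C M \<and> \<Delta> \<in> extensional (carrier C) \<and> coproduct_formula V C q \<Delta>"
proof -
 obtain h where h: "h \<in> star_hom C M" "\<And>i j. i \<in> V ==> j \<in> V ==> h (q i j) = P i j"
  using hom_exists[OF M.cstar_alg_axioms M.magic_mprod[OF cx] M.path_sym_mprod[OF cx lf_magic(2) rt_magic(2)]] by blast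
 have "restrict h (carrier C) \<in> star_hom C M"
  using T.A.star_map_cong[OF star_homD(1)[OF h(1)], of "restrict h (carrier C)"] star_homD(2)[OF h(1)]
  by (intro star_homI) auto
 then have "\<exists>\<Delta>. \<Delta> \<in> star_hom C M \<and> \<Delta> \<in> extensional (carrier C) \<and> coproduct_formula V C q \<Delta>"
  using h(2) by (intro exI[of _ "restrict h (carrier C)"]) (simp add: coproduct_formula_def P_eq)
 moreover have "f = g" if f: "f \<in> star_hom C M \<and> f \<in> extensional (carrier C) \<and> coproduct_formula V C q f"
  and g: "g \<in> star_hom C M \<and> g \<in> extensional (carrier C) \<and> coproduct_formula V C q g" for f g
 proof (rule extensionalityI[where A = "carrier C"])
  fix x assume x: "x \<in> carrier C"
  show "f x = g x"
  proof (rule hom_eqI[OF M.cstar_alg_axioms _ _ _ x])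
   show "f (q i j) = g (q i j)" if "i \<in> V" "j \<in> V" for i j
    using f g that by (simp add: coproduct_formula_def)
  qed (use f g in simp_all)
 qed (use f g in simp_all)
 ultimately show ?thesis by blast
qed

context
 fixes \<Delta> assumes D: "\<Delta> \<in> star_hom C M" and formula: "coproduct_formula V C q \<Delta>"
begin

interpretation cp: coproduct C \<Delta>
 by unfold_locales (rule infinite_univ_elem, rule D)

lemma Delta_q: "i \<in> V ==> j \<in> V ==> \<Delta> (q i j) = (\<Oplus>\<^bsub>M\<^esub>l\<in>V. tensor2 C C (q i l) (q l j))"
 using formula by (simp add: coproduct_formula_def)

lemma hom_Delta_q:
 assumes B: "star_alg B" and h: "h \<in> star_hom M B" and ij: "i \<in> V" "j \<in> V"
 shows "h (\<Delta> (q i j)) = (\<Oplus>\<^bsub>B\<^esub>l\<in>V. h (tensor2 C C (q i l) (q l j)))"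
 unfolding Delta_q[OF ij] using ij by (intro M.star_map_finsum[OF B star_homD(1)[OF h] fin]) auto

text \<open>On a generator both composites become the double sum of
  \<open>?t (q i m) (q m l) (q l j)\<close>, in opposite orders of summation.\<close>

lemma coassociative:
 assumes x: "x \<in> carrier C" shows "coproduct_id C \<Delta> (\<Delta> x) = id_coproduct C \<Delta> (\<Delta> x)"
proof (rule hom_eqI[OF M3.cstar_alg_axioms star_hom_comp[OF D cp.coproduct_id(1)] star_hom_comp[OF D cp.id_coproduct(1)] _ x])
 fix i j assume ij: "i \<in> V" "j \<in> V"
 let ?t = "tensor3 C C C"
 have "coproduct_id C \<Delta> (\<Delta> (q i j)) = (\<Oplus>\<^bsub>M3\<^esub>l\<in>V. coproduct_id C \<Delta> (tensor2 C C (q i l) (q l j)))"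
  by (rule hom_Delta_q[OF M3.star_alg_axioms cp.coproduct_id(1) ij])
 also have "\<dots> = (\<Oplus>\<^bsub>M3\<^esub>l\<in>V. \<Oplus>\<^bsub>M3\<^esub>m\<in>V. ?t (q i m) (q m l) (q l j))"
 proof (rule M3.finsum_cong'[OF refl])
  fix l assume l: "l \<in> V"
  have "leg12 C (\<Delta> (q i l)) = (\<Oplus>\<^bsub>M3\<^esub>m\<in>V. leg12 C (tensor2 C C (q i m) (q m l)))"
   by (rule hom_Delta_q[OF M3.star_alg_axioms T.leg12(1) ij(1) l])
  also have "\<dots> = (\<Oplus>\<^bsub>M3\<^esub>m\<in>V. ?t (q i m) (q m l) \<one>\<^bsub>C\<^esub>)"
   using ij l by (intro M3.finsum_cong') (auto simp: T.leg12(2))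
  finally have "coproduct_id C \<Delta> (tensor2 C C (q i l) (q l j)) =
   (\<Oplus>\<^bsub>M3\<^esub>m\<in>V. ?t (q i m) (q m l) \<one>\<^bsub>C\<^esub>) \<otimes>\<^bsub>M3\<^esub> ?t \<one>\<^bsub>C\<^esub> \<one>\<^bsub>C\<^esub> (q l j)"
   using ij l by (simp add: cp.coproduct_id(2))
  also have "\<dots> = (\<Oplus>\<^bsub>M3\<^esub>m\<in>V. ?t (q i m) (q m l) \<one>\<^bsub>C\<^esub> \<otimes>\<^bsub>M3\<^esub> ?t \<one>\<^bsub>C\<^esub> \<one>\<^bsub>C\<^esub> (q l j))"
   using ij l by (intro M3.finsum_mult_left[OF fin]) auto
  also have "\<dots> = (\<Oplus>\<^bsub>M3\<^esub>m\<in>V. ?t (q i m) (q m l) (q l j))"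
   using ij l by (intro M3.finsum_cong') (auto simp: T.tensor3_mult)
  finally show "coproduct_id C \<Delta> (tensor2 C C (q i l) (q l j)) = \<dots>" .
 qed (use ij in \<open>auto intro!: M3.finsum_closed\<close>)
 also have "\<dots> = (\<Oplus>\<^bsub>M3\<^esub>m\<in>V. \<Oplus>\<^bsub>M3\<^esub>l\<in>V. ?t (q i m) (q m l) (q l j))"
  using ij by (intro M3.finsum_swap[OF fin fin]) auto
 also have "\<dots> = (\<Oplus>\<^bsub>M3\<^esub>m\<in>V. id_coproduct C \<Delta> (tensor2 C C (q i m) (q m j)))"
 proof (rule M3.finsum_cong'[OF refl])
  fix m assume m: "m \<in> V"
  have "leg23 C (\<Delta> (q m j)) = (\<Oplus>\<^bsub>M3\<^esub>l\<in>V. leg23 C (tensor2 C C (q m l) (q l j)))"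
   by (rule hom_Delta_q[OF M3.star_alg_axioms T.leg23(1) m ij(2)])
  also have "\<dots> = (\<Oplus>\<^bsub>M3\<^esub>l\<in>V. ?t \<one>\<^bsub>C\<^esub> (q m l) (q l j))"
   using ij m by (intro M3.finsum_cong') (auto simp: T.leg23(2))
  finally have "id_coproduct C \<Delta> (tensor2 C C (q i m) (q m j)) =
   ?t (q i m) \<one>\<^bsub>C\<^esub> \<one>\<^bsub>C\<^esub> \<otimes>\<^bsub>M3\<^esub> (\<Oplus>\<^bsub>M3\<^esub>l\<in>V. ?t \<one>\<^bsub>C\<^esub> (q m l) (q l j))"
   using ij m by (simp add: cp.id_coproduct(2))
  also have "\<dots> = (\<Oplus>\<^bsub>M3\<^esub>l\<in>V. ?t (q i m) \<one>\<^bsub>C\<^esub> \<one>\<^bsub>C\<^esub> \<otimes>\<^bsub>M3\<^esub> ?t \<one>\<^bsub>C\<^esub> (q m l) (q l j))"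
   using ij m by (intro M3.finsum_mult_right[OF fin]) auto
  also have "\<dots> = (\<Oplus>\<^bsub>M3\<^esub>l\<in>V. ?t (q i m) (q m l) (q l j))"
   using ij m by (intro M3.finsum_cong') (auto simp: T.tensor3_mult)
  finally show "(\<Oplus>\<^bsub>M3\<^esub>l\<in>V. ?t (q i m) (q m l) (q l j)) = id_coproduct C \<Delta> (tensor2 C C (q i m) (q m j))" by simp
 qed (use ij in \<open>auto intro!: star_mapD(1)[OF star_homD(1)[OF cp.id_coproduct(1)]]\<close>)
 also have "\<dots> = id_coproduct C \<Delta> (\<Delta> (q i j))"
  by (rule hom_Delta_q[OF M3.star_alg_axioms cp.id_coproduct(1) ij, symmetric])
 finally show "coproduct_id C \<Delta> (\<Delta> (q i j)) = id_coproduct C \<Delta> (\<Delta> (q i j))" .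
qed

text \<open>If \<open>jl c\<close> lies in the span of the products \<open>\<Delta> a \<cdot> jr b\<close>, then so does \<open>\<Delta> a \<cdot> jr b \<cdot> jl c =
 \<Delta> a \<cdot> jl c \<cdot> jr b\<close>. Hence the \<open>c\<close> with this property form a subalgebra, and it suffices to
 check the generators.\<close>

lemma cancellation:
 fixes jl jr
 defines "X \<equiv> {\<Delta> a \<otimes>\<^bsub>M\<^esub> jr b | a b. a \<in> carrier C \<and> b \<in> carrier C}"
 assumes jl: "jl \<in> star_hom C M" and jr: "jr \<in> star_hom C M"
  and com: "\<And>a b. a \<in> carrier C ==> b \<in> carrier C ==> jl a \<otimes>\<^bsub>M\<^esub> jr b = jr b \<otimes>\<^bsub>M\<^esub> jl a"
  and gens: "\<And>i j. i \<in> V ==> j \<in> V ==> jl (q i j) \<in> lin_span M X"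
  and el: "\<And>a b. a \<in> carrier C ==> b \<in> carrier C ==> \<exists>c\<in>carrier C. \<exists>d\<in>carrier C. tensor2 C C a b = jl c \<otimes>\<^bsub>M\<^esub> jr d"
 shows "norm_dense M (lin_span M X)"
proof -
 let ?S = "lin_span M X"
 note L = star_mapD[OF star_homD(1)[OF jl]] star_homD(2)[OF jl]
  and Rr = star_mapD[OF star_homD(1)[OF jr]] star_homD(2)[OF jr]
  and Dm = star_mapD[OF star_homD(1)[OF D]] star_homD(2)[OF D]
 have X: "X \<subseteq> carrier M" by (auto simp: X_def L(1) Rr(1) Dm(1))
 have XI: "\<Delta> a \<otimes>\<^bsub>M\<^esub> jr b \<in> ?S" if "a \<in> carrier C" "b \<in> carrier C" for a b
  using that X by (intro M.lin_span_base) (auto simp: X_def)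
 note Sc = subsetD[OF M.lin_span_closed[OF X]]
 have right: "y \<otimes>\<^bsub>M\<^esub> jr b \<in> ?S" if y: "y \<in> ?S" and b: "b \<in> carrier C" for y b
 proof (rule M.lin_span_invariant[OF X y, where T = "\<lambda>y. y \<otimes>\<^bsub>M\<^esub> jr b"])
  fix x assume "x \<in> X"
  then obtain a c where x: "x = \<Delta> a \<otimes>\<^bsub>M\<^esub> jr c" "a \<in> carrier C" "c \<in> carrier C" by (auto simp: X_def)
  have "x \<otimes>\<^bsub>M\<^esub> jr b = \<Delta> a \<otimes>\<^bsub>M\<^esub> jr (c \<otimes>\<^bsub>C\<^esub> b)" using x b by (simp add: M.m_assoc Rr Dm(1))
  then show "x \<otimes>\<^bsub>M\<^esub> jr b \<in> ?S" using XI x b by simp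
 qed (use b in \<open>auto simp: Rr(1) M.l_distr M.smult_mult_left\<close>)
 have left: "\<Delta> c \<otimes>\<^bsub>M\<^esub> y \<in> ?S" if y: "y \<in> ?S" and c: "c \<in> carrier C" for y c
 proof (rule M.lin_span_invariant[OF X y, where T = "\<lambda>y. \<Delta> c \<otimes>\<^bsub>M\<^esub> y"])
  fix x assume "x \<in> X"
  then obtain a b where x: "x = \<Delta> a \<otimes>\<^bsub>M\<^esub> jr b" "a \<in> carrier C" "b \<in> carrier C" by (auto simp: X_def)
  have "\<Delta> c \<otimes>\<^bsub>M\<^esub> x = \<Delta> (c \<otimes>\<^bsub>C\<^esub> a) \<otimes>\<^bsub>M\<^esub> jr b" using x c by (simp add: M.m_assoc Rr(1) Dm)
  then show "\<Delta> c \<otimes>\<^bsub>M\<^esub> x \<in> ?S" using XI x c by simp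
 qed (use c in \<open>auto simp: Dm(1) M.r_distr M.smult_mult_right\<close>)
 have times: "y \<otimes>\<^bsub>M\<^esub> jl c \<in> ?S" if y: "y \<in> ?S" and c: "c \<in> carrier C" "jl c \<in> ?S" for y c
 proof (rule M.lin_span_invariant[OF X y, where T = "\<lambda>y. y \<otimes>\<^bsub>M\<^esub> jl c"])
  fix x assume "x \<in> X"
  then obtain a b where x: "x = \<Delta> a \<otimes>\<^bsub>M\<^esub> jr b" "a \<in> carrier C" "b \<in> carrier C" by (auto simp: X_def)
  have "x \<otimes>\<^bsub>M\<^esub> jl c = \<Delta> a \<otimes>\<^bsub>M\<^esub> (jl c \<otimes>\<^bsub>M\<^esub> jr b)" using x c(1) by (simp add: M.m_assoc Rr(1) Dm(1) L(1) com)
  then show "x \<otimes>\<^bsub>M\<^esub> jl c \<in> ?S" using left[OF right[OF c(2) x(3)] x(2)] by simp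
 qed (use c in \<open>auto simp: L(1) M.l_distr M.smult_mult_left\<close>)
 \<comment> \<open>The identity homomorphism shows that the generators themselves form a magic
   unitary; starred letters thereby reduce to unstarred ones.\<close>
 have q_star: "star C (q i j) = q i j" if "i \<in> V" "j \<in> V" for i j
  using T.A.magicD(2)[OF hom_magic(1)[OF T.A.star_alg_axioms] that, of "\<lambda>x. x"]
  by (simp add: star_hom_iff star_map_def)
 have all: "jl (Un.to_univ f) \<in> ?S" if "f \<in> carrier F" for f
  using that
 proof (induction f rule: free_star_alg_induct)
  case one
  have "\<one>\<^bsub>M\<^esub> = \<Delta> \<one>\<^bsub>C\<^esub> \<otimes>\<^bsub>M\<^esub> jr \<one>\<^bsub>C\<^esub>" by (simp add: Dm(6) Rr(6))
  then show ?case using XI[of "\<one>\<^bsub>C\<^esub>" "\<one>\<^bsub>C\<^esub>"] by (simp add: tu(6) L(6))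
 next
  case (gen g)
  then show ?case using gens by (auto simp: to_univ_gen)
 next
  case (star g)
  then show ?case using gens by (auto simp: to_univ_gen tu(5) free_gen_carrier q_star)
 next
  case (mult x y)
  then show ?case using times[OF mult(3) tu(1)[OF mult(2)] mult(4)] by (simp add: tu(1,3) L(3))
 next
  case (add x y)
  then show ?case using M.lin_span_add[OF X add(3,4)] by (simp add: tu(1,2) L(2))
 next
  case (smult c x)
  then show ?case using M.lin_span_smult[OF X smult(2)] by (simp add: tu(1,4) L(4))
 qed
 \<comment> \<open>The closure of the span, described by sequences so that it is visibly closed
   under sums and scalar multiples.\<close>
 define cl where "cl y \<longleftrightarrow> (\<exists>\<sigma>. (\<forall>n. \<sigma> n \<in> ?S) \<and> M.lim_to \<sigma> y)" for y
 have cl_add: "cl (x \<oplus>\<^bsub>M\<^esub> y)" if x: "cl x" and y: "cl y" for x y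
 proof -
  obtain \<sigma> where \<sigma>: "\<forall>n. \<sigma> n \<in> ?S" "M.lim_to \<sigma> x" using x unfolding cl_def by blast
  obtain \<tau> where \<tau>: "\<forall>n. \<tau> n \<in> ?S" "M.lim_to \<tau> y" using y unfolding cl_def by blast
  show ?thesis using \<sigma> \<tau> unfolding cl_def
   by (intro exI[of _ "\<lambda>n. \<sigma> n \<oplus>\<^bsub>M\<^esub> \<tau> n"] conjI allI M.lin_span_add[OF X] M.lim_to_add) simp_all
 qed
 have cl_smult: "cl (c \<odot>\<^bsub>M\<^esub> x)" if x: "cl x" for c x
 proof -
  obtain \<sigma> where \<sigma>: "\<forall>n. \<sigma> n \<in> ?S" "M.lim_to \<sigma> x" using x unfolding cl_def by blast
  show ?thesis using \<sigma> unfolding cl_def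
   by (intro exI[of _ "\<lambda>n. c \<odot>\<^bsub>M\<^esub> \<sigma> n"] conjI allI M.lin_span_smult[OF X] M.lim_to_smult) simp_all
 qed
 \<comment> \<open>Only the \<open>jl\<close> factor is approximated by polynomials in the
   generators; the \<open>jr\<close> factor is absorbed by the span as it stands.\<close>
 have cl_t: "cl (tensor2 C C a b)" if ab: "a \<in> carrier C" "b \<in> carrier C" for a b
 proof -
  obtain c d where cd: "c \<in> carrier C" "d \<in> carrier C" "tensor2 C C a b = jl c \<otimes>\<^bsub>M\<^esub> jr d" using el[OF ab] by blast
  have "norm_dense C (Un.to_univ ` carrier F)" unfolding C_G_def by (rule Un.to_univ_dense)
  then obtain \<sigma> where \<sigma>: "\<And>n. \<sigma> n \<in> Un.to_univ ` carrier F" "T.A.lim_to \<sigma> c" using T.A.dense_seq cd(1) by blast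
  have "M.lim_to (\<lambda>n. jl (\<sigma> n) \<otimes>\<^bsub>M\<^esub> jr d) (jl c \<otimes>\<^bsub>M\<^esub> jr d)"
   using T.A.lin_map_lim[OF M.cstar_alg_axioms T.A.star_map_lin_map[OF M.cstar_alg_axioms star_homD(1)[OF jl]] \<sigma>(2)]
    M.lim_to_const[OF Rr(1)[OF cd(2)]] by (rule M.lim_to_mult)
  moreover have "jl (\<sigma> n) \<otimes>\<^bsub>M\<^esub> jr d \<in> ?S" for n using \<sigma>(1)[of n] all right[OF _ cd(2)] by auto
  ultimately show ?thesis unfolding cl_def cd(3)
   by (intro exI[of _ "\<lambda>n. jl (\<sigma> n) \<otimes>\<^bsub>M\<^esub> jr d"] conjI allI)
 qed
 have elem: "T.T.elem \<in> carrier (C \<times>\<times> C) \<rightarrow> carrier M"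
 proof (rule funcsetI)
  fix m assume "m \<in> carrier (C \<times>\<times> C)"
  then obtain a b where m: "m = (a, b)" "a \<in> carrier C" "b \<in> carrier C" by (cases m) (simp add: DirProd_def)
  show "T.T.elem m \<in> carrier M" unfolding m(1) T.tensor2_eq[symmetric] by (rule T.tensor2_closed[OF m(2,3)])
 qed
 have cl_lin: "cl (lin M T.T.elem f)" if "f \<in> carrier T.T.MA" for f
  using that
 proof (induction f rule: T.T.MA_induct)
  case zero
  have "cl (0 \<odot>\<^bsub>M\<^esub> tensor2 C C \<one>\<^bsub>C\<^esub> \<one>\<^bsub>C\<^esub>)" by (intro cl_smult cl_t) auto
  moreover have "0 \<odot>\<^bsub>M\<^esub> tensor2 C C \<one>\<^bsub>C\<^esub> \<one>\<^bsub>C\<^esub> = \<zero>\<^bsub>M\<^esub>" by (rule M.smult_zero_left) simp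
  ultimately show ?case unfolding T.T.lin_zero[OF M.star_alg_axioms elem] by (simp only:)
 next
  case (single m c)
  then obtain a b where m: "m = (a, b)" "a \<in> carrier C" "b \<in> carrier C" by (cases m) (simp add: DirProd_def)
  show ?case
   unfolding T.T.lin_single[OF M.star_alg_axioms elem single] unfolding m(1) T.tensor2_eq[symmetric]
   by (intro cl_smult cl_t m)
 next
  case (add f g)
  show ?case unfolding T.T.lin_add[OF M.star_alg_axioms elem add(1,2)] by (rule cl_add[OF add(3,4)])
 qed
 have dense: "norm_dense M (lin M T.T.elem ` carrier T.T.MA)" using T.T.MC_lin_dense unfolding T.min_tensor2_eq .
 have "\<exists>x\<in>?S. cnorm M (y \<ominus>\<^bsub>M\<^esub> x) < e" if y: "y \<in> carrier M" and e: "e > 0" for y e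
 proof -
  have "e / 2 > 0" using e by simp
  then obtain f where f: "f \<in> carrier T.T.MA" "cnorm M (y \<ominus>\<^bsub>M\<^esub> lin M T.T.elem f) < e / 2"
   using dense y unfolding norm_dense_def by blast
  let ?z = "lin M T.T.elem f"
  obtain \<sigma> where \<sigma>: "\<forall>n. \<sigma> n \<in> ?S" "M.lim_to \<sigma> ?z" using cl_lin[OF f(1)] unfolding cl_def by blast
  have "(\<lambda>n. cnorm M (\<sigma> n \<ominus>\<^bsub>M\<^esub> ?z)) \<longlonglongrightarrow> 0" using \<sigma>(2) unfolding M.lim_to_def by simp
  then have "\<forall>\<^sub>F n in sequentially. cnorm M (\<sigma> n \<ominus>\<^bsub>M\<^esub> ?z) < e / 2"
   using \<open>e / 2 > 0\<close> by (rule order_tendstoD(2))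
  then obtain n where n: "cnorm M (\<sigma> n \<ominus>\<^bsub>M\<^esub> ?z) < e / 2" by (auto simp: eventually_sequentially)
  have z: "?z \<in> carrier M" by (rule M.lim_to_closed(2)[OF \<sigma>(2)])
  have "cnorm M (y \<ominus>\<^bsub>M\<^esub> \<sigma> n) \<le> cnorm M (y \<ominus>\<^bsub>M\<^esub> ?z) + cnorm M (?z \<ominus>\<^bsub>M\<^esub> \<sigma> n)"
   by (intro M.p_triangle y z Sc spec[OF \<sigma>(1)])
  also have "\<dots> < e" using f(2) n M.p_diff_commute[OF z Sc[OF spec[OF \<sigma>(1), of n]]] by simp
  finally show ?thesis using \<sigma>(1) by (intro bexI[of _ "\<sigma> n"]) simp_all
 qed
 then show ?thesis unfolding norm_dense_def using M.lin_span_closed[OF X] by blast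
qed

text \<open>The two density conditions are one cancellation argument with the roles of the legs
  exchanged.\<close>

theorem compact_quantum_group_C: "compact_quantum_group (C, \<Delta>)"
proof -
 have lr: "(\<Oplus>\<^bsub>M\<^esub>m\<in>V. \<Delta> (q i m) \<otimes>\<^bsub>M\<^esub> rt (q j m)) = lf (q i j)"
  "(\<Oplus>\<^bsub>M\<^esub>m\<in>V. \<Delta> (q m j) \<otimes>\<^bsub>M\<^esub> lf (q m i)) = rt (q i j)" if ij: "i \<in> V" "j \<in> V" for i j
 proof -
  have c: "P i m \<in> carrier M" "\<Delta> (q i m) = P i m" if "i \<in> V" "m \<in> V" for i m
   using that by (auto simp: Delta_q P_eq intro!: M.finsum_closed)
  have s: "(\<Oplus>\<^bsub>M\<^esub>m\<in>V. \<Delta> (q i m) \<otimes>\<^bsub>M\<^esub> rt (q j m)) = (\<Oplus>\<^bsub>M\<^esub>m\<in>V. P i m \<otimes>\<^bsub>M\<^esub> rt (q j m))"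
   "(\<Oplus>\<^bsub>M\<^esub>m\<in>V. \<Delta> (q m j) \<otimes>\<^bsub>M\<^esub> lf (q m i)) = (\<Oplus>\<^bsub>M\<^esub>m\<in>V. P m j \<otimes>\<^bsub>M\<^esub> lf (q m i))"
   using ij by (intro M.finsum_cong'; auto simp: c)+
  show "(\<Oplus>\<^bsub>M\<^esub>m\<in>V. \<Delta> (q i m) \<otimes>\<^bsub>M\<^esub> rt (q j m)) = lf (q i j)"
   unfolding s by (rule M.mprod_row_recover(1)[OF cx ij])
  show "(\<Oplus>\<^bsub>M\<^esub>m\<in>V. \<Delta> (q m j) \<otimes>\<^bsub>M\<^esub> lf (q m i)) = rt (q i j)"
   unfolding s by (rule M.mprod_row_recover(2)[OF cx ij])
 qed
 have Dc: "a \<in> carrier C ==> \<Delta> a \<in> carrier M" for a by (rule star_mapD(1)[OF star_homD(1)[OF D]])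
 have "norm_dense M (lin_span M {\<Delta> a \<otimes>\<^bsub>M\<^esub> rt b | a b. a \<in> carrier C \<and> b \<in> carrier C})" (is "norm_dense M (lin_span M ?X)")
 proof (rule cancellation[OF T.left_leg T.right_leg])
  fix i j assume ij: "i \<in> V" "j \<in> V"
  have "\<Delta> (q i m) \<otimes>\<^bsub>M\<^esub> rt (q j m) \<in> ?X" if "m \<in> V" for m
   unfolding mem_Collect_eq using ij that by (intro exI[of _ "q i m"] exI[of _ "q j m"]) simp
  moreover have "?X \<subseteq> carrier M" using Dc by auto
  ultimately show "lf (q i j) \<in> lin_span M ?X"
   unfolding lr(1)[OF ij, symmetric] by (intro M.lin_span_finsum fin M.lin_span_base) auto
 next
  fix a b assume "a \<in> carrier C" "b \<in> carrier C"
  then show "\<exists>c\<in>carrier C. \<exists>d\<in>carrier C. tensor2 C C a b = lf c \<otimes>\<^bsub>M\<^esub> rt d" using legs(1) by metis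
 qed (simp add: legs)
 moreover have "norm_dense M (lin_span M {\<Delta> a \<otimes>\<^bsub>M\<^esub> lf b | a b. a \<in> carrier C \<and> b \<in> carrier C})" (is "norm_dense M (lin_span M ?Y)")
 proof (rule cancellation[OF T.right_leg T.left_leg])
  fix i j assume ij: "i \<in> V" "j \<in> V"
  have "\<Delta> (q m j) \<otimes>\<^bsub>M\<^esub> lf (q m i) \<in> ?Y" if "m \<in> V" for m
   unfolding mem_Collect_eq using ij that by (intro exI[of _ "q m j"] exI[of _ "q m i"]) simp
  moreover have "?Y \<subseteq> carrier M" using Dc by auto
  ultimately show "rt (q i j) \<in> lin_span M ?Y"
   unfolding lr(2)[OF ij, symmetric] by (intro M.lin_span_finsum fin M.lin_span_base) auto
 next
  fix a b assume "a \<in> carrier C" "b \<in> carrier C"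
  then show "\<exists>c\<in>carrier C. \<exists>d\<in>carrier C. tensor2 C C a b = rt c \<otimes>\<^bsub>M\<^esub> lf d" using legs(2) by metis
 qed (simp add: legs)
 ultimately show ?thesis
  using coassociative D T.A.cstar_algebra by (simp add: compact_quantum_group_def)
qed

end

end

section \<open>The quantum subgroup map\<close>

lemma coproduct_intertwined:
 fixes \<Gamma> :: "('v, 'e) pre_digraph"
 assumes fin: "finite (verts \<Gamma>)"
  and D0: "\<Delta>\<^sub>0 \<in> star_hom (C_G \<Gamma> l) (min_tensor2 (C_G \<Gamma> l) (C_G \<Gamma> l))" "coproduct_formula (verts \<Gamma>) (C_G \<Gamma> l) (q_G \<Gamma> l) \<Delta>\<^sub>0"
  and D: "\<Delta> \<in> star_hom (C_G \<Gamma> k) (min_tensor2 (C_G \<Gamma> k) (C_G \<Gamma> k))" "coproduct_formula (verts \<Gamma>) (C_G \<Gamma> k) (q_G \<Gamma> k) \<Delta>"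
  and p: "p \<in> star_hom (C_G \<Gamma> l) (C_G \<Gamma> k)" "\<And>i j. i \<in> verts \<Gamma> ==> j \<in> verts \<Gamma> ==> p (q_G \<Gamma> l i j) = q_G \<Gamma> k i j"
  and x: "x \<in> carrier (C_G \<Gamma> l)"
 shows "tensor_map (C_G \<Gamma> l) (C_G \<Gamma> l) (C_G \<Gamma> k) (C_G \<Gamma> k) p p (\<Delta>\<^sub>0 x) = \<Delta> (p x)"
proof -
 interpret G0: graph_quantum \<Gamma> l by unfold_locales (rule fin)
 interpret G: graph_quantum \<Gamma> k by unfold_locales (rule fin)
 interpret M0: cstar_alg "min_tensor2 (C_G \<Gamma> l) (C_G \<Gamma> l)" by (rule G0.T.cstar_alg_tensor2)
 interpret M: cstar_alg "min_tensor2 (C_G \<Gamma> k) (C_G \<Gamma> k)" by (rule G.T.cstar_alg_tensor2)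
 note t = tensor_map_star_hom[OF G0.cstar_alg_C G0.cstar_alg_C G.cstar_alg_C G.cstar_alg_C p(1) p(1)]
 show ?thesis
 proof (rule G0.hom_eqI[OF M.cstar_alg_axioms star_hom_comp[OF D0(1) t(1)] star_hom_comp[OF p(1) D(1)] _ x])
  fix i j assume ij: "i \<in> verts \<Gamma>" "j \<in> verts \<Gamma>"
  show "tensor_map G0.C G0.C G.C G.C p p (\<Delta>\<^sub>0 (G0.q i j)) = \<Delta> (p (G0.q i j))"
   unfolding G0.hom_Delta_q[OF D0 M.star_alg_axioms t(1) ij] p(2)[OF ij] G.Delta_q[OF D ij]
   using ij by (intro M.finsum_cong') (simp_all add: t(2) p(2))
 qed
qed

text \<open>A C*-seminorm on the source that vanishes on the kernel of \<open>p\<close> kills the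
  relations of the target. Pulled back to the free algebra it is admissible there, hence bounded by
  the universal seminorm, as the surjectivity criterion demands.\<close>

lemma quotient_surjective:
 fixes \<Gamma> :: "('v, 'e) pre_digraph"
 assumes fin: "finite (verts \<Gamma>)"
  and p: "p \<in> star_hom (C_G \<Gamma> l) (C_G \<Gamma> k)" "\<And>i j. i \<in> verts \<Gamma> ==> j \<in> verts \<Gamma> ==> p (q_G \<Gamma> l i j) = q_G \<Gamma> k i j"
 shows "p ` carrier (C_G \<Gamma> l) = carrier (C_G \<Gamma> k)"
proof -
 interpret G0: graph_quantum \<Gamma> l by unfold_locales (rule fin)
 interpret G: graph_quantum \<Gamma> k by unfold_locales (rule fin)
 interpret F: star_alg G.F by (rule star_alg_free)
 have eq: "p (G0.Un.to_univ s) = G.Un.to_univ s" if "s \<in> carrier G.F" for s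
 proof (rule G.Un.free_map_eqI[OF G.T.A.star_alg_axioms star_hom_comp[OF G0.to_univ_hom p(1)] G.to_univ_hom _ that])
  fix g assume "g \<in> gen_indices \<Gamma>"
  then show "p (G0.Un.to_univ (free_gen g)) = G.Un.to_univ (free_gen g)"
   by (auto simp: G0.to_univ_gen G.to_univ_gen p(2))
 qed
 have dense: "norm_dense G.C (G.Un.to_univ ` carrier G.F)" unfolding C_G_def by (rule G.Un.to_univ_dense)
 show ?thesis
 proof (rule star_map_surjective[OF G0.cstar_alg_C G.cstar_alg_C star_alg_free star_homD(1)[OF G0.to_univ_hom]
   star_homD(1)[OF G.to_univ_hom] dense star_homD(1)[OF p(1)] eq])
  fix r s assume r: "cstar_seminorm G0.C r" "\<And>z. z \<in> carrier G0.C ==> p z = \<zero>\<^bsub>G.C\<^esub> ==> r z = 0" and s: "s \<in> carrier G.F"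
  interpret r: cstar_semi G0.C r by unfold_locales (rule r(1))
  have "r (G0.Un.to_univ (u \<ominus>\<^bsub>G.F\<^esub> v)) = 0" if uv: "(u, v) \<in> qaut_relations \<Gamma> \<union> path_relations \<Gamma> k" for u v
  proof (rule r(2))
   have c: "u \<in> carrier G.F" "v \<in> carrier G.F" using G.Un.R_carrier uv by auto
   then show "G0.Un.to_univ (u \<ominus>\<^bsub>G.F\<^esub> v) \<in> carrier G0.C" by (intro G0.tu(1)) simp
   have "p (G0.Un.to_univ (u \<ominus>\<^bsub>G.F\<^esub> v)) = G.Un.to_univ u \<ominus>\<^bsub>G.C\<^esub> G.Un.to_univ v"
    using c F.star_map_diff[OF G.T.A.star_alg_axioms star_homD(1)[OF G.to_univ_hom] c] by (simp add: eq)
   then show "p (G0.Un.to_univ (u \<ominus>\<^bsub>G.F\<^esub> v)) = \<zero>\<^bsub>G.C\<^esub>"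
    using G.Un.to_univ_relation[OF uv] G.tu(1)[OF c(2)] by simp
  qed
  then have "(\<lambda>s. r (G0.Un.to_univ s)) \<in> G.Un.admissible"
   unfolding G.Un.admissible_def using r.pullback_seminorm[OF star_alg_free star_homD(1)[OF G0.to_univ_hom]] by auto
  then have "r (G0.Un.to_univ s) \<le> universal_seminorm (gen_indices \<Gamma>) (qaut_relations \<Gamma> \<union> path_relations \<Gamma> k) s"
   using G.Un.admissible_le s by (simp add: G.Un.free_star_alg_eq[symmetric])
  then show "r (G0.Un.to_univ s) \<le> cnorm G.C (G.Un.to_univ s)"
   unfolding C_G_def using G.Un.cnorm_to_univ[OF s] by simp
 qed
qed

theorem lemma3p1:
  fixes \<Gamma> :: "('v, 'e) pre_digraph" and k :: nat
  assumes "graph \<Gamma>" and "k \<ge> 1"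
  shows "\<exists>\<Delta>. compact_quantum_group (C_G \<Gamma> k, \<Delta>) \<and>
             coproduct_formula (verts \<Gamma>) (C_G \<Gamma> k) (q_G \<Gamma> k) \<Delta> \<and>
             (\<exists>\<pi>. quantum_subgroup_via \<pi> (C_G \<Gamma> k, \<Delta>) (Aut_plus \<Gamma>) \<and>
                  (\<forall>i\<in>verts \<Gamma>. \<forall>j\<in>verts \<Gamma>. \<pi> (q_Aut \<Gamma> i j) = q_G \<Gamma> k i j))"
proof -
 interpret D: graph \<Gamma> by fact
 have fin: "finite (verts \<Gamma>)" by simp
 interpret G0: graph_quantum \<Gamma> 0 by unfold_locales (rule fin)
 interpret G: graph_quantum \<Gamma> k by unfold_locales (rule fin)
 define \<Delta>\<^sub>0 where "\<Delta>\<^sub>0 = (THE \<Delta>. \<Delta> \<in> star_hom G0.C G0.M \<and> \<Delta> \<in> extensional (carrier G0.C) \<and> coproduct_formula (verts \<Gamma>) G0.C G0.q \<Delta>)"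
 have D0: "\<Delta>\<^sub>0 \<in> star_hom G0.C G0.M" "coproduct_formula (verts \<Gamma>) G0.C G0.q \<Delta>\<^sub>0"
  using theI'[OF G0.ex1_coproduct] unfolding \<Delta>\<^sub>0_def by simp_all
 have Aut: "Aut_plus \<Gamma> = (G0.C, \<Delta>\<^sub>0)"
  unfolding Aut_plus_def \<Delta>\<^sub>0_def C_Aut_eq q_Aut_eq ..
 obtain \<Delta> where D: "\<Delta> \<in> star_hom G.C G.M" "coproduct_formula (verts \<Gamma>) G.C G.q \<Delta>"
  using G.ex1_coproduct by blast
 \<comment> \<open>Through the identity, the generators of \<open>G.C\<close> satisfy the relations
   for k = 0, whose path relations are trivial; universality then yields the map from the algebra of
   the quantum automorphism group.\<close>
 have id: "(\<lambda>x. x) \<in> star_hom G.C G.C" by (simp add: star_hom_iff star_map_def)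
 obtain p where p: "p \<in> star_hom G0.C G.C" "\<And>i j. i \<in> verts \<Gamma> ==> j \<in> verts \<Gamma> ==> p (G0.q i j) = G.q i j"
  using G0.hom_exists[OF G.cstar_alg_C G.hom_magic(1)[OF G.T.A.star_alg_axioms id] G.T.A.path_sym_0] by blast
 have "quantum_subgroup_via p (G.C, \<Delta>) (Aut_plus \<Gamma>)"
  unfolding quantum_subgroup_via_def Aut
  using G.compact_quantum_group_C[OF D] G0.compact_quantum_group_C[OF D0] p(1)
   quotient_surjective[OF fin p] coproduct_intertwined[OF fin D0 D p] by simp
 then show ?thesis using G.compact_quantum_group_C[OF D] D(2) p(2) by (intro exI conjI ballI) (simp_all add: q_Aut_eq)
qed

end
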